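(* Let $n\ge2$, let $I\subset\mathbb{R}$ be an interval with $|I|=1$, and let $n'=n/(n-1)$. Let $Z(I^n)$ be an r.i. space and let $X_{W^1Z,L^\infty}(I^{n-1})$ be the r.i. space $Y'(I^{n-1})$, the associate space of the r.i. space $Y(I^{n-1})$ with norm $$\|f\|_{Y(I^{n-1})}=\|f^{**}(t^{1/n'})\|_{\overline{Z}'(0,1)}.$$ Then the Sobolev embedding $$W^1Z(I^n)\hookrightarrow\mathcal{R}(X_{W^1Z,L^\infty},L^\infty)$$ holds. Moreover, $\mathcal{R}(X_{W^1Z,L^\infty},L^\infty)$ is the smallest space of the form $\mathcal{R}(X,L^\infty)$ with this property; that is, if $X(I^{n-1})$ is an r.i. space such that $W^1Z(I^n)\hookrightarrow\mathcal{R}(X,L^\infty)$, then $\mathcal{R}(X_{W^1Z,L^\infty},L^\infty)\hookrightarrow\mathcal{R}(X,L^\infty)$.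
   Context: Rearrangements: for a measurable real function $f$ on $I^m$ ($m\ge1$, $|I|=1$), $\lambda_f(t)=|\{x:|f(x)|>t\}|$, $f^*(t)=\inf\{s\ge 0:\lambda_f(s)\le t\}$ and $f^{**}(t)=t^{-1}\int_0^tf^*(s)\,ds$. R.i. spaces: a Banach function norm is a map $\rho$ from non-negative measurable functions on $I^m$ to $[0,\infty]$ with: $\rho(f)=0$ iff $f=0$ a.e., $\rho(f+g)\le\rho(f)+\rho(g)$, $\rho(\alpha f)=\alpha\rho(f)$ for $\alpha\ge0$; $0\le g\le f$ a.e. implies $\rho(g)\le\rho(f)$; $0\le f_j\uparrow f$ a.e. implies $\rho(f_j)\uparrow\rho(f)$; $\rho(\chi_{I^m})<\infty$; $\int_{I^m}f\,dx\le C\rho(f)$ for a constant $C$. The space $X(I^m)=\{f \text{ measurable}:\|f\|_{X(I^m)}:=\rho(|f|)<\infty\}$ is rearrangement invariant (r.i.) if $\|f\|_{X(I^m)}=\|g\|_{X(I^m)}$ whenever $\lambda_f=\lambda_g$. R.i. spaces on $(0,1)$ are defined in the same way. By the Luxemburg representation theorem, for an r.i. space $X(I^m)$ there is an r.i. space $\overline{X}(0,1)$ with $\|f\|_{X(I^m)}=\|f^*\|_{\overline{X}(0,1)}$ for all $f$. The associate space $X'(I^m)$ consists of the measurable $f$ with $\|f\|_{X'(I^m)}=\sup_{\|g\|_{X(I^m)}\le1}\int_{I^m}|f(x)g(x)|\,dx<\infty$; it is again r.i. Here $\overline{Z}'(0,1)$ is the associate space of $\overline{Z}(0,1)$, and $f^{**}(t^{1/n'})$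 is regarded as a function of $t\in(0,1)$. Sobolev space: $W^1Z(I^n)=\{u\in Z(I^n):|\nabla u|\in Z(I^n)\}$ ($\nabla u$ the distributional gradient, $|\cdot|$ Euclidean length), with norm $\|u\|_{W^1Z(I^n)}=\|u\|_{Z(I^n)}+\||\nabla u|\|_{Z(I^n)}$. Mixed norm spaces: for $x\in I^n$ and $k\in\{1,\dots,n\}$ let $\widehat{x}_k\in I^{n-1}$ be $x$ with its $k$th coordinate removed. For r.i. spaces $X(I^{n-1})$, $Y(I)$, let $\psi_k(f,Y)(\widehat{x}_k)=\|f(\widehat{x}_k,\cdot)\|_{Y(I)}$ (norm in the $k$th variable), $\|f\|_{\mathcal{R}_k(X,Y)}=\|\psi_k(f,Y)\|_{X(I^{n-1})}$, $\mathcal{R}_k(X,Y)=\{f:\|f\|_{\mathcal{R}_k(X,Y)}<\infty\}$, and $\mathcal{R}(X,Y)=\bigcap_{k=1}^n\mathcal{R}_k(X,Y)$ with norm $\|f\|_{\mathcal{R}(X,Y)}=\sum_{k=1}^n\|f\|_{\mathcal{R}_k(X,Y)}$. $A\hookrightarrow B$ denotes a continuous embedding: $A\subset B$ and $\|f\|_B\le C\|f\|_A$ for all $f\in A$. *)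

theory Defs
  imports "HOL-Analysis.Analysis" "HOL-Probability.Essential_Supremum"
begin

section \<open>The cube and rearrangements\<close>

text \<open>
  Points of \<open>I\<^sup>m\<close> are extensional functions on \<open>{..<m}\<close> (coordinates are numbered from 0),
  and the measure is \<open>m\<close>-dimensional Lebesgue measure; the completion makes
  ``measurable'' mean Lebesgue measurable.
\<close>

definition cube :: "real set \<Rightarrow> nat \<Rightarrow> (nat \<Rightarrow> real) measure" where
  "cube I m = completion (PiM {..<m} (\<lambda>_. restrict_space lborel I))"

definition distribution_fun :: "'a measure \<Rightarrow> ('a \<Rightarrow> ennreal) \<Rightarrow> ennreal \<Rightarrow> ennreal" where
  "distribution_fun M f s = emeasure M {x \<in> space M. s < f x}"

definition rearrangement :: "'a measure \<Rightarrow> ('a \<Rightarrow> ennreal) \<Rightarrow> real \<Rightarrow> ennreal" where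
  "rearrangement M f t = Inf {s. distribution_fun M f s \<le> ennreal t}"

definition max_rearrangement :: "'a measure \<Rightarrow> ('a \<Rightarrow> ennreal) \<Rightarrow> real \<Rightarrow> ennreal" where
  "max_rearrangement M f t = (\<integral>\<^sup>+ s\<in>{0<..<t}. rearrangement M f s \<partial>lborel) / ennreal t"


section \<open>Rearrangement invariant spaces\<close>

text \<open>
  A function norm acts on nonnegative, possibly infinite, measurable functions. Its values at
  non-measurable functions are unconstrained and irrelevant.
\<close>

definition banach_function_norm :: "'a measure \<Rightarrow> (('a \<Rightarrow> ennreal) \<Rightarrow> ennreal) \<Rightarrow> bool" where
  "banach_function_norm M \<rho> \<longleftrightarrow>
     (\<forall>f \<in> borel_measurable M. \<rho> f = 0 \<longleftrightarrow> (AE x in M. f x = 0)) \<and>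
     (\<forall>f \<in> borel_measurable M. \<forall>g \<in> borel_measurable M. \<rho> (\<lambda>x. f x + g x) \<le> \<rho> f + \<rho> g) \<and>
     (\<forall>f \<in> borel_measurable M. \<forall>\<alpha>\<ge>0. \<rho> (\<lambda>x. ennreal \<alpha> * f x) = ennreal \<alpha> * \<rho> f) \<and>
     (\<forall>f \<in> borel_measurable M. \<forall>g \<in> borel_measurable M.
        (AE x in M. g x \<le> f x) \<longrightarrow> \<rho> g \<le> \<rho> f) \<and>
     (\<forall>F f. (\<forall>j::nat. F j \<in> borel_measurable M) \<and> f \<in> borel_measurable M \<and>
        (AE x in M. incseq (\<lambda>j. F j x) \<and> (SUP j. F j x) = f x) \<longrightarrow>
        incseq (\<lambda>j. \<rho> (F j)) \<and> (SUP j. \<rho> (F j)) = \<rho> f) \<and>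
     \<rho> (\<lambda>_. 1) < \<infinity> \<and>
     (\<exists>C::real. \<forall>f \<in> borel_measurable M. (\<integral>\<^sup>+ x. f x \<partial>M) \<le> ennreal C * \<rho> f)"

definition ri_norm :: "'a measure \<Rightarrow> (('a \<Rightarrow> ennreal) \<Rightarrow> ennreal) \<Rightarrow> bool" where
  "ri_norm M \<rho> \<longleftrightarrow> banach_function_norm M \<rho> \<and>
     (\<forall>f \<in> borel_measurable M. \<forall>g \<in> borel_measurable M.
        distribution_fun M f = distribution_fun M g \<longrightarrow> \<rho> f = \<rho> g)"

definition space_norm :: "(('a \<Rightarrow> ennreal) \<Rightarrow> ennreal) \<Rightarrow> ('a \<Rightarrow> real) \<Rightarrow> ennreal" where
  "space_norm \<rho> f = \<rho> (\<lambda>x. ennreal \<bar>f x\<bar>)"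

definition function_space :: "'a measure \<Rightarrow> (('a \<Rightarrow> ennreal) \<Rightarrow> ennreal) \<Rightarrow> ('a \<Rightarrow> real) set" where
  "function_space M \<rho> = {f \<in> borel_measurable M. space_norm \<rho> f < \<infinity>}"

definition associate_norm ::
    "'a measure \<Rightarrow> (('a \<Rightarrow> ennreal) \<Rightarrow> ennreal) \<Rightarrow> ('a \<Rightarrow> ennreal) \<Rightarrow> ennreal" where
  "associate_norm M \<rho> f = (SUP g \<in> {g \<in> borel_measurable M. \<rho> g \<le> 1}. \<integral>\<^sup>+ x. f x * g x \<partial>M)"

abbreviation unit_interval :: "real measure" where
  "unit_interval \<equiv> lebesgue_on {0<..<1}"

text \<open>
  The Luxemburg representation on \<open>(0,1)\<close>. On a cube it exists, and it is unique on measurable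
  functions since every nonincreasing right-continuous function on \<open>(0,1)\<close> is a rearrangement;
  hence the choice operator is harmless.
\<close>

definition luxemburg_rep ::
    "'a measure \<Rightarrow> (('a \<Rightarrow> ennreal) \<Rightarrow> ennreal) \<Rightarrow> (real \<Rightarrow> ennreal) \<Rightarrow> ennreal" where
  "luxemburg_rep M \<rho> = (SOME \<rho>'. ri_norm unit_interval \<rho>' \<and>
     (\<forall>f \<in> borel_measurable M. \<rho> f = \<rho>' (rearrangement M f)))"

definition L_infinity_norm :: "'a measure \<Rightarrow> ('a \<Rightarrow> ennreal) \<Rightarrow> ennreal" where
  "L_infinity_norm M f = esssup M f"


section \<open>Sobolev spaces\<close>

definition partial_deriv :: "nat \<Rightarrow> ((nat \<Rightarrow> real) \<Rightarrow> real) \<Rightarrow> (nat \<Rightarrow> real) \<Rightarrow> real" where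
  "partial_deriv i \<phi> x = deriv (\<lambda>t. \<phi> (x(i := t))) (x i)"

primrec iterated_partial :: "nat list \<Rightarrow> ((nat \<Rightarrow> real) \<Rightarrow> real) \<Rightarrow> (nat \<Rightarrow> real) \<Rightarrow> real" where
  "iterated_partial [] \<phi> = \<phi>"
| "iterated_partial (i # ks) \<phi> = partial_deriv i (iterated_partial ks \<phi>)"

abbreviation coord_space :: "nat \<Rightarrow> (nat \<Rightarrow> real) set" where
  "coord_space n \<equiv> PiE {..<n} (\<lambda>_. UNIV)"

text \<open>
  Smoothness on \<open>\<real>\<^sup>n\<close>: all iterated partial derivatives exist and are continuous. The topology on
  the function type is the product topology, which on \<open>coord_space n\<close> is the Euclidean one.
\<close>

definition smooth_fun :: "nat \<Rightarrow> ((nat \<Rightarrow> real) \<Rightarrow> real) \<Rightarrow> bool" where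
  "smooth_fun n \<phi> \<longleftrightarrow> (\<forall>ks. set ks \<subseteq> {..<n} \<longrightarrow>
     continuous_on (coord_space n) (iterated_partial ks \<phi>) \<and>
     (\<forall>i<n. \<forall>x \<in> coord_space n.
        (\<lambda>t. iterated_partial ks \<phi> (x(i := t))) differentiable (at (x i))))"

text \<open>
  A set has compact closure inside the open cube iff it lies in \<open>[a,b]\<^sup>n\<close> for some compact
  interval \<open>[a,b]\<close> contained in the interior of \<open>I\<close>. This is used both for compact supports
  and for local integrability.
\<close>

definition test_function :: "real set \<Rightarrow> nat \<Rightarrow> ((nat \<Rightarrow> real) \<Rightarrow> real) \<Rightarrow> bool" where
  "test_function I n \<phi> \<longleftrightarrow> smooth_fun n \<phi> \<and>
     (\<exists>a b. {a..b} \<subseteq> interior I \<and>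
        (\<forall>x \<in> coord_space n - PiE {..<n} (\<lambda>_. {a..b}). \<phi> x = 0))"

definition locally_integrable :: "real set \<Rightarrow> nat \<Rightarrow> ((nat \<Rightarrow> real) \<Rightarrow> real) \<Rightarrow> bool" where
  "locally_integrable I n f \<longleftrightarrow> f \<in> borel_measurable (cube I n) \<and>
     (\<forall>a b. {a..b} \<subseteq> interior I \<longrightarrow> set_integrable (cube I n) (PiE {..<n} (\<lambda>_. {a..b})) f)"

definition is_weak_gradient ::
    "real set \<Rightarrow> nat \<Rightarrow> ((nat \<Rightarrow> real) \<Rightarrow> real) \<Rightarrow> (nat \<Rightarrow> (nat \<Rightarrow> real) \<Rightarrow> real) \<Rightarrow> bool" where
  "is_weak_gradient I n u g \<longleftrightarrow> locally_integrable I n u \<and>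
     (\<forall>i<n. locally_integrable I n (g i) \<and>
        (\<forall>\<phi>. test_function I n \<phi> \<longrightarrow>
           (LINT x|cube I n. u x * partial_deriv i \<phi> x) = - (LINT x|cube I n. g i x * \<phi> x)))"

text \<open>Weak gradients are unique up to null sets, so the choice does not affect any norm.\<close>

definition weak_gradient ::
    "real set \<Rightarrow> nat \<Rightarrow> ((nat \<Rightarrow> real) \<Rightarrow> real) \<Rightarrow> nat \<Rightarrow> (nat \<Rightarrow> real) \<Rightarrow> real" where
  "weak_gradient I n u = (SOME g. is_weak_gradient I n u g)"

definition gradient_length ::
    "real set \<Rightarrow> nat \<Rightarrow> ((nat \<Rightarrow> real) \<Rightarrow> real) \<Rightarrow> (nat \<Rightarrow> real) \<Rightarrow> real" where
  "gradient_length I n u x = sqrt (\<Sum>i<n. (weak_gradient I n u i x)\<^sup>2)"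

definition sobolev_space ::
    "real set \<Rightarrow> nat \<Rightarrow> (((nat \<Rightarrow> real) \<Rightarrow> ennreal) \<Rightarrow> ennreal) \<Rightarrow> ((nat \<Rightarrow> real) \<Rightarrow> real) set" where
  "sobolev_space I n Z = {u \<in> function_space (cube I n) Z.
     (\<exists>g. is_weak_gradient I n u g) \<and> gradient_length I n u \<in> function_space (cube I n) Z}"

definition sobolev_norm ::
    "real set \<Rightarrow> nat \<Rightarrow> (((nat \<Rightarrow> real) \<Rightarrow> ennreal) \<Rightarrow> ennreal) \<Rightarrow> ((nat \<Rightarrow> real) \<Rightarrow> real) \<Rightarrow> ennreal" where
  "sobolev_norm I n Z u = space_norm Z u + space_norm Z (gradient_length I n u)"


section \<open>Mixed norm spaces\<close>

text \<open>
  \<open>insert_coord n k y t\<close> is the point \<open>x\<close> of \<open>I\<^sup>n\<close> whose \<open>k\<close>-th coordinate is \<open>t\<close> and which becomes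
  \<open>y\<close> when that coordinate is removed.
\<close>

definition insert_coord :: "nat \<Rightarrow> nat \<Rightarrow> (nat \<Rightarrow> real) \<Rightarrow> real \<Rightarrow> nat \<Rightarrow> real" where
  "insert_coord n k y t =
     (\<lambda>i\<in>{..<n}. if i < k then y i else if i = k then t else y (i - 1))"

definition section_norm ::
    "nat \<Rightarrow> nat \<Rightarrow> ((real \<Rightarrow> ennreal) \<Rightarrow> ennreal) \<Rightarrow> ((nat \<Rightarrow> real) \<Rightarrow> real) \<Rightarrow> (nat \<Rightarrow> real) \<Rightarrow> ennreal" where
  "section_norm n k Y f y = space_norm Y (\<lambda>t. f (insert_coord n k y t))"

definition mixed_norm_dir ::
    "nat \<Rightarrow> nat \<Rightarrow> (((nat \<Rightarrow> real) \<Rightarrow> ennreal) \<Rightarrow> ennreal) \<Rightarrow> ((real \<Rightarrow> ennreal) \<Rightarrow> ennreal)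
      \<Rightarrow> ((nat \<Rightarrow> real) \<Rightarrow> real) \<Rightarrow> ennreal" where
  "mixed_norm_dir n k X Y f = X (section_norm n k Y f)"

definition mixed_space_dir ::
    "real set \<Rightarrow> nat \<Rightarrow> nat \<Rightarrow> (((nat \<Rightarrow> real) \<Rightarrow> ennreal) \<Rightarrow> ennreal) \<Rightarrow> ((real \<Rightarrow> ennreal) \<Rightarrow> ennreal)
      \<Rightarrow> ((nat \<Rightarrow> real) \<Rightarrow> real) set" where
  "mixed_space_dir I n k X Y = {f \<in> borel_measurable (cube I n). mixed_norm_dir n k X Y f < \<infinity>}"

definition mixed_space ::
    "real set \<Rightarrow> nat \<Rightarrow> (((nat \<Rightarrow> real) \<Rightarrow> ennreal) \<Rightarrow> ennreal) \<Rightarrow> ((real \<Rightarrow> ennreal) \<Rightarrow> ennreal)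
      \<Rightarrow> ((nat \<Rightarrow> real) \<Rightarrow> real) set" where
  "mixed_space I n X Y = (\<Inter>k<n. mixed_space_dir I n k X Y)"

definition mixed_norm ::
    "nat \<Rightarrow> (((nat \<Rightarrow> real) \<Rightarrow> ennreal) \<Rightarrow> ennreal) \<Rightarrow> ((real \<Rightarrow> ennreal) \<Rightarrow> ennreal)
      \<Rightarrow> ((nat \<Rightarrow> real) \<Rightarrow> real) \<Rightarrow> ennreal" where
  "mixed_norm n X Y f = (\<Sum>k<n. mixed_norm_dir n k X Y f)"


section \<open>Embeddings and the optimal space\<close>

definition continuously_embedded ::
    "'a set \<Rightarrow> ('a \<Rightarrow> ennreal) \<Rightarrow> 'a set \<Rightarrow> ('a \<Rightarrow> ennreal) \<Rightarrow> bool" where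
  "continuously_embedded A normA B normB \<longleftrightarrow>
     A \<subseteq> B \<and> (\<exists>C::real. \<forall>f\<in>A. normB f \<le> ennreal C * normA f)"

definition sobolev_embeds_mixed ::
    "real set \<Rightarrow> nat \<Rightarrow> (((nat \<Rightarrow> real) \<Rightarrow> ennreal) \<Rightarrow> ennreal) \<Rightarrow> (((nat \<Rightarrow> real) \<Rightarrow> ennreal) \<Rightarrow> ennreal)
      \<Rightarrow> bool" where
  "sobolev_embeds_mixed I n Z X \<longleftrightarrow>
     continuously_embedded (sobolev_space I n Z) (sobolev_norm I n Z)
       (mixed_space I n X (L_infinity_norm (lebesgue_on I)))
       (mixed_norm n X (L_infinity_norm (lebesgue_on I)))"

definition mixed_embeds_mixed ::
    "real set \<Rightarrow> nat \<Rightarrow> (((nat \<Rightarrow> real) \<Rightarrow> ennreal) \<Rightarrow> ennreal) \<Rightarrow> (((nat \<Rightarrow> real) \<Rightarrow> ennreal) \<Rightarrow> ennreal)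
      \<Rightarrow> bool" where
  "mixed_embeds_mixed I n X1 X2 \<longleftrightarrow>
     continuously_embedded
       (mixed_space I n X1 (L_infinity_norm (lebesgue_on I)))
       (mixed_norm n X1 (L_infinity_norm (lebesgue_on I)))
       (mixed_space I n X2 (L_infinity_norm (lebesgue_on I)))
       (mixed_norm n X2 (L_infinity_norm (lebesgue_on I)))"

definition conj_exponent :: "nat \<Rightarrow> real" where
  "conj_exponent n = real n / (real n - 1)"

definition predual_norm ::
    "real set \<Rightarrow> nat \<Rightarrow> (((nat \<Rightarrow> real) \<Rightarrow> ennreal) \<Rightarrow> ennreal) \<Rightarrow> ((nat \<Rightarrow> real) \<Rightarrow> ennreal) \<Rightarrow> ennreal" where
  "predual_norm I n Z f =
     associate_norm unit_interval (luxemburg_rep (cube I n) Z)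
       (\<lambda>t. max_rearrangement (cube I (n - 1)) f (t powr (1 / conj_exponent n)))"

definition optimal_norm ::
    "real set \<Rightarrow> nat \<Rightarrow> (((nat \<Rightarrow> real) \<Rightarrow> ennreal) \<Rightarrow> ennreal) \<Rightarrow> ((nat \<Rightarrow> real) \<Rightarrow> ennreal) \<Rightarrow> ennreal" where
  "optimal_norm I n Z = associate_norm (cube I (n - 1)) (predual_norm I n Z)"

end

theory Submission imports Defs "HOL-Probability.Probability" begin

text \<open>
  Write \<open>\<psi>\<^sub>k y\<close> for the essential supremum of \<open>\<bar>u\<bar>\<close> on the line through \<open>y\<close> in the direction \<open>k\<close>, \<open>w = \<bar>u\<bar> + \<bar>\<nabla>u\<bar>\<close>,
  and \<open>\<alpha> = 1/n'\<close>.

  \<^bold>\<open>Embedding.\<close> A function with a weak derivative is absolutely continuous on almost every line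
  (\<open>weak_derivative_primitive\<close>). Hence the excess of \<open>\<psi>\<^sub>k\<close> over a level \<open>s\<close> is at most the integral of \<open>w\<close> over
  the part of the line where \<open>\<bar>u\<bar> > s\<close> (\<open>line_excess\<close>). Let \<open>\<mu> s\<close> be the sum over \<open>k\<close> of the measures of
  \<open>{\<psi>\<^sub>k > s}\<close>. Summation over \<open>k\<close> and the Hardy--Littlewood inequality bound the integral of \<open>\<mu>\<close> over \<open>(s, \<infinity>)\<close> by
  \<open>n\<close> times the integral of \<open>w\<^sup>*\<close> from 0 to the measure of \<open>{\<bar>u\<bar> > s}\<close>. The projections of this set lie in the sets
  \<open>{\<psi>\<^sub>k > s}\<close>, so by the Loomis--Whitney inequality (\<open>loomis_whitney_sum\<close>) its measure to the power \<open>\<alpha>\<close> is at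
  most \<open>\<mu> s\<close>. These two facts are all that is needed to pair \<open>\<psi>\<^sub>k\<close> with a function \<open>g\<close>
  (\<open>pairing_le_of_tail_bounds\<close>): the integral of \<open>\<psi>\<^sub>k * g\<close> is at most \<open>n\<close> times that of
  \<open>w\<^sup>* t * g\<^sup>*\<^sup>* (t powr \<alpha>)\<close>, and Hoelder's inequality in the representation space gives the bound
  of \<open>\<psi>\<^sub>k\<close> in the associate of the norm \<open>g \<mapsto> \<parallel>g\<^sup>*\<^sup>* (t powr \<alpha>)\<parallel>\<close>.

  \<^bold>\<open>Optimality.\<close> A decreasing \<open>h\<close> on \<open>(0, 1)\<close> defines a function \<open>u\<close> of the distance \<open>r\<close> from the centre of
  the cube, in the maximum norm, whose derivative in \<open>r\<close> is \<open>- h (r ^ n)\<close>. Its Sobolev norm is at most a constant times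
  the norm of \<open>h\<close>, because \<open>r ^ n\<close> is uniformly distributed, and its section norm on the line through \<open>y\<close> is the integral of
  \<open>h (\<rho> ^ n)\<close> over \<open>\<rho>\<close> between the radius of \<open>y\<close> and 1. An embedding into \<open>R(X, L\<^sup>\<infinity>)\<close> thus bounds the norm in \<open>X\<close> of these integrals by that of \<open>h\<close>
  (\<open>radial_test_inequality\<close>). The inequality dualizes: a norming functional of a step function \<open>f\<close> in \<open>X\<close> can
  be represented by a step function \<open>g\<close>, and Fubini's theorem shows that the norm of \<open>g\<^sup>*\<^sup>* (t powr \<alpha>)\<close> is
  bounded (\<open>norm_le_associate_norm\<close>). So the norm of \<open>f\<close> in \<open>X\<close> is at most a constant times the optimal norm. Norming
  functionals on step functions exist by the finite-dimensional Hahn--Banach theorem; that they are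
  bounded by the norm of \<open>X\<close> on all decreasing functions rests on rearrangement invariance
  (\<open>step_norming_functional\<close>).

  The representation space is accessible because the cube has a measure preserving map onto the
  interval, a power of the radius (\<open>luxemburg_rep\<close>), and the associate of a norm that is monotone with respect to
  the maximal rearrangement is rearrangement invariant (\<open>ri_norm_associate\<close>).
\<close>

section \<open>Layer cake formulas\<close>

lemma ennreal_excess_layer_cake:
  fixes c :: ennreal and s :: real
  assumes s: "0 \<le> s"
  shows "c - ennreal s = (\<integral>\<^sup>+ y. indicator {s..} y * indicator {y. ennreal y < c} y \<partial>lborel)"
proof -
  have eq: "(\<integral>\<^sup>+ y. indicator {s..} y * indicator {y. ennreal y < c} y \<partial>lborel)
      = emeasure lborel ({s..} \<inter> {y. ennreal y < c})"
    by (simp add: indicator_inter_arith[symmetric])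
  show ?thesis
  proof (cases c)
    case (real r)
    have "{s..} \<inter> {y. ennreal y < c} = {s..<r}"
      using s real by (auto simp: ennreal_less_iff)
    then show ?thesis
      using s real unfolding eq by (cases "s \<le> r") (simp_all add: ennreal_minus ennreal_neg)
  next
    case top
    have *: "ennreal (real n) \<le> emeasure lborel {s..}" for n
      using emeasure_mono[of "{s..s + real n}" "{s..}" lborel] by simp
    have "emeasure lborel {s..} = top"
    proof (rule ccontr)
      assume "emeasure lborel {s..} \<noteq> top"
      then obtain r where r: "emeasure lborel {s..} = ennreal r" "0 \<le> r" by (metis ennreal_cases)
      obtain n where "r < real n" using reals_Archimedean2 by blast
      then show False using *[of n] r by simp
    qed
    then show ?thesis using top unfolding eq by simp
  qed
qed

lemma (in sigma_finite_measure) nn_integral_excess_layer_cake: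
  fixes f w :: "'a \<Rightarrow> ennreal" and s :: real
  assumes [measurable]: "f \<in> borel_measurable M" "w \<in> borel_measurable M" and s: "0 \<le> s"
  shows "(\<integral>\<^sup>+ x. (f x - ennreal s) * w x \<partial>M)
      = (\<integral>\<^sup>+ y\<in>{s..}. (\<integral>\<^sup>+ x. w x * indicator {x. ennreal y < f x} x \<partial>M) \<partial>lborel)"
proof -
  interpret pair_sigma_finite M lborel ..
  have "(\<integral>\<^sup>+ x. (f x - ennreal s) * w x \<partial>M)
      = (\<integral>\<^sup>+ x. (\<integral>\<^sup>+ y. indicator {s..} y * indicator {y. ennreal y < f x} y * w x \<partial>lborel) \<partial>M)"
    by (subst ennreal_excess_layer_cake[OF s], subst nn_integral_multc) auto
  also have "\<dots> = (\<integral>\<^sup>+ x. (\<integral>\<^sup>+ y. (indicator {s..} y * indicator {p \<in> space (M \<Otimes>\<^sub>M lborel). ennreal (snd p) < f (fst p)} (x, y)) * w x \<partial>lborel) \<partial>M)"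
    by (intro nn_integral_cong) (auto simp: indicator_def space_pair_measure)
  also have "\<dots> = (\<integral>\<^sup>+ y. (\<integral>\<^sup>+ x. (indicator {s..} y * indicator {p \<in> space (M \<Otimes>\<^sub>M lborel). ennreal (snd p) < f (fst p)} (x, y)) * w x \<partial>M) \<partial>lborel)"
    by (rule Fubini'[symmetric]) measurable
  also have "\<dots> = (\<integral>\<^sup>+ y\<in>{s..}. (\<integral>\<^sup>+ x. w x * indicator {x. ennreal y < f x} x \<partial>M) \<partial>lborel)"
    by (intro nn_integral_cong, subst nn_integral_multc[symmetric])
      (auto simp: indicator_def space_pair_measure intro!: nn_integral_cong)
  finally show ?thesis .
qed

lemma (in sigma_finite_measure) nn_integral_layer_cake:
  fixes f w :: "'a \<Rightarrow> ennreal"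
  assumes "f \<in> borel_measurable M" "w \<in> borel_measurable M"
  shows "(\<integral>\<^sup>+ x. f x * w x \<partial>M)
      = (\<integral>\<^sup>+ y\<in>{0..}. (\<integral>\<^sup>+ x. w x * indicator {x. ennreal y < f x} x \<partial>M) \<partial>lborel)"
  using nn_integral_excess_layer_cake[OF assms, of 0] by simp

section \<open>Rearrangements\<close>

lemma distribution_fun_antimono:
  assumes "f \<in> borel_measurable M" "s \<le> t"
  shows "distribution_fun M f t \<le> distribution_fun M f s"
  using assms unfolding distribution_fun_def by (intro emeasure_mono) auto

text \<open>
  The distribution function and the rearrangement form a Galois connection, because the former is right
  continuous and the infimum that defines the latter is therefore attained.
\<close>

lemma less_rearrangement_iff:
  assumes f[measurable]: "f \<in> borel_measurable M"
  shows "s < rearrangement M f t \<longleftrightarrow> ennreal t < distribution_fun M f s"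
proof -
  let ?S = "{s. distribution_fun M f s \<le> ennreal t}"
  have "top \<in> ?S" by (simp add: distribution_fun_def)
  then obtain e :: "nat \<Rightarrow> ennreal" where e: "decseq e" "range e \<subseteq> ?S" "Inf ?S = (INF i. e i)"
    using ennreal_Inf_countable_INF[of ?S] by auto
  have "distribution_fun M f (Inf ?S) = (SUP i. distribution_fun M f (e i))"
  proof -
    have "{x \<in> space M. Inf ?S < f x} = (\<Union>i. {x \<in> space M. e i < f x})"
      unfolding e(3) by (auto simp: INF_less_iff)
    moreover have "incseq (\<lambda>i. {x \<in> space M. e i < f x})"
      using e(1) by (fastforce simp: incseq_def decseq_def intro: le_less_trans)
    ultimately show ?thesis
      unfolding distribution_fun_def by (simp add: SUP_emeasure_incseq image_subset_iff)
  qed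
  also have "\<dots> \<le> ennreal t" using e(2) by (auto intro!: SUP_least)
  finally have *: "distribution_fun M f (Inf ?S) \<le> ennreal t" .
  show ?thesis
  proof
    assume "s < rearrangement M f t"
    then have "s \<notin> ?S" unfolding rearrangement_def
      by (meson Inf_lower leD)
    then show "ennreal t < distribution_fun M f s" by simp
  next
    assume a: "ennreal t < distribution_fun M f s"
    show "s < rearrangement M f t"
    proof (rule ccontr)
      assume "\<not> ?thesis"
      then have "Inf ?S \<le> s" by (simp add: rearrangement_def not_less)
      from distribution_fun_antimono[OF f this] * a show False
	by (auto dest: leD order_trans)
    qed
  qed
qed

lemma rearrangement_antimono:
  assumes f: "f \<in> borel_measurable M" and "t \<le> t'"
  shows "rearrangement M f t' \<le> rearrangement M f t"
proof (rule ccontr)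
  assume "\<not> ?thesis"
  then have "rearrangement M f t < rearrangement M f t'" by simp
  then have "ennreal t' < distribution_fun M f (rearrangement M f t)"
    by (simp add: less_rearrangement_iff[OF f])
  then have "ennreal t < distribution_fun M f (rearrangement M f t)"
    using \<open>t \<le> t'\<close> by (meson ennreal_leI le_less_trans)
  then show False by (simp add: less_rearrangement_iff[OF f, symmetric])
qed

lemma borel_measurable_rearrangement[measurable]:
  assumes f: "f \<in> borel_measurable M"
  shows "rearrangement M f \<in> borel_measurable borel"
proof (rule borel_measurableI_greater)
  fix y
  have "{x. y < rearrangement M f x} = {x. ennreal x < distribution_fun M f y}"
    by (simp add: less_rearrangement_iff[OF f])
  then show "{x \<in> space borel. y < rearrangement M f x} \<in> sets borel"
    by simp
qed

text \<open>
  Peetre's \<open>K\<close>-functional of \<open>f\<close> between \<open>L\<^sup>1\<close> and \<open>L\<^sup>\<infinity>\<close>: it is the infimum of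
  \<open>t * s + \<integral> (f - s)\<^sub>+\<close> over \<open>s\<close>, as the lemmas below show.
\<close>

definition rearrangement_int :: "'a measure \<Rightarrow> ('a \<Rightarrow> ennreal) \<Rightarrow> real \<Rightarrow> ennreal" where
  "rearrangement_int M f t = (\<integral>\<^sup>+ s\<in>{0<..<t}. rearrangement M f s \<partial>lborel)"

lemma max_rearrangement_eq: "max_rearrangement M f t = rearrangement_int M f t / ennreal t"
  by (simp add: max_rearrangement_def rearrangement_int_def)

text \<open>
  Fubini's theorem for the region below the graph of the rearrangement; the section at height \<open>y\<close> is
  \<open>(0, D y)\<close> cut off at \<open>t\<close>.
\<close>

lemma rearrangement_int_layers:
  assumes f[measurable]: "f \<in> borel_measurable M" and "0 \<le> t"
  shows "rearrangement_int M f t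
      = (\<integral>\<^sup>+ y\<in>{0..}. min (ennreal t) (distribution_fun M f (ennreal y)) \<partial>lborel)"
proof -
  have "rearrangement_int M f t
      = (\<integral>\<^sup>+ y\<in>{0..}. (\<integral>\<^sup>+ s. indicator {0<..<t} s * indicator {s. ennreal y < rearrangement M f s} s \<partial>lborel) \<partial>lborel)"
    unfolding rearrangement_int_def
    by (subst lborel.nn_integral_layer_cake) auto
  also have "\<dots> = (\<integral>\<^sup>+ y\<in>{0..}. min (ennreal t) (distribution_fun M f (ennreal y)) \<partial>lborel)"
  proof (intro nn_integral_cong arg_cong2[where f="(*)"] refl)
    fix y :: real
    let ?D = "distribution_fun M f (ennreal y)"
    have "(\<integral>\<^sup>+ s. indicator {0<..<t} s * indicator {s. ennreal y < rearrangement M f s} s \<partial>lborel)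
       = (\<integral>\<^sup>+ s. indicator ({0<..<t} \<inter> {s. ennreal s < ?D}) s \<partial>lborel)"
      by (intro nn_integral_cong) (auto simp: indicator_def less_rearrangement_iff)
    also have "\<dots> = emeasure lborel ({0<..<t} \<inter> {s. ennreal s < ?D})"
      by (rule nn_integral_indicator) measurable
    also have "\<dots> = min (ennreal t) ?D"
    proof (cases ?D)
      case (real r)
      have "{0<..<t} \<inter> {s. ennreal s < ?D} = {0<..<min t r}"
	using real by (auto simp: ennreal_less_iff)
      then show ?thesis using real \<open>0 \<le> t\<close> by (simp add: min_def ennreal_le_iff)
    next
      case top
      then show ?thesis using \<open>0 \<le> t\<close> by simp
    qed
    finally show "(\<integral>\<^sup>+ s. indicator {0<..<t} s * indicator {s. ennreal y < rearrangement M f s} s \<partial>lborel)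
      = min (ennreal t) ?D" .
  qed
  finally show ?thesis .
qed

lemma (in sigma_finite_measure) nn_integral_excess:
  assumes f[measurable]: "f \<in> borel_measurable M" and "0 \<le> s"
  shows "(\<integral>\<^sup>+ x. f x - ennreal s \<partial>M) = (\<integral>\<^sup>+ y\<in>{s..}. distribution_fun M f (ennreal y) \<partial>lborel)"
proof -
  have "(\<integral>\<^sup>+ x. (f x - ennreal s) * 1 \<partial>M)
    = (\<integral>\<^sup>+ y\<in>{s..}. (\<integral>\<^sup>+ x. 1 * indicator {x. ennreal y < f x} x \<partial>M) \<partial>lborel)"
    by (rule nn_integral_excess_layer_cake) (use assms in auto)
  also have "\<dots> = (\<integral>\<^sup>+ y\<in>{s..}. distribution_fun M f (ennreal y) \<partial>lborel)"
  proof (intro nn_integral_cong arg_cong2[where f="(*)"] refl)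
    fix y :: real
    have "(\<integral>\<^sup>+ x. 1 * indicator {x. ennreal y < f x} x \<partial>M)
	= (\<integral>\<^sup>+ x. indicator {x \<in> space M. ennreal y < f x} x \<partial>M)"
      by (intro nn_integral_cong) (auto simp: indicator_def)
    then show "(\<integral>\<^sup>+ x. 1 * indicator {x. ennreal y < f x} x \<partial>M) = distribution_fun M f (ennreal y)"
      by (simp add: distribution_fun_def)
  qed
  finally show ?thesis by simp
qed

lemma borel_measurable_distribution_fun[measurable]:
  assumes f[measurable]: "f \<in> borel_measurable M"
  shows "distribution_fun M f \<in> borel_measurable borel"
proof (rule borel_measurableI_greater)
  fix y
  let ?S = "{x. y < distribution_fun M f x}"
  have "?S = {..< Sup ?S} \<or>
     ?S = {..Sup ?S}"
  proof (cases "Sup ?S \<in> ?S")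
    case True
    then have "?S = {..Sup ?S}"
      by (auto intro: Sup_upper less_le_trans[OF _ distribution_fun_antimono[OF f]])
    then show ?thesis ..
  next
    case False
    have "?S = {..< Sup ?S}"
    proof (intro set_eqI iffI)
      fix x assume "x \<in> ?S"
      then show "x \<in> {..< Sup ?S}"
	using False by (auto simp: less_le intro: Sup_upper)
    next
      fix x assume "x \<in> {..< Sup ?S}"
      then obtain z where "x < z" "y < distribution_fun M f z" by (auto simp: less_Sup_iff)
      then show "x \<in> ?S"
	using distribution_fun_antimono[OF f, of x z] by (auto intro: less_le_trans)
    qed
    then show ?thesis ..
  qed
  then have "?S \<in> sets borel"
    by (metis borel_closed borel_open closed_atMost open_lessThan)
  then show "{x \<in> space borel. y < distribution_fun M f x} \<in> sets borel"
    by simp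
qed

lemma (in sigma_finite_measure) rearrangement_int_le:
  assumes f[measurable]: "f \<in> borel_measurable M" and t: "0 \<le> t" and s: "0 \<le> s"
  shows "rearrangement_int M f t \<le> ennreal (t * s) + (\<integral>\<^sup>+ x. f x - ennreal s \<partial>M)"
proof -
  have "rearrangement_int M f t
     \<le> (\<integral>\<^sup>+ y. ennreal t * indicator {0..s} y + distribution_fun M f (ennreal y) * indicator {s..} y \<partial>lborel)"
    unfolding rearrangement_int_layers[OF f t]
    by (intro nn_integral_mono) (auto simp: indicator_def min_le_iff_disj intro: add_increasing2)
  also have "\<dots> = ennreal (t * s) + (\<integral>\<^sup>+ x. f x - ennreal s \<partial>M)"
    using t s by (subst nn_integral_add) (simp_all add: nn_integral_excess nn_integral_cmult ennreal_mult)
  finally show ?thesis .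
qed

lemma (in sigma_finite_measure) rearrangement_int_attained:
  assumes f[measurable]: "f \<in> borel_measurable M" and t: "0 < t" and fin: "rearrangement M f t = ennreal s" and s: "0 \<le> s"
  shows "rearrangement_int M f t = ennreal (t * s) + (\<integral>\<^sup>+ x. f x - ennreal s \<partial>M)"
proof -
  have "rearrangement_int M f t
     = (\<integral>\<^sup>+ y. ennreal t * indicator {0..<s} y + distribution_fun M f (ennreal y) * indicator {s..} y \<partial>lborel)"
    unfolding rearrangement_int_layers[OF f less_imp_le[OF t]]
  proof (intro nn_integral_cong)
    fix y :: real
    show "min (ennreal t) (distribution_fun M f (ennreal y)) * indicator {0..} y =
	 ennreal t * indicator {0..<s} y + distribution_fun M f (ennreal y) * indicator {s..} y"
    proof (cases "0 \<le> y \<and> y < s")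
      case True
      then have "ennreal t < distribution_fun M f (ennreal y)"
	using fin s by (simp add: less_rearrangement_iff[OF f, symmetric] ennreal_less_iff)
      then show ?thesis using True by (simp add: min_absorb1 less_imp_le)
    next
      case False
      then have "y < 0 \<or> \<not> ennreal t < distribution_fun M f (ennreal y)"
	using fin s by (auto simp: less_rearrangement_iff[OF f, symmetric] ennreal_less_iff)
      then show ?thesis using False s by (auto simp: min_def indicator_def)
    qed
  qed
  also have "\<dots> = ennreal (t * s) + (\<integral>\<^sup>+ x. f x - ennreal s \<partial>M)"
    using t s by (subst nn_integral_add) (simp_all add: nn_integral_excess nn_integral_cmult ennreal_mult)
  finally show ?thesis .
qed

lemma rearrangement_int_mono_dist:
  assumes f: "f \<in> borel_measurable M" and g: "g \<in> borel_measurable N"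
    and "\<And>y. 0 \<le> y \<Longrightarrow> distribution_fun M f (ennreal y) \<le> distribution_fun N g (ennreal y)"
  shows "rearrangement_int M f t \<le> rearrangement_int N g t"
proof (cases "0 \<le> t")
  case True
  then show ?thesis using assms
    by (auto simp: rearrangement_int_layers min_le_iff_disj intro!: nn_integral_mono split: split_indicator)
qed (simp add: rearrangement_int_def)

lemma rearrangement_int_infinite:
  assumes f[measurable]: "f \<in> borel_measurable M" and t: "0 < t" and "rearrangement M f t = top"
  shows "rearrangement_int M f t = top"
proof -
  have "ennreal t < distribution_fun M f (ennreal y)" for y
    using assms by (simp add: less_rearrangement_iff[OF f, symmetric])
  then have "min (ennreal t) (distribution_fun M f (ennreal y)) = ennreal t" for y
    by (simp add: min_def less_imp_le)
  then have "rearrangement_int M f t = ennreal t * (\<integral>\<^sup>+ y. indicator {0..} y * indicator {y. ennreal y < top} y \<partial>lborel)"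
    using t unfolding rearrangement_int_layers[OF f less_imp_le[OF t]] by (simp add: nn_integral_cmult)
  then show ?thesis using t ennreal_excess_layer_cake[of 0 top] by (simp add: ennreal_mult_top)
qed

text \<open>
  The infimum formula for the primitive of the rearrangement is what makes it subadditive and
  what lets Jensen's inequality be applied to it.
\<close>

lemma (in sigma_finite_measure) rearrangement_int_geI:
  assumes f[measurable]: "f \<in> borel_measurable M" and t: "0 < t"
    and *: "\<And>s. 0 \<le> s \<Longrightarrow> c \<le> ennreal (t * s) + (\<integral>\<^sup>+ x. f x - ennreal s \<partial>M)"
  shows "c \<le> rearrangement_int M f t"
proof (cases "rearrangement M f t")
  case (real s)
  then show ?thesis using rearrangement_int_attained[OF f t] * by auto
next
  case top
  then show ?thesis using rearrangement_int_infinite[OF f t] by simp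
qed

lemma (in sigma_finite_measure) rearrangement_int_add:
  assumes f[measurable]: "f \<in> borel_measurable M" and g[measurable]: "g \<in> borel_measurable M"
  shows "rearrangement_int M (\<lambda>x. f x + g x) t \<le> rearrangement_int M f t + rearrangement_int M g t"
proof (cases "0 < t")
  case t: True
  show ?thesis
  proof (cases "rearrangement M f t = top \<or> rearrangement M g t = top")
    case True
    then show ?thesis using rearrangement_int_infinite[OF f t] rearrangement_int_infinite[OF g t] by auto
  next
    case False
    then obtain r s where r: "rearrangement M f t = ennreal r" "0 \<le> r" and s: "rearrangement M g t = ennreal s" "0 \<le> s"
      by (metis ennreal_cases)
    have pw: "f x + g x - ennreal (r + s) \<le> (f x - ennreal r) + (g x - ennreal s)" for x
    proof (cases "f x = top \<or> g x = top")
      case False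
      then obtain a b where "f x = ennreal a" "g x = ennreal b" "0 \<le> a" "0 \<le> b" by (metis ennreal_cases)
      moreover have "ennreal (a + b - (r + s)) \<le> ennreal (max 0 (a - r) + max 0 (b - s))"
	by (rule ennreal_leI) auto
      moreover have "ennreal (max 0 (a - r) + max 0 (b - s)) = ennreal (a - r) + ennreal (b - s)"
	by (subst ennreal_plus) (auto simp: max_def ennreal_neg)
      ultimately show ?thesis
	using r(2) s(2) by (simp add: ennreal_minus flip: ennreal_plus)
    qed auto
    have "rearrangement_int M (\<lambda>x. f x + g x) t \<le> ennreal (t * (r + s)) + (\<integral>\<^sup>+ x. f x + g x - ennreal (r + s) \<partial>M)"
      using t r s by (intro rearrangement_int_le) auto
    also have "\<dots> \<le> ennreal (t * (r + s)) + (\<integral>\<^sup>+ x. (f x - ennreal r) + (g x - ennreal s) \<partial>M)"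
      by (intro add_left_mono nn_integral_mono pw)
    also have "\<dots> = rearrangement_int M f t + rearrangement_int M g t"
      using t r s rearrangement_int_attained[OF f t r] rearrangement_int_attained[OF g t s]
      by (simp add: nn_integral_add distrib_left add_ac)
    finally show ?thesis .
  qed
qed (simp add: rearrangement_int_def)

text \<open>The Hardy--Littlewood inequality for a set.\<close>

lemma (in sigma_finite_measure) set_integral_le_rearrangement_int:
  assumes f[measurable]: "f \<in> borel_measurable M" and E[measurable]: "E \<in> sets M"
    and t: "0 \<le> t" and le: "emeasure M E \<le> ennreal t"
  shows "(\<integral>\<^sup>+ x\<in>E. f x \<partial>M) \<le> rearrangement_int M f t"
proof -
  have "(\<integral>\<^sup>+ x\<in>E. f x \<partial>M) = (\<integral>\<^sup>+ y\<in>{0..}. (\<integral>\<^sup>+ x. indicator E x * indicator {x. ennreal y < f x} x \<partial>M) \<partial>lborel)"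
    by (rule nn_integral_layer_cake) auto
  also have "\<dots> \<le> rearrangement_int M f t"
    unfolding rearrangement_int_layers[OF f t]
  proof (intro nn_integral_mono mult_right_mono)
    fix y :: real
    have "(\<integral>\<^sup>+ x. indicator E x * indicator {x. ennreal y < f x} x \<partial>M)
	= (\<integral>\<^sup>+ x. indicator (E \<inter> {x \<in> space M. ennreal y < f x}) x \<partial>M)"
      by (intro nn_integral_cong) (auto simp: indicator_def)
    also have "\<dots> = emeasure M (E \<inter> {x \<in> space M. ennreal y < f x})"
      by (rule nn_integral_indicator) measurable
    also have "\<dots> \<le> min (ennreal t) (distribution_fun M f (ennreal y))"
      unfolding distribution_fun_def
      by (auto intro!: emeasure_mono order_trans[OF _ le])
    finally show "(\<integral>\<^sup>+ x. indicator E x * indicator {x. ennreal y < f x} x \<partial>M) \<le> min (ennreal t) (distribution_fun M f (ennreal y))" .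
  qed simp
  finally show ?thesis .
qed

lemma (in sigma_finite_measure) rearrangement_int_total:
  assumes f[measurable]: "f \<in> borel_measurable M" and t: "0 \<le> t" and le: "emeasure M (space M) \<le> ennreal t"
  shows "rearrangement_int M f t = (\<integral>\<^sup>+ x. f x \<partial>M)"
proof (rule antisym)
  show "rearrangement_int M f t \<le> (\<integral>\<^sup>+ x. f x \<partial>M)"
    using rearrangement_int_le[OF f t order_refl] by simp
  have "(\<integral>\<^sup>+ x. f x \<partial>M) = (\<integral>\<^sup>+ x\<in>space M. f x \<partial>M)" by (intro nn_integral_cong) auto
  also have "\<dots> \<le> rearrangement_int M f t"
    by (rule set_integral_le_rearrangement_int) (use t le in auto)
  finally show "(\<integral>\<^sup>+ x. f x \<partial>M) \<le> rearrangement_int M f t" .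
qed

text \<open>
  In terms of layers the average is the integral of \<open>min 1 (D y / t)\<close>, which decreases in \<open>t\<close>. This avoids
  a separate treatment of infinite values.
\<close>

lemma max_rearrangement_antimono:
  assumes f[measurable]: "f \<in> borel_measurable M" and t: "0 < t" "t \<le> t'"
  shows "max_rearrangement M f t' \<le> max_rearrangement M f t"
proof -
  have *: "max_rearrangement M f r = (\<integral>\<^sup>+ y\<in>{0..}. min 1 (distribution_fun M f (ennreal y) / ennreal r) \<partial>lborel)" if "0 < r" for r
  proof -
    have "min (ennreal r) c / ennreal r = min 1 (c / ennreal r)" for c
    proof (cases "c \<le> ennreal r")
      case True
      then have "c / ennreal r \<le> 1" using that by (simp add: divide_le_posI_ennreal)
      then show ?thesis using True by (simp add: min_def)
    next
      case False
      then have "1 \<le> c / ennreal r" using that divide_right_mono_ennreal[of "ennreal r" c "ennreal r"] by simp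
      then show ?thesis using False that by (auto simp: min_def)
    qed
    then have "min (ennreal r) c * i / ennreal r = min 1 (c / ennreal r) * i" for c i
      by (metis ennreal_times_divide mult.commute)
    then show ?thesis
      using that
      by (simp add: max_rearrangement_eq rearrangement_int_layers[OF f] nn_integral_divide[symmetric])
  qed
  have "inverse (ennreal t') \<le> inverse (ennreal t)"
    using t by (simp add: inverse_ennreal ennreal_leI le_imp_inverse_le)
  then show ?thesis using t
    by (auto simp: * divide_ennreal_def intro!: nn_integral_mono mult_right_mono mult_left_mono min.mono)
qed

lemma borel_measurable_max_rearrangement[measurable]:
  assumes f[measurable]: "f \<in> borel_measurable M"
  shows "max_rearrangement M f \<in> borel_measurable borel"
proof -
  have "rearrangement_int M f = (\<lambda>t. \<integral>\<^sup>+ s. rearrangement M f s * indicator {p. 0 < snd p \<and> snd p < fst p} (t, s) \<partial>lborel)"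
    unfolding rearrangement_int_def by (intro ext nn_integral_cong) (auto simp: indicator_def)
  also have "\<dots> \<in> borel_measurable borel" by measurable
  finally have [measurable]: "rearrangement_int M f \<in> borel_measurable borel" .
  show ?thesis unfolding max_rearrangement_eq by measurable
qed

section \<open>Banach function norms and their associates\<close>

lemma banach_function_normD:
  assumes "banach_function_norm M \<rho>"
  shows "f \<in> borel_measurable M \<Longrightarrow> \<rho> f = 0 \<longleftrightarrow> (AE x in M. f x = 0)"
    and "f \<in> borel_measurable M \<Longrightarrow> g \<in> borel_measurable M \<Longrightarrow> \<rho> (\<lambda>x. f x + g x) \<le> \<rho> f + \<rho> g"
    and "f \<in> borel_measurable M \<Longrightarrow> 0 \<le> c \<Longrightarrow> \<rho> (\<lambda>x. ennreal c * f x) = ennreal c * \<rho> f"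
    and "f \<in> borel_measurable M \<Longrightarrow> g \<in> borel_measurable M \<Longrightarrow> (AE x in M. g x \<le> f x) \<Longrightarrow> \<rho> g \<le> \<rho> f"
    and "\<rho> (\<lambda>_. 1) < \<infinity>"
    and "\<exists>C::real. \<forall>f \<in> borel_measurable M. (\<integral>\<^sup>+ x. f x \<partial>M) \<le> ennreal C * \<rho> f"
  using assms unfolding banach_function_norm_def by blast+

lemma banach_function_norm_Fatou:
  assumes "banach_function_norm M \<rho>"
    and "\<And>j. F j \<in> borel_measurable M" "f \<in> borel_measurable M"
    and "AE x in M. incseq (\<lambda>j. F j x) \<and> (SUP j. F j x) = f x"
  shows "incseq (\<lambda>j. \<rho> (F j))" "(SUP j. \<rho> (F j)) = \<rho> f"
  using assms unfolding banach_function_norm_def by blast+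

lemma banach_function_norm_cong_AE:
  assumes "banach_function_norm M \<rho>" "f \<in> borel_measurable M" "g \<in> borel_measurable M" "AE x in M. f x = g x"
  shows "\<rho> f = \<rho> g"
proof (rule antisym)
  show "\<rho> f \<le> \<rho> g" by (rule banach_function_normD(4)[OF assms(1,3,2)]) (use assms(4) in auto)
  show "\<rho> g \<le> \<rho> f" by (rule banach_function_normD(4)[OF assms(1,2,3)]) (use assms(4) in auto)
qed

text \<open>
  Hoelder's inequality. Finiteness of the second norm excludes the indeterminate product of zero and
  infinity, and makes the normalization of \<open>g\<close> possible.
\<close>

lemma nn_integral_mult_le_associate_norm:
  assumes \<rho>: "banach_function_norm M \<rho>"
    and [measurable]: "f \<in> borel_measurable M" "g \<in> borel_measurable M" and fin: "\<rho> g < \<infinity>"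
  shows "(\<integral>\<^sup>+ x. f x * g x \<partial>M) \<le> associate_norm M \<rho> f * \<rho> g"
proof (cases "\<rho> g = 0")
  case True
  then have "AE x in M. g x = 0" using banach_function_normD(1)[OF \<rho>] by simp
  then have "(\<integral>\<^sup>+ x. f x * g x \<partial>M) = (\<integral>\<^sup>+ x. 0 \<partial>M)"
    by (intro nn_integral_cong_AE) auto
  then show ?thesis by simp
next
  case False
  then obtain r where r: "\<rho> g = ennreal r" "0 < r"
    using fin by (cases "\<rho> g") (auto simp: less_le)
  have "\<rho> (\<lambda>x. ennreal (1 / r) * g x) = ennreal (1 / r) * ennreal r"
    using banach_function_normD(3)[OF \<rho>, of g "1 / r"] r by simp
  also have "\<dots> = 1" using r by (simp flip: ennreal_mult)
  finally have "(\<integral>\<^sup>+ x. f x * (ennreal (1 / r) * g x) \<partial>M) \<le> associate_norm M \<rho> f"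
    unfolding associate_norm_def by (intro SUP_upper) auto
  then have "(\<integral>\<^sup>+ x. f x * (ennreal (1 / r) * g x) \<partial>M) * ennreal r \<le> associate_norm M \<rho> f * ennreal r"
    by (rule mult_right_mono) simp
  moreover have "(\<integral>\<^sup>+ x. f x * (ennreal (1 / r) * g x) \<partial>M) * ennreal r = (\<integral>\<^sup>+ x. f x * g x \<partial>M)"
  proof -
    have "f x * (ennreal (1 / r) * g x) * ennreal r = f x * g x" for x
    proof -
      have "f x * (ennreal (1 / r) * g x) * ennreal r = (ennreal (1 / r) * ennreal r) * (f x * g x)"
	by (simp add: mult_ac)
      also have "ennreal (1 / r) * ennreal r = 1" using r by (simp flip: ennreal_mult)
      finally show ?thesis by simp
    qed
    then show ?thesis by (subst nn_integral_multc[symmetric]) auto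
  qed
  ultimately show ?thesis using r by simp
qed

lemma associate_norm_mono:
  assumes "AE x in M. f x \<le> g x"
  shows "associate_norm M \<rho> f \<le> associate_norm M \<rho> g"
  unfolding associate_norm_def
  by (intro SUP_mono bexI nn_integral_mono_AE) (use assms in \<open>auto elim!: eventually_mono intro: mult_right_mono\<close>)

lemma banach_function_norm_associate:
  fixes M :: "'a measure"
  assumes M: "prob_space M" and \<rho>: "banach_function_norm M \<rho>"
  shows "banach_function_norm M (associate_norm M \<rho>)"
proof -
  interpret prob_space M by fact
  let ?B = "{g \<in> borel_measurable M. \<rho> g \<le> 1}"
  have "\<rho> (\<lambda>_. 1) \<noteq> 0"
    using banach_function_normD(1)[OF \<rho>, of "\<lambda>_. 1"] by (simp add: AE_False)
  then obtain r where r: "\<rho> (\<lambda>_. 1) = ennreal r" "0 < r"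
    using banach_function_normD(5)[OF \<rho>] by (cases "\<rho> (\<lambda>_. 1)") (auto simp: less_le)
  have integral_le: "(\<integral>\<^sup>+ x. f x \<partial>M) \<le> ennreal r * associate_norm M \<rho> f" if "f \<in> borel_measurable M" for f
    using nn_integral_mult_le_associate_norm[OF \<rho> that, of "\<lambda>_. 1"] r by (simp add: mult.commute)
  obtain C where C: "(\<integral>\<^sup>+ x. f x \<partial>M) \<le> ennreal C * \<rho> f" if "f \<in> borel_measurable M" for f
    using banach_function_normD(6)[OF \<rho>] by blast
  show ?thesis
    unfolding banach_function_norm_def
  proof (intro conjI ballI allI impI)
    fix f :: "'a \<Rightarrow> ennreal" assume f[measurable]: "f \<in> borel_measurable M"
    show "associate_norm M \<rho> f = 0 \<longleftrightarrow> (AE x in M. f x = 0)"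
    proof
      assume "associate_norm M \<rho> f = 0"
      then have "(\<integral>\<^sup>+ x. f x \<partial>M) = 0" using integral_le[OF f] by simp
      then show "AE x in M. f x = 0" by (simp add: nn_integral_0_iff_AE)
    next
      assume "AE x in M. f x = 0"
      then have "(\<integral>\<^sup>+ x. f x * g x \<partial>M) = (\<integral>\<^sup>+ x. 0 \<partial>M)" for g
	by (intro nn_integral_cong_AE) auto
      then show "associate_norm M \<rho> f = 0" unfolding associate_norm_def by (auto intro!: antisym SUP_least)
    qed
    { fix g :: "'a \<Rightarrow> ennreal" assume [measurable]: "g \<in> borel_measurable M"
      show "associate_norm M \<rho> (\<lambda>x. f x + g x) \<le> associate_norm M \<rho> f + associate_norm M \<rho> g"
	unfolding associate_norm_def[of _ _ "\<lambda>x. f x + g x"]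
      proof (rule SUP_least)
	fix h assume h: "h \<in> ?B"
	then have [measurable]: "h \<in> borel_measurable M" by simp
	have "(\<integral>\<^sup>+ x. (f x + g x) * h x \<partial>M) = (\<integral>\<^sup>+ x. f x * h x \<partial>M) + (\<integral>\<^sup>+ x. g x * h x \<partial>M)"
	  by (subst nn_integral_add[symmetric]) (auto simp: distrib_right)
	also have "\<dots> \<le> associate_norm M \<rho> f + associate_norm M \<rho> g"
	  unfolding associate_norm_def using h by (intro add_mono SUP_upper)
	finally show "(\<integral>\<^sup>+ x. (f x + g x) * h x \<partial>M) \<le> associate_norm M \<rho> f + associate_norm M \<rho> g" .
      qed }
    { fix c :: real assume "0 \<le> c"
      have "associate_norm M \<rho> (\<lambda>x. ennreal c * f x) = (SUP g\<in>?B. ennreal c * (\<integral>\<^sup>+ x. f x * g x \<partial>M))"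
	unfolding associate_norm_def
	by (intro SUP_cong refl) (auto simp: mult.assoc nn_integral_cmult)
      also have "\<dots> = ennreal c * associate_norm M \<rho> f"
	unfolding associate_norm_def by (simp add: SUP_mult_left_ennreal)
      finally show "associate_norm M \<rho> (\<lambda>x. ennreal c * f x) = ennreal c * associate_norm M \<rho> f" . }
    { fix g :: "'a \<Rightarrow> ennreal" assume "AE x in M. g x \<le> f x"
      then show "associate_norm M \<rho> g \<le> associate_norm M \<rho> f" by (rule associate_norm_mono) }
  next
    fix F :: "nat \<Rightarrow> 'a \<Rightarrow> ennreal" and f :: "'a \<Rightarrow> ennreal"
    assume *: "(\<forall>j. F j \<in> borel_measurable M) \<and> f \<in> borel_measurable M \<and>
	(AE x in M. incseq (\<lambda>j. F j x) \<and> (SUP j. F j x) = f x)"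
    then have [measurable]: "\<And>j. F j \<in> borel_measurable M" "f \<in> borel_measurable M" by auto
    show "incseq (\<lambda>j. associate_norm M \<rho> (F j))"
      using * by (auto intro!: incseq_SucI associate_norm_mono elim!: eventually_mono simp: incseq_Suc_iff)
    have "(SUP j. associate_norm M \<rho> (F j)) = (SUP g\<in>?B. SUP j. (\<integral>\<^sup>+ x. F j x * g x \<partial>M))"
      unfolding associate_norm_def by (rule SUP_commute)
    also have "\<dots> = (SUP g\<in>?B. (\<integral>\<^sup>+ x. f x * g x \<partial>M))"
    proof (intro SUP_cong refl)
      fix g assume "g \<in> ?B"
      then have [measurable]: "g \<in> borel_measurable M" by simp
      have "(SUP j. (\<integral>\<^sup>+ x. F j x * g x \<partial>M)) = (\<integral>\<^sup>+ x. (SUP j. F j x * g x) \<partial>M)"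
	using * by (intro nn_integral_monotone_convergence_SUP_AE[symmetric])
	  (auto elim!: eventually_mono intro!: mult_right_mono simp: incseq_Suc_iff)
      also have "\<dots> = (\<integral>\<^sup>+ x. f x * g x \<partial>M)"
      proof (rule nn_integral_cong_AE)
	have "AE x in M. (SUP j. F j x) = f x" using * by auto
	then show "AE x in M. (SUP j. F j x * g x) = f x * g x"
	  by eventually_elim (simp add: SUP_mult_right_ennreal[symmetric])
      qed
      finally show "(SUP j. (\<integral>\<^sup>+ x. F j x * g x \<partial>M)) = (\<integral>\<^sup>+ x. f x * g x \<partial>M)" .
    qed
    finally show "(SUP j. associate_norm M \<rho> (F j)) = associate_norm M \<rho> f"
      unfolding associate_norm_def .
  next
    have "associate_norm M \<rho> (\<lambda>_. 1) \<le> ennreal C * 1"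
      unfolding associate_norm_def
    proof (intro SUP_least)
      fix g assume "g \<in> ?B"
      then have "(\<integral>\<^sup>+ x. g x \<partial>M) \<le> ennreal C * \<rho> g" "ennreal C * \<rho> g \<le> ennreal C * 1"
	by (auto intro: C mult_left_mono simp del: mult_1_right)
      then show "(\<integral>\<^sup>+ x. 1 * g x \<partial>M) \<le> ennreal C * 1" by simp
    qed
    also have "\<dots> < \<infinity>" by simp
    finally show "associate_norm M \<rho> (\<lambda>_. 1) < \<infinity>" .
  next
    show "\<exists>C. \<forall>f\<in>borel_measurable M. (\<integral>\<^sup>+ x. f x \<partial>M) \<le> ennreal C * associate_norm M \<rho> f"
      using integral_le by blast
  qed
qed

section \<open>Equimeasurable functions\<close>

lemma emeasure_vimage_eq_of_distribution_fun_eq: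
  fixes f g :: "_ \<Rightarrow> ennreal"
  assumes M: "prob_space M" and f[measurable]: "f \<in> borel_measurable M" and g[measurable]: "g \<in> borel_measurable M"
    and eq: "distribution_fun M f = distribution_fun M g" and S: "S \<in> sets borel"
  shows "emeasure M {x \<in> space M. f x \<in> S} = emeasure M {x \<in> space M. g x \<in> S}"
proof -
  interpret prob_space M by fact
  have "distr M borel f = distr M borel g"
  proof (rule measure_eqI_generator_eq[where \<Omega>=UNIV and A="\<lambda>_. UNIV" and E="insert UNIV (range greaterThan)"])
    show "Int_stable (insert UNIV (range (greaterThan :: ennreal \<Rightarrow> _)))"
    proof (rule Int_stableI)
      fix a b :: "ennreal set"
      assume "a \<in> insert UNIV (range greaterThan)" "b \<in> insert UNIV (range greaterThan)"
      moreover have "{x<..} \<inter> {y<..} = {max x y<..}" for x y :: ennreal by auto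
      ultimately show "a \<inter> b \<in> insert UNIV (range greaterThan)" by auto
    qed
    have "sets borel = sigma_sets UNIV (range (greaterThan :: ennreal \<Rightarrow> _))"
      by (simp add: borel_Ioi)
    moreover have "sigma_sets UNIV (insert UNIV (range (greaterThan :: ennreal \<Rightarrow> _))) = sigma_sets UNIV (range greaterThan)"
      by (intro antisym sigma_sets_mono) (auto intro: sigma_sets_top)
    ultimately show "sets (distr M borel f) = sigma_sets UNIV (insert UNIV (range greaterThan))"
      "sets (distr M borel g) = sigma_sets UNIV (insert UNIV (range greaterThan))"
      by simp_all
    show "emeasure (distr M borel f) X = emeasure (distr M borel g) X"
      if X: "X \<in> insert UNIV (range greaterThan)" for X
    proof (cases "X = UNIV")
      case False
      then obtain s where "X = {s<..}" using X by auto
      then show ?thesis using fun_cong[OF eq, of s]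
	by (simp add: emeasure_distr distribution_fun_def vimage_def Int_def conj_commute)
    qed (simp add: emeasure_distr)
  qed (auto simp: emeasure_distr emeasure_space_1)
  then have "emeasure (distr M borel f) S = emeasure (distr M borel g) S" by simp
  then show ?thesis using S
    by (simp add: emeasure_distr vimage_def Int_def conj_commute)
qed

lemma nn_integral_finite_partition:
  assumes "finite V" and [measurable]: "F \<in> borel_measurable M" "p \<in> borel_measurable M"
    and "\<And>x. x \<in> space M \<Longrightarrow> p x \<in> V"
  shows "(\<integral>\<^sup>+ x. F x \<partial>M) = (\<Sum>v\<in>V. \<integral>\<^sup>+ x. F x * indicator {x \<in> space M. p x = (v::ennreal)} x \<partial>M)"
proof -
  have "(\<integral>\<^sup>+ x. F x \<partial>M) = (\<integral>\<^sup>+ x. (\<Sum>v\<in>V. F x * indicator {x \<in> space M. p x = v} x) \<partial>M)"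
  proof (intro nn_integral_cong)
    fix x assume x: "x \<in> space M"
    have "(\<Sum>v\<in>V. F x * indicator {x \<in> space M. p x = v} x) = (\<Sum>v\<in>V. if v = p x then F x else 0)"
      using x by (intro sum.cong) (auto simp: indicator_def)
    then show "F x = (\<Sum>v\<in>V. F x * indicator {x \<in> space M. p x = v} x)"
      using assms(1) assms(4)[OF x] by simp
  qed
  also have "\<dots> = (\<Sum>v\<in>V. \<integral>\<^sup>+ x. F x * indicator {x \<in> space M. p x = v} x \<partial>M)"
    by (rule nn_integral_sum) measurable
  finally show ?thesis .
qed

lemma ennreal_le_diff_add: "a \<le> a - b + (b::ennreal)"
  by (cases "b \<le> a") (auto simp: diff_add_cancel_ennreal intro: add_increasing)

text \<open>
  If a norm is monotone with respect to the order of the maximal rearrangements, its associate is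
  rearrangement invariant: for a function with finitely many values, a competitor \<open>g\<close> may be
  replaced by its averages over the level sets, which can be moved to the level sets of any
  equimeasurable function; by Jensen's inequality the averages have smaller maximal rearrangement.
\<close>

lemma ri_norm_associate:
  assumes M: "prob_space M" and \<rho>: "banach_function_norm M \<rho>"
    and mono: "\<And>f g. f \<in> borel_measurable M \<Longrightarrow> g \<in> borel_measurable M \<Longrightarrow>
      (\<And>t. 0 < t \<Longrightarrow> rearrangement_int M f t \<le> rearrangement_int M g t) \<Longrightarrow> \<rho> f \<le> \<rho> g"
  shows "ri_norm M (associate_norm M \<rho>)"
proof -
  interpret prob_space M by fact
  have le: "associate_norm M \<rho> f1 \<le> associate_norm M \<rho> f2"
    if [measurable]: "f1 \<in> borel_measurable M" "f2 \<in> borel_measurable M"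
      and eq: "distribution_fun M f1 = distribution_fun M f2" for f1 f2
    unfolding associate_norm_def[of _ _ f1]
  proof (rule SUP_least)
    fix g assume "g \<in> {g \<in> borel_measurable M. \<rho> g \<le> 1}"
    then have g[measurable]: "g \<in> borel_measurable M" and g1: "\<rho> g \<le> 1" by auto
    obtain q :: "nat \<Rightarrow> ennreal \<Rightarrow> ennreal" where
      q: "\<And>i. simple_function borel (q i)" "incseq q" "\<And>i x. q i x < top" "\<And>x. (SUP i. q i x) = x"
      using borel_measurable_implies_simple_function_sequence'[of "\<lambda>x. x" borel] by auto
    have [measurable]: "q i \<in> borel_measurable borel" for i
      using q(1) by (rule borel_measurable_simple_function)
    have step: "(\<integral>\<^sup>+ x. q i (f1 x) * g x \<partial>M) \<le> associate_norm M \<rho> f2" for i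
    proof -
      let ?V = "range (q i)"
      let ?A = "\<lambda>v. {x \<in> space M. q i (f1 x) = v}" and ?B = "\<lambda>v. {x \<in> space M. q i (f2 x) = v}"
      have V: "finite ?V" using q(1)[of i] by (simp add: simple_function_def)
      have AB: "emeasure M (?A v) = emeasure M (?B v)" for v
	using emeasure_vimage_eq_of_distribution_fun_eq[OF M _ _ eq, of "q i -` {v}"]
	by (simp add: vimage_def measurable_sets_borel[of "q i"])
      define c where "c v = (\<integral>\<^sup>+ x. g x * indicator (?A v) x \<partial>M) / emeasure M (?A v)" for v
      have cA: "c v * emeasure M (?A v) = (\<integral>\<^sup>+ x. g x * indicator (?A v) x \<partial>M)" for v
      proof (cases "emeasure M (?A v) = 0")
	case True
	then have "AE x in M. x \<notin> ?A v" by (intro AE_not_in) (auto simp: null_sets_def)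
	then have "(\<integral>\<^sup>+ x. g x * indicator (?A v) x \<partial>M) = (\<integral>\<^sup>+ x. 0 \<partial>M)"
	  by (intro nn_integral_cong_AE) auto
	then show ?thesis using True by simp
      next
	case False
	have "c v * emeasure M (?A v) = emeasure M (?A v) * c v" by (rule mult.commute)
	also have "\<dots> = (\<integral>\<^sup>+ x. g x * indicator (?A v) x \<partial>M) * emeasure M (?A v) / emeasure M (?A v)"
	  unfolding c_def by (simp only: ennreal_times_divide mult.commute)
	also have "\<dots> = (\<integral>\<^sup>+ x. g x * indicator (?A v) x \<partial>M)"
	  using False by (intro ennreal_mult_divide_eq) auto
	finally show ?thesis .
      qed
      have "simple_function borel (\<lambda>x. c (q i x))"
	using simple_function_compose1[OF q(1), of c i] by (simp add: comp_def)
      then have [measurable]: "(\<lambda>x. c (q i x)) \<in> borel_measurable borel"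
	by (rule borel_measurable_simple_function)
      let ?g2 = "\<lambda>x. c (q i (f2 x))"
      have g2[measurable]: "?g2 \<in> borel_measurable M" by measurable
      have ind: "(\<integral>\<^sup>+ x. h (q i (f2 x)) * indicator (?B v) x \<partial>M) = h v * emeasure M (?A v)" for h v
      proof -
	have "(\<integral>\<^sup>+ x. h (q i (f2 x)) * indicator (?B v) x \<partial>M) = (\<integral>\<^sup>+ x. h v * indicator (?B v) x \<partial>M)"
	  by (intro nn_integral_cong) (auto simp: indicator_def)
	then show ?thesis by (simp add: nn_integral_cmult_indicator AB)
      qed
      have "rearrangement_int M ?g2 t \<le> rearrangement_int M g t" if t: "0 < t" for t
      proof (rule rearrangement_int_geI[OF g t])
	fix s :: real assume s: "0 \<le> s"
	have "rearrangement_int M ?g2 t \<le> ennreal (t * s) + (\<integral>\<^sup>+ x. ?g2 x - ennreal s \<partial>M)"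
	  using t s by (intro rearrangement_int_le) auto
	also have "(\<integral>\<^sup>+ x. ?g2 x - ennreal s \<partial>M) = (\<Sum>v\<in>?V. (c v - ennreal s) * emeasure M (?A v))"
	  by (subst nn_integral_finite_partition[OF V, where p="\<lambda>x. q i (f2 x)"])
	    (auto simp: ind[of "\<lambda>v. c v - ennreal s"])
	also have "\<dots> \<le> (\<Sum>v\<in>?V. \<integral>\<^sup>+ x. (g x - ennreal s) * indicator (?A v) x \<partial>M)"
	proof (rule sum_mono)
	  fix v assume "v \<in> ?V"
	  have "(\<integral>\<^sup>+ x. g x * indicator (?A v) x \<partial>M)
	      \<le> (\<integral>\<^sup>+ x. (g x - ennreal s) * indicator (?A v) x + ennreal s * indicator (?A v) x \<partial>M)"
	    using ennreal_le_diff_add by (intro nn_integral_mono) (auto simp: indicator_def)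
	  also have "\<dots> = (\<integral>\<^sup>+ x. (g x - ennreal s) * indicator (?A v) x \<partial>M) + ennreal s * emeasure M (?A v)"
	    by (subst nn_integral_add) (auto simp: nn_integral_cmult_indicator)
	  finally have "c v * emeasure M (?A v) - ennreal s * emeasure M (?A v)
	      \<le> (\<integral>\<^sup>+ x. (g x - ennreal s) * indicator (?A v) x \<partial>M)"
	    unfolding cA by (simp add: ennreal_minus_le_iff add.commute ennreal_mult_eq_top_iff)
	  then show "(c v - ennreal s) * emeasure M (?A v) \<le> (\<integral>\<^sup>+ x. (g x - ennreal s) * indicator (?A v) x \<partial>M)"
	    by (subst mult.commute, subst ennreal_right_diff_distrib) (simp_all add: mult.commute)
	qed
	also have "\<dots> = (\<integral>\<^sup>+ x. g x - ennreal s \<partial>M)"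
	  by (subst (2) nn_integral_finite_partition[OF V, where p="\<lambda>x. q i (f1 x)"]) auto
	finally show "rearrangement_int M ?g2 t \<le> ennreal (t * s) + (\<integral>\<^sup>+ x. g x - ennreal s \<partial>M)"
	  by (simp add: add_left_mono)
      qed
      then have "\<rho> ?g2 \<le> 1" using mono[OF g2 g] g1 by (meson order_trans)
      have "(\<integral>\<^sup>+ x. q i (f1 x) * g x \<partial>M) = (\<Sum>v\<in>?V. \<integral>\<^sup>+ x. q i (f1 x) * g x * indicator (?A v) x \<partial>M)"
	by (subst nn_integral_finite_partition[OF V, where p="\<lambda>x. q i (f1 x)"]) auto
      also have "\<dots> = (\<Sum>v\<in>?V. \<integral>\<^sup>+ x. v * (g x * indicator (?A v) x) \<partial>M)"
	by (intro sum.cong nn_integral_cong refl) (auto simp: indicator_def)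
      also have "\<dots> = (\<Sum>v\<in>?V. v * (c v * emeasure M (?A v)))"
	by (intro sum.cong refl) (simp add: nn_integral_cmult cA)
      also have "\<dots> = (\<Sum>v\<in>?V. \<integral>\<^sup>+ x. (q i (f2 x) * c (q i (f2 x))) * indicator (?B v) x \<partial>M)"
	by (intro sum.cong refl) (subst ind[of "\<lambda>v. v * c v"], simp add: mult.assoc)
      also have "\<dots> = (\<integral>\<^sup>+ x. q i (f2 x) * ?g2 x \<partial>M)"
	by (subst (2) nn_integral_finite_partition[OF V, where p="\<lambda>x. q i (f2 x)"]) auto
      also have "\<dots> \<le> (\<integral>\<^sup>+ x. f2 x * ?g2 x \<partial>M)"
	by (intro nn_integral_mono mult_right_mono) (metis SUP_upper UNIV_I q(4), simp)
      also have "\<dots> \<le> associate_norm M \<rho> f2"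
	unfolding associate_norm_def using \<open>\<rho> ?g2 \<le> 1\<close> by (intro SUP_upper) auto
      finally show ?thesis .
    qed
    have "(\<integral>\<^sup>+ x. f1 x * g x \<partial>M) = (\<integral>\<^sup>+ x. (SUP i. q i (f1 x) * g x) \<partial>M)"
      by (simp add: SUP_mult_right_ennreal[symmetric] q(4))
    also have "\<dots> = (SUP i. \<integral>\<^sup>+ x. q i (f1 x) * g x \<partial>M)"
      using q(2) by (intro nn_integral_monotone_convergence_SUP)
	(auto simp: incseq_def le_fun_def intro!: mult_right_mono)
    also have "\<dots> \<le> associate_norm M \<rho> f2" by (intro SUP_least step)
    finally show "(\<integral>\<^sup>+ x. f1 x * g x \<partial>M) \<le> associate_norm M \<rho> f2" .
  qed
  show ?thesis
    unfolding ri_norm_def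
    using banach_function_norm_associate[OF M \<rho>] by (auto intro!: antisym le)
qed

section \<open>Transport along measure preserving maps\<close>

definition measure_preserving :: "'a measure \<Rightarrow> 'b measure \<Rightarrow> ('a \<Rightarrow> 'b) \<Rightarrow> bool" where
  "measure_preserving M N \<sigma> \<longleftrightarrow> \<sigma> \<in> measurable M N \<and> distr M N \<sigma> = N"

lemma measure_preserving_measurable: "measure_preserving M N \<sigma> \<Longrightarrow> \<sigma> \<in> measurable M N"
  by (simp add: measure_preserving_def)

lemma measure_preserving_nn_integral:
  assumes "measure_preserving M N \<sigma>" "f \<in> borel_measurable N"
  shows "(\<integral>\<^sup>+ x. f (\<sigma> x) \<partial>M) = (\<integral>\<^sup>+ y. f y \<partial>N)"
  using assms nn_integral_distr[of \<sigma> M N f] by (simp add: measure_preserving_def)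

lemma measure_preserving_distribution_fun:
  assumes "measure_preserving M N \<sigma>" "f \<in> borel_measurable N"
  shows "distribution_fun M (\<lambda>x. f (\<sigma> x)) = distribution_fun N f"
proof
  fix s
  have "distribution_fun N f s = emeasure (distr M N \<sigma>) {y \<in> space N. s < f y}"
    using assms by (simp add: distribution_fun_def measure_preserving_def)
  also have "\<dots> = emeasure M (\<sigma> -` {y \<in> space N. s < f y} \<inter> space M)"
    using assms by (intro emeasure_distr) (auto simp: measure_preserving_def)
  also have "\<sigma> -` {y \<in> space N. s < f y} \<inter> space M = {x \<in> space M. s < f (\<sigma> x)}"
    using assms measurable_space[of \<sigma> M N] by (auto simp: measure_preserving_def)
  finally show "distribution_fun M (\<lambda>x. f (\<sigma> x)) s = distribution_fun N f s"
    by (simp add: distribution_fun_def)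
qed

lemma measure_preserving_AE:
  assumes "measure_preserving M N \<sigma>" "AE y in N. P y"
  shows "AE x in M. P (\<sigma> x)"
proof -
  have "\<sigma> \<in> measurable M N" "AE y in distr M N \<sigma>. P y"
    using assms by (simp_all only: measure_preserving_def)
  then show ?thesis by (rule AE_distrD)
qed

lemma ri_norm_transport:
  fixes M :: "'a measure" and N :: "'b measure"
  assumes \<sigma>: "measure_preserving M N \<sigma>" and \<rho>: "ri_norm M \<rho>"
  shows "ri_norm N (\<lambda>f. \<rho> (\<lambda>x. f (\<sigma> x)))"
proof -
  have m[measurable]: "\<sigma> \<in> measurable M N" and d: "distr M N \<sigma> = N"
    using \<sigma> by (auto simp: measure_preserving_def)
  have AE_iff: "(AE x in M. P (\<sigma> x)) \<longleftrightarrow> (AE y in N. P y)" if "{y \<in> space N. P y} \<in> sets N" for P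
    using AE_distr_iff[OF m that] unfolding d by simp
  have b: "banach_function_norm M \<rho>" using \<rho> by (simp add: ri_norm_def)
  show ?thesis
    unfolding ri_norm_def banach_function_norm_def
  proof (intro conjI ballI allI impI)
    fix f :: "'b \<Rightarrow> ennreal" assume [measurable]: "f \<in> borel_measurable N"
    show "\<rho> (\<lambda>x. f (\<sigma> x)) = 0 \<longleftrightarrow> (AE x in N. f x = 0)"
      by (subst AE_iff[symmetric]) (auto intro!: banach_function_normD(1)[OF b])
    { fix c :: real assume "0 \<le> c"
      then show "\<rho> (\<lambda>x. ennreal c * f (\<sigma> x)) = ennreal c * \<rho> (\<lambda>x. f (\<sigma> x))"
	by (intro banach_function_normD(3)[OF b]) auto }
    fix g :: "'b \<Rightarrow> ennreal" assume [measurable]: "g \<in> borel_measurable N"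
    show "\<rho> (\<lambda>x. f (\<sigma> x) + g (\<sigma> x)) \<le> \<rho> (\<lambda>x. f (\<sigma> x)) + \<rho> (\<lambda>x. g (\<sigma> x))"
      by (intro banach_function_normD(2)[OF b]) auto
    { assume "AE x in N. g x \<le> f x"
      then show "\<rho> (\<lambda>x. g (\<sigma> x)) \<le> \<rho> (\<lambda>x. f (\<sigma> x))"
	by (intro banach_function_normD(4)[OF b]) (auto intro: measure_preserving_AE[OF \<sigma>]) }
    { assume "distribution_fun N f = distribution_fun N g"
      then have "distribution_fun M (\<lambda>x. f (\<sigma> x)) = distribution_fun M (\<lambda>x. g (\<sigma> x))"
	by (simp add: measure_preserving_distribution_fun[OF \<sigma>])
      then show "\<rho> (\<lambda>x. f (\<sigma> x)) = \<rho> (\<lambda>x. g (\<sigma> x))"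
	using \<rho> unfolding ri_norm_def by simp }
  next
    fix F :: "nat \<Rightarrow> 'b \<Rightarrow> ennreal" and f :: "'b \<Rightarrow> ennreal"
    assume *: "(\<forall>j. F j \<in> borel_measurable N) \<and> f \<in> borel_measurable N \<and>
	(AE x in N. incseq (\<lambda>j. F j x) \<and> (SUP j. F j x) = f x)"
    then have [measurable]: "\<And>j. F j \<in> borel_measurable N" "f \<in> borel_measurable N" by auto
    have "AE x in M. incseq (\<lambda>j. F j (\<sigma> x)) \<and> (SUP j. F j (\<sigma> x)) = f (\<sigma> x)"
      using * by (intro measure_preserving_AE[OF \<sigma>]) auto
    then show "incseq (\<lambda>j. \<rho> (\<lambda>x. F j (\<sigma> x)))" "(SUP j. \<rho> (\<lambda>x. F j (\<sigma> x))) = \<rho> (\<lambda>x. f (\<sigma> x))"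
      using banach_function_norm_Fatou[OF b, of "\<lambda>j x. F j (\<sigma> x)" "\<lambda>x. f (\<sigma> x)"] by auto
  next
    show "\<rho> (\<lambda>_. 1) < \<infinity>" by (rule banach_function_normD(5)[OF b])
  next
    obtain C where C: "(\<integral>\<^sup>+ x. f x \<partial>M) \<le> ennreal C * \<rho> f" if "f \<in> borel_measurable M" for f
      using banach_function_normD(6)[OF b] by blast
    show "\<exists>C. \<forall>f\<in>borel_measurable N. (\<integral>\<^sup>+ x. f x \<partial>N) \<le> ennreal C * \<rho> (\<lambda>x. f (\<sigma> x))"
    proof (intro exI ballI)
      fix f :: "'b \<Rightarrow> ennreal" assume [measurable]: "f \<in> borel_measurable N"
      show "(\<integral>\<^sup>+ x. f x \<partial>N) \<le> ennreal C * \<rho> (\<lambda>x. f (\<sigma> x))"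
	using C[of "\<lambda>x. f (\<sigma> x)"] by (simp add: measure_preserving_nn_integral[OF \<sigma>])
    qed
  qed
qed

subsection \<open>The unit interval\<close>

lemma prob_space_unit_interval: "prob_space unit_interval"
  by (rule prob_spaceI) (simp add: emeasure_restrict_space space_restrict_space)

lemma nn_integral_unit_interval: "(\<integral>\<^sup>+ t. f t \<partial>unit_interval) = (\<integral>\<^sup>+ t\<in>{0<..<1}. f t \<partial>lborel)"
  by (subst nn_integral_restrict_space) (auto simp: nn_integral_completion)

lemma borel_measurable_unit_intervalI:
  "f \<in> borel_measurable borel \<Longrightarrow> f \<in> borel_measurable unit_interval"
  by (intro measurable_restrict_space1 measurable_completion) simp

lemma distribution_fun_rearrangement:
  assumes M: "prob_space M" and f[measurable]: "f \<in> borel_measurable M"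
  shows "distribution_fun unit_interval (rearrangement M f) = distribution_fun M f"
proof
  fix s
  interpret prob_space M by fact
  have "distribution_fun M f s \<le> 1"
    unfolding distribution_fun_def by (rule measure_le_1[unfolded emeasure_eq_measure] emeasure_le_1)
  then obtain r where r: "distribution_fun M f s = ennreal r" "0 \<le> r" "r \<le> 1"
    by (cases "distribution_fun M f s") (auto simp: top_unique)
  have "distribution_fun unit_interval (rearrangement M f) s = emeasure unit_interval {t \<in> {0<..<1}. ennreal t < ennreal r}"
    by (simp add: distribution_fun_def[of unit_interval] less_rearrangement_iff[OF f] r(1))
  also have "{t \<in> {0<..<1}. ennreal t < ennreal r} = {0<..<r}"
    using r by (auto simp: ennreal_less_iff)
  also have "emeasure unit_interval {0<..<r} = ennreal r"
    using r by (subst emeasure_restrict_space) auto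
  finally show "distribution_fun unit_interval (rearrangement M f) s = distribution_fun M f s"
    using r by simp
qed

text \<open>
  A measure preserving map onto the unit interval turns the Luxemburg representation into a
  composition: \<open>\<rho> (f \<circ> \<sigma>)\<close> is a representation of \<open>\<rho>\<close>, and any other one agrees with it on measurable
  functions.
\<close>

lemma luxemburg_rep:
  fixes M :: "'a measure"
  assumes M: "prob_space M" and \<sigma>: "measure_preserving M unit_interval \<sigma>" and \<rho>: "ri_norm M \<rho>"
  shows ri_norm_luxemburg_rep: "ri_norm unit_interval (luxemburg_rep M \<rho>)"
    and luxemburg_rep_rearrangement: "f \<in> borel_measurable M \<Longrightarrow> luxemburg_rep M \<rho> (rearrangement M f) = \<rho> f"
    and luxemburg_rep_eq: "g \<in> borel_measurable unit_interval \<Longrightarrow> luxemburg_rep M \<rho> g = \<rho> (\<lambda>x. g (\<sigma> x))"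
proof -
  have m: "\<sigma> \<in> measurable M unit_interval"
    using \<sigma> by (rule measure_preserving_measurable)
  have ri: "\<rho> f = \<rho> g" if "f \<in> borel_measurable M" "g \<in> borel_measurable M"
    "distribution_fun M f = distribution_fun M g" for f g
    using \<rho>[unfolded ri_norm_def, THEN conjunct2, THEN bspec, OF that(1), THEN bspec, OF that(2)] that(3) by (rule mp)
  have "ri_norm unit_interval (\<lambda>f. \<rho> (\<lambda>x. f (\<sigma> x))) \<and>
      (\<forall>f\<in>borel_measurable M. \<rho> f = \<rho> (\<lambda>x. rearrangement M f (\<sigma> x)))"
  proof (intro conjI ballI ri_norm_transport[OF \<sigma> \<rho>] ri)
    fix f :: "'a \<Rightarrow> ennreal" assume [measurable]: "f \<in> borel_measurable M"
    show "f \<in> borel_measurable M" by fact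
    show "(\<lambda>x. rearrangement M f (\<sigma> x)) \<in> borel_measurable M"
      by (rule measurable_compose[OF m borel_measurable_unit_intervalI[OF borel_measurable_rearrangement]]) fact
    show "distribution_fun M f = distribution_fun M (\<lambda>x. rearrangement M f (\<sigma> x))"
      unfolding measure_preserving_distribution_fun[OF \<sigma> borel_measurable_unit_intervalI[OF borel_measurable_rearrangement[OF \<open>f \<in> borel_measurable M\<close>]]]
	distribution_fun_rearrangement[OF M \<open>f \<in> borel_measurable M\<close>] ..
  qed
  then have *: "ri_norm unit_interval (luxemburg_rep M \<rho>) \<and>
      (\<forall>f\<in>borel_measurable M. \<rho> f = luxemburg_rep M \<rho> (rearrangement M f))"
    unfolding luxemburg_rep_def
    by (rule someI[where P="\<lambda>\<rho>'. ri_norm unit_interval \<rho>' \<and> (\<forall>f\<in>borel_measurable M. \<rho> f = \<rho>' (rearrangement M f))"])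
  then show "ri_norm unit_interval (luxemburg_rep M \<rho>)" ..
  show **: "luxemburg_rep M \<rho> (rearrangement M f) = \<rho> f" if "f \<in> borel_measurable M" for f
    using *[THEN conjunct2, THEN bspec, OF that] by (rule sym)
  assume g: "g \<in> borel_measurable unit_interval"
  have g\<sigma>: "(\<lambda>x. g (\<sigma> x)) \<in> borel_measurable M"
    using m g by (rule measurable_compose)
  have "luxemburg_rep M \<rho> g = luxemburg_rep M \<rho> (rearrangement M (\<lambda>x. g (\<sigma> x)))"
  proof (rule mp[OF bspec[OF bspec[OF conjunct2[OF *[THEN conjunct1, unfolded ri_norm_def]]]]])
    show "g \<in> borel_measurable unit_interval" by fact
    show "rearrangement M (\<lambda>x. g (\<sigma> x)) \<in> borel_measurable unit_interval"
      by (rule borel_measurable_unit_intervalI[OF borel_measurable_rearrangement[OF g\<sigma>]])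
    show "distribution_fun unit_interval g = distribution_fun unit_interval (rearrangement M (\<lambda>x. g (\<sigma> x)))"
      unfolding measure_preserving_distribution_fun[OF \<sigma> g, symmetric]
      by (rule distribution_fun_rearrangement[OF M g\<sigma>, symmetric])
  qed
  also have "\<dots> = \<rho> (\<lambda>x. g (\<sigma> x))"
    by (rule **) fact
  finally show "luxemburg_rep M \<rho> g = \<rho> (\<lambda>x. g (\<sigma> x))" .
qed

section \<open>The norm of the maximal rearrangement\<close>

lemma rearrangement_cong_distribution_fun:
  "distribution_fun M f = distribution_fun N g \<Longrightarrow> rearrangement M f = rearrangement N g"
  unfolding rearrangement_def by simp

lemma rearrangement_cmult:
  assumes f[measurable]: "f \<in> borel_measurable M" and "0 < c"
  shows "rearrangement M (\<lambda>x. ennreal c * f x) t = ennreal c * rearrangement M f t"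
proof -
  have div: "s < ennreal c * x \<longleftrightarrow> s / ennreal c < x" for s x
    using \<open>0 < c\<close> by (subst divide_less_ennreal) (auto simp: mult.commute)
  have "s < rearrangement M (\<lambda>x. ennreal c * f x) t \<longleftrightarrow> s < ennreal c * rearrangement M f t" for s
    unfolding div by (simp add: less_rearrangement_iff distribution_fun_def div)
  from this[of "rearrangement M (\<lambda>x. ennreal c * f x) t"] this[of "ennreal c * rearrangement M f t"]
  show ?thesis by (intro antisym) (simp_all add: not_less)
qed

lemma max_rearrangement_cmult:
  assumes f[measurable]: "f \<in> borel_measurable M" and "0 \<le> c" "0 < t"
  shows "max_rearrangement M (\<lambda>x. ennreal c * f x) t = ennreal c * max_rearrangement M f t"
proof (cases "c = 0")
  case True
  have "distribution_fun M (\<lambda>x. 0) = (\<lambda>_. 0)" by (simp add: distribution_fun_def fun_eq_iff)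
  then show ?thesis using True \<open>0 < t\<close>
    by (simp add: max_rearrangement_eq rearrangement_int_layers)
next
  case False
  then show ?thesis using assms
    by (simp add: max_rearrangement_eq rearrangement_int_def rearrangement_cmult mult.assoc
	nn_integral_cmult ennreal_times_divide)
qed

lemma max_rearrangement_1:
  assumes "prob_space M" "f \<in> borel_measurable M"
  shows "max_rearrangement M f 1 = (\<integral>\<^sup>+ x. f x \<partial>M)"
proof -
  interpret prob_space M by fact
  show ?thesis using assms(2)
    by (simp add: max_rearrangement_eq rearrangement_int_total emeasure_space_1 divide_ennreal_def)
qed

lemma max_rearrangement_mono:
  assumes "rearrangement_int M f t \<le> rearrangement_int N g t"
  shows "max_rearrangement M f t \<le> max_rearrangement N g t"
  unfolding max_rearrangement_eq by (rule divide_right_mono_ennreal) fact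

lemma max_rearrangement_mono_AE:
  assumes [measurable]: "f \<in> borel_measurable M" "g \<in> borel_measurable M" and "AE x in M. f x \<le> g x"
  shows "max_rearrangement M f t \<le> max_rearrangement M g t"
proof (intro max_rearrangement_mono rearrangement_int_mono_dist)
  fix y
  show "distribution_fun M f (ennreal y) \<le> distribution_fun M g (ennreal y)"
    unfolding distribution_fun_def using assms(3) by (intro emeasure_mono_AE) (auto elim!: eventually_mono)
qed auto

lemma max_rearrangement_SUP:
  assumes [measurable]: "\<And>j::nat. F j \<in> borel_measurable M" "f \<in> borel_measurable M"
    and AE: "AE x in M. incseq (\<lambda>j. F j x) \<and> (SUP j. F j x) = f x" and t: "0 < t"
  shows "(SUP j. max_rearrangement M (F j) t) = max_rearrangement M f t"
proof -
  have AE1: "AE x in M. incseq (\<lambda>j. F j x)" using AE by auto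
  have mono: "distribution_fun M (F i) y \<le> distribution_fun M (F j) y" if "i \<le> j" for i j y
    unfolding distribution_fun_def using AE1 that
    by (intro emeasure_mono_AE) (auto elim!: eventually_mono simp: incseq_def intro: less_le_trans)
  have dist: "distribution_fun M f y = (SUP j. distribution_fun M (F j) y)" for y
  proof -
    have ind: "distribution_fun M h y = (\<integral>\<^sup>+ x. indicator {y<..} (h x) \<partial>M)" if [measurable]: "h \<in> borel_measurable M" for h
    proof -
      have "(\<integral>\<^sup>+ x. indicator {y<..} (h x) \<partial>M) = (\<integral>\<^sup>+ x. indicator {x \<in> space M. y < h x} x \<partial>M)"
	by (intro nn_integral_cong) (auto simp: indicator_def)
      then show ?thesis by (simp add: distribution_fun_def)
    qed
    have "distribution_fun M f y = (\<integral>\<^sup>+ x. (SUP j. indicator {y<..} (F j x)) \<partial>M)"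
      unfolding ind[OF assms(2)]
    proof (intro nn_integral_cong_AE, use AE in eventually_elim)
      case (elim x)
      show "indicator {y<..} (f x) = (SUP j. indicator {y<..} (F j x) :: ennreal)"
      proof (cases "y < f x")
	case True
	then have "y < (SUP j. F j x)" using elim by simp
	then obtain j where "y < F j x" by (auto simp: less_SUP_iff)
	then have "(1::ennreal) \<le> (SUP j. indicator {y<..} (F j x))" by (intro SUP_upper2[of j]) auto
	then show ?thesis using True by (auto intro!: antisym SUP_least simp: indicator_def)
      next
	case False
	then have "\<not> y < F j x" for j using elim SUP_upper[of j UNIV "\<lambda>j. F j x"] by (auto simp: not_less)
	then show ?thesis using False by simp
      qed
    qed
    also have "\<dots> = (SUP j. \<integral>\<^sup>+ x. indicator {y<..} (F j x) \<partial>M)"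
      using AE1 by (intro nn_integral_monotone_convergence_SUP_AE)
	(auto elim!: eventually_mono simp: incseq_Suc_iff indicator_def intro: less_le_trans)
    finally show ?thesis by (simp add: ind)
  qed
  have "rearrangement_int M f t = (\<integral>\<^sup>+ y. (SUP j. min (ennreal t) (distribution_fun M (F j) (ennreal y)) * indicator {0..} y) \<partial>lborel)"
    using t by (simp add: rearrangement_int_layers dist inf_min[symmetric] inf_SUP SUP_mult_right_ennreal)
  also have "\<dots> = (SUP j. rearrangement_int M (F j) t)"
    using t by (subst nn_integral_monotone_convergence_SUP)
      (auto simp: rearrangement_int_layers incseq_def le_fun_def intro!: mult_right_mono min.mono mono)
  finally show ?thesis unfolding max_rearrangement_eq divide_ennreal_def
    by (simp add: SUP_mult_right_ennreal)
qed

lemma powr_le_one: "0 < t \<Longrightarrow> t < 1 \<Longrightarrow> 0 < \<alpha> \<Longrightarrow> t powr \<alpha> \<le> (1::real)"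
  using powr_mono2[of \<alpha> t 1] by simp

text \<open>
  For fixed \<open>t\<close> the maximal rearrangement is subadditive and has the Fatou property; that it dominates the
  mean of \<open>f\<close> on \<open>(0, 1)\<close> yields definiteness and the embedding into \<open>L\<^sup>1\<close>.
\<close>

lemma banach_function_norm_max_rearrangement:
  fixes M :: "'a measure"
  assumes M: "prob_space M" and \<tau>: "banach_function_norm unit_interval \<tau>" and \<alpha>: "0 < (\<alpha>::real)"
  shows "banach_function_norm M (\<lambda>f. \<tau> (\<lambda>t. max_rearrangement M f (t powr \<alpha>)))"
proof -
  let ?A = "\<lambda>f t. max_rearrangement M f (t powr \<alpha>)"
  interpret prob_space M by fact
  interpret U: prob_space unit_interval by (rule prob_space_unit_interval)
  have AE_U: "AE t in unit_interval. P t" if "\<And>t. 0 < t \<Longrightarrow> t < 1 \<Longrightarrow> P t" for P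
    using that by (intro AE_I2) simp
  have meas[measurable]: "(?A f) \<in> borel_measurable unit_interval"
    if [measurable]: "f \<in> borel_measurable M" for f
    by (rule borel_measurable_unit_intervalI) measurable
  have ge: "(\<integral>\<^sup>+ x. f x \<partial>M) \<le> ?A f t"
    if "f \<in> borel_measurable M" "0 < t" "t < 1" for f t
    using max_rearrangement_antimono[OF that(1), of "t powr \<alpha>" 1] that \<alpha>
    by (simp add: max_rearrangement_1[OF M] powr_le_one)
  have const: "(\<integral>\<^sup>+ x. c \<partial>unit_interval) = c" for c :: ennreal
    using U.emeasure_space_1 by (simp add: space_restrict_space)
  have int_le: "(\<integral>\<^sup>+ x. f x \<partial>M) \<le> (\<integral>\<^sup>+ t. ?A f t \<partial>unit_interval)"
    if "f \<in> borel_measurable M" for f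
    by (subst const[symmetric], intro nn_integral_mono_AE AE_U ge that)
  show ?thesis
    unfolding banach_function_norm_def
  proof (intro conjI ballI allI impI)
    fix f :: "'a \<Rightarrow> ennreal" assume f[measurable]: "f \<in> borel_measurable M"
    show "\<tau> (?A f) = 0 \<longleftrightarrow> (AE x in M. f x = 0)"
      unfolding banach_function_normD(1)[OF \<tau> meas[OF f]]
    proof
      assume "AE t in unit_interval. ?A f t = 0"
      then have "(\<integral>\<^sup>+ t. ?A f t \<partial>unit_interval) = 0"
	by (simp add: nn_integral_0_iff_AE)
      then have "(\<integral>\<^sup>+ x. f x \<partial>M) = 0" using int_le[OF f] by simp
      then show "AE x in M. f x = 0" by (simp add: nn_integral_0_iff_AE)
    next
      assume "AE x in M. f x = 0"
      then have "(\<integral>\<^sup>+ x. f x \<partial>M) = 0" by (simp add: nn_integral_0_iff_AE)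
      then have "max_rearrangement M f s = 0" if "0 < s" for s
	using rearrangement_int_le[OF f, of s 0] that by (simp add: max_rearrangement_eq)
      then show "AE t in unit_interval. ?A f t = 0"
	by (intro AE_U) simp
    qed
    { fix c :: real assume c: "0 \<le> c"
      have "\<tau> (?A (\<lambda>x. ennreal c * f x)) = \<tau> (\<lambda>t. ennreal c * ?A f t)"
	using c by (intro banach_function_norm_cong_AE[OF \<tau>] AE_U max_rearrangement_cmult) auto
      then show "\<tau> (?A (\<lambda>x. ennreal c * f x)) = ennreal c * \<tau> (?A f)"
	using banach_function_normD(3)[OF \<tau> meas[OF f] c] by simp }
    fix g :: "'a \<Rightarrow> ennreal" assume g[measurable]: "g \<in> borel_measurable M"
    { assume "AE x in M. g x \<le> f x"
      then show "\<tau> (?A g) \<le> \<tau> (?A f)"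
	by (intro banach_function_normD(4)[OF \<tau>] AE_U max_rearrangement_mono_AE) auto }
    have "\<tau> (?A (\<lambda>x. f x + g x))
	\<le> \<tau> (\<lambda>t. ?A f t + ?A g t)"
    proof (intro banach_function_normD(4)[OF \<tau>] AE_U)
      fix t :: real
      show "?A (\<lambda>x. f x + g x) t \<le> ?A f t + ?A g t"
	using divide_right_mono_ennreal[OF rearrangement_int_add[OF f g, of "t powr \<alpha>"]]
	by (simp add: max_rearrangement_eq divide_ennreal_def distrib_right)
    qed auto
    also have "\<dots> \<le> \<tau> (?A f) + \<tau> (?A g)"
      by (intro banach_function_normD(2)[OF \<tau>]) auto
    finally show "\<tau> (?A (\<lambda>x. f x + g x))
	\<le> \<tau> (?A f) + \<tau> (?A g)" .
  next
    fix F :: "nat \<Rightarrow> 'a \<Rightarrow> ennreal" and f :: "'a \<Rightarrow> ennreal"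
    assume *: "(\<forall>j. F j \<in> borel_measurable M) \<and> f \<in> borel_measurable M \<and>
	(AE x in M. incseq (\<lambda>j. F j x) \<and> (SUP j. F j x) = f x)"
    then have [measurable]: "\<And>j. F j \<in> borel_measurable M" "f \<in> borel_measurable M"
      and AE: "AE x in M. incseq (\<lambda>j. F j x) \<and> (SUP j. F j x) = f x" by auto
    have "AE x in M. F j x \<le> F (Suc j) x" for j
      using AE by (auto elim!: eventually_mono simp: incseq_Suc_iff)
    then have "AE t in unit_interval. incseq (\<lambda>j. ?A (F j) t) \<and>
	(SUP j. ?A (F j) t) = ?A f t"
      by (intro AE_U conjI max_rearrangement_SUP AE incseq_SucI max_rearrangement_mono_AE) auto
    then show "incseq (\<lambda>j. \<tau> (?A (F j)))"
      "(SUP j. \<tau> (?A (F j))) = \<tau> (?A f)"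
      using banach_function_norm_Fatou[OF \<tau>, of "\<lambda>j t. ?A (F j) t"
	  "?A f"] by auto
  next
    have "max_rearrangement M (\<lambda>_. 1) s \<le> 1" if "0 < s" for s
      using divide_right_mono_ennreal[OF rearrangement_int_le[of "\<lambda>_. 1" s 1], of "ennreal s"] that
      by (simp add: max_rearrangement_eq)
    then have "\<tau> (?A (\<lambda>_. 1)) \<le> \<tau> (\<lambda>_. 1)"
      by (intro banach_function_normD(4)[OF \<tau>] AE_U) auto
    then show "\<tau> (?A (\<lambda>_. 1)) < \<infinity>"
      using banach_function_normD(5)[OF \<tau>] by simp
  next
    obtain C where C: "(\<integral>\<^sup>+ x. f x \<partial>unit_interval) \<le> ennreal C * \<tau> f" if "f \<in> borel_measurable unit_interval" for f
      using banach_function_normD(6)[OF \<tau>] by blast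
    show "\<exists>C. \<forall>f\<in>borel_measurable M. (\<integral>\<^sup>+ x. f x \<partial>M) \<le> ennreal C * \<tau> (?A f)"
      using order_trans[OF int_le C[OF meas]] by blast
  qed
qed

section \<open>The cube as a product\<close>

lemma lebesgue_on_eq_completion:
  fixes S :: "'a::euclidean_space set"
  assumes S: "S \<in> sets borel"
  shows "lebesgue_on S = completion (restrict_space lborel S)"
proof -
  have SL: "S \<inter> space lebesgue \<in> sets lebesgue" "S \<inter> space lborel \<in> sets lborel" using S by auto
  have split: "A \<in> sets (completion (restrict_space lborel S)) \<and>
      emeasure (completion (restrict_space lborel S)) A = emeasure (lebesgue_on S) A"
    if A: "A \<in> sets (lebesgue_on S)" for A
  proof -
    have "A \<subseteq> S" "A \<in> sets lebesgue" using A SL by (auto simp: sets_restrict_space_iff)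
    then obtain B N N' where B: "A = B \<union> N" "N \<subseteq> N'" "N' \<in> null_sets lborel" "B \<in> sets lborel"
      by (auto elim: sets_completionE)
    have B': "B \<in> sets (restrict_space lborel S)" "N' \<inter> S \<in> null_sets (restrict_space lborel S)" "N \<subseteq> N' \<inter> S"
      using B S \<open>A \<subseteq> S\<close> null_set_Int2[of N' lborel S]
      by (auto simp: sets_restrict_space_iff null_sets_restrict_space)
    have N: "N \<in> null_sets (completion (restrict_space lborel S))"
      by (rule null_sets_completion_subset[OF B'(3) null_sets_completionI[OF B'(2)]])
    have NL: "N \<in> null_sets (lebesgue_on S)"
      using null_sets_completion_subset[OF B(2) null_sets_completionI[OF B(3)]] SL(1) B'(3)
      by (auto simp: null_sets_restrict_space)
    have "emeasure (completion (restrict_space lborel S)) (B \<union> N) = emeasure (restrict_space lborel S) B"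
      using B'(1) N by (subst emeasure_Un_null_set) auto
    also have "\<dots> = emeasure lborel B" using B' SL by (simp add: emeasure_restrict_space sets_restrict_space_iff)
    also have "\<dots> = emeasure (lebesgue_on S) B"
      using B' B SL by (subst emeasure_restrict_space) (auto simp: sets_restrict_space_iff)
    also have "\<dots> = emeasure (lebesgue_on S) (B \<union> N)"
      using NL B' B SL by (subst emeasure_Un_null_set) (auto simp: sets_restrict_space_iff)
    finally show ?thesis
      using B'(1) N B(1) by auto
  qed
  show ?thesis
  proof (rule measure_eqI)
    show "sets (lebesgue_on S) = sets (completion (restrict_space lborel S))"
    proof
      show "sets (lebesgue_on S) \<subseteq> sets (completion (restrict_space lborel S))" using split by auto
      show "sets (completion (restrict_space lborel S)) \<subseteq> sets (lebesgue_on S)"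
      proof
	fix A assume "A \<in> sets (completion (restrict_space lborel S))"
	then obtain B N N' where B: "A = B \<union> N" "N \<subseteq> N'" "N' \<in> null_sets (restrict_space lborel S)" "B \<in> sets (restrict_space lborel S)"
	  by (auto elim: sets_completionE)
	have B': "B \<subseteq> S" "B \<in> sets borel" "N' \<subseteq> S" "N' \<in> null_sets lborel"
	  using B S by (auto simp: sets_restrict_space_iff null_sets_restrict_space)
	then have "N \<in> sets lebesgue"
	  using null_sets_completion_subset[OF B(2) null_sets_completionI[of N' lborel]] by auto
	then show "A \<in> sets (lebesgue_on S)" using B B' S SL by (auto simp: sets_restrict_space_iff)
      qed
    qed
  next
    fix A assume "A \<in> sets (lebesgue_on S)"
    then show "emeasure (lebesgue_on S) A = emeasure (completion (restrict_space lborel S)) A"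
      using split[of A] by (simp only:)
  qed
qed

lemma measure_preserving_completion:
  assumes \<sigma>: "measure_preserving M N \<sigma>"
  shows "measure_preserving (completion M) (completion N) \<sigma>"
proof -
  have m: "\<sigma> \<in> measurable M N" and d: "distr M N \<sigma> = N"
    using \<sigma> by (auto simp: measure_preserving_def)
  have m': "\<sigma> \<in> measurable (completion M) N" using m by (rule measurable_completion)
  have d': "distr (completion M) N \<sigma> = N" by (simp only: distr_completion[OF m] d)
  have C: "complete_measure (completion M)" ..
  have "\<sigma> \<in> measurable (completion M) (completion N)"
    by (rule complete_measure.measurable_completion2[OF C m']) (simp only: d' order_refl)
  moreover have "distr (completion M) (completion N) \<sigma> = completion N"
    using complete_measure.completion_distr_eq[OF C m'] unfolding d' by simp
  ultimately show ?thesis by (simp add: measure_preserving_def)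
qed

text \<open>
  The Borel version of the cube. The theorem of Fubini and the measurability of sections refer to it, while
  statements up to null sets pass to its completion \<open>cube I m\<close>.
\<close>

definition bcube :: "real set \<Rightarrow> nat \<Rightarrow> (nat \<Rightarrow> real) measure" where
  "bcube I m = PiM {..<m} (\<lambda>_. restrict_space lborel I)"

lemma cube_eq: "cube I m = completion (bcube I m)"
  by (simp add: cube_def bcube_def)

text \<open>
  An interval of length one; which of its end points belong to it is left open.
\<close>

locale unit_edge =
  fixes I :: "real set" and a :: real
  assumes interior_subset: "{a<..<a+1} \<subseteq> I" and subset_closure: "I \<subseteq> {a..a+1}"
begin

lemma sets_I[measurable, simp]: "I \<in> sets borel"
proof -
  have "I = {a<..<a+1} \<union> (I \<inter> {a, a+1})"
    using interior_subset subset_closure by force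
  moreover have "finite (I \<inter> {a, a+1})" by simp
  ultimately show ?thesis by (metis borel_open finite_imp_closed borel_closed open_greaterThanLessThan sets.Un)
qed

lemma AE_I: "AE x in lborel. x \<in> I \<longleftrightarrow> x \<in> {a<..<a+1}"
proof -
  have "AE x in lborel. x \<noteq> a \<and> x \<noteq> a + 1"
    by (intro AE_conjI AE_lborel_singleton)
  then show ?thesis
    by (rule AE_mp) (use interior_subset subset_closure in \<open>force intro!: AE_I2\<close>)
qed

abbreviation edge :: "real measure" where "edge \<equiv> restrict_space lborel I"

lemma space_edge[simp]: "space edge = I" by (simp add: space_restrict_space)

lemma sets_edge_iff: "A \<in> sets edge \<longleftrightarrow> A \<subseteq> I \<and> A \<in> sets borel"
  by (subst sets_restrict_space_iff) auto

lemma emeasure_edge: "A \<in> sets borel \<Longrightarrow> emeasure edge (A \<inter> I) = emeasure lborel (A \<inter> {a<..<a+1})"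
proof -
  assume A[measurable]: "A \<in> sets borel"
  have "emeasure edge (A \<inter> I) = emeasure lborel (A \<inter> I)"
    by (rule emeasure_restrict_space) auto
  also have "\<dots> = emeasure lborel (A \<inter> {a<..<a+1})"
    using AE_I by (intro emeasure_eq_AE) (auto elim!: eventually_mono)
  finally show ?thesis .
qed

sublocale edge: prob_space edge
  using emeasure_edge[of UNIV] by (intro prob_spaceI) simp

sublocale product_sigma_finite "\<lambda>_::nat. edge" by unfold_locales

lemma prob_space_bcube: "prob_space (bcube I m)"
  unfolding bcube_def by (rule prob_space_PiM) unfold_locales

lemma prob_space_cube: "prob_space (cube I m)"
proof -
  interpret prob_space "bcube I m" by (rule prob_space_bcube)
  show ?thesis by (rule prob_spaceI) (simp add: cube_eq emeasure_space_1)
qed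

lemma space_bcube: "space (bcube I m) = PiE {..<m} (\<lambda>_. I)"
  by (simp add: bcube_def space_PiM)

lemma space_cube: "space (cube I m) = PiE {..<m} (\<lambda>_. I)"
  by (simp add: cube_eq space_bcube)

end

lemma unit_edge_exists:
  fixes I :: "real set"
  assumes int: "is_interval I" and one: "measure lborel I = 1"
  shows "\<exists>a. unit_edge I a"
proof -
  have ne: "I \<noteq> {}" using one by auto
  then obtain x0 where x0: "x0 \<in> I" by auto
  have I: "I \<in> sets lborel"
  proof (rule ccontr)
    assume "I \<notin> sets lborel"
    then have "measure lborel I = 0" by (rule measure_notin_sets)
    then show False using one by simp
  qed
  have "emeasure lborel I \<noteq> top"
    using one by (auto simp: measure_def)
  then have em: "emeasure lborel I = 1"
    using emeasure_eq_ennreal_measure[of lborel I] one by simp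
  have le: "y \<le> x + 1" if "x \<in> I" "y \<in> I" for x y
  proof (cases "x \<le> y")
    case True
    have "t \<in> I" if "x \<le> t" "t \<le> y" for t
      using int[unfolded is_interval_1, rule_format, OF \<open>x \<in> I\<close> \<open>y \<in> I\<close>, of t] that by simp
    then have "{x..y} \<subseteq> I" by auto
    then have "emeasure lborel {x..y} \<le> emeasure lborel I" using I by (rule emeasure_mono)
    then have "ennreal (y - x) \<le> ennreal 1" using True em by simp
    then show ?thesis by (subst (asm) ennreal_le_iff) auto
  qed simp
  have bdd: "bdd_above I" "bdd_below I"
  proof -
    show "bdd_above I" using le[OF x0] by (rule bdd_aboveI)
    have "x0 - 1 \<le> x" if "x \<in> I" for x using le[OF that x0] by simp
    then show "bdd_below I" by (rule bdd_belowI)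
  qed
  let ?a = "Inf I" and ?b = "Sup I"
  have sub: "I \<subseteq> {?a..?b}" using bdd by (auto intro: cInf_lower cSup_upper)
  have sup: "{?a<..<?b} \<subseteq> I"
  proof
    fix t assume t: "t \<in> {?a<..<?b}"
    obtain u where u: "u \<in> I" "u < t" using t cInf_lessD[OF ne, of t] by auto
    obtain v where v: "v \<in> I" "t < v" using t less_cSupD[OF ne, of t] by auto
    show "t \<in> I" using int[unfolded is_interval_1, rule_format, OF u(1) v(1), of t] u v by simp
  qed
  have ab: "?a \<le> ?b" using cInf_le_cSup[OF ne bdd] by simp
  have "ennreal (?b - ?a) \<le> ennreal 1"
    using emeasure_mono[OF sup I] ab em by simp
  moreover have "ennreal 1 \<le> ennreal (?b - ?a)"
    using emeasure_mono[OF sub, of lborel] ab em by simp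
  ultimately have "?b - ?a = 1"
    using ab by (subst (asm) (1 2) ennreal_le_iff) auto
  then have "?b = ?a + 1" by simp
  then show ?thesis using sub sup by (intro exI[of _ ?a] unit_edge.intro) simp_all
qed

subsection \<open>Inserting a coordinate\<close>

text \<open>
  The position in \<open>I\<^sup>m\<^sup>+\<^sup>1\<close> of the \<open>i\<close>-th coordinate when the \<open>k\<close>-th one is left out.
\<close>

definition skip_index :: "nat \<Rightarrow> nat \<Rightarrow> nat" where
  "skip_index k i = (if i < k then i else Suc i)"

lemma lessThan_Suc_eq_skip_index:
  assumes "k \<le> m"
  shows "{..<Suc m} = insert k (skip_index k ` {..<m})"
proof (intro set_eqI iffI)
  fix i assume i: "i \<in> {..<Suc m}"
  show "i \<in> insert k (skip_index k ` {..<m})"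
  proof (cases "i = k")
    case False
    show ?thesis
    proof (cases "i < k")
      case True
      then have "i = skip_index k i" "i < m" using assms by (auto simp: skip_index_def)
      then show ?thesis by auto
    next
      case False
      then have "i = skip_index k (i - 1)" "i - 1 < m" using \<open>i \<noteq> k\<close> i by (auto simp: skip_index_def)
      then show ?thesis by auto
    qed
  qed simp
qed (use assms in \<open>auto simp: skip_index_def\<close>)

lemma inj_skip_index: "inj_on (skip_index k) A"
  by (auto simp: inj_on_def skip_index_def split: if_splits)

lemma skip_index_neq: "skip_index k i \<noteq> k"
  by (auto simp: skip_index_def)

lemma prod_skip_index:
  fixes f :: "nat \<Rightarrow> 'a::comm_monoid_mult"
  assumes "k \<le> m"
  shows "(\<Prod>i<Suc m. f i) = f k * (\<Prod>i<m. f (skip_index k i))"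
proof -
  have "k \<notin> skip_index k ` {..<m}" using skip_index_neq by (metis imageE)
  then show ?thesis
    by (simp add: lessThan_Suc_eq_skip_index[OF assms] prod.reindex[OF inj_skip_index] comp_def del: lessThan_Suc lessThan_Suc_eq_insert_0)
qed

lemma insert_coord_skip_index: "i < m \<Longrightarrow> k \<le> m \<Longrightarrow> insert_coord (Suc m) k y t (skip_index k i) = y i"
  by (auto simp: insert_coord_def skip_index_def)

lemma insert_coord_same: "k \<le> m \<Longrightarrow> insert_coord (Suc m) k y t k = t"
  by (auto simp: insert_coord_def)

lemma all_skip_index:
  assumes "k \<le> m"
  shows "(\<forall>i<Suc m. P i) \<longleftrightarrow> P k \<and> (\<forall>i<m. P (skip_index k i))"
proof -
  have "(\<forall>i<Suc m. P i) \<longleftrightarrow> (\<forall>i\<in>{..<Suc m}. P i)" by auto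
  then show ?thesis unfolding lessThan_Suc_eq_skip_index[OF assms] by auto
qed

lemma insert_coord_in_PiE_iff:
  assumes "k \<le> m" "y \<in> extensional {..<m}"
  shows "insert_coord (Suc m) k y t \<in> PiE {..<Suc m} A \<longleftrightarrow> y \<in> PiE {..<m} (\<lambda>i. A (skip_index k i)) \<and> t \<in> A k"
proof -
  have "insert_coord (Suc m) k y t \<in> extensional {..<Suc m}" by (simp add: insert_coord_def)
  then have "insert_coord (Suc m) k y t \<in> PiE {..<Suc m} A \<longleftrightarrow> (\<forall>i<Suc m. insert_coord (Suc m) k y t i \<in> A i)"
    by (simp add: PiE_def Pi_def)
  also have "\<dots> \<longleftrightarrow> y \<in> PiE {..<m} (\<lambda>i. A (skip_index k i)) \<and> t \<in> A k"
    unfolding all_skip_index[OF assms(1)] using assms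
    by (auto simp: PiE_def Pi_def insert_coord_skip_index insert_coord_same)
  finally show ?thesis .
qed

context unit_edge
begin

lemma measurable_insert_coord[measurable]:
  assumes "k \<le> m"
  shows "(\<lambda>(y, t). insert_coord (Suc m) k y t) \<in> measurable (bcube I m \<Otimes>\<^sub>M edge) (bcube I (Suc m))"
proof -
  have [measurable]: "(\<lambda>x. fst x j) \<in> measurable (bcube I m \<Otimes>\<^sub>M edge) edge" if "j < m" for j
  proof -
    have "(\<lambda>y. y j) \<in> measurable (bcube I m) edge"
      unfolding bcube_def by (rule measurable_component_singleton) (use that in simp)
    then show ?thesis by (rule measurable_compose[OF measurable_fst])
  qed
  show ?thesis
    unfolding bcube_def[of I "Suc m"] insert_coord_def split_beta
  proof (rule measurable_restrict)
    fix i assume "i \<in> {..<Suc m}"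
    then consider "i < k" "i < m" | "i = k" | "k < i" "i - 1 < m" using assms by fastforce
    then show "(\<lambda>x. if i < k then fst x i else if i = k then snd x else fst x (i - 1)) \<in> measurable (bcube I m \<Otimes>\<^sub>M edge) edge"
      by cases (simp_all add: measurable_snd)
  qed
qed

lemma distr_insert_coord:
  assumes k: "k \<le> m"
  shows "distr (bcube I m \<Otimes>\<^sub>M edge) (bcube I (Suc m)) (\<lambda>(y, t). insert_coord (Suc m) k y t) = bcube I (Suc m)"
  (is "?D = _")
proof -
  interpret B: prob_space "bcube I m" by (rule prob_space_bcube)
  interpret P: pair_sigma_finite "bcube I m" edge ..
  have "?D = PiM {..<Suc m} (\<lambda>_. edge)"
  proof (rule PiM_eqI)
    fix A :: "nat \<Rightarrow> real set" assume A: "\<And>i. i \<in> {..<Suc m} \<Longrightarrow> A i \<in> sets edge"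
    have A': "A (skip_index k i) \<in> sets edge" if "i < m" for i
      using that k by (intro A) (auto simp: skip_index_def)
    have AI: "A i \<subseteq> I" if "i < Suc m" for i using A[of i] that by (auto simp: sets_edge_iff)
    have "?D (PiE {..<Suc m} A) = (bcube I m \<Otimes>\<^sub>M edge)
	((\<lambda>(y, t). insert_coord (Suc m) k y t) -` PiE {..<Suc m} A \<inter> space (bcube I m \<Otimes>\<^sub>M edge))"
      using A k by (intro emeasure_distr measurable_insert_coord) (auto simp: bcube_def intro!: sets_PiM_I_finite)
    also have "(\<lambda>(y, t). insert_coord (Suc m) k y t) -` PiE {..<Suc m} A \<inter> space (bcube I m \<Otimes>\<^sub>M edge)
	= PiE {..<m} (\<lambda>i. A (skip_index k i)) \<times> A k"
    proof -
      have "insert_coord (Suc m) k y t \<in> PiE {..<Suc m} A \<longleftrightarrow> (y, t) \<in> PiE {..<m} (\<lambda>i. A (skip_index k i)) \<times> A k"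
	if "y \<in> PiE {..<m} (\<lambda>_. I)" for y t
	using that insert_coord_in_PiE_iff[OF k, of y t A] by (auto simp: PiE_def)
      moreover have "PiE {..<m} (\<lambda>i. A (skip_index k i)) \<subseteq> PiE {..<m} (\<lambda>_. I)" "A k \<subseteq> I"
	using A' A[of k] k by (auto intro!: PiE_mono simp: sets_edge_iff)
      ultimately show ?thesis by (auto simp: space_pair_measure space_bcube)
    qed
    also have "(bcube I m \<Otimes>\<^sub>M edge) \<dots> = bcube I m (PiE {..<m} (\<lambda>i. A (skip_index k i))) * edge (A k)"
      using A' A[of k] k by (intro edge.emeasure_pair_measure_Times) (auto simp: bcube_def intro!: sets_PiM_I_finite)
    also have "\<dots> = (\<Prod>i<m. edge (A (skip_index k i))) * edge (A k)"
      using A' unfolding bcube_def by (subst emeasure_PiM) auto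
    also have "\<dots> = (\<Prod>i<Suc m. edge (A i))"
      by (subst prod_skip_index[OF k]) (simp add: mult.commute)
    finally show "?D (PiE {..<Suc m} A) = (\<Prod>i<Suc m. edge (A i))" .
  qed (auto simp: bcube_def)
  then show ?thesis by (simp add: bcube_def)
qed

lemma nn_integral_insert_coord:
  assumes k: "k \<le> m" and F[measurable]: "F \<in> borel_measurable (bcube I (Suc m))"
  shows "(\<integral>\<^sup>+ x. F x \<partial>bcube I (Suc m)) = (\<integral>\<^sup>+ y. \<integral>\<^sup>+ t. F (insert_coord (Suc m) k y t) \<partial>edge \<partial>bcube I m)"
    and "(\<integral>\<^sup>+ x. F x \<partial>bcube I (Suc m)) = (\<integral>\<^sup>+ t. \<integral>\<^sup>+ y. F (insert_coord (Suc m) k y t) \<partial>bcube I m \<partial>edge)"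
proof -
  interpret B: prob_space "bcube I m" by (rule prob_space_bcube)
  interpret P: pair_sigma_finite "bcube I m" edge ..
  note [measurable] = measurable_insert_coord[OF k]
  have [measurable]: "(\<lambda>p. F (insert_coord (Suc m) k (fst p) (snd p))) \<in> borel_measurable (bcube I m \<Otimes>\<^sub>M edge)"
    using measurable_compose[OF measurable_insert_coord[OF k] F] by (simp add: split_beta)
  have "(\<integral>\<^sup>+ x. F x \<partial>bcube I (Suc m)) = (\<integral>\<^sup>+ p. F (insert_coord (Suc m) k (fst p) (snd p)) \<partial>(bcube I m \<Otimes>\<^sub>M edge))"
    by (subst distr_insert_coord[OF k, symmetric], subst nn_integral_distr) (auto simp: split_beta)
  then show "(\<integral>\<^sup>+ x. F x \<partial>bcube I (Suc m)) = (\<integral>\<^sup>+ y. \<integral>\<^sup>+ t. F (insert_coord (Suc m) k y t) \<partial>edge \<partial>bcube I m)"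
    "(\<integral>\<^sup>+ x. F x \<partial>bcube I (Suc m)) = (\<integral>\<^sup>+ t. \<integral>\<^sup>+ y. F (insert_coord (Suc m) k y t) \<partial>bcube I m \<partial>edge)"
    using edge.nn_integral_fst[of "\<lambda>p. F (insert_coord (Suc m) k (fst p) (snd p))" "bcube I m"]
      P.nn_integral_snd[of "\<lambda>p. F (insert_coord (Suc m) k (fst p) (snd p))"] by simp_all
qed

lemma AE_insert_coord:
  assumes k: "k \<le> m" and "AE x in bcube I (Suc m). P x"
  shows "AE y in bcube I m. AE t in edge. P (insert_coord (Suc m) k y t)"
proof -
  interpret B: prob_space "bcube I m" by (rule prob_space_bcube)
  interpret P: pair_sigma_finite "bcube I m" edge ..
  have "AE x in distr (bcube I m \<Otimes>\<^sub>M edge) (bcube I (Suc m)) (\<lambda>(y, t). insert_coord (Suc m) k y t). P x"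
    unfolding distr_insert_coord[OF k] by fact
  then have "AE p in bcube I m \<Otimes>\<^sub>M edge. P ((\<lambda>(y, t). insert_coord (Suc m) k y t) p)"
    by (rule AE_distrD[OF measurable_insert_coord[OF k]])
  from P.AE_pair[OF this] show ?thesis by simp
qed

lemma integral_insert_coord:
  fixes F :: "_ \<Rightarrow> real"
  assumes k: "k \<le> m" and F: "integrable (bcube I (Suc m)) F"
  shows "integrable (bcube I m) (\<lambda>y. \<integral>t. F (insert_coord (Suc m) k y t) \<partial>edge)"
    and "AE y in bcube I m. integrable edge (\<lambda>t. F (insert_coord (Suc m) k y t))"
    and "(\<integral>x. F x \<partial>bcube I (Suc m)) = (\<integral>y. \<integral>t. F (insert_coord (Suc m) k y t) \<partial>edge \<partial>bcube I m)"
proof -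
  interpret B: prob_space "bcube I m" by (rule prob_space_bcube)
  interpret P: pair_sigma_finite "bcube I m" edge ..
  note [measurable] = measurable_insert_coord[OF k]
  have [measurable]: "F \<in> borel_measurable (bcube I (Suc m))" using F by auto
  have "integrable (distr (bcube I m \<Otimes>\<^sub>M edge) (bcube I (Suc m)) (\<lambda>(y, t). insert_coord (Suc m) k y t)) F"
    unfolding distr_insert_coord[OF k] by fact
  then have i: "integrable (bcube I m \<Otimes>\<^sub>M edge) (\<lambda>(y, t). F (insert_coord (Suc m) k y t))"
    by (subst (asm) integrable_distr_eq) (auto simp: split_beta')
  show "integrable (bcube I m) (\<lambda>y. \<integral>t. F (insert_coord (Suc m) k y t) \<partial>edge)"
    using P.integrable_fst'[OF i] by simp
  show "AE y in bcube I m. integrable edge (\<lambda>t. F (insert_coord (Suc m) k y t))"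
    using P.AE_integrable_fst'[OF i] by simp
  have "(\<integral>x. F x \<partial>bcube I (Suc m)) = (\<integral>p. (\<lambda>(y, t). F (insert_coord (Suc m) k y t)) p \<partial>(bcube I m \<Otimes>\<^sub>M edge))"
    by (subst distr_insert_coord[OF k, symmetric], subst integral_distr) (auto simp: split_beta')
  also have "\<dots> = (\<integral>y. \<integral>t. F (insert_coord (Suc m) k y t) \<partial>edge \<partial>bcube I m)"
    using P.integral_fst'[OF i] by simp
  finally show "(\<integral>x. F x \<partial>bcube I (Suc m)) = (\<integral>y. \<integral>t. F (insert_coord (Suc m) k y t) \<partial>edge \<partial>bcube I m)" .
qed

end

section \<open>A measure preserving map from the cube onto the interval\<close>

context unit_edge
begin

text \<open>
  The distance from the centre in the maximum norm, scaled to be 1 on the boundary. On a line in a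
  coordinate direction it is the maximum of the radius of the projection and a function of one variable.
\<close>

definition cube_radius :: "nat \<Rightarrow> (nat \<Rightarrow> real) \<Rightarrow> real" where
  "cube_radius m x = Max (insert 0 ((\<lambda>i. \<bar>2 * (x i - (a + 1/2))\<bar>) ` {..<m}))"

lemma cube_radius_le_iff: "cube_radius m x \<le> r \<longleftrightarrow> 0 \<le> r \<and> (\<forall>i<m. \<bar>2 * (x i - (a + 1/2))\<bar> \<le> r)"
  unfolding cube_radius_def by (subst Max_le_iff) auto

lemma cube_radius_nonneg: "0 \<le> cube_radius m x"
  unfolding cube_radius_def by (rule Max_ge) auto

lemma cube_radius_less_iff: "cube_radius m x < r \<longleftrightarrow> 0 < r \<and> (\<forall>i<m. \<bar>2 * (x i - (a + 1/2))\<bar> < r)"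
  unfolding cube_radius_def by (subst Max_less_iff) auto

lemma cube_radius_insert_coord:
  assumes "k \<le> m"
  shows "cube_radius (Suc m) (insert_coord (Suc m) k y t) = max (cube_radius m y) \<bar>2 * (t - (a + 1/2))\<bar>"
proof -
  have "cube_radius (Suc m) (insert_coord (Suc m) k y t) \<le> r \<longleftrightarrow> max (cube_radius m y) \<bar>2 * (t - (a + 1/2))\<bar> \<le> r" for r
    unfolding cube_radius_le_iff max.bounded_iff all_skip_index[OF assms]
    by (auto simp: insert_coord_skip_index[OF _ assms] insert_coord_same[OF assms])
  then show ?thesis by (meson order_antisym order_refl)
qed

lemma measurable_coord[measurable]: "i < m \<Longrightarrow> (\<lambda>x. x i) \<in> borel_measurable (bcube I m)"
proof -
  assume "i < m"
  then have "(\<lambda>x. x i) \<in> measurable (bcube I m) edge"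
    unfolding bcube_def by (intro measurable_component_singleton) simp
  then show ?thesis by (auto simp: measurable_restrict_space2_iff)
qed

lemma measurable_cube_radius[measurable]: "cube_radius m \<in> borel_measurable (bcube I m)"
proof (rule borel_measurableI_le)
  fix r
  have "{x \<in> space (bcube I m). cube_radius m x \<le> r}
    = {x \<in> space (bcube I m). 0 \<le> r \<and> (\<forall>i\<in>{..<m}. \<bar>2 * (x i - (a + 1/2))\<bar> \<le> r)}"
    by (auto simp: cube_radius_le_iff)
  also have "\<dots> \<in> sets (bcube I m)"
    by (intro sets.sets_Collect_conj sets.sets_Collect_const sets.sets_Collect_finite_All) auto
  finally show "{x \<in> space (bcube I m). cube_radius m x \<le> r} \<in> sets (bcube I m)" .
qed

lemma emeasure_cube_radius_le:
  assumes "0 \<le> r" "r \<le> 1"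
  shows "emeasure (bcube I m) {x \<in> space (bcube I m). cube_radius m x \<le> r} = ennreal (r ^ m)"
proof -
  define l u where "l = a + 1/2 - r/2" and "u = a + 1/2 + r/2"
  have lu: "a \<le> l" "l \<le> u" "u \<le> a + 1" "u - l = r" using assms by (auto simp: l_def u_def)
  have J: "\<bar>2 * (z - (a + 1/2))\<bar> \<le> r \<longleftrightarrow> l \<le> z \<and> z \<le> u" for z
    unfolding l_def u_def by (auto simp: abs_le_iff)
  have "{x \<in> space (bcube I m). cube_radius m x \<le> r} = PiE {..<m} (\<lambda>_. {l..u} \<inter> I)"
  proof (rule set_eqI)
    fix x
    have "x \<in> {x \<in> space (bcube I m). cube_radius m x \<le> r} \<longleftrightarrow> x \<in> PiE {..<m} (\<lambda>_. I) \<and> (\<forall>i\<in>{..<m}. x i \<in> {l..u})"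
      using assms(1) unfolding mem_Collect_eq space_bcube cube_radius_le_iff J by (simp add: Ball_def)
    also have "\<dots> \<longleftrightarrow> x \<in> PiE {..<m} (\<lambda>_. {l..u} \<inter> I)"
      unfolding PiE_iff by blast
    finally show "x \<in> {x \<in> space (bcube I m). cube_radius m x \<le> r} \<longleftrightarrow> x \<in> PiE {..<m} (\<lambda>_. {l..u} \<inter> I)" .
  qed
  also have "emeasure (bcube I m) \<dots> = (\<Prod>i<m. emeasure edge ({l..u} \<inter> I))"
    unfolding bcube_def by (subst emeasure_PiM) (auto simp: sets_edge_iff)
  also have "emeasure edge ({l..u} \<inter> I) = emeasure lborel ({l..u} \<inter> {a<..<a+1})"
    by (rule emeasure_edge) simp
  also have "\<dots> = emeasure lborel {l..u}"
  proof (rule emeasure_eq_AE)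
    have "AE x in lborel. x \<noteq> a \<and> x \<noteq> a + 1" by (intro AE_conjI AE_lborel_singleton)
    then show "AE x in lborel. x \<in> {l..u} \<inter> {a<..<a+1} \<longleftrightarrow> x \<in> {l..u}"
      by (rule AE_mp) (use lu(1-3) in \<open>auto intro!: AE_I2 simp: less_le\<close>)
  qed auto
  also have "\<dots> = ennreal r" using lu by simp
  finally show ?thesis using assms by (simp add: ennreal_power)
qed

lemma AE_cube_radius:
  assumes m: "0 < m"
  shows "AE x in bcube I m. 0 < cube_radius m x \<and> cube_radius m x < 1"
proof (rule AE_conjI)
  interpret prob_space "bcube I m" by (rule prob_space_bcube)
  have "{x \<in> space (bcube I m). cube_radius m x \<le> 0} \<in> null_sets (bcube I m)"
    using emeasure_cube_radius_le[of 0 m] m by (auto simp: null_sets_def)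
  then have "AE x in bcube I m. x \<notin> {x \<in> space (bcube I m). cube_radius m x \<le> 0}"
    by (rule AE_not_in)
  then show "AE x in bcube I m. 0 < cube_radius m x"
    using AE_space by eventually_elim auto

  have "emeasure (bcube I m) {x \<in> space (bcube I m). cube_radius m x < 1} \<ge> ennreal (r ^ m)" if "0 \<le> r" "r < 1" for r
    using that emeasure_cube_radius_le[of r m]
    by (auto intro!: emeasure_mono simp: emeasure_cube_radius_le[symmetric])
  then have ge: "r ^ m \<le> prob {x \<in> space (bcube I m). cube_radius m x < 1}" if "0 \<le> r" "r < 1" for r
    using that by (auto simp: emeasure_eq_measure ennreal_le_iff)
  have "1 \<le> prob {x \<in> space (bcube I m). cube_radius m x < 1}"
  proof (rule LIMSEQ_le_const2)
    show "(\<lambda>j. (1 - 1 / real (Suc j)) ^ m) \<longlonglongrightarrow> 1"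
      by (rule tendsto_eq_intros tendsto_const LIMSEQ_inverse_real_of_nat[unfolded inverse_eq_divide] refl | simp)+
    show "\<exists>N. \<forall>n\<ge>N. (1 - 1 / real (Suc n)) ^ m \<le> prob {x \<in> space (bcube I m). cube_radius m x < 1}"
      by (intro exI allI impI ge) auto
  qed
  then have "prob {x \<in> space (bcube I m). cube_radius m x < 1} = 1"
    using prob_le_1 by (intro antisym) auto
  from AE_prob_1[OF this] show "AE x in bcube I m. cube_radius m x < 1"
    by eventually_elim simp
qed

text \<open>The values on a null set are chosen so that the map takes values in the open interval.\<close>

definition cube_to_interval :: "nat \<Rightarrow> (nat \<Rightarrow> real) \<Rightarrow> real" where
  "cube_to_interval m x = (if 0 < cube_radius m x \<and> cube_radius m x < 1 then cube_radius m x ^ m else 1/2)"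

text \<open>
  A centred cube of radius \<open>r\<close> has measure \<open>r ^ m\<close>, that is, \<open>radius ^ m\<close> is uniformly distributed.
\<close>

lemma measure_preserving_cube_to_interval:
  assumes m: "0 < m"
  shows "measure_preserving (cube I m) unit_interval (cube_to_interval m)"
proof -
  interpret B: prob_space "bcube I m" by (rule prob_space_bcube)
  let ?U = "restrict_space lborel {0<..<1::real}"
  interpret U: prob_space ?U
    by (rule prob_spaceI) (simp add: emeasure_restrict_space space_restrict_space)
  have [measurable]: "cube_to_interval m \<in> borel_measurable (bcube I m)"
    unfolding cube_to_interval_def[abs_def] by measurable
  have [measurable]: "(\<lambda>x. x) \<in> borel_measurable ?U" by (intro measurable_restrict_space1) simp
  have range: "cube_to_interval m x \<in> {0<..<1}" for x
    using power_strict_mono[of "cube_radius m x" 1 m] m by (auto simp: cube_to_interval_def)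
  have mU: "cube_to_interval m \<in> measurable (bcube I m) ?U"
    using range by (intro measurable_restrict_space2) auto
  have D: "distr (bcube I m) borel (cube_to_interval m) = distr ?U borel (\<lambda>x. x)"
  proof (rule cdf_unique)
    show "real_distribution (distr (bcube I m) borel (cube_to_interval m))"
      by (rule B.real_distribution_distr) simp
    show "real_distribution (distr ?U borel (\<lambda>x. x))" by (rule U.real_distribution_distr) simp
    show "cdf (distr (bcube I m) borel (cube_to_interval m)) = cdf (distr ?U borel (\<lambda>x. x))"
    proof
      fix t :: real
      consider "t \<le> 0" | "0 < t" "t < 1" | "1 \<le> t" by linarith
      then have "measure (bcube I m) {x \<in> space (bcube I m). cube_to_interval m x \<le> t} = measure lborel ({0<..<1} \<inter> {..t})"
      proof cases
	case 1
	then have "{x \<in> space (bcube I m). cube_to_interval m x \<le> t} = {}" "{0<..<1} \<inter> {..t} = {}"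
	  using range[of _] by (auto simp: not_le intro: le_less_trans)
	then show ?thesis by (simp only: measure_empty)
      next
	case 2
	have "cube_radius m x ^ m \<le> t \<longleftrightarrow> cube_radius m x \<le> root m t" for x
	  using real_root_le_iff[OF m, of "cube_radius m x ^ m" t]
	  unfolding real_root_power_cancel[OF m cube_radius_nonneg] by (rule sym)
	note * = this
	have "emeasure (bcube I m) {x \<in> space (bcube I m). cube_to_interval m x \<le> t}
	    = emeasure (bcube I m) {x \<in> space (bcube I m). cube_radius m x \<le> root m t}"
	proof (rule emeasure_eq_AE)
	  show "AE x in bcube I m. x \<in> {x \<in> space (bcube I m). cube_to_interval m x \<le> t}
	      \<longleftrightarrow> x \<in> {x \<in> space (bcube I m). cube_radius m x \<le> root m t}"
	    using AE_cube_radius[OF m] by eventually_elim (simp add: cube_to_interval_def *)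
	  show "{x \<in> space (bcube I m). cube_to_interval m x \<le> t} \<in> sets (bcube I m)"
	    "{x \<in> space (bcube I m). cube_radius m x \<le> root m t} \<in> sets (bcube I m)"
	    by measurable
	qed
	also have "\<dots> = ennreal t"
	  using m 2 by (subst emeasure_cube_radius_le) (auto simp: real_root_le_1_iff)
	finally have "measure (bcube I m) {x \<in> space (bcube I m). cube_to_interval m x \<le> t} = t"
	  using 2 by (simp add: measure_def)
	moreover have "{0<..<1} \<inter> {..t} = {0<..t}" using 2 by auto
	ultimately show ?thesis using 2 by simp
      next
	case 3
	then have "{x \<in> space (bcube I m). cube_to_interval m x \<le> t} = space (bcube I m)" "{0<..<1} \<inter> {..t} = {0<..<1}"
	  using range[of _] by (auto intro: less_imp_le less_le_trans)
	then show ?thesis by (simp add: B.prob_space)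
      qed
      moreover have "cdf (distr (bcube I m) borel (cube_to_interval m)) t
	  = measure (bcube I m) {x \<in> space (bcube I m). cube_to_interval m x \<le> t}"
	by (simp add: cdf_def measure_distr vimage_def Int_def conj_commute)
      moreover have "cdf (distr ?U borel (\<lambda>x. x)) t = measure ?U ({0<..<1} \<inter> {..t})"
	by (simp add: cdf_def measure_distr space_restrict_space Int_commute)
      moreover have "measure ?U ({0<..<1} \<inter> {..t}) = measure lborel ({0<..<1} \<inter> {..t})"
	by (rule measure_restrict_space) auto
      ultimately show "cdf (distr (bcube I m) borel (cube_to_interval m)) t = cdf (distr ?U borel (\<lambda>x. x)) t"
	by (simp only:)
    qed
  qed
  have "distr (bcube I m) ?U (cube_to_interval m) = ?U"
  proof (rule measure_eqI)
    fix A assume "A \<in> sets (distr (bcube I m) ?U (cube_to_interval m))"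
    then have A: "A \<in> sets ?U" by simp
    then have A': "A \<in> sets borel" "A \<subseteq> {0<..<1}" by (auto simp: sets_restrict_space_iff)
    have "emeasure (distr (bcube I m) ?U (cube_to_interval m)) A = emeasure (distr (bcube I m) borel (cube_to_interval m)) A"
      using A A' mU by (simp add: emeasure_distr)
    also have "\<dots> = emeasure (distr ?U borel (\<lambda>x. x)) A" unfolding D ..
    also have "\<dots> = emeasure ?U A"
      using A A' by (subst emeasure_distr) (auto simp: space_restrict_space Int_absorb2)
    finally show "emeasure (distr (bcube I m) ?U (cube_to_interval m)) A = emeasure ?U A" .
  qed simp
  then have "measure_preserving (bcube I m) ?U (cube_to_interval m)"
    using mU by (simp add: measure_preserving_def)
  then show ?thesis
    unfolding cube_eq by (subst lebesgue_on_eq_completion) (auto intro: measure_preserving_completion)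
qed

lemma AE_cube_to_interval:
  assumes m: "0 < m"
  shows "AE x in cube I m. cube_to_interval m x = cube_radius m x ^ m \<and> 0 < cube_radius m x \<and> cube_radius m x < 1"
proof -
  have "AE x in bcube I m. cube_to_interval m x = cube_radius m x ^ m \<and> 0 < cube_radius m x \<and> cube_radius m x < 1"
    using AE_cube_radius[OF m] by eventually_elim (simp add: cube_to_interval_def)
  then show ?thesis unfolding cube_eq by (rule AE_completion)
qed

end

section \<open>A Loomis--Whitney inequality\<close>

definition remove_coord :: "nat \<Rightarrow> nat \<Rightarrow> (nat \<Rightarrow> real) \<Rightarrow> nat \<Rightarrow> real" where
  "remove_coord m k x = (\<lambda>i\<in>{..<m}. x (skip_index k i))"

lemma remove_coord_insert_coord:
  assumes "k \<le> m" "y \<in> extensional {..<m}"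
  shows "remove_coord m k (insert_coord (Suc m) k y t) = y"
  using assms unfolding remove_coord_def
  by (intro ext) (auto simp: insert_coord_skip_index restrict_def extensional_def)

lemma remove_coord_insert_last:
  assumes "j \<le> m"
  shows "remove_coord (Suc m) j (insert_coord (Suc (Suc m)) (Suc m) z t) = insert_coord (Suc m) m (remove_coord m j z) t"
  using assms unfolding remove_coord_def insert_coord_def skip_index_def
  by (intro ext) (auto simp: restrict_def)

context unit_edge
begin

lemma measurable_remove_coord[measurable]: "remove_coord m k \<in> measurable (bcube I (Suc m)) (bcube I m)"
  unfolding bcube_def remove_coord_def
  by (intro measurable_restrict measurable_component_singleton) (auto simp: skip_index_def)

lemma sets_remove_coord:
  assumes "A \<in> sets (bcube I m)"
  shows "{x \<in> space (bcube I (Suc m)). remove_coord m k x \<in> A} \<in> sets (bcube I (Suc m))"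
proof -
  have "remove_coord m k -` A \<inter> space (bcube I (Suc m)) = {x \<in> space (bcube I (Suc m)). remove_coord m k x \<in> A}"
    by auto
  with measurable_sets[OF measurable_remove_coord assms, of k] show ?thesis by (simp only:)
qed

lemma sets_bcube_slice:
  assumes A: "A \<in> sets (bcube I (Suc m))" and t: "t \<in> I"
  shows "{y \<in> space (bcube I m). insert_coord (Suc m) m y t \<in> A} \<in> sets (bcube I m)"
proof -
  have t': "t \<in> space edge" using t by simp
  have "(\<lambda>y. (\<lambda>(y, t). insert_coord (Suc m) m y t) (y, t)) \<in> measurable (bcube I m) (bcube I (Suc m))"
    by (rule measurable_compose[OF measurable_Pair2'[OF t'] measurable_insert_coord[OF order_refl]])
  then have *: "(\<lambda>y. insert_coord (Suc m) m y t) \<in> measurable (bcube I m) (bcube I (Suc m))" by simp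
  have "(\<lambda>y. insert_coord (Suc m) m y t) -` A \<inter> space (bcube I m) = {y \<in> space (bcube I m). insert_coord (Suc m) m y t \<in> A}"
    by auto
  with measurable_sets[OF * A] show ?thesis by (simp only:)
qed

lemma emeasure_bcube_slices:
  assumes A: "A \<in> sets (bcube I (Suc m))"
  shows "emeasure (bcube I (Suc m)) A
    = (\<integral>\<^sup>+ t. emeasure (bcube I m) {y \<in> space (bcube I m). insert_coord (Suc m) m y t \<in> A} \<partial>edge)"
proof -
  have "emeasure (bcube I (Suc m)) A = (\<integral>\<^sup>+ x. indicator A x \<partial>bcube I (Suc m))" using A by simp
  also have "\<dots> = (\<integral>\<^sup>+ t. \<integral>\<^sup>+ y. indicator A (insert_coord (Suc m) m y t) \<partial>bcube I m \<partial>edge)"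
    using A by (intro nn_integral_insert_coord) auto
  also have "\<dots> = (\<integral>\<^sup>+ t. emeasure (bcube I m) {y \<in> space (bcube I m). insert_coord (Suc m) m y t \<in> A} \<partial>edge)"
  proof (rule nn_integral_cong)
    fix t assume "t \<in> space edge"
    then have [measurable]: "{y \<in> space (bcube I m). insert_coord (Suc m) m y t \<in> A} \<in> sets (bcube I m)"
      by (intro sets_bcube_slice[OF A]) simp
    have "(\<integral>\<^sup>+ y. indicator A (insert_coord (Suc m) m y t) \<partial>bcube I m)
	= (\<integral>\<^sup>+ y. indicator {y \<in> space (bcube I m). insert_coord (Suc m) m y t \<in> A} y \<partial>bcube I m)"
      by (intro nn_integral_cong) (auto simp: indicator_def)
    then show "(\<integral>\<^sup>+ y. indicator A (insert_coord (Suc m) m y t) \<partial>bcube I m)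
	= emeasure (bcube I m) {y \<in> space (bcube I m). insert_coord (Suc m) m y t \<in> A}" by simp
  qed
  finally show ?thesis .
qed


text \<open>
  The Loomis--Whitney inequality with the sum of the projections in place of their product. Cut along
  the last coordinate. If the last projection has measure \<open>p\<close>, every slice of volume \<open>e\<close> satisfies
  \<open>e \<le> p\<close>, hence \<open>e \<le> p powr (1 / (m + 1)) * e powr (m / (m + 1))\<close>, and the last factor is controlled by
  the induction hypothesis.
\<close>

lemma loomis_whitney_sum:
  assumes "\<And>j. j \<le> m \<Longrightarrow> P j \<in> sets (bcube I m)"
  shows "measure (bcube I (Suc m)) {x \<in> space (bcube I (Suc m)). \<forall>j\<le>m. remove_coord m j x \<in> P j} powr (real m / real (Suc m))
     \<le> (\<Sum>j\<le>m. measure (bcube I m) (P j))"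
  using assms
proof (induction m arbitrary: P)
  case 0
  interpret B0: prob_space "bcube I 0" by (rule prob_space_bcube)
  let ?E = "{x \<in> space (bcube I (Suc 0)). \<forall>j\<le>0. remove_coord 0 j x \<in> P j}"
  show ?case
  proof (cases "?E = {}")
    case False
    then obtain x where "remove_coord 0 0 x \<in> P 0" by auto
    moreover have "space (bcube I 0) = {remove_coord 0 0 x}"
      by (simp add: space_bcube remove_coord_def restrict_def)
    moreover have "P 0 \<subseteq> space (bcube I 0)" using "0.prems"[of 0] sets.sets_into_space by auto
    ultimately have "P 0 = space (bcube I 0)" by auto
    then show ?thesis by (simp add: B0.prob_space powr_def)
  next
    case True
    have "measure (bcube I (Suc 0)) ?E = 0" unfolding True by simp
    then show ?thesis by simp
  qed
next
  case (Suc m)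
  interpret Bm: prob_space "bcube I m" by (rule prob_space_bcube)
  interpret B1: prob_space "bcube I (Suc m)" by (rule prob_space_bcube)
  interpret B2: prob_space "bcube I (Suc (Suc m))" by (rule prob_space_bcube)
  let ?E = "{x \<in> space (bcube I (Suc (Suc m))). \<forall>j\<le>Suc m. remove_coord (Suc m) j x \<in> P j}"
  let ?E' = "\<lambda>t. {y \<in> space (bcube I (Suc m)). insert_coord (Suc (Suc m)) (Suc m) y t \<in> ?E}"
  let ?P' = "\<lambda>j t. {z \<in> space (bcube I m). insert_coord (Suc m) m z t \<in> P j}"

  have E: "?E \<in> sets (bcube I (Suc (Suc m)))"
  proof -
    have "?E = {x \<in> space (bcube I (Suc (Suc m))). \<forall>j\<in>{..Suc m}. remove_coord (Suc m) j x \<in> P j}" by auto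
    also have "\<dots> \<in> sets (bcube I (Suc (Suc m)))"
      by (intro sets.sets_Collect_finite_All sets_remove_coord) (auto intro!: Suc.prems)
    finally show ?thesis .
  qed
  define p where "p = measure (bcube I (Suc m)) (P (Suc m))"
  define S where "S = (\<Sum>j\<le>m. measure (bcube I (Suc m)) (P j))"
  define e where "e = measure (bcube I (Suc (Suc m))) ?E"
  have slice: "measure (bcube I (Suc m)) (?E' t) \<le> p powr (1 / real (Suc m)) * (\<Sum>j\<le>m. measure (bcube I m) (?P' j t))"
    if t: "t \<in> I" for t
  proof -
    let ?e = "measure (bcube I (Suc m)) (?E' t)"
    have "?E' t \<subseteq> {y \<in> space (bcube I (Suc m)). \<forall>j\<le>m. remove_coord m j y \<in> ?P' j t}"
    proof safe
      fix y j assume y: "y \<in> space (bcube I (Suc m))" and j: "j \<le> m"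
	and *: "\<forall>j\<le>Suc m. remove_coord (Suc m) j (insert_coord (Suc (Suc m)) (Suc m) y t) \<in> P j"
      show "remove_coord m j y \<in> space (bcube I m)" using measurable_space[OF measurable_remove_coord y] .
      show "insert_coord (Suc m) m (remove_coord m j y) t \<in> P j"
	using * j by (simp add: remove_coord_insert_last[OF j, symmetric])
    qed
    moreover have sP: "?P' j t \<in> sets (bcube I m)" if "j \<le> m" for j
      using that t by (intro sets_bcube_slice Suc.prems) auto
    moreover have "{y \<in> space (bcube I (Suc m)). \<forall>j\<in>{..m}. remove_coord m j y \<in> ?P' j t} \<in> sets (bcube I (Suc m))"
      by (intro sets.sets_Collect_finite_All sets_remove_coord sP) auto
    ultimately have "?e \<le> measure (bcube I (Suc m)) {y \<in> space (bcube I (Suc m)). \<forall>j\<le>m. remove_coord m j y \<in> ?P' j t}"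
      by (intro B1.finite_measure_mono) (auto simp: Ball_def)
    then have "?e powr (real m / real (Suc m))
       \<le> measure (bcube I (Suc m)) {y \<in> space (bcube I (Suc m)). \<forall>j\<le>m. remove_coord m j y \<in> ?P' j t} powr (real m / real (Suc m))"
      by (intro powr_mono2) auto
    also have "\<dots> \<le> (\<Sum>j\<le>m. measure (bcube I m) (?P' j t))" by (rule Suc.IH[OF sP])
    finally have 1: "?e powr (real m / real (Suc m)) \<le> (\<Sum>j\<le>m. measure (bcube I m) (?P' j t))" .
    have "?E' t \<subseteq> P (Suc m)"
    proof safe
      fix y assume y: "y \<in> space (bcube I (Suc m))"
	and *: "\<forall>j\<le>Suc m. remove_coord (Suc m) j (insert_coord (Suc (Suc m)) (Suc m) y t) \<in> P j"
      have "remove_coord (Suc m) (Suc m) (insert_coord (Suc (Suc m)) (Suc m) y t) = y"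
	using y by (intro remove_coord_insert_coord) (auto simp: space_bcube PiE_def)
      then show "y \<in> P (Suc m)" using *[rule_format, of "Suc m"] by simp
    qed
    then have ep: "?e \<le> p" unfolding p_def using Suc.prems[of "Suc m"] by (intro B1.finite_measure_mono) auto
    have "1 / real (Suc m) + real m / real (Suc m) = 1" by (simp add: field_simps)
    then have "?e = ?e powr (1 / real (Suc m)) * ?e powr (real m / real (Suc m))"
      by (cases "?e = 0") (simp_all add: powr_add[symmetric] less_le)
    also have "\<dots> \<le> p powr (1 / real (Suc m)) * (\<Sum>j\<le>m. measure (bcube I m) (?P' j t))"
      using ep 1 by (intro mult_mono powr_mono2) auto
    finally show ?thesis .
  qed
  have "ennreal e = (\<integral>\<^sup>+ t. ennreal (measure (bcube I (Suc m)) (?E' t)) \<partial>edge)"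
    unfolding e_def B2.emeasure_eq_measure[symmetric] emeasure_bcube_slices[OF E] by (simp add: B1.emeasure_eq_measure)
  also have "\<dots> \<le> (\<integral>\<^sup>+ t. ennreal (p powr (1 / real (Suc m)) * (\<Sum>j\<le>m. measure (bcube I m) (?P' j t))) \<partial>edge)"
  proof (rule nn_integral_mono)
    fix t assume "t \<in> space edge"
    then have "t \<in> I" unfolding space_edge .
    then show "ennreal (measure (bcube I (Suc m)) (?E' t))
	\<le> ennreal (p powr (1 / real (Suc m)) * (\<Sum>j\<le>m. measure (bcube I m) (?P' j t)))"
      by (rule ennreal_leI[OF slice])
  qed
  also have "\<dots> = (\<integral>\<^sup>+ t. ennreal (p powr (1 / real (Suc m))) * (\<Sum>j\<le>m. emeasure (bcube I m) (?P' j t)) \<partial>edge)"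
    unfolding Bm.emeasure_eq_measure by (simp add: ennreal_mult sum_nonneg)
  also have "\<dots> = ennreal (p powr (1 / real (Suc m))) * (\<Sum>j\<le>m. \<integral>\<^sup>+ t. emeasure (bcube I m) (?P' j t) \<partial>edge)"
  proof -
    have me: "(\<lambda>t. emeasure (bcube I m) (?P' j t)) \<in> borel_measurable edge" if "j \<le> m" for j
    proof -
      have "{p \<in> space (edge \<Otimes>\<^sub>M bcube I m). insert_coord (Suc m) m (snd p) (fst p) \<in> P j} \<in> sets (edge \<Otimes>\<^sub>M bcube I m)"
      proof -
	have "(\<lambda>p. insert_coord (Suc m) m (snd p) (fst p)) \<in> measurable (edge \<Otimes>\<^sub>M bcube I m) (bcube I (Suc m))"
	  using measurable_compose[OF measurable_Pair[OF measurable_snd measurable_fst] measurable_insert_coord[of m m]] by simp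
	from measurable_sets[OF this, of "P j"]
	show ?thesis using Suc.prems[of j] that by (simp add: vimage_def Int_def conj_commute)
      qed
      from Bm.measurable_emeasure_Pair[OF this]
      have "(\<lambda>t. emeasure (bcube I m) (Pair t -` {p \<in> space (edge \<Otimes>\<^sub>M bcube I m). insert_coord (Suc m) m (snd p) (fst p) \<in> P j})) \<in> borel_measurable edge" .
      also have "?this \<longleftrightarrow> ?thesis"
	by (intro measurable_cong arg_cong[where f="emeasure (bcube I m)"]) (auto simp: space_pair_measure)
      finally show ?thesis .
    qed
    have "(\<integral>\<^sup>+ t. (\<Sum>j\<le>m. emeasure (bcube I m) (?P' j t)) \<partial>edge) = (\<Sum>j\<le>m. \<integral>\<^sup>+ t. emeasure (bcube I m) (?P' j t) \<partial>edge)"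
      by (intro nn_integral_sum me) simp
    moreover have "(\<lambda>t. \<Sum>j\<le>m. emeasure (bcube I m) (?P' j t)) \<in> borel_measurable edge"
      by (intro borel_measurable_sum me) simp
    ultimately show ?thesis by (simp only: nn_integral_cmult)
  qed
  also have "\<dots> = ennreal (p powr (1 / real (Suc m)) * S)"
    unfolding S_def using Suc.prems
    by (simp add: emeasure_bcube_slices[symmetric] B1.emeasure_eq_measure ennreal_mult sum_nonneg)
  finally have main: "e \<le> p powr (1 / real (Suc m)) * S"
    by (subst (asm) ennreal_le_iff) (auto simp: S_def sum_nonneg)
  have S0: "0 \<le> S" and p0: "0 \<le> p" and e0: "0 \<le> e" by (auto simp: S_def p_def e_def sum_nonneg)
  have "e powr (real (Suc m) / real (Suc (Suc m))) \<le> p + S"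
  proof (cases "e powr (real (Suc m) / real (Suc (Suc m))) \<le> p \<or> e = 0")
    case True
    then show ?thesis using S0 p0 by auto
  next
    case False
    then have e: "0 < e" using e0 by auto
    let ?\<theta> = "1 / real (Suc (Suc m))"
    have "p powr (1 / real (Suc m)) \<le> (e powr (real (Suc m) / real (Suc (Suc m)))) powr (1 / real (Suc m))"
      using False p0 by (intro powr_mono2) auto
    also have "\<dots> = e powr ?\<theta>" by (simp add: powr_powr del: of_nat_Suc)
    finally have "e \<le> e powr ?\<theta> * S" using main S0 mult_right_mono order_trans by blast
    moreover have "e = e powr ?\<theta> * e powr (real (Suc m) / real (Suc (Suc m)))"
    proof -
      have "?\<theta> + real (Suc m) / real (Suc (Suc m)) = 1" by (simp add: field_simps)
      then show ?thesis using e by (simp add: powr_add[symmetric])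
    qed
    ultimately have "e powr ?\<theta> * e powr (real (Suc m) / real (Suc (Suc m))) \<le> e powr ?\<theta> * S" by simp
    then have "e powr (real (Suc m) / real (Suc (Suc m))) \<le> S" using e by (simp add: mult_le_cancel_left)
    then show ?thesis using p0 by simp
  qed
  also have "p + S = (\<Sum>j\<le>Suc m. measure (bcube I (Suc m)) (P j))" by (simp add: p_def S_def)
  finally show ?case unfolding e_def .
qed

end

section \<open>Smooth cut-off functions\<close>

primrec cont_diff :: "nat \<Rightarrow> (real \<Rightarrow> real) \<Rightarrow> bool" where
  "cont_diff 0 f \<longleftrightarrow> continuous_on UNIV f"
| "cont_diff (Suc k) f \<longleftrightarrow> (\<exists>f'. (\<forall>x. (f has_real_derivative f' x) (at x)) \<and> cont_diff k f')"

lemma cont_diff_SucI: "(\<And>x. (f has_real_derivative f' x) (at x)) \<Longrightarrow> cont_diff k f' \<Longrightarrow> cont_diff (Suc k) f"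
  by auto

lemma cont_diff_SucD: "cont_diff (Suc k) f \<Longrightarrow> cont_diff k f"
proof (induction k arbitrary: f)
  case 0
  then obtain f' where "\<And>x. (f has_real_derivative f' x) (at x)" by auto
  then have "continuous_on UNIV f" by (intro DERIV_continuous_on[where D=f']) simp
  then show ?case by simp
next
  case (Suc k)
  then obtain f' where "\<And>x. (f has_real_derivative f' x) (at x)" "cont_diff (Suc k) f'" by auto
  then show ?case using Suc.IH[of f'] by (intro cont_diff_SucI)
qed

lemma cont_diff_add: "cont_diff k f \<Longrightarrow> cont_diff k g \<Longrightarrow> cont_diff k (\<lambda>x. f x + g x)"
proof (induction k arbitrary: f g)
  case (Suc k)
  then obtain f' g' where "\<And>x. (f has_real_derivative f' x) (at x)" "cont_diff k f'"
    "\<And>x. (g has_real_derivative g' x) (at x)" "cont_diff k g'" by auto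
  then show ?case by (intro cont_diff_SucI[where f'="\<lambda>x. f' x + g' x"] Suc.IH DERIV_add)
qed (auto intro: continuous_on_add)

lemma cont_diff_mult: "cont_diff k f \<Longrightarrow> cont_diff k g \<Longrightarrow> cont_diff k (\<lambda>x. f x * g x)"
proof (induction k arbitrary: f g)
  case (Suc k)
  then obtain f' g' where *: "\<And>x. (f has_real_derivative f' x) (at x)" "cont_diff k f'"
    "\<And>x. (g has_real_derivative g' x) (at x)" "cont_diff k g'" by auto
  have "cont_diff k f" "cont_diff k g" using Suc.prems by (blast dest: cont_diff_SucD)+
  then have "cont_diff k (\<lambda>x. f' x * g x + g' x * f x)"
    using * by (intro cont_diff_add Suc.IH)
  then show ?case using * by (intro cont_diff_SucI[where f'="\<lambda>x. f' x * g x + g' x * f x"] DERIV_mult)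
qed (auto intro: continuous_on_mult)

lemma cont_diff_const: "cont_diff k (\<lambda>x. c)"
proof (induction k arbitrary: c)
  case (Suc k)
  show ?case by (rule cont_diff_SucI[where f'="\<lambda>x. 0"]) (auto intro: Suc.IH)
qed simp

lemma cont_diff_inverse: "cont_diff k g \<Longrightarrow> (\<And>x. g x \<noteq> 0) \<Longrightarrow> cont_diff k (\<lambda>x. inverse (g x))"
proof (induction k)
  case (Suc k)
  then obtain g' where g': "\<And>x. (g has_real_derivative g' x) (at x)" "cont_diff k g'" by auto
  have "cont_diff k (\<lambda>x. inverse (g x))" using Suc.IH Suc.prems by (blast dest: cont_diff_SucD)
  then have "cont_diff k (\<lambda>x. (-1) * ((inverse (g x) * g' x) * inverse (g x)))"
    using g'(2) by (intro cont_diff_mult cont_diff_const)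
  then have "cont_diff k (\<lambda>x. - (inverse (g x) * g' x * inverse (g x)))" by simp
  then show ?case using g' Suc.prems(2)
    by (intro cont_diff_SucI[where f'="\<lambda>x. - (inverse (g x) * g' x * inverse (g x))"] DERIV_inverse')
qed (auto intro!: continuous_on_inverse)

lemma cont_diff_affine: "cont_diff k f \<Longrightarrow> cont_diff k (\<lambda>x. f (p * x + q))"
proof (induction k arbitrary: f)
  case 0
  then have "continuous_on UNIV (f \<circ> (\<lambda>x. p * x + q))"
    by (intro continuous_on_compose continuous_intros) (auto intro: continuous_on_subset)
  then show ?case by (simp add: o_def)
next
  case (Suc k)
  then obtain f' where f': "\<And>x. (f has_real_derivative f' x) (at x)" "cont_diff k f'" by auto
  have "((\<lambda>x. f (p * x + q)) has_real_derivative f' (p * x + q) * p) (at x)" for x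
    by (rule DERIV_chain2[OF f'(1)]) (auto intro!: derivative_eq_intros)
  then show ?case
    by (rule cont_diff_SucI) (intro cont_diff_mult cont_diff_const Suc.IH f')
qed

definition smooth_real :: "(real \<Rightarrow> real) \<Rightarrow> bool" where
  "smooth_real f \<longleftrightarrow> (\<forall>k. cont_diff k f)"

lemma smooth_real_deriv:
  assumes "smooth_real f"
  shows "(f has_real_derivative deriv f x) (at x)" "smooth_real (deriv f)"
proof -
  have *: "(f has_real_derivative deriv f x) (at x) \<and> cont_diff k (deriv f)" for k x
  proof -
    have "cont_diff (Suc k) f" using assms by (simp only: smooth_real_def)
    then obtain f' where f': "\<And>x. (f has_real_derivative f' x) (at x)" "cont_diff k f'" by auto
    then have "deriv f = f'" by (auto intro!: DERIV_imp_deriv)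
    then show ?thesis using f' by simp
  qed
  then show "(f has_real_derivative deriv f x) (at x)" by blast
  from * show "smooth_real (deriv f)" by (simp add: smooth_real_def)
qed

lemma smooth_realI:
  assumes "\<And>x. (f has_real_derivative f' x) (at x)" "smooth_real f'"
  shows "smooth_real f"
  unfolding smooth_real_def
proof
  fix k
  have "cont_diff (Suc k) f" using assms by (intro cont_diff_SucI[where f'=f']) (auto simp: smooth_real_def)
  then show "cont_diff k f" by (rule cont_diff_SucD)
qed

lemma smooth_real_continuous: "smooth_real f \<Longrightarrow> continuous_on S f"
proof -
  assume "smooth_real f"
  then have "cont_diff 0 f" unfolding smooth_real_def by (rule spec)
  then show ?thesis by (auto intro: continuous_on_subset)
qed

lemma smooth_real_borel: "smooth_real f \<Longrightarrow> f \<in> borel_measurable borel"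
  by (intro borel_measurable_continuous_onI smooth_real_continuous)

lemma smooth_real_mult: "smooth_real f \<Longrightarrow> smooth_real g \<Longrightarrow> smooth_real (\<lambda>x. f x * g x)"
  by (simp add: smooth_real_def cont_diff_mult)

lemma smooth_real_add: "smooth_real f \<Longrightarrow> smooth_real g \<Longrightarrow> smooth_real (\<lambda>x. f x + g x)"
  by (simp add: smooth_real_def cont_diff_add)

lemma smooth_real_inverse: "smooth_real g \<Longrightarrow> (\<And>x. g x \<noteq> 0) \<Longrightarrow> smooth_real (\<lambda>x. inverse (g x))"
  by (simp add: smooth_real_def cont_diff_inverse)

lemma smooth_real_const: "smooth_real (\<lambda>x. c)"
  by (simp add: smooth_real_def cont_diff_const)

lemma smooth_real_affine: "smooth_real f \<Longrightarrow> smooth_real (\<lambda>x. f (p * x + q))"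
  by (simp add: smooth_real_def cont_diff_affine)

text \<open>
  The family \<open>p (1 / x) * exp (- 1 / x)\<close> with polynomial \<open>p\<close>, extended by zero to the left, is closed
  under differentiation.
\<close>

definition flat_poly :: "real poly \<Rightarrow> real \<Rightarrow> real" where
  "flat_poly p x = (if x \<le> 0 then 0 else poly p (1 / x) * exp (- (1 / x)))"

lemma tendsto_poly_div_exp: "((\<lambda>y. poly p y * exp (- y)) \<longlongrightarrow> (0::real)) at_top"
proof -
  have "((\<lambda>y. \<Sum>i\<le>degree p. coeff p i * (y ^ i / exp y)) \<longlongrightarrow> (\<Sum>i\<le>degree p. coeff p i * 0)) at_top"
    by (intro tendsto_sum tendsto_mult tendsto_const tendsto_power_div_exp_0)
  then show ?thesis
    by (simp add: poly_altdef sum_distrib_right exp_minus divide_inverse mult.assoc)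
qed

lemma flat_poly_deriv:
  "(flat_poly p has_real_derivative flat_poly ([:0, 0, 1:] * (p - pderiv p)) x) (at x)"
proof -
  consider "x < 0" | "x = 0" | "0 < x" by linarith
  then show ?thesis
  proof cases
    case 1
    have "((\<lambda>_. 0) has_real_derivative 0) (at x)" by simp
    then have "(flat_poly p has_real_derivative 0) (at x)"
      by (rule has_field_derivative_transform_within_open[where S="{..<0}"]) (use 1 in \<open>auto simp: flat_poly_def\<close>)
    then show ?thesis using 1 by (simp add: flat_poly_def)
  next
    case 3
    have "((\<lambda>x. poly p (1 / x) * exp (- (1 / x))) has_real_derivative
	(poly (pderiv p) (1 / x) * (- (1 / x\<^sup>2))) * exp (- (1 / x)) + (exp (- (1 / x)) * (1 / x\<^sup>2)) * poly p (1 / x)) (at x)"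
    proof (rule DERIV_mult)
      have d: "((\<lambda>x. 1 / x) has_real_derivative - (1 / x\<^sup>2)) (at x)"
	using 3 by (auto intro!: derivative_eq_intros simp: power2_eq_square)
      show "((\<lambda>x. poly p (1 / x)) has_real_derivative poly (pderiv p) (1 / x) * (- (1 / x\<^sup>2))) (at x)"
	by (rule DERIV_chain2[OF poly_DERIV d])
      have "((\<lambda>x. - (1 / x)) has_real_derivative 1 / x\<^sup>2) (at x)" using DERIV_minus[OF d] by simp
      then show "((\<lambda>x. exp (- (1 / x))) has_real_derivative exp (- (1 / x)) * (1 / x\<^sup>2)) (at x)"
	by (rule DERIV_chain2[OF DERIV_exp])
    qed
    then have "(flat_poly p has_real_derivative
	(poly (pderiv p) (1 / x) * (- (1 / x\<^sup>2))) * exp (- (1 / x)) + (exp (- (1 / x)) * (1 / x\<^sup>2)) * poly p (1 / x)) (at x)"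
      by (rule has_field_derivative_transform_within_open[where S="{0<..}"]) (use 3 in \<open>auto simp: flat_poly_def\<close>)
    moreover have "(poly (pderiv p) (1 / x) * (- (1 / x\<^sup>2))) * exp (- (1 / x)) + (exp (- (1 / x)) * (1 / x\<^sup>2)) * poly p (1 / x)
	= flat_poly ([:0, 0, 1:] * (p - pderiv p)) x"
      using 3 by (simp add: flat_poly_def power2_eq_square algebra_simps)
    ultimately show ?thesis by simp
  next
    case 2
    have "((\<lambda>h. flat_poly p h / h) \<longlongrightarrow> 0) (at_right 0)"
    proof -
      have "((\<lambda>h. poly (pCons 0 p) (inverse h) * exp (- inverse h)) \<longlongrightarrow> (0::real)) (at_right 0)"
	by (rule filterlim_compose[OF tendsto_poly_div_exp filterlim_inverse_at_top_right])
      then show ?thesis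
	by (rule Lim_transform_eventually)
	  (auto simp: eventually_at_filter flat_poly_def divide_inverse mult_ac intro!: always_eventually)
    qed
    moreover have "((\<lambda>h. flat_poly p h / h) \<longlongrightarrow> 0) (at_left 0)"
      by (rule Lim_transform_eventually[OF tendsto_const])
	(auto simp: eventually_at_filter flat_poly_def intro!: always_eventually)
    ultimately have "((\<lambda>h. flat_poly p h / h) \<longlongrightarrow> 0) (at 0)"
      by (simp add: filterlim_split_at)
    then have "(flat_poly p has_real_derivative 0) (at 0)"
      by (simp add: DERIV_def flat_poly_def[of p 0])
    then show ?thesis using 2 by (simp add: flat_poly_def)
  qed
qed

lemma smooth_flat_poly: "smooth_real (flat_poly p)"
  unfolding smooth_real_def
proof
  show "cont_diff k (flat_poly p)" for k
  proof (induction k arbitrary: p)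
    case 0
    have "continuous_on UNIV (flat_poly p)"
      by (rule DERIV_continuous_on) (rule has_field_derivative_at_within[OF flat_poly_deriv])
    then show ?case by simp
  next
    case (Suc k)
    show ?case by (rule cont_diff_SucI[OF flat_poly_deriv Suc.IH])
  qed
qed

definition smooth_step :: "real \<Rightarrow> real" where
  "smooth_step x = flat_poly 1 x * inverse (flat_poly 1 x + flat_poly 1 (1 - x))"

lemma flat_poly_1_nonneg: "0 \<le> flat_poly 1 x" by (simp add: flat_poly_def)

lemma flat_poly_1_pos: "0 < flat_poly 1 x + flat_poly 1 (1 - x)"
  by (cases "x \<le> 0") (auto simp: flat_poly_def intro: add_pos_nonneg)

lemma smooth_smooth_step: "smooth_real smooth_step"
proof -
  have "smooth_real (\<lambda>x. flat_poly 1 (1 - x))"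
    using smooth_real_affine[OF smooth_flat_poly[of 1], of "-1" 1] by simp
  then have "smooth_real (\<lambda>x. flat_poly 1 x + flat_poly 1 (1 - x))"
    by (intro smooth_real_add smooth_flat_poly)
  then have "smooth_real (\<lambda>x. inverse (flat_poly 1 x + flat_poly 1 (1 - x)))"
    using less_imp_neq[OF flat_poly_1_pos] by (intro smooth_real_inverse) auto
  then show ?thesis
    unfolding smooth_step_def[abs_def] by (intro smooth_real_mult smooth_flat_poly)
qed

lemma smooth_step_values:
  "0 \<le> smooth_step x" "smooth_step x \<le> 1" "x \<le> 0 \<Longrightarrow> smooth_step x = 0" "1 \<le> x \<Longrightarrow> smooth_step x = 1"
proof -
  show "0 \<le> smooth_step x" "smooth_step x \<le> 1"
    using flat_poly_1_nonneg[of x] flat_poly_1_nonneg[of "1 - x"] flat_poly_1_pos[of x]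
    by (auto simp: smooth_step_def divide_simps simp flip: divide_inverse)
  show "x \<le> 0 \<Longrightarrow> smooth_step x = 0" by (simp add: smooth_step_def flat_poly_def)
  show "1 \<le> x \<Longrightarrow> smooth_step x = 1" by (simp add: smooth_step_def flat_poly_def)
qed

text \<open>As \<open>j\<close> grows these functions, supported inside the interval, converge to its indicator.\<close>

definition bump :: "real \<Rightarrow> real \<Rightarrow> nat \<Rightarrow> real \<Rightarrow> real" where
  "bump c d j x = smooth_step (real (Suc j) * (x - c) - 1) * smooth_step (real (Suc j) * (d - x) - 1)"

lemma smooth_bump: "smooth_real (bump c d j)"
proof -
  have "bump c d j = (\<lambda>x. smooth_step (real (Suc j) * x + (- real (Suc j) * c - 1))
      * smooth_step ((- real (Suc j)) * x + (real (Suc j) * d - 1)))"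
    by (intro ext) (simp add: bump_def algebra_simps)
  moreover have "smooth_real (\<lambda>x. smooth_step (real (Suc j) * x + (- real (Suc j) * c - 1))
      * smooth_step ((- real (Suc j)) * x + (real (Suc j) * d - 1)))"
    by (intro smooth_real_mult smooth_real_affine smooth_smooth_step)
  ultimately show ?thesis by (simp only:)
qed

lemma bump_bounds: "0 \<le> bump c d j x" "bump c d j x \<le> 1"
  using smooth_step_values(1,2) by (auto simp: bump_def intro: mult_le_one)

lemma bump_eq_0: "x \<notin> {c + 1 / real (Suc j)..d - 1 / real (Suc j)} \<Longrightarrow> bump c d j x = 0"
proof -
  assume "x \<notin> {c + 1 / real (Suc j)..d - 1 / real (Suc j)}"
  then have "x - c \<le> 1 / real (Suc j) \<or> d - x \<le> 1 / real (Suc j)" by auto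
  then have "real (Suc j) * (x - c) - 1 \<le> 0 \<or> real (Suc j) * (d - x) - 1 \<le> 0"
    by (simp add: pos_le_divide_eq mult.commute del: of_nat_Suc)
  then show ?thesis by (auto simp: bump_def smooth_step_values(3) simp del: of_nat_Suc)
qed

lemma bump_tendsto: "(\<lambda>j. bump c d j x) \<longlonglongrightarrow> indicator {c<..<d} x"
proof (cases "x \<in> {c<..<d}")
  case False

  have "x \<notin> {c + 1 / real (Suc j)..d - 1 / real (Suc j)}" for j
  proof -
    have "0 < 1 / real (Suc j)" by simp
    moreover have "x \<le> c \<or> d \<le> x" using False by auto
    ultimately show ?thesis unfolding atLeastAtMost_iff by linarith
  qed
  then show ?thesis using False by (simp add: bump_eq_0)
next
  case True
  obtain N1 where N1: "2 / (x - c) < real N1" using reals_Archimedean2 by blast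
  obtain N2 where N2: "2 / (d - x) < real N2" using reals_Archimedean2 by blast
  have "bump c d j x = 1" if j: "max N1 N2 \<le> j" for j
  proof -
    have "2 / (x - c) < real (Suc j)" "2 / (d - x) < real (Suc j)"
      using N1 N2 j by (auto intro: less_le_trans)
    then have "2 < real (Suc j) * (x - c)" "2 < real (Suc j) * (d - x)"
      using True by (simp_all add: pos_divide_less_eq del: of_nat_Suc)
    then show ?thesis by (simp add: bump_def smooth_step_values(4) del: of_nat_Suc)
  qed
  then have "\<forall>\<^sub>F j in sequentially. bump c d j x = 1" by (rule eventually_sequentiallyI)
  then show ?thesis using True by (simp add: tendsto_eventually)
qed

text \<open>
  This turns a mean zero function into the derivative of a test function. To the right of the support the
  primitive is constant, equal to the vanishing mean.
\<close>

lemma smooth_primitive: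
  assumes g: "smooth_real g" and supp: "\<And>x. x \<notin> {l..u} \<Longrightarrow> g x = 0" and zero: "integral {l..u} g = 0" and lu: "l \<le> u"
  defines "\<theta> \<equiv> \<lambda>x. integral {l..x} g"
  shows "\<And>x. (\<theta> has_real_derivative g x) (at x)" "\<And>x. x \<notin> {l..u} \<Longrightarrow> \<theta> x = 0" "smooth_real \<theta>"
proof -
  have cont: "continuous_on S g" for S using g by (rule smooth_real_continuous)
  have eq: "\<theta> x = integral {l - 1..x} g" if "l - 1 \<le> x" for x
  proof (cases "l \<le> x")
    case True
    have "integral {l - 1..l} g + integral {l..x} g = integral {l - 1..x} g"
      using True by (intro Henstock_Kurzweil_Integration.integral_combine integrable_continuous_real cont) auto
    moreover have "integral {l - 1..l} g = integral {l - 1..l} (\<lambda>_. 0)"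
    proof (rule integral_spike[of "{l}"])
      show "0 = g x" if "x \<in> {l - 1..l} - {l}" for x using supp[of x] that by auto
    qed simp
    ultimately show ?thesis by (simp add: \<theta>_def)
  next
    case False
    have "integral {l - 1..x} g = integral {l - 1..x} (\<lambda>_. 0)"
      using False supp by (intro Henstock_Kurzweil_Integration.integral_cong) auto
    then show ?thesis using False by (simp add: \<theta>_def)
  qed
  show deriv: "(\<theta> has_real_derivative g x) (at x)" for x
  proof (cases "l - 1 < x")
    case True
    have "((\<lambda>y. integral {l - 1..y} g) has_real_derivative g x) (at x within {l - 1..x + 1})"
      using True by (intro integral_has_real_derivative cont) auto
    then have "((\<lambda>y. integral {l - 1..y} g) has_real_derivative g x) (at x)"
      using True by (simp add: at_within_Icc_at)
    then show ?thesis
      by (rule has_field_derivative_transform_within_open[where S="{l - 1<..}"]) (use True eq in auto)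
  next
    case False
    have "((\<lambda>_. 0) has_real_derivative 0) (at x)" by simp
    then have "(\<theta> has_real_derivative 0) (at x)"
      by (rule has_field_derivative_transform_within_open[where S="{..<l}"]) (use False in \<open>auto simp: \<theta>_def\<close>)
    then show ?thesis using supp[of x] False by simp
  qed
  then show "smooth_real \<theta>" using g by (rule smooth_realI)
  show "\<theta> x = 0" if "x \<notin> {l..u}" for x
  proof (cases "x < l")
    case False
    then have "u < x" using that by auto
    have "integral {l..u} g + integral {u..x} g = integral {l..x} g"
      using \<open>u < x\<close> lu by (intro Henstock_Kurzweil_Integration.integral_combine integrable_continuous_real cont) auto
    moreover have "integral {u..x} g = integral {u..x} (\<lambda>_. 0)"
    proof (rule integral_spike[of "{u}"])
      show "0 = g y" if "y \<in> {u..x} - {u}" for y using supp[of y] that by auto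
    qed simp
    ultimately show ?thesis using zero by (simp add: \<theta>_def)
  qed (simp add: \<theta>_def)
qed

section \<open>Product test functions\<close>

lemma partial_deriv_prod:
  assumes i: "i < n" and h: "\<And>j x. (h j has_real_derivative h' j x) (at x)"
  shows "partial_deriv i (\<lambda>x. \<Prod>j<n. h j (x j)) x = (\<Prod>j<n. (h(i := h' i)) j (x j))"
    and "((\<lambda>t. \<Prod>j<n. h j ((x(i := t)) j)) has_real_derivative (\<Prod>j<n. (h(i := h' i)) j (x j))) (at (x i))"
proof -
  have split: "{..<n} = insert i ({..<n} - {i})" using i by auto
  have eq: "(\<Prod>j<n. h j ((x(i := t)) j)) = h i t * (\<Prod>j\<in>{..<n} - {i}. h j (x j))" for t
    by (subst split, subst prod.insert) (auto intro!: prod.cong)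
  have eq': "(\<Prod>j<n. (h(i := h' i)) j (x j)) = h' i (x i) * (\<Prod>j\<in>{..<n} - {i}. h j (x j))"
    by (subst split, subst prod.insert) (auto intro!: prod.cong)
  show *: "((\<lambda>t. \<Prod>j<n. h j ((x(i := t)) j)) has_real_derivative (\<Prod>j<n. (h(i := h' i)) j (x j))) (at (x i))"
    unfolding eq eq' by (rule DERIV_cmult_right[OF h])
  show "partial_deriv i (\<lambda>x. \<Prod>j<n. h j (x j)) x = (\<Prod>j<n. (h(i := h' i)) j (x j))"
    unfolding partial_deriv_def by (rule DERIV_imp_deriv[OF *])
qed

lemma smooth_fun_prod:
  assumes h: "\<And>j. smooth_real (h j)"
  shows "smooth_fun n (\<lambda>x. \<Prod>j<n. h j (x j))"
  unfolding smooth_fun_def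
proof (intro allI impI)
  fix ks assume ks: "set ks \<subseteq> {..<n}"
  have "\<exists>h'. (\<forall>j. smooth_real (h' j)) \<and> iterated_partial ks (\<lambda>x. \<Prod>j<n. h j (x j)) = (\<lambda>x. \<Prod>j<n. h' j (x j))"
    using ks
  proof (induction ks)
    case Nil
    then show ?case using h by auto
  next
    case (Cons i ks)
    then obtain h' where h': "\<And>j. smooth_real (h' j)" "iterated_partial ks (\<lambda>x. \<Prod>j<n. h j (x j)) = (\<lambda>x. \<Prod>j<n. h' j (x j))"
      by auto
    have "iterated_partial (i # ks) (\<lambda>x. \<Prod>j<n. h j (x j)) = (\<lambda>x. \<Prod>j<n. (h'(i := deriv (h' i))) j (x j))"
      using Cons.prems h'
      by (intro ext) (simp add: partial_deriv_prod(1)[where h'="\<lambda>j. deriv (h' j)", OF _ smooth_real_deriv(1)[OF h'(1)]])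
    moreover have "smooth_real ((h'(i := deriv (h' i))) j)" for j
      using h'(1) smooth_real_deriv(2)[OF h'(1)] by (cases "j = i") auto
    ultimately show ?case by blast
  qed
  then obtain h' where h': "\<And>j. smooth_real (h' j)" "iterated_partial ks (\<lambda>x. \<Prod>j<n. h j (x j)) = (\<lambda>x. \<Prod>j<n. h' j (x j))"
    by auto
  have "continuous_on (coord_space n) (\<lambda>x. h' j (x j))" for j
  proof -
    have "continuous_on (coord_space n) (\<lambda>x::nat \<Rightarrow> real. x j)"
      by (rule continuous_on_subset[OF continuous_on_product_coordinates]) simp
    then have "continuous_on (coord_space n) (h' j \<circ> (\<lambda>x. x j))"
      by (intro continuous_on_compose smooth_real_continuous h')
    then show ?thesis by (simp add: o_def)
  qed
  then have "continuous_on (coord_space n) (\<lambda>x. \<Prod>j<n. h' j (x j))"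
    by (intro continuous_on_prod)
  moreover have "(\<lambda>t. \<Prod>j<n. h' j ((x(i := t)) j)) differentiable at (x i)" if "i < n" for i x
    using partial_deriv_prod(2)[where h=h' and h'="\<lambda>j. deriv (h' j)", OF that smooth_real_deriv(1)[OF h'(1)]]
    unfolding real_differentiable_def by (rule exI)
  ultimately show "continuous_on (coord_space n) (iterated_partial ks (\<lambda>x. \<Prod>j<n. h j (x j))) \<and>
     (\<forall>i<n. \<forall>x \<in> coord_space n. (\<lambda>t. iterated_partial ks (\<lambda>x. \<Prod>j<n. h j (x j)) (x(i := t))) differentiable (at (x i)))"
    unfolding h'(2) by blast
qed

context unit_edge
begin

lemma interior_I: "interior I = {a<..<a+1}"
proof (rule antisym)
  have "interior I \<subseteq> interior {a..a+1}" by (rule interior_mono) (rule subset_closure)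
  then show "interior I \<subseteq> {a<..<a+1}" by simp
  show "{a<..<a+1} \<subseteq> interior I" by (rule interior_maximal) (use interior_subset in auto)
qed

lemma test_function_prod:
  assumes h: "\<And>j. smooth_real (h j)" and lu: "a < l" "u < a + 1"
    and supp: "\<And>j x. j < n \<Longrightarrow> x \<notin> {l..u} \<Longrightarrow> h j x = 0"
  shows "test_function I n (\<lambda>x. \<Prod>j<n. h j (x j))"
  unfolding test_function_def
proof (intro conjI exI ballI)
  show "smooth_fun n (\<lambda>x. \<Prod>j<n. h j (x j))" using h by (rule smooth_fun_prod)
  show "{l..u} \<subseteq> interior I" unfolding interior_I using lu by auto
  fix x assume "x \<in> coord_space n - PiE {..<n} (\<lambda>_. {l..u})"
  then obtain j where "j < n" "x j \<notin> {l..u}" by (auto simp: PiE_iff)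
  then have "h j (x j) = 0" using supp by blast
  then show "(\<Prod>j<n. h j (x j)) = 0" using \<open>j < n\<close> by (intro prod_zero) auto
qed

end

section \<open>Norming functionals on step functions\<close>

text \<open>The Hahn--Banach theorem in finite dimensions, adding one coordinate at a time.\<close>

lemma sublinear_supporting_functional:
  fixes p :: "(nat \<Rightarrow> real) \<Rightarrow> real" and f :: "nat \<Rightarrow> real"
  assumes add: "\<And>u v. p (\<lambda>i. u i + v i) \<le> p u + p v"
    and scale: "\<And>c u. 0 \<le> c \<Longrightarrow> p (\<lambda>i. c * u i) = c * p u"
    and cong: "\<And>u v. (\<And>i. i < N \<Longrightarrow> u i = v i) \<Longrightarrow> p u = p v"
  shows "\<exists>b. (\<forall>u. (\<Sum>i<N. b i * u i) \<le> p u) \<and> (\<Sum>i<N. b i * f i) = p f"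
proof -
  have zero: "p (\<lambda>i. 0) = 0" using scale[of 0 "\<lambda>i. 0"] by simp
  define P where "P k c w = (\<lambda>j. c * f j + (if j < k then w j else 0))" for k :: nat and c :: real and w :: "nat \<Rightarrow> real"
  have ex: "\<exists>b. \<forall>c w. c * p f + (\<Sum>i<k. b i * w i) \<le> p (P k c w)" for k
  proof (induction k)
    case 0
    have "c * p f \<le> p (\<lambda>j. c * f j)" for c
    proof (cases "0 \<le> c")
      case False
      have "0 = p (\<lambda>j. c * f j + (- c) * f j)" by (simp add: zero)
      also have "\<dots> \<le> p (\<lambda>j. c * f j) + p (\<lambda>j. (- c) * f j)" by (rule add)
      also have "p (\<lambda>j. (- c) * f j) = (- c) * p f" using False by (intro scale) simp
      finally show ?thesis by simp
    qed (simp add: scale)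
    then show ?case by (simp add: P_def)
  next
    case (Suc k)
    then obtain b where b: "\<And>c w. c * p f + (\<Sum>i<k. b i * w i) \<le> p (P k c w)" by blast
    define L where "L c w = c * p f + (\<Sum>i<k. b i * w i)" for c w
    define e where "e = (\<lambda>j. if j = k then 1 else 0 :: real)"
    have Lp: "L c w \<le> p (P k c w)" for c w using b by (simp add: L_def)
    have Lscale: "s * L c w = L (s * c) (\<lambda>i. s * w i)" for s c w
      by (simp add: L_def distrib_left sum_distrib_left mult_ac)
    have Ladd: "L c w + L c' w' = L (c + c') (\<lambda>i. w i + w' i)" for c w c' w'
      by (simp add: L_def algebra_simps sum.distrib)
    have sep: "L c' w' - p (\<lambda>j. P k c' w' j - e j) \<le> p (\<lambda>j. P k c w j + e j) - L c w" for c w c' w'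
    proof -
      have "L c w + L c' w' \<le> p (P k (c + c') (\<lambda>i. w i + w' i))" unfolding Ladd by (rule Lp)
      also have "P k (c + c') (\<lambda>i. w i + w' i) = (\<lambda>j. (P k c w j + e j) + (P k c' w' j - e j))"
	by (auto simp: P_def algebra_simps)
      also have "p \<dots> \<le> p (\<lambda>j. P k c w j + e j) + p (\<lambda>j. P k c' w' j - e j)" by (rule add)
      finally show ?thesis by simp
    qed
    define \<beta> where "\<beta> = (INF x. p (\<lambda>j. P k (fst x) (snd x) j + e j) - L (fst x) (snd x))"
    have bdd: "bdd_below (range (\<lambda>x. p (\<lambda>j. P k (fst x) (snd x) j + e j) - L (fst x) (snd x)))"
      using sep by (intro bdd_belowI[of _ "L 0 (\<lambda>_. 0) - p (\<lambda>j. P k 0 (\<lambda>_. 0) j - e j)"]) auto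
    have up: "\<beta> \<le> p (\<lambda>j. P k c w j + e j) - L c w" for c w
      unfolding \<beta>_def using cINF_lower[OF bdd, of "(c, w)"] by simp
    have low: "L c w - p (\<lambda>j. P k c w j - e j) \<le> \<beta>" for c w
      unfolding \<beta>_def using sep by (intro cINF_greatest) auto
    have "c * p f + (\<Sum>i<Suc k. (b(k := \<beta>)) i * w i) \<le> p (P (Suc k) c w)" for c w
    proof -
      have 1: "c * p f + (\<Sum>i<Suc k. (b(k := \<beta>)) i * w i) = L c w + \<beta> * w k"
	by (simp add: L_def)
      have 2: "P (Suc k) c w = (\<lambda>j. P k c w j + w k * e j)"
	by (auto simp: P_def e_def less_Suc_eq)
      consider "w k = 0" | "0 < w k" | "w k < 0" by linarith
      then have "L c w + \<beta> * w k \<le> p (\<lambda>j. P k c w j + w k * e j)"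
      proof cases
	case 1
	then show ?thesis using Lp[of c w] by (simp add: P_def)
      next
	case 2
	let ?s = "w k"
	let ?P = "P k (c / ?s) (\<lambda>i. w i / ?s)" and ?L = "L (c / ?s) (\<lambda>i. w i / ?s)"
	have "\<beta> * ?s \<le> (p (\<lambda>j. ?P j + e j) - ?L) * ?s"
	  using 2 up by (intro mult_right_mono) auto
	also have "\<dots> = ?s * p (\<lambda>j. ?P j + e j) - ?s * ?L"
	  by (simp add: algebra_simps)
	also have "?s * p (\<lambda>j. ?P j + e j) = p (\<lambda>j. ?s * (?P j + e j))"
	  using 2 by (intro scale[symmetric]) simp
	also have "(\<lambda>j. ?s * (?P j + e j)) = (\<lambda>j. P k c w j + w k * e j)"
	  using 2 by (auto simp: P_def field_simps)
	also have "?s * ?L = L c w"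
	  using 2 unfolding Lscale by simp
	finally show ?thesis by simp
      next
	case 3
	let ?s = "- w k"
	let ?P = "P k (c / ?s) (\<lambda>i. w i / ?s)" and ?L = "L (c / ?s) (\<lambda>i. w i / ?s)"
	have s: "0 < ?s" using 3 by simp
	have "(?L - p (\<lambda>j. ?P j - e j)) * ?s \<le> \<beta> * ?s"
	  using s low by (intro mult_right_mono) auto
	moreover have "(?L - p (\<lambda>j. ?P j - e j)) * ?s
	    = ?s * ?L - ?s * p (\<lambda>j. ?P j - e j)"
	  by (rule trans[OF mult.commute right_diff_distrib])
	moreover have "?s * p (\<lambda>j. ?P j - e j) = p (\<lambda>j. ?s * (?P j - e j))"
	  using s by (intro scale[symmetric]) simp
	moreover have "(\<lambda>j. ?s * (?P j - e j)) = (\<lambda>j. P k c w j + w k * e j)"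
	  using 3 by (auto simp: P_def field_simps)
	moreover have "?s * ?L = L c w"
	  using 3 unfolding Lscale by simp
	ultimately show ?thesis by simp
      qed
      then show ?thesis unfolding 1 2 .
    qed
    then show ?case by blast
  qed
  obtain b where b: "\<And>c w. c * p f + (\<Sum>i<N. b i * w i) \<le> p (P N c w)" using ex by blast
  have le: "(\<Sum>i<N. b i * u i) \<le> p u" for u
  proof -
    have "p (P N 0 u) = p u" by (rule cong) (simp add: P_def)
    then show ?thesis using b[of 0 u] by simp
  qed
  have "p (P N 1 (\<lambda>i. - f i)) = p (\<lambda>i. 0)" by (rule cong) (simp add: P_def)
  then have "p f \<le> (\<Sum>i<N. b i * f i)" using b[of 1 "\<lambda>i. - f i"] by (simp add: zero sum_negf)
  then show ?thesis using le by (intro exI[of _ b]) (auto intro: antisym)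
qed

definition cell :: "nat \<Rightarrow> nat \<Rightarrow> real set" where
  "cell K i = {real i / real K<..<real (Suc i) / real K}"

abbreviation cell_int :: "nat \<Rightarrow> nat \<Rightarrow> (real \<Rightarrow> ennreal) \<Rightarrow> ennreal" where
  "cell_int K i G \<equiv> (\<integral>\<^sup>+ t\<in>cell K i. G t \<partial>lborel)"

definition step_fun :: "nat \<Rightarrow> (nat \<Rightarrow> 'a) \<Rightarrow> real \<Rightarrow> 'a" where
  "step_fun K u t = u (nat \<lfloor>real K * t\<rfloor>)"

lemma sets_cell[measurable, simp]: "cell K i \<in> sets borel" by (simp add: cell_def)

lemma floor_in_cell: "0 < K \<Longrightarrow> t \<in> cell K i \<Longrightarrow> nat \<lfloor>real K * t\<rfloor> = i"
proof -
  assume K: "0 < K" and t: "t \<in> cell K i"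
  have "real i < real K * t" "real K * t < real i + 1"
    using t K by (simp_all add: cell_def pos_divide_less_eq pos_less_divide_eq mult.commute add.commute)
  then have "\<lfloor>real K * t\<rfloor> = int i" by (intro floor_unique) auto
  then show ?thesis by simp
qed

lemma step_fun_cell: "0 < K \<Longrightarrow> t \<in> cell K i \<Longrightarrow> step_fun K u t = u i"
  by (simp add: step_fun_def floor_in_cell)

lemma floor_less: "0 < K \<Longrightarrow> 0 < t \<Longrightarrow> t < 1 \<Longrightarrow> nat \<lfloor>real K * t\<rfloor> < K"
proof -
  assume "0 < K" "0 < t" "t < 1"
  then have "real K * t < real K" by simp
  then show ?thesis using \<open>0 < t\<close> by (simp add: floor_less_iff nat_less_iff)
qed

lemma borel_measurable_step_fun[measurable]:
  fixes u :: "nat \<Rightarrow> 'a::topological_space"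
  shows "step_fun K u \<in> borel_measurable borel"
proof -
  have "(\<lambda>t. nat \<lfloor>real K * t\<rfloor>) \<in> measurable borel (count_space UNIV)" by measurable
  from measurable_compose[OF this, of u borel] show ?thesis
    by (simp add: step_fun_def[abs_def])
qed

lemma AE_cell:
  assumes K: "0 < K"
  shows "AE t in lborel. t \<in> {0<..<1} \<longrightarrow> nat \<lfloor>real K * t\<rfloor> < K \<and> t \<in> cell K (nat \<lfloor>real K * t\<rfloor>)"
proof -
  have "AE t in lborel. \<forall>i::nat. t \<noteq> real i / real K"
    unfolding AE_all_countable by (intro allI AE_lborel_singleton)
  then show ?thesis
  proof eventually_elim
    case (elim t)
    show ?case
    proof
      assume t: "t \<in> {0<..<1}"
      let ?i = "nat \<lfloor>real K * t\<rfloor>"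
      have "0 \<le> \<lfloor>real K * t\<rfloor>" using t by simp
      then have i: "real ?i = of_int \<lfloor>real K * t\<rfloor>" by simp
      have "real ?i \<le> real K * t" "real K * t < real (Suc ?i)"
	using i by (auto, linarith)
      then have "real ?i / real K \<le> t" "t < real (Suc ?i) / real K"
	using K by (simp_all add: pos_divide_le_eq pos_less_divide_eq mult.commute)
      then have "t \<in> cell K ?i" using elim[rule_format, of ?i] by (simp add: cell_def)
      then show "?i < K \<and> t \<in> cell K ?i" using floor_less[OF K, of t] t by simp
    qed
  qed
qed

lemma cell_subset: "i < K \<Longrightarrow> cell K i \<subseteq> {0<..<1}"
proof
  fix t assume i: "i < K" and t: "t \<in> cell K i"
  have "0 \<le> real i / real K" "real (Suc i) / real K \<le> 1" using i by (auto simp: divide_le_eq_1)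
  then show "t \<in> {0<..<1}" using t unfolding cell_def greaterThanLessThan_iff by linarith
qed

lemma nn_integral_cells:
  fixes h :: "real \<Rightarrow> ennreal"
  assumes K: "0 < K" and [measurable]: "h \<in> borel_measurable borel"
  shows "(\<integral>\<^sup>+ t\<in>{0<..<1}. h t \<partial>lborel) = (\<Sum>i<K. cell_int K i h)"
proof -
  have "(\<integral>\<^sup>+ t\<in>{0<..<1}. h t \<partial>lborel) = (\<integral>\<^sup>+ t. (\<Sum>i<K. h t * indicator (cell K i) t) \<partial>lborel)"
  proof (rule nn_integral_cong_AE, use AE_cell[OF K] in eventually_elim)
    case (elim t)
    show ?case
    proof (cases "t \<in> {0<..<1}")
      case True
      let ?i = "nat \<lfloor>real K * t\<rfloor>"
      have "(\<Sum>i<K. h t * indicator (cell K i) t) = (\<Sum>i<K. if i = ?i then h t else 0)"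
	using elim True floor_in_cell[OF K, of t] by (intro sum.cong) (auto simp: indicator_def)
      then show ?thesis using elim True by simp
    next
      case False
      then have "t \<notin> cell K i" if "i < K" for i using cell_subset[OF that] by blast
      then have "(\<Sum>i<K. h t * indicator (cell K i) t) = 0" by (intro sum.neutral) auto
      then show ?thesis using False by simp
    qed
  qed
  also have "\<dots> = (\<Sum>i<K. cell_int K i h)"
    by (rule nn_integral_sum) measurable
  finally show ?thesis .
qed

lemma cell_shift_iff: "t + (real j - real i) / real K \<in> cell K j \<longleftrightarrow> t \<in> cell K i"
proof -
  have 1: "(real j - real i) / real K = real j / real K - real i / real K" by (rule diff_divide_distrib)
  have 2: "real (Suc p) / real K = real p / real K + 1 / real K" for p
    by (simp add: add_divide_distrib add.commute)
  have "A < t + c \<and> t + c < A' \<longleftrightarrow> B < t \<and> t < B'"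
    if "c = A - B" "A' = A + d" "B' = B + d" for A A' B B' c d :: real
    using that by auto
  from this[OF 1 2 2] show ?thesis unfolding cell_def greaterThanLessThan_iff .
qed

lemma nn_integral_cell_shift:
  fixes h :: "real \<Rightarrow> ennreal"
  assumes K: "0 < K" and [measurable]: "h \<in> borel_measurable borel"
  shows "(\<integral>\<^sup>+ t\<in>cell K i. h (t + (real j - real i) / real K) \<partial>lborel) = cell_int K j h"
proof -
  let ?c = "(real j - real i) / real K"
  note cell_shift_iff[of _ j i K]
  then have ind: "indicator (cell K j) (?c + t) = (indicator (cell K i) t :: ennreal)" for t
    by (simp add: indicator_def add.commute)
  have "cell_int K j h = (\<integral>\<^sup>+ t. h (?c + t) * indicator (cell K j) (?c + t) \<partial>lborel)"
    using nn_integral_real_affine[of "\<lambda>t. h t * indicator (cell K j) t" 1 ?c] by simp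
  then show ?thesis unfolding ind by (simp add: add.commute)
qed

lemma distribution_fun_unit_interval:
  assumes [measurable]: "F \<in> borel_measurable borel"
  shows "distribution_fun unit_interval F s = (\<integral>\<^sup>+ t\<in>{0<..<1}. indicator {s<..} (F t) \<partial>lborel)"
proof -
  have m: "F \<in> borel_measurable unit_interval" by (rule borel_measurable_unit_intervalI) fact
  have "distribution_fun unit_interval F s = (\<integral>\<^sup>+ t. indicator {t \<in> space unit_interval. s < F t} t \<partial>unit_interval)"
    unfolding distribution_fun_def
    by (intro nn_integral_indicator[symmetric])
      (use measurable_sets[OF m, of "{s<..}"] in \<open>simp add: vimage_def Int_def conj_commute\<close>)
  also have "\<dots> = (\<integral>\<^sup>+ t. indicator {s<..} (F t) \<partial>unit_interval)"
    by (intro nn_integral_cong) (auto simp: indicator_def)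
  finally show ?thesis by (simp add: nn_integral_unit_interval)
qed

lemma distribution_fun_permute_cells:
  assumes K: "0 < K" and \<pi>: "\<pi> permutes {..<K}"
    and [measurable]: "F \<in> borel_measurable borel" "G \<in> borel_measurable borel"
    and eq: "\<And>i t. i < K \<Longrightarrow> t \<in> cell K i \<Longrightarrow> F t = G (t + (real (\<pi> i) - real i) / real K)"
  shows "distribution_fun unit_interval F = distribution_fun unit_interval G"
proof
  fix s
  have "distribution_fun unit_interval F s = (\<Sum>i<K. \<integral>\<^sup>+ t\<in>cell K i. indicator {s<..} (F t) \<partial>lborel)"
    unfolding distribution_fun_unit_interval[OF assms(3)] by (rule nn_integral_cells[OF K]) measurable
  also have "\<dots> = (\<Sum>i<K. \<integral>\<^sup>+ t\<in>cell K i. indicator {s<..} (G (t + (real (\<pi> i) - real i) / real K)) \<partial>lborel)"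
    by (intro sum.cong refl nn_integral_cong) (auto simp: indicator_def eq)
  also have "\<dots> = (\<Sum>i<K. \<integral>\<^sup>+ t\<in>cell K (\<pi> i). indicator {s<..} (G t) \<partial>lborel)"
    by (intro sum.cong refl nn_integral_cell_shift[OF K, of "\<lambda>t. indicator {s<..} (G t)"]) measurable
  also have "\<dots> = (\<Sum>i<K. \<integral>\<^sup>+ t\<in>cell K i. indicator {s<..} (G t) \<partial>lborel)"
    using sum.permute[OF \<pi>, of "\<lambda>i. \<integral>\<^sup>+ t\<in>cell K i. indicator {s<..} (G t) \<partial>lborel"] by (simp add: o_def)
  also have "\<dots> = distribution_fun unit_interval G s"
    unfolding distribution_fun_unit_interval[OF assms(4)] by (rule nn_integral_cells[OF K, symmetric]) measurable
  finally show "distribution_fun unit_interval F s = distribution_fun unit_interval G s" .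
qed

lemma emeasure_cell: "0 < K \<Longrightarrow> emeasure lborel (cell K i) = ennreal (1 / real K)"
  unfolding cell_def by (subst emeasure_lborel_Ioo) (auto simp: divide_right_mono diff_divide_distrib[symmetric])


lemma banach_function_norm_sum:
  assumes \<tau>: "banach_function_norm M \<tau>" and "\<And>j::nat. F j \<in> borel_measurable M"
  shows "\<tau> (\<lambda>t. \<Sum>j<k. F j t) \<le> (\<Sum>j<k. \<tau> (F j))"
proof (induction k)
  case 0
  have "\<tau> (\<lambda>t. 0) = 0" using banach_function_normD(1)[OF \<tau>, of "\<lambda>t. 0"] by simp
  then show ?case by simp
next
  case (Suc k)
  have "\<tau> (\<lambda>t. (\<Sum>j<k. F j t) + F k t) \<le> \<tau> (\<lambda>t. \<Sum>j<k. F j t) + \<tau> (F k)"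
    using assms(2) by (intro banach_function_normD(2)[OF \<tau>] borel_measurable_sum)
  also have "\<dots> \<le> (\<Sum>j<k. \<tau> (F j)) + \<tau> (F k)" by (intro add_right_mono Suc.IH)
  finally show ?case by simp
qed

text \<open>
  Rotating the subcells of all cells at once permutes the finer partition; a mean over the rotations
  imitates the average over a cell without leaving the class of equimeasurable functions.
\<close>

definition rotate_index :: "nat \<Rightarrow> nat \<Rightarrow> nat \<Rightarrow> nat" where
  "rotate_index L j l = (if l + j < L then l + j else l + j - L)"

lemma rotate_index_less: "l < L \<Longrightarrow> j < L \<Longrightarrow> rotate_index L j l < L"
  by (auto simp: rotate_index_def)

lemma bij_rotate_index:
  assumes "l < L"
  shows "bij_betw (\<lambda>j. rotate_index L j l) {..<L} {..<L}"
proof -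
  have "inj_on (\<lambda>j. rotate_index L j l) {..<L}"
    by (intro inj_onI) (auto simp: rotate_index_def split: if_splits)
  moreover have "(\<lambda>j. rotate_index L j l) ` {..<L} \<subseteq> {..<L}"
    using assms by (auto intro: rotate_index_less)
  ultimately show ?thesis
    by (simp add: bij_betw_def endo_inj_surj)
qed

definition rotate_cells :: "nat \<Rightarrow> nat \<Rightarrow> nat \<Rightarrow> nat \<Rightarrow> nat" where
  "rotate_cells K L j q = (if q < K * L then (q div L) * L + rotate_index L j (q mod L) else q)"

lemma rotate_cells_permutes:
  assumes L: "0 < L" and j: "j < L"
  shows "rotate_cells K L j permutes {..<K * L}"
proof -
  have dm: "rotate_cells K L j q div L = q div L" "rotate_cells K L j q mod L = rotate_index L j (q mod L)"
    if "q < K * L" for q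
    using that rotate_index_less[of "q mod L" L j] L j by (auto simp: rotate_cells_def)
  have lt: "rotate_cells K L j q < K * L" if "q < K * L" for q
  proof -
    have "q div L < K" using that L by (simp add: less_mult_imp_div_less)
    then have "rotate_cells K L j q div L < K" using dm(1)[OF that] by simp
    then show ?thesis using L by (simp add: div_less_iff_less_mult)
  qed
  have inj_mod: "l = l'" if "rotate_index L j l = rotate_index L j l'" "l < L" "l' < L" for l l'
    using that j by (auto simp: rotate_index_def split: if_splits)
  have "inj_on (rotate_cells K L j) {..<K * L}"
  proof (rule inj_onI)
    fix q q' assume q: "q \<in> {..<K * L}" "q' \<in> {..<K * L}" and eq: "rotate_cells K L j q = rotate_cells K L j q'"
    have "q div L = q' div L" using dm(1)[of q] dm(1)[of q'] q eq by simp
    moreover have "q mod L = q' mod L"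
    proof (rule inj_mod)
      show "rotate_index L j (q mod L) = rotate_index L j (q' mod L)"
	using dm(2)[of q] dm(2)[of q'] q eq by simp
    qed (use L in simp_all)
    ultimately have "q div L * L + q mod L = q' div L * L + q' mod L" by simp
    then show "q = q'" unfolding div_mult_mod_eq .
  qed
  moreover have "rotate_cells K L j ` {..<K * L} \<subseteq> {..<K * L}" using lt by auto
  ultimately have "bij_betw (rotate_cells K L j) {..<K * L} {..<K * L}"
    by (simp add: bij_betw_def endo_inj_surj)
  then show ?thesis by (rule bij_imp_permutes) (simp add: rotate_cells_def)
qed

text \<open>
  Averages of a decreasing function over the cells have smaller norm. Dividing every cell into \<open>L\<close>
  subcells, the mean of the \<open>L\<close> rotated copies of the function lies above the average over the cell
  without its first subcell: each subcell contains one of the \<open>L\<close> points at which the function is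
  evaluated, and the value there dominates the average over the next subcell.
\<close>

lemma norm_cell_average_le:
  fixes G :: "real \<Rightarrow> ennreal"
  assumes \<tau>: "ri_norm unit_interval \<tau>" and K: "0 < K" and L: "0 < L"
    and G[measurable]: "G \<in> borel_measurable borel"
    and anti: "\<And>s t. 0 < s \<Longrightarrow> s \<le> t \<Longrightarrow> t < 1 \<Longrightarrow> G t \<le> G s"
  shows "\<tau> (step_fun K (\<lambda>i. ennreal (real K) * (\<Sum>l\<in>{1..<L}. cell_int (K * L) (i * L + l) G))) \<le> \<tau> G"
    (is "\<tau> (step_fun K ?c) \<le> _")
proof -
  have b: "banach_function_norm unit_interval \<tau>" using \<tau> by (simp add: ri_norm_def)
  let ?M = "K * L"
  have M: "0 < ?M" using K L by simp
  define F where "F j t = G (t + step_fun ?M (\<lambda>q. (real (rotate_cells K L j q) - real q) / real ?M) t)" for j t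
  have F[measurable]: "F j \<in> borel_measurable borel" for j unfolding F_def[abs_def] by measurable
  have FU: "F j \<in> borel_measurable unit_interval" for j by (rule borel_measurable_unit_intervalI[OF F])
  have eqn: "\<tau> (F j) = \<tau> G" if "j < L" for j
  proof -
    have "distribution_fun unit_interval (F j) = distribution_fun unit_interval G"
      by (rule distribution_fun_permute_cells[OF M rotate_cells_permutes[OF L that] F G])
	(simp add: F_def step_fun_cell[OF M])
    then show ?thesis
      using \<tau>[unfolded ri_norm_def, THEN conjunct2, THEN bspec, OF FU, THEN bspec, OF borel_measurable_unit_intervalI[OF G]]
      by simp
  qed
  have cFU: "(\<lambda>t. ennreal (1 / real L) * F j t) \<in> borel_measurable unit_interval" for j
    by (rule borel_measurable_unit_intervalI) measurable
  have "\<tau> (\<lambda>t. \<Sum>j<L. ennreal (1 / real L) * F j t) \<le> (\<Sum>j<L. \<tau> (\<lambda>t. ennreal (1 / real L) * F j t))"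
    by (rule banach_function_norm_sum[OF b cFU])
  also have "\<dots> = (\<Sum>j<L. ennreal (1 / real L) * \<tau> G)"
    using banach_function_normD(3)[OF b FU, of "1 / real L"] by (intro sum.cong) (auto simp: eqn)
  also have "\<dots> = \<tau> G"
  proof -
    have "(\<Sum>j<L. ennreal (1 / real L) * \<tau> G) = (ennreal (real L) * ennreal (1 / real L)) * \<tau> G"
      by (simp add: mult.assoc ennreal_of_nat_eq_real_of_nat)
    also have "ennreal (real L) * ennreal (1 / real L) = 1" using L by (simp flip: ennreal_mult)
    finally show ?thesis by simp
  qed
  finally have avg: "\<tau> (\<lambda>t. \<Sum>j<L. ennreal (1 / real L) * F j t) \<le> \<tau> G" .
  have "AE t in unit_interval. step_fun K ?c t \<le> (\<Sum>j<L. ennreal (1 / real L) * F j t)"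
  proof -
    have "AE t in lebesgue. t \<in> {0<..<1} \<longrightarrow> step_fun K ?c t \<le> (\<Sum>j<L. ennreal (1 / real L) * F j t)"
    proof (rule AE_completion, use AE_cell[OF M] in eventually_elim)
      case (elim t)
      show ?case
      proof
	assume t: "t \<in> {0<..<1}"
	define q where "q = nat \<lfloor>real ?M * t\<rfloor>"
	define i where "i = q div L"
	define l where "l = q mod L"
	have q: "q < ?M" "t \<in> cell ?M q" using elim t by (auto simp: q_def)
	have qil: "q = i * L + l" and l: "l < L" and i: "i < K"
	  using L q by (auto simp: i_def l_def less_mult_imp_div_less)
	have tM: "real q < real K * real L * t" "real K * real L * t < real q + 1"
	  using q(2) M by (simp_all add: cell_def pos_divide_less_eq pos_less_divide_eq mult.commute add.commute)
	have "real (i * L) \<le> real q" "real q + 1 \<le> real ((i + 1) * L)"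
	proof -
	  show "real (i * L) \<le> real q" using qil by simp
	  have "q + 1 \<le> (i + 1) * L" using qil l by simp
	  then have "real (q + 1) \<le> real ((i + 1) * L)" by (rule of_nat_mono)
	  then show "real q + 1 \<le> real ((i + 1) * L)" by simp
	qed
	moreover have "real (i * L) = real L * real i" "real ((i + 1) * L) = real L * real (Suc i)"
	  by (simp_all add: algebra_simps)
	moreover have "real K * real L * t = real L * (real K * t)" by (simp only: mult_ac)
	ultimately have "real L * real i < real L * (real K * t)" "real L * (real K * t) < real L * real (Suc i)"
	  using tM by linarith+
	then have "real i < real K * t" "real K * t < real (Suc i)"
	  using mult_less_cancel_left_pos[of "real L"] L by (simp_all only: of_nat_0_less_iff)
	then have tK: "t \<in> cell K i"
	  using K by (simp add: cell_def pos_divide_less_eq pos_less_divide_eq mult.commute)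
	define z where "z l' = t + (real (i * L + l') - real q) / real ?M" for l'
	have z: "z l' \<in> cell ?M (i * L + l')" for l'
	  unfolding z_def cell_shift_iff by (rule q(2))
	have Fz: "F j t = G (z (rotate_index L j l))" for j
	proof -
	  have "rotate_cells K L j q = i * L + rotate_index L j l"
	    using q(1) by (simp add: rotate_cells_def i_def l_def)
	  then show ?thesis by (simp add: F_def step_fun_cell[OF M q(2)] z_def)
	qed
	have next_le: "ennreal (real ?M) * cell_int ?M (i * L + Suc l') G \<le> G (z l')"
	  if l': "Suc l' < L" for l'
	proof -
	  have "i * L + Suc l' < ?M"
	  proof -
	    have "i * L + Suc l' < (i + 1) * L" using l' by simp
	    also have "(i + 1) * L \<le> K * L" using i by (intro mult_right_mono) auto
	    finally show ?thesis .
	  qed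
	  note c = cell_subset[OF this]
	  have z0: "0 < z l'" using cell_subset[of "i * L + l'" ?M] z[of l'] \<open>i * L + Suc l' < ?M\<close> by auto
	  have "G s \<le> G (z l')" if s: "s \<in> cell ?M (i * L + Suc l')" for s
	  proof (rule anti[OF z0])
	    show "s < 1" using c s by auto
	    have "z l' < real (Suc (i * L + l')) / real ?M" using z[of l'] by (simp add: cell_def)
	    moreover have "real (i * L + Suc l') / real ?M < s" using s by (simp add: cell_def)
	    ultimately show "z l' \<le> s" by simp
	  qed
	  then have "cell_int ?M (i * L + Suc l') G \<le> (\<integral>\<^sup>+ t. G (z l') * indicator (cell ?M (i * L + Suc l')) t \<partial>lborel)"
	    by (intro nn_integral_mono) (auto simp: indicator_def)
	  also have "\<dots> = G (z l') * ennreal (1 / real ?M)"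
	    by (subst nn_integral_cmult_indicator) (simp_all add: emeasure_cell[OF M] del: of_nat_mult)
	  finally have "ennreal (real ?M) * cell_int ?M (i * L + Suc l') G
	     \<le> ennreal (real ?M) * (G (z l') * ennreal (1 / real ?M))"
	    by (rule mult_left_mono) simp
	  also have "\<dots> = (ennreal (real ?M) * ennreal (1 / real ?M)) * G (z l')" by (simp only: mult_ac)
	  also have "ennreal (real ?M) * ennreal (1 / real ?M) = 1"
	    using M by (subst ennreal_mult[symmetric]) (auto simp del: of_nat_mult)
	  finally show ?thesis by simp
	qed
	have "{1..<L} = Suc ` {..<L - 1}"
	  using L by (auto simp: image_iff lessThan_atLeast0 image_Suc_atLeastLessThan)
	then have "?c i = ennreal (real K) * (\<Sum>l'<L - 1. cell_int ?M (i * L + Suc l') G)"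
	  by (simp add: sum.reindex)
	moreover have "ennreal (real K) = ennreal (1 / real L) * ennreal (real ?M)"
	proof -
	  have "ennreal (1 / real L) * ennreal (real ?M) = ennreal (1 / real L * real ?M)"
	    by (rule ennreal_mult[symmetric]) auto
	  also have "1 / real L * real ?M = real K" using L by simp
	  finally show ?thesis by (rule sym)
	qed
	ultimately have "?c i = ennreal (1 / real L) * (\<Sum>l'<L - 1. ennreal (real ?M) * cell_int ?M (i * L + Suc l') G)"
	  by (simp only: mult.assoc sum_distrib_left[of "ennreal (real ?M)"])
	also have "\<dots> \<le> ennreal (1 / real L) * (\<Sum>l'<L - 1. G (z l'))"
	  using next_le by (intro mult_left_mono sum_mono) auto
	also have "\<dots> \<le> ennreal (1 / real L) * (\<Sum>l'<L. G (z l'))"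
	  by (intro mult_left_mono sum_mono2) auto
	also have "(\<Sum>l'<L. G (z l')) = (\<Sum>j<L. F j t)"
	  unfolding Fz by (rule sum.reindex_bij_betw[OF bij_rotate_index[OF l], symmetric])
	finally show "step_fun K ?c t \<le> (\<Sum>j<L. ennreal (1 / real L) * F j t)"
	  by (simp add: step_fun_cell[OF K tK] sum_distrib_left)
      qed
    qed
    then show ?thesis by (subst AE_restrict_space_iff) auto
  qed
  then have "\<tau> (step_fun K ?c) \<le> \<tau> (\<lambda>t. \<Sum>j<L. ennreal (1 / real L) * F j t)"
    by (intro banach_function_normD(4)[OF b] borel_measurable_unit_intervalI) measurable
  then show ?thesis using avg by (rule order_trans)
qed

text \<open>
  A norming functional for the norm of a step function, regarded as a norm on coefficient vectors. On
  bounded decreasing functions it is still dominated by the norm, because averages over the cells have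
  smaller norm; by rearrangement invariance this survives a permutation of its coefficients.
\<close>

lemma step_norming_functional:
  fixes u :: "nat \<Rightarrow> real"
  assumes \<tau>: "ri_norm unit_interval \<tau>" and K: "0 < K" and u: "\<And>i. 0 \<le> u i"
  shows "\<exists>b. (\<forall>i. 0 \<le> b i) \<and> \<tau> (step_fun K (\<lambda>i. ennreal (u i))) = ennreal (\<Sum>i<K. b i * u i) \<and>
    (\<forall>\<pi> G B. \<pi> permutes {..<K} \<longrightarrow> G \<in> borel_measurable borel \<longrightarrow>
      (\<forall>s t. 0 < s \<longrightarrow> s \<le> t \<longrightarrow> t < 1 \<longrightarrow> G t \<le> G s) \<longrightarrow> (\<forall>t. G t \<le> ennreal B) \<longrightarrow> 0 \<le> B \<longrightarrow>
      (\<Sum>i<K. ennreal (b (\<pi> i)) * (ennreal (real K) * cell_int K i G)) \<le> \<tau> G)"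
proof -
  have bn: "banach_function_norm unit_interval \<tau>" using \<tau> by (simp add: ri_norm_def)
  have mU: "step_fun K (\<lambda>i. ennreal (v i)) \<in> borel_measurable unit_interval" for v
    by (rule borel_measurable_unit_intervalI[OF borel_measurable_step_fun])
  have AE_U: "AE t in unit_interval. P t" if "\<And>t. 0 < t \<Longrightarrow> t < 1 \<Longrightarrow> P t" for P
    using that by (intro AE_I2) (simp add: space_restrict_space)
  have fin: "\<tau> (step_fun K (\<lambda>i. ennreal (v i))) < top" for v
  proof -
    let ?B = "\<Sum>i<K. \<bar>v i\<bar>"
    have "\<tau> (step_fun K (\<lambda>i. ennreal (v i))) \<le> \<tau> (\<lambda>t. ennreal ?B * 1)"
    proof (rule banach_function_normD(4)[OF bn _ mU])
      show "AE t in unit_interval. step_fun K (\<lambda>i. ennreal (v i)) t \<le> ennreal ?B * 1"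
      proof (rule AE_U)
	fix t :: real assume "0 < t" "t < 1"
	then have i: "nat \<lfloor>real K * t\<rfloor> < K" using floor_less[OF K] by simp
	have "v (nat \<lfloor>real K * t\<rfloor>) \<le> \<bar>v (nat \<lfloor>real K * t\<rfloor>)\<bar>" by simp
	also have "\<dots> \<le> ?B" using i by (intro member_le_sum) auto
	finally show "step_fun K (\<lambda>i. ennreal (v i)) t \<le> ennreal ?B * 1"
	  by (simp add: step_fun_def ennreal_leI)
      qed
    qed simp
    also have "\<dots> = ennreal ?B * \<tau> (\<lambda>t. 1)" by (intro banach_function_normD(3)[OF bn]) (auto simp: sum_nonneg)
    also have "\<dots> < top" using banach_function_normD(5)[OF bn] by (simp add: ennreal_mult_less_top)
    finally show ?thesis .
  qed
  define p where "p v = enn2real (\<tau> (step_fun K (\<lambda>i. ennreal (v i))))" for v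
  have p: "\<tau> (step_fun K (\<lambda>i. ennreal (v i))) = ennreal (p v)" for v
    using fin[of v] by (simp add: p_def)
  have p0: "0 \<le> p v" for v by (simp add: p_def)
  have "\<exists>b. (\<forall>v. (\<Sum>i<K. b i * v i) \<le> p v) \<and> (\<Sum>i<K. b i * u i) = p u"
  proof (rule sublinear_supporting_functional)
    fix v w :: "nat \<Rightarrow> real"
    have "\<tau> (step_fun K (\<lambda>i. ennreal (v i + w i)))
	\<le> \<tau> (\<lambda>t. step_fun K (\<lambda>i. ennreal (v i)) t + step_fun K (\<lambda>i. ennreal (w i)) t)"
    proof (rule banach_function_normD(4)[OF bn _ mU])
      show "(\<lambda>t. step_fun K (\<lambda>i. ennreal (v i)) t + step_fun K (\<lambda>i. ennreal (w i)) t) \<in> borel_measurable unit_interval"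
	by (rule borel_measurable_unit_intervalI) measurable
      have "ennreal (x + y) \<le> ennreal x + ennreal y" for x y :: real
      proof -
	have "ennreal (x + y) \<le> ennreal (max 0 x + max 0 y)" by (rule ennreal_leI) auto
	also have "\<dots> = ennreal (max 0 x) + ennreal (max 0 y)" by (rule ennreal_plus) auto
	finally show ?thesis by (simp add: ennreal_max_0)
      qed
      then show "AE t in unit_interval. step_fun K (\<lambda>i. ennreal (v i + w i)) t
	  \<le> step_fun K (\<lambda>i. ennreal (v i)) t + step_fun K (\<lambda>i. ennreal (w i)) t"
	by (intro AE_U) (simp add: step_fun_def)
    qed
    also have "\<dots> \<le> ennreal (p v) + ennreal (p w)"
      unfolding p[symmetric] by (rule banach_function_normD(2)[OF bn mU mU])
    finally have "ennreal (p (\<lambda>i. v i + w i)) \<le> ennreal (p v + p w)" unfolding p using p0 by simp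
    then show "p (\<lambda>i. v i + w i) \<le> p v + p w" using p0 by (subst (asm) ennreal_le_iff) auto
  next
    fix c :: real and v :: "nat \<Rightarrow> real" assume c: "0 \<le> c"
    have "ennreal (p (\<lambda>i. c * v i)) = \<tau> (\<lambda>t. ennreal c * step_fun K (\<lambda>i. ennreal (v i)) t)"
      unfolding p[symmetric] using c by (simp add: step_fun_def[abs_def] ennreal_mult')
    also have "\<dots> = ennreal (c * p v)"
      using c p0 by (subst banach_function_normD(3)[OF bn mU c]) (simp add: p ennreal_mult)
    finally show "p (\<lambda>i. c * v i) = c * p v" using c p0 by (subst (asm) ennreal_inj) auto
  next
    fix v w :: "nat \<Rightarrow> real" assume eq: "\<And>i. i < K \<Longrightarrow> v i = w i"
    have "\<tau> (step_fun K (\<lambda>i. ennreal (v i))) = \<tau> (step_fun K (\<lambda>i. ennreal (w i)))"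
      using eq floor_less[OF K]
      by (intro banach_function_norm_cong_AE[OF bn mU mU] AE_U) (simp add: step_fun_def)
    then show "p v = p w" by (simp add: p_def)
  qed
  then obtain b0 where b0: "\<And>v. (\<Sum>i<K. b0 i * v i) \<le> p v" "(\<Sum>i<K. b0 i * u i) = p u" by blast
  have b0_nonneg: "0 \<le> b0 k" if k: "k < K" for k
  proof -
    have "(\<Sum>i<K. b0 i * (if i = k then - 1 else 0)) \<le> p (\<lambda>i. if i = k then - 1 else 0)" by (rule b0)
    moreover have "(\<Sum>i<K. b0 i * (if i = k then - 1 else 0)) = (\<Sum>i<K. if i = k then - b0 k else 0)"
      by (intro sum.cong) auto
    moreover have "p (\<lambda>i. if i = k then - 1 else 0) = 0"
    proof -
      have "step_fun K (\<lambda>i. ennreal (if i = k then - 1 else 0)) = (\<lambda>t. 0)" by (auto simp: step_fun_def ennreal_neg)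
      then show ?thesis using banach_function_normD(1)[OF bn, of "\<lambda>t. 0"] by (simp add: p_def)
    qed
    ultimately show ?thesis using k by simp
  qed
  define b where "b i = (if i < K then b0 i else 0)" for i
  have b: "\<And>i. 0 \<le> b i" using b0_nonneg by (simp add: b_def)
  have b_le: "(\<Sum>i<K. b i * v i) \<le> p v" for v using b0(1)[of v] by (simp add: b_def)
  have b_eq: "(\<Sum>i<K. b i * u i) = p u" using b0(2) by (simp add: b_def)
  have main: "(\<Sum>i<K. ennreal (b (\<pi> i)) * (ennreal (real K) * cell_int K i G)) \<le> \<tau> G"
    if \<pi>: "\<pi> permutes {..<K}" and G[measurable]: "G \<in> borel_measurable borel"
      and anti: "\<And>s t. 0 < s \<Longrightarrow> s \<le> t \<Longrightarrow> t < 1 \<Longrightarrow> G t \<le> G s" and B: "\<And>t. G t \<le> ennreal B" "0 \<le> B" for \<pi> G B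
  proof -
    define c where "c L i = ennreal (real K) * (\<Sum>l\<in>{1..<L}. cell_int (K * L) (i * L + l) G)" for L i
    have cell_le: "cell_int (K * L) q G \<le> ennreal (B / real (K * L))" if "0 < L" for L q
    proof -
      have "cell_int (K * L) q G \<le> (\<integral>\<^sup>+ t. ennreal B * indicator (cell (K * L) q) t \<partial>lborel)"
	using B by (intro nn_integral_mono mult_right_mono) auto
      also have "\<dots> = ennreal B * ennreal (1 / real (K * L))"
	using K that by (subst nn_integral_cmult_indicator) (auto simp: emeasure_cell simp del: of_nat_mult)
      also have "\<dots> = ennreal (B / real (K * L))"
	using B(2) by (subst ennreal_mult[symmetric]) auto
      finally show ?thesis .
    qed
    have cfin: "c L i < top" if "0 < L" for L i
    proof -
      have "cell_int (K * L) q G < top" for q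
	using cell_le[OF that, of q] by (rule order_le_less_trans) simp
      then show ?thesis unfolding c_def by (simp add: ennreal_mult_less_top)
    qed
    have step: "(\<Sum>i<K. ennreal (b (\<pi> i)) * c L i) \<le> \<tau> G" if L: "0 < L" for L
    proof -
      have c_eq: "c L i = ennreal (enn2real (c L i))" for i using cfin[OF L, of i] by simp
      let ?v = "\<lambda>i. enn2real (c L i)"
      have inv: "inv \<pi> permutes {..<K}" using \<pi> by (rule permutes_inv)
      have "(\<Sum>i<K. ennreal (b (\<pi> i)) * c L i) = (\<Sum>i<K. ennreal (b (\<pi> i) * ?v i))"
	using b by (subst c_eq) (simp add: ennreal_mult)
      also have "\<dots> = ennreal (\<Sum>i<K. b (\<pi> i) * ?v i)"
	using b by (intro sum_ennreal) simp
      also have "(\<Sum>i<K. b (\<pi> i) * ?v i) = (\<Sum>i<K. b i * ?v (inv \<pi> i))"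
	using sum.permute[OF \<pi>, of "\<lambda>i. b i * ?v (inv \<pi> i)"] permutes_inverses(2)[OF \<pi>] by (simp add: o_def)
      also have "ennreal \<dots> \<le> \<tau> (step_fun K (\<lambda>i. ennreal (?v (inv \<pi> i))))"
	unfolding p by (intro ennreal_leI b_le)
      also have "\<dots> = \<tau> (step_fun K (\<lambda>i. ennreal (?v i)))"
      proof -
	have "distribution_fun unit_interval (step_fun K (\<lambda>i. ennreal (?v (inv \<pi> i))))
	    = distribution_fun unit_interval (step_fun K (\<lambda>i. ennreal (?v i)))"
	proof (rule distribution_fun_permute_cells[OF K inv])
	  fix i t assume "t \<in> cell K i"
	  then show "step_fun K (\<lambda>i. ennreal (?v (inv \<pi> i))) t
	      = step_fun K (\<lambda>i. ennreal (?v i)) (t + (real (inv \<pi> i) - real i) / real K)"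
	    using cell_shift_iff[of t "inv \<pi> i" i K] by (simp add: step_fun_cell[OF K])
	qed measurable
	then show ?thesis
	  by (rule mp[OF \<tau>[unfolded ri_norm_def, THEN conjunct2, THEN bspec, OF mU, THEN bspec, OF mU]])
      qed
      also have "\<dots> = \<tau> (step_fun K (c L))" by (simp only: c_eq[symmetric])
      also have "\<dots> \<le> \<tau> G"
	unfolding c_def[abs_def] by (rule norm_cell_average_le[OF \<tau> K L G anti])
      finally show ?thesis .
    qed
    have close: "ennreal (real K) * cell_int K i G \<le> c L i + ennreal (B / real L)"
      if i: "i < K" and L: "0 < L" for L i
    proof -
      have M: "0 < K * L" using K L by simp
      have sub: "cell_int K i G \<le> (\<integral>\<^sup>+ t. (\<Sum>l<L. G t * indicator (cell (K * L) (i * L + l)) t) \<partial>lborel)"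
      proof (rule nn_integral_mono_AE, use AE_cell[OF M] in eventually_elim)
	case (elim t)
	show ?case
	proof (cases "t \<in> cell K i")
	  case True
	  define q where "q = nat \<lfloor>real (K * L) * t\<rfloor>"
	  have t: "t \<in> {0<..<1}" using cell_subset[OF i] True by blast
	  then have q: "t \<in> cell (K * L) q" using elim by (simp add: q_def)
	  have "real i < real K * t" "real K * t < real (Suc i)"
	    using True K by (simp_all add: cell_def pos_divide_less_eq pos_less_divide_eq mult.commute del: of_nat_Suc)
	  then have a: "real L * real i < real L * (real K * t)" "real L * (real K * t) < real L * real (Suc i)"
	    using L by simp_all
	  have "real q < real (K * L) * t" "real (K * L) * t < real (Suc q)"
	    using q M by (simp_all add: cell_def pos_divide_less_eq pos_less_divide_eq mult.commute del: of_nat_Suc of_nat_mult)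
	  moreover have "real (K * L) * t = real L * (real K * t)" by (simp add: mult_ac)
	  ultimately have "real L * real i < real (Suc q)" "real q < real L * real (Suc i)"
	    using a by linarith+
	  then have "real (L * i) < real (Suc q)" "real q < real (L * Suc i)" by (simp_all only: of_nat_mult)
	  then have "i * L < Suc q" "q < i * L + L" unfolding of_nat_less_iff by (simp_all add: mult.commute)
	  then obtain l where l: "l < L" "q = i * L + l"
	    by (metis add_diff_inverse_nat less_Suc_eq_le nat_add_left_cancel_less not_less)
	  have "G t * indicator (cell (K * L) (i * L + l)) t \<le> (\<Sum>l<L. G t * indicator (cell (K * L) (i * L + l)) t)"
	    using l(1) by (intro member_le_sum) auto
	  then show ?thesis using q l True by simp
	qed simp
      qed
      also have "\<dots> = (\<Sum>l<L. cell_int (K * L) (i * L + l) G)"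
	by (rule nn_integral_sum) measurable
      also have "\<dots> = cell_int (K * L) (i * L) G + (\<Sum>l\<in>{1..<L}. cell_int (K * L) (i * L + l) G)"
	using L sum.atLeast_Suc_lessThan[of 0 L "\<lambda>l. cell_int (K * L) (i * L + l) G"]
	by (simp add: lessThan_atLeast0)
      finally have "ennreal (real K) * cell_int K i G
	  \<le> ennreal (real K) * cell_int (K * L) (i * L) G + c L i"
	unfolding c_def distrib_left[symmetric] by (intro mult_left_mono) auto
      also have "ennreal (real K) * cell_int (K * L) (i * L) G \<le> ennreal (real K) * ennreal (B / real (K * L))"
	by (intro mult_left_mono cell_le[OF L]) simp
      also have "\<dots> = ennreal (real K * (B / real (K * L)))"
	using B(2) by (intro ennreal_mult[symmetric]) auto
      also have "real K * (B / real (K * L)) = B / real L" using K by simp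
      finally show ?thesis by (simp add: add.commute add_left_mono)
    qed
    let ?S = "\<Sum>i<K. b (\<pi> i)"
    have S: "0 \<le> ?S" using b by (simp add: sum_nonneg)
    have "(\<Sum>i<K. ennreal (b (\<pi> i)) * (ennreal (real K) * cell_int K i G))
	\<le> \<tau> G + ennreal (?S * B / real (Suc L))" for L
    proof -
      have "(\<Sum>i<K. ennreal (b (\<pi> i)) * (ennreal (real K) * cell_int K i G))
	\<le> (\<Sum>i<K. ennreal (b (\<pi> i)) * (c (Suc L) i + ennreal (B / real (Suc L))))"
	by (intro sum_mono mult_left_mono close) auto
      also have "\<dots> = (\<Sum>i<K. ennreal (b (\<pi> i)) * c (Suc L) i) + (\<Sum>i<K. ennreal (b (\<pi> i)) * ennreal (B / real (Suc L)))"
	by (simp add: distrib_left sum.distrib)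
      also have "(\<Sum>i<K. ennreal (b (\<pi> i)) * ennreal (B / real (Suc L))) = ennreal (?S * (B / real (Suc L)))"
      proof -
	have "(\<Sum>i<K. ennreal (b (\<pi> i)) * ennreal (B / real (Suc L))) = (\<Sum>i<K. ennreal (b (\<pi> i))) * ennreal (B / real (Suc L))"
	  by (rule sum_distrib_right[symmetric])
	also have "(\<Sum>i<K. ennreal (b (\<pi> i))) = ennreal ?S" by (rule sum_ennreal) (rule b)
	also have "ennreal ?S * ennreal (B / real (Suc L)) = ennreal (?S * (B / real (Suc L)))"
	  using S B(2) by (intro ennreal_mult[symmetric]) auto
	finally show ?thesis .
      qed
      finally show ?thesis using step[of "Suc L"] by (simp add: add_right_mono order_trans del: of_nat_Suc)
    qed
    moreover have "(\<lambda>L. \<tau> G + ennreal (?S * B / real (Suc L))) \<longlonglongrightarrow> \<tau> G + ennreal 0"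
    proof (intro tendsto_add tendsto_const tendsto_ennrealI)
      show "(\<lambda>L. ?S * B / real (Suc L)) \<longlonglongrightarrow> 0"
	using tendsto_mult[OF tendsto_const[of "?S * B"] LIMSEQ_inverse_real_of_nat] by (simp add: divide_inverse)
    qed
    ultimately show ?thesis
      by (intro LIMSEQ_le_const[of _ "\<tau> G"]) auto
  qed
  show ?thesis
  proof (intro exI[of _ b] conjI allI impI)
    show "0 \<le> b i" for i by (rule b)
    show "\<tau> (step_fun K (\<lambda>i. ennreal (u i))) = ennreal (\<Sum>i<K. b i * u i)" unfolding p b_eq ..
    fix \<pi> and G :: "real \<Rightarrow> ennreal" and B :: real
    assume "\<pi> permutes {..<K}" "G \<in> borel_measurable borel"
      and G: "\<forall>s t. 0 < s \<longrightarrow> s \<le> t \<longrightarrow> t < 1 \<longrightarrow> G t \<le> G s" "\<forall>t. G t \<le> ennreal B" "0 \<le> B"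
    then show "(\<Sum>i<K. ennreal (b (\<pi> i)) * (ennreal (real K) * cell_int K i G)) \<le> \<tau> G"
      by (intro main[where B=B] G(1)[rule_format] G(2)[rule_format])
  qed
qed

section \<open>Decreasing functions\<close>

text \<open>
  The superlevel sets of \<open>B\<close> are initial intervals, and on those the integral of a function is largest for
  its rearrangement.
\<close>

lemma set_integral_decreasing_le:
  assumes q: "q \<in> borel_measurable unit_interval"
    and B[measurable]: "B \<in> borel_measurable borel" and anti: "\<And>s t. 0 < s \<Longrightarrow> s \<le> t \<Longrightarrow> t < 1 \<Longrightarrow> B t \<le> (B s :: ennreal)"
  shows "(\<integral>\<^sup>+ t. B t * q t \<partial>unit_interval) \<le> (\<integral>\<^sup>+ t. B t * rearrangement unit_interval q t \<partial>unit_interval)"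
proof -
  interpret U: prob_space unit_interval by (rule prob_space_unit_interval)
  have BU: "B \<in> borel_measurable unit_interval" by (rule borel_measurable_unit_intervalI) fact
  have rU: "rearrangement unit_interval q \<in> borel_measurable unit_interval"
    by (rule borel_measurable_unit_intervalI[OF borel_measurable_rearrangement[OF q]])
  have "(\<integral>\<^sup>+ t. q t * indicator {t. ennreal y < B t} t \<partial>unit_interval)
      \<le> (\<integral>\<^sup>+ t. rearrangement unit_interval q t * indicator {t. ennreal y < B t} t \<partial>unit_interval)" for y
  proof -
    let ?E = "{t \<in> {0<..<1}. ennreal y < B t}"
    have Eb: "?E \<in> sets borel" by measurable
    have E: "?E \<in> sets unit_interval" using Eb by (auto simp: sets_restrict_space_iff)
    have emE: "emeasure unit_interval ?E = emeasure lborel ?E"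
      using Eb by (subst emeasure_restrict_space) auto
    have "emeasure lborel ?E \<le> emeasure lborel {0<..<1::real}" by (rule emeasure_mono) auto
    then obtain r where r: "emeasure lborel ?E = ennreal r" "0 \<le> r" "r \<le> 1"
      by (cases "emeasure lborel ?E") (auto simp: top_unique)
    have sub: "{0<..<r} \<subseteq> ?E"
    proof
      fix t assume t: "t \<in> {0<..<r}"
      then have t1: "0 < t" "t < 1" using r by auto
      show "t \<in> ?E"
      proof (rule ccontr)
	assume "t \<notin> ?E"
	then have "B t \<le> ennreal y" using t1 by auto
	have "?E \<subseteq> {0<..<t}"
	proof
	  fix s assume s: "s \<in> ?E"
	  have "\<not> t \<le> s" using anti[of t s] s t1 \<open>B t \<le> ennreal y\<close> by (auto dest: leD order_trans)
	  then show "s \<in> {0<..<t}" using s by auto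
	qed
	then have "emeasure lborel ?E \<le> emeasure lborel {0<..<t}" by (rule emeasure_mono) simp
	then have "ennreal r \<le> ennreal t" using r t1 by simp
	then show False using t r by (simp add: ennreal_le_iff)
      qed
    qed
    have "(\<integral>\<^sup>+ t. q t * indicator {t. ennreal y < B t} t \<partial>unit_interval) = (\<integral>\<^sup>+ t\<in>?E. q t \<partial>unit_interval)"
      by (intro nn_integral_cong) (auto simp: indicator_def space_restrict_space)
    also have "\<dots> \<le> rearrangement_int unit_interval q r"
      using r emE by (intro U.set_integral_le_rearrangement_int[OF q E]) auto
    also have "\<dots> \<le> (\<integral>\<^sup>+ t. rearrangement unit_interval q t * indicator {t. ennreal y < B t} t * indicator {0<..<1} t \<partial>lborel)"
      unfolding rearrangement_int_def using sub r(3) by (intro nn_integral_mono) (auto simp: indicator_def)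
    finally show ?thesis by (simp add: nn_integral_unit_interval)
  qed
  note le = this
  have "(\<integral>\<^sup>+ y\<in>{0..}. (\<integral>\<^sup>+ t. q t * indicator {t. ennreal y < B t} t \<partial>unit_interval) \<partial>lborel)
      \<le> (\<integral>\<^sup>+ y\<in>{0..}. (\<integral>\<^sup>+ t. rearrangement unit_interval q t * indicator {t. ennreal y < B t} t \<partial>unit_interval) \<partial>lborel)"
    by (rule nn_integral_mono) (rule mult_right_mono[OF le], simp)
  then show ?thesis
    by (simp only: U.nn_integral_layer_cake[OF BU q] U.nn_integral_layer_cake[OF BU rU])
qed

text \<open>
  For a decreasing function the level \<open>d t\<close> is optimal in the infimum formula for the \<open>K\<close>-functional.
\<close>

lemma rearrangement_int_decreasing_le:
  fixes d :: "real \<Rightarrow> real"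
  assumes d[measurable]: "d \<in> borel_measurable borel" and d0: "\<And>t. 0 \<le> d t"
    and anti: "\<And>s t. 0 < s \<Longrightarrow> s \<le> t \<Longrightarrow> t < 1 \<Longrightarrow> d t \<le> d s" and t: "0 < t" "t < 1"
  shows "rearrangement_int unit_interval (\<lambda>s. ennreal (d s)) t \<le> (\<integral>\<^sup>+ s\<in>{0<..<t}. ennreal (d s) \<partial>lborel)"
proof -
  interpret U: prob_space unit_interval by (rule prob_space_unit_interval)
  have dU: "(\<lambda>s. ennreal (d s)) \<in> borel_measurable unit_interval" by (rule borel_measurable_unit_intervalI) measurable
  have "rearrangement_int unit_interval (\<lambda>s. ennreal (d s)) t
      \<le> ennreal (t * d t) + (\<integral>\<^sup>+ s. ennreal (d s) - ennreal (d t) \<partial>unit_interval)"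
    using t d0 by (intro U.rearrangement_int_le[OF dU]) auto
  also have "\<dots> = (\<integral>\<^sup>+ s. ennreal (d t) * indicator {0<..<t} s + (ennreal (d s) - ennreal (d t)) * indicator {0<..<1} s \<partial>lborel)"
    using t d0 by (subst nn_integral_add) (auto simp: nn_integral_unit_interval nn_integral_cmult_indicator ennreal_mult mult.commute)
  also have "\<dots> \<le> (\<integral>\<^sup>+ s. ennreal (d s) * indicator {0<..<t} s + 0 * indicator {t} s + (ennreal (d s) - ennreal (d t)) * indicator {t} s \<partial>lborel)"
  proof (intro nn_integral_mono)
    fix s :: real
    consider "s \<in> {0<..<t}" | "s = t" | "s \<notin> {0<..<1}" | "t < s" "s < 1" using t by force
    then show "ennreal (d t) * indicator {0<..<t} s + (ennreal (d s) - ennreal (d t)) * indicator {0<..<1} s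
      \<le> ennreal (d s) * indicator {0<..<t} s + 0 * indicator {t} s + (ennreal (d s) - ennreal (d t)) * indicator {t} s"
    proof cases
      case 1
      then have "d t \<le> d s" using anti[of s t] t by simp
      then have e: "ennreal (d t) + (ennreal (d s) - ennreal (d t)) = ennreal (d s)"
	by (subst add.commute) (intro diff_add_cancel_ennreal ennreal_leI)
      have i: "indicator {0<..<t} s = (1::ennreal)" "indicator {0<..<1} s = (1::ennreal)" "indicator {t} s = (0::ennreal)"
	using 1 t by (auto simp: indicator_def)
      show ?thesis unfolding i by (simp add: e)
    next
      case 4
      then have "d s \<le> d t" using anti[of t s] t by simp
      then show ?thesis using 4 d0 by (simp add: ennreal_minus ennreal_neg)
    qed (use t in auto)
  qed
  also have "\<dots> = (\<integral>\<^sup>+ s. ennreal (d s) * indicator {0<..<t} s \<partial>lborel)"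
    by (intro nn_integral_cong_AE, use AE_lborel_singleton[of t] in eventually_elim) auto
  finally show ?thesis .
qed

section \<open>Norms dominated by an associate norm\<close>

lemma ri_norm_associate_max_rearrangement:
  assumes M: "prob_space M" and \<tau>: "banach_function_norm unit_interval \<tau>" and \<alpha>: "0 < (\<alpha>::real)"
  shows "ri_norm M (\<lambda>f. \<tau> (\<lambda>t. max_rearrangement M f (t powr \<alpha>)))"
    and "ri_norm M (associate_norm M (\<lambda>f. \<tau> (\<lambda>t. max_rearrangement M f (t powr \<alpha>))))"
proof -
  note b = banach_function_norm_max_rearrangement[OF M \<tau> \<alpha>]
  show "ri_norm M (\<lambda>f. \<tau> (\<lambda>t. max_rearrangement M f (t powr \<alpha>)))"
    unfolding ri_norm_def
  proof (intro conjI b ballI impI)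
    fix f g :: "'a \<Rightarrow> ennreal" assume "distribution_fun M f = distribution_fun M g"
    then have "rearrangement M f = rearrangement M g" by (rule rearrangement_cong_distribution_fun)
    then show "\<tau> (\<lambda>t. max_rearrangement M f (t powr \<alpha>)) = \<tau> (\<lambda>t. max_rearrangement M g (t powr \<alpha>))"
      unfolding max_rearrangement_def by simp
  qed
  show "ri_norm M (associate_norm M (\<lambda>f. \<tau> (\<lambda>t. max_rearrangement M f (t powr \<alpha>))))"
  proof (rule ri_norm_associate[OF M b])
    fix f g :: "'a \<Rightarrow> ennreal" assume f: "f \<in> borel_measurable M" and g: "g \<in> borel_measurable M"
      and le: "\<And>t. 0 < t \<Longrightarrow> rearrangement_int M f t \<le> rearrangement_int M g t"
    have m: "(\<lambda>t. max_rearrangement M h (t powr \<alpha>)) \<in> borel_measurable unit_interval" if [measurable]: "h \<in> borel_measurable M" for h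
      by (rule borel_measurable_unit_intervalI) measurable
    show "\<tau> (\<lambda>t. max_rearrangement M f (t powr \<alpha>)) \<le> \<tau> (\<lambda>t. max_rearrangement M g (t powr \<alpha>))"
      by (intro banach_function_normD(4)[OF \<tau> m[OF g] m[OF f]] AE_I2 max_rearrangement_mono le)
	(simp add: space_restrict_space)
  qed
qed

lemma decreasing_arrangement:
  fixes b :: "nat \<Rightarrow> real"
  shows "\<exists>\<pi>. \<pi> permutes {..<K} \<and> (\<forall>i j. i \<le> j \<longrightarrow> j < K \<longrightarrow> b (\<pi> j) \<le> b (\<pi> i))"
proof -
  let ?xs = "map b [0..<K]" and ?ys = "rev (sort (map b [0..<K]))"
  have "mset ?ys = mset ?xs" by simp
  from mset_eq_permutation[OF this]
  obtain p where p: "p permutes {..<length ?xs}" "permute_list p ?xs = ?ys" by blast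
  have bp: "b (p i) = ?ys ! i" if "i < K" for i
  proof -
    have "p i < K" using p(1) that permutes_in_image[OF p(1), of i] by simp
    moreover have "permute_list p ?xs ! i = ?xs ! p i"
      by (rule permute_list_nth[OF p(1)]) (use that in simp)
    ultimately show ?thesis using p(2) by simp
  qed
  have "b (p j) \<le> b (p i)" if ij: "i \<le> j" "j < K" for i j
  proof -
    have "sort ?xs ! (K - Suc j) \<le> sort ?xs ! (K - Suc i)"
      using ij by (intro sorted_nth_mono sorted_sort) auto
    then show ?thesis using bp[of i] bp[of j] ij by (simp add: rev_nth)
  qed
  then show ?thesis using p(1) by (intro exI[of _ p]) auto
qed

lemma nn_integral_power_substitution:
  fixes f :: "real \<Rightarrow> ennreal"
  assumes f[measurable]: "f \<in> borel_measurable borel" and n: "0 < n"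
  shows "(\<integral>\<^sup>+ t\<in>{0<..<1}. f t \<partial>lborel) = (\<integral>\<^sup>+ \<rho>\<in>{0<..<1}. f (\<rho> ^ n) * ennreal (real n * \<rho> ^ (n - 1)) \<partial>lborel)"
proof -
  have n0: "(0::real) ^ n = 0" using n by simp
  have AE01: "AE t::real in lborel. t \<noteq> 0 \<and> t \<noteq> 1" by (intro AE_conjI AE_lborel_singleton)
  have "(\<integral>\<^sup>+ t\<in>{0<..<1}. f t \<partial>lborel) = (\<integral>\<^sup>+ t. f t * indicator {0 ^ n..1 ^ n} t \<partial>lborel)"
    by (intro nn_integral_cong_AE, use AE01 in eventually_elim) (auto simp: indicator_def n0)
  also have "\<dots> = (\<integral>\<^sup>+ \<rho>. f (\<rho> ^ n) * ennreal (real n * \<rho> ^ (n - 1)) * indicator {0..1} \<rho> \<partial>lborel)"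
  proof (rule nn_integral_substitution_aux)
    show "((\<lambda>x. x ^ n) has_real_derivative real n * x ^ (n - 1)) (at x)" for x :: real
      by (auto intro!: derivative_eq_intros)
    show "continuous_on {0..1} (\<lambda>x. real n * x ^ (n - 1))" by (intro continuous_intros)
    show "0 \<le> real n * x ^ (n - 1)" if "x \<in> {0..1}" for x :: real using that by simp
  qed auto
  also have "\<dots> = (\<integral>\<^sup>+ \<rho>\<in>{0<..<1}. f (\<rho> ^ n) * ennreal (real n * \<rho> ^ (n - 1)) \<partial>lborel)"
    by (intro nn_integral_cong_AE, use AE01 in eventually_elim) (auto simp: indicator_def)
  finally show ?thesis .
qed

lemma rearrangement_right_continuous:
  assumes f: "f \<in> borel_measurable M" and "y < rearrangement M f t" and t: "0 \<le> t"
  shows "\<exists>t'>t. y < rearrangement M f t'"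
proof -
  have "ennreal t < distribution_fun M f y" using assms(2) by (simp add: less_rearrangement_iff[OF f])
  then obtain c where c: "ennreal t < c" "c < distribution_fun M f y" using dense by blast
  then obtain t' where t': "c = ennreal t'" "0 \<le> t'" by (cases c) (auto simp: less_top)
  then show ?thesis using c t
    by (intro exI[of _ t']) (auto simp: less_rearrangement_iff[OF f] ennreal_less_iff)
qed

text \<open>
  The value at the right end point of a dyadic interval is the smallest one there, so that these step
  functions increase with \<open>j\<close>; right continuity gives the limit.
\<close>

lemma rearrangement_dyadic_steps:
  fixes f :: "'a \<Rightarrow> ennreal"
  assumes f: "f \<in> borel_measurable M"
  defines "u \<equiv> \<lambda>j i. enn2real (min (of_nat j) (rearrangement M f ((real i + 1) / 2 ^ j)))"
  assumes t: "0 < t"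
  shows "incseq (\<lambda>j. step_fun (2 ^ j) (\<lambda>i. ennreal (u j i)) t)"
    and "(SUP j. step_fun (2 ^ j) (\<lambda>i. ennreal (u j i)) t) = rearrangement M f t"
proof -
  let ?r = "rearrangement M f"
  define e where "e j = (real (nat \<lfloor>2 ^ j * t\<rfloor>) + 1) / 2 ^ j" for j :: nat
  have S: "step_fun (2 ^ j) (\<lambda>i. ennreal (u j i)) t = min (of_nat j) (?r (e j))" for j
  proof -
    have "min (of_nat j) (?r (e j)) < top" by (simp add: min_less_iff_disj ennreal_of_nat_eq_real_of_nat)
    then show ?thesis by (simp add: step_fun_def u_def e_def)
  qed
  have fl: "real (nat \<lfloor>2 ^ j * t\<rfloor>) = of_int \<lfloor>2 ^ j * t\<rfloor>" for j using t by simp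
  have e1: "t < e j" for j
  proof -
    have "2 ^ j * t < real (nat \<lfloor>2 ^ j * t\<rfloor>) + 1" unfolding fl by (rule real_of_int_floor_add_one_gt)
    then show ?thesis by (simp add: e_def pos_less_divide_eq mult.commute)
  qed
  have e2: "e j \<le> t + 1 / 2 ^ j" for j
  proof -
    have "real (nat \<lfloor>2 ^ j * t\<rfloor>) + 1 \<le> 2 ^ j * t + 1" unfolding fl by simp
    then have "e j \<le> (2 ^ j * t + 1) / 2 ^ j" unfolding e_def by (rule divide_right_mono) simp
    then show ?thesis by (simp add: add_divide_distrib)
  qed
  have e_anti: "e (Suc j) \<le> e j" for j
  proof -
    have "of_int \<lfloor>2 * z\<rfloor> < (of_int (2 * (\<lfloor>z\<rfloor> + 1)) :: real)" for z :: real
    proof -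
      have "2 * z < 2 * (of_int \<lfloor>z\<rfloor> + 1)"
	by (rule mult_strict_left_mono[OF real_of_int_floor_add_one_gt]) simp
      from le_less_trans[OF of_int_floor_le this] show ?thesis by simp
    qed
    then have "of_int \<lfloor>2 ^ Suc j * t\<rfloor> < (of_int (2 * (\<lfloor>2 ^ j * t\<rfloor> + 1)) :: real)"
      unfolding power_Suc mult.assoc .
    then have "\<lfloor>2 ^ Suc j * t\<rfloor> + 1 \<le> 2 * (\<lfloor>2 ^ j * t\<rfloor> + 1)" by (simp only: of_int_less_iff)
    then have "(of_int (\<lfloor>2 ^ Suc j * t\<rfloor> + 1) :: real) \<le> of_int (2 * (\<lfloor>2 ^ j * t\<rfloor> + 1))" by (simp only: of_int_le_iff)
    then have "real (nat \<lfloor>2 ^ Suc j * t\<rfloor>) + 1 \<le> 2 * (real (nat \<lfloor>2 ^ j * t\<rfloor>) + 1)" unfolding fl by simp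
    then have "e (Suc j) \<le> (2 * (real (nat \<lfloor>2 ^ j * t\<rfloor>) + 1)) / 2 ^ Suc j"
      unfolding e_def by (rule divide_right_mono) simp
    also have "\<dots> = e j" unfolding e_def power_Suc by (rule mult_divide_mult_cancel_left) simp
    finally show ?thesis .
  qed
  show "incseq (\<lambda>j. step_fun (2 ^ j) (\<lambda>i. ennreal (u j i)) t)"
    unfolding S by (intro incseq_SucI min.mono rearrangement_antimono[OF f e_anti]) simp
  show "(SUP j. step_fun (2 ^ j) (\<lambda>i. ennreal (u j i)) t) = ?r t"
    unfolding S
  proof (rule antisym)
    show "(SUP j. min (of_nat j) (?r (e j))) \<le> ?r t"
      using rearrangement_antimono[OF f less_imp_le[OF e1]] by (intro SUP_least) (simp add: min.coboundedI2)
    show "?r t \<le> (SUP j. min (of_nat j) (?r (e j)))"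
    proof (rule dense_le)
      fix y assume y: "y < ?r t"
      then obtain t' where t': "t < t'" "y < ?r t'" using rearrangement_right_continuous[OF f y] t by auto
      obtain y' where y': "y = ennreal y'" "0 \<le> y'" using y by (cases y) auto
      obtain j1 where j1: "y' < real j1" using reals_Archimedean2 by blast
      obtain j2 where j2: "1 / (t' - t) < real j2" using reals_Archimedean2 by blast
      let ?j = "max j1 j2"
      have "real j2 < 2 ^ ?j"
	using of_nat_less_two_power[of "?j", where 'a=real] by (meson le_less_trans max.cobounded2 of_nat_le_iff)
      from less_trans[OF j2 this] have "1 / (t' - t) < 2 ^ ?j" .
      then have "1 / 2 ^ ?j < t' - t" using t' by (simp add: pos_divide_less_eq mult.commute)
      then have "e ?j \<le> t'" using e2[of ?j] by simp
      then have "y < ?r (e ?j)" using rearrangement_antimono[OF f, of "e ?j" t'] t' by (auto intro: less_le_trans)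
      moreover have "y < of_nat ?j"
	using j1 y' by (simp add: ennreal_of_nat_eq_real_of_nat ennreal_less_iff less_max_iff_disj)
      ultimately have "y \<le> min (of_nat ?j) (?r (e ?j))" by (intro min.boundedI less_imp_le)
      then show "y \<le> (SUP j. min (of_nat j) (?r (e j)))" by (intro SUP_upper2[of ?j]) auto
    qed
  qed
qed

text \<open>
  A norm on the cube that satisfies the one-dimensional inequality expressed by the radial test
  functions is dominated by the associate of the norm of \<open>t \<mapsto> g\<^sup>*\<^sup>* (t powr \<alpha>)\<close>: apply the norming
  functional of a step function \<open>f\<close>, and bound the dual norm of that functional by moving the maximal
  rearrangement to the other factor of the pairing.
\<close>

lemma norm_le_associate_norm:
  fixes X :: "('a \<Rightarrow> ennreal) \<Rightarrow> ennreal" and C :: real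
  assumes M: "prob_space M" and \<sigma>: "measure_preserving M unit_interval \<sigma>" and X: "ri_norm M X"
    and \<zeta>: "ri_norm unit_interval \<zeta>" and n: "2 \<le> n" and C: "0 \<le> C"
    and test: "\<And>h B. h \<in> borel_measurable borel \<Longrightarrow> (\<And>t. 0 \<le> h t) \<Longrightarrow> (\<And>t. h t \<le> B) \<Longrightarrow>
      (\<And>s t. 0 < s \<Longrightarrow> s \<le> t \<Longrightarrow> t < 1 \<Longrightarrow> h t \<le> h s) \<Longrightarrow>
      X (\<lambda>x. \<integral>\<^sup>+ \<rho>\<in>{0<..<1}. ennreal (h (\<rho> ^ n)) * indicator {\<sigma> x<..} (\<rho> ^ (n - 1)) \<partial>lborel)
	\<le> ennreal C * \<zeta> (\<lambda>t. ennreal (h t))"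
    and f: "f \<in> borel_measurable M"
  defines "\<alpha> \<equiv> 1 / conj_exponent n"
  defines "P \<equiv> (\<lambda>g. associate_norm unit_interval \<zeta> (\<lambda>t. max_rearrangement M g (t powr \<alpha>)))"
  shows "X f \<le> ennreal (real n * C) * associate_norm M P f"
proof -
  interpret prob_space M by fact
  interpret U: prob_space unit_interval by (rule prob_space_unit_interval)
  have \<alpha>: "\<alpha> = (real n - 1) / real n" and \<alpha>0: "0 < \<alpha>"
    using n by (auto simp: \<alpha>_def conj_exponent_def)
  have \<sigma>m: "\<sigma> \<in> measurable M unit_interval" using \<sigma> by (rule measure_preserving_measurable)
  have b\<zeta>: "banach_function_norm unit_interval \<zeta>" using \<zeta> by (simp add: ri_norm_def)
  have b\<zeta>': "banach_function_norm unit_interval (associate_norm unit_interval \<zeta>)"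
    by (rule banach_function_norm_associate[OF U.prob_space_axioms b\<zeta>])
  have riP: "ri_norm M P" and riP': "ri_norm M (associate_norm M P)"
    unfolding P_def by (rule ri_norm_associate_max_rearrangement[OF M b\<zeta>' \<alpha>0])+
  have bP: "banach_function_norm M P" using riP by (simp add: ri_norm_def)
  have bX: "banach_function_norm M X" using X by (simp add: ri_norm_def)
  define \<tau> where "\<tau> \<phi> = X (\<lambda>x. \<phi> (\<sigma> x))" for \<phi>
  have \<tau>: "ri_norm unit_interval \<tau>" unfolding \<tau>_def[abs_def] by (rule ri_norm_transport[OF \<sigma> X])
  have comp: "(\<lambda>x. \<phi> (\<sigma> x)) \<in> borel_measurable M" if "\<phi> \<in> borel_measurable borel" for \<phi> :: "real \<Rightarrow> ennreal"
    by (rule measurable_compose[OF \<sigma>m borel_measurable_unit_intervalI[OF that]])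
  have step: "\<tau> (step_fun K (\<lambda>i. ennreal (u i))) \<le> ennreal (real n * C) * associate_norm M P (\<lambda>x. step_fun K (\<lambda>i. ennreal (u i)) (\<sigma> x))"
    if K: "0 < K" and u: "\<And>i. 0 \<le> u i" for K and u :: "nat \<Rightarrow> real"
  proof -
    obtain b where b: "\<And>i. 0 \<le> b i" and b_eq: "\<tau> (step_fun K (\<lambda>i. ennreal (u i))) = ennreal (\<Sum>i<K. b i * u i)"
      and b_le: "\<And>\<pi> G B. \<pi> permutes {..<K} \<Longrightarrow> G \<in> borel_measurable borel \<Longrightarrow>
	(\<forall>s t. 0 < s \<longrightarrow> s \<le> t \<longrightarrow> t < 1 \<longrightarrow> G t \<le> G s) \<Longrightarrow> (\<forall>t. G t \<le> ennreal B) \<Longrightarrow> 0 \<le> B \<Longrightarrow>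
	(\<Sum>i<K. ennreal (b (\<pi> i)) * (ennreal (real K) * cell_int K i G)) \<le> \<tau> G"
      using step_norming_functional[where u=u, OF \<tau> K u] by blast
    define gs where "gs = step_fun K (\<lambda>i. ennreal (real K * b i))"
    have gs[measurable]: "gs \<in> borel_measurable borel" unfolding gs_def by measurable
    define g where "g = (\<lambda>x. gs (\<sigma> x))"
    have g: "g \<in> borel_measurable M" unfolding g_def by (rule comp[OF gs])
    obtain \<pi> where \<pi>: "\<pi> permutes {..<K}" and dec: "\<And>i j. i \<le> j \<Longrightarrow> j < K \<Longrightarrow> b (\<pi> j) \<le> b (\<pi> i)"
      using decreasing_arrangement[of K b] by blast
    define d where "d = step_fun K (\<lambda>i. real K * b (\<pi> i))"
    have d[measurable]: "d \<in> borel_measurable borel" unfolding d_def by measurable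
    have d0: "0 \<le> d t" for t using b by (simp add: d_def step_fun_def)
    have d_anti: "d t \<le> d s" if "0 < s" "s \<le> t" "t < 1" for s t
    proof -
      have "real K * s \<le> real K * t" using that by (simp add: mult_left_mono)
      then have "nat \<lfloor>real K * s\<rfloor> \<le> nat \<lfloor>real K * t\<rfloor>" by (intro nat_mono floor_mono)
      moreover have "nat \<lfloor>real K * t\<rfloor> < K" using that by (intro floor_less[OF K]) auto
      ultimately show ?thesis using dec by (simp add: d_def step_fun_def mult_left_mono)
    qed
    have "distribution_fun unit_interval (\<lambda>t. ennreal (d t)) = distribution_fun unit_interval gs"
    proof (rule distribution_fun_permute_cells[OF K \<pi>])
      fix i t assume t: "t \<in> cell K i"
      then show "ennreal (d t) = gs (t + (real (\<pi> i) - real i) / real K)"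
	using cell_shift_iff[of t "\<pi> i" i K] by (simp add: d_def gs_def step_fun_cell[OF K])
    qed measurable
    then have "distribution_fun M g = distribution_fun unit_interval (\<lambda>t. ennreal (d t))"
      unfolding g_def by (subst measure_preserving_distribution_fun[OF \<sigma> borel_measurable_unit_intervalI[OF gs]]) simp
    then have "rearrangement M g = rearrangement unit_interval (\<lambda>t. ennreal (d t))"
      by (rule rearrangement_cong_distribution_fun)
    then have rint: "rearrangement_int M g t \<le> (\<integral>\<^sup>+ s\<in>{0<..<t}. ennreal (d s) \<partial>lborel)" if "0 < t" "t < 1" for t
      using rearrangement_int_decreasing_le[OF d d0 d_anti that] unfolding rearrangement_int_def by simp
    have pair: "(\<integral>\<^sup>+ t. max_rearrangement M g (t powr \<alpha>) * ennreal (h t) \<partial>unit_interval) \<le> ennreal (real n * C) * \<zeta> (\<lambda>t. ennreal (h t))"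
      if h[measurable]: "h \<in> borel_measurable borel" and h0: "\<And>t. 0 \<le> h t" and hB: "\<And>t. h t \<le> B"
	and h_anti: "\<And>s t. 0 < s \<Longrightarrow> s \<le> t \<Longrightarrow> t < 1 \<Longrightarrow> h t \<le> h s" for h B
    proof -
      \<comment> \<open>Substituting \<open>\<rho> ^ n\<close> turns \<open>t powr \<alpha>\<close> into \<open>\<rho> ^ (n - 1)\<close>, and the weight \<open>n * \<rho> ^ (n - 1)\<close> turns the
	average into the primitive of the decreasing rearrangement \<open>d\<close> of \<open>g\<close>. After an interchange of the
	integrals \<open>d\<close> is paired with \<open>G\<close>, the profile to which the test inequality applies.\<close>
      let ?F = "\<lambda>\<rho> s. ennreal (h (\<rho> ^ n)) * indicator {s<..} (\<rho> ^ (n - 1)) * indicator {0<..<1} \<rho> * (ennreal (d s) * indicator {0<..<1} s)"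
      let ?F2 = "\<lambda>\<rho> s. ennreal (h (\<rho> ^ n)) * indicator {p. snd p < fst p ^ (n - 1)} (\<rho>, s) * indicator {0<..<1} \<rho> * (ennreal (d s) * indicator {0<..<1} s)"
      define G where "G s = (\<integral>\<^sup>+ \<rho>\<in>{0<..<1}. ennreal (h (\<rho> ^ n)) * indicator {s<..} (\<rho> ^ (n - 1)) \<partial>lborel)" for s :: real
      have "G = (\<lambda>s. \<integral>\<^sup>+ \<rho>. ennreal (h (\<rho> ^ n)) * indicator {p. fst p < snd p ^ (n - 1)} (s, \<rho>) * indicator {0<..<1} \<rho> \<partial>lborel)"
	unfolding G_def by (intro ext nn_integral_cong) (auto simp: indicator_def)
      then have G[measurable]: "G \<in> borel_measurable borel" by simp
      have B0: "0 \<le> B" using h0[of 0] hB[of 0] by simp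
      have G_le: "G s \<le> ennreal B" for s
      proof -
	have "G s \<le> (\<integral>\<^sup>+ \<rho>. ennreal B * indicator {0<..<1} (\<rho>::real) \<partial>lborel)"
	  unfolding G_def using hB by (intro nn_integral_mono) (auto simp: indicator_def intro!: ennreal_leI)
	also have "\<dots> = ennreal B" by (subst nn_integral_cmult_indicator) auto
	finally show ?thesis .
      qed
      have G_anti: "G t \<le> G s" if "s \<le> t" for s t
	unfolding G_def using that by (intro nn_integral_mono) (auto simp: indicator_def)
      have [measurable]: "max_rearrangement M g \<in> borel_measurable borel" using g by measurable
      have "(\<integral>\<^sup>+ t. max_rearrangement M g (t powr \<alpha>) * ennreal (h t) \<partial>unit_interval)
	  = (\<integral>\<^sup>+ \<rho>\<in>{0<..<1}. (max_rearrangement M g ((\<rho> ^ n) powr \<alpha>) * ennreal (h (\<rho> ^ n))) * ennreal (real n * \<rho> ^ (n - 1)) \<partial>lborel)"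
	unfolding nn_integral_unit_interval using n by (intro nn_integral_power_substitution) auto
      also have "\<dots> \<le> (\<integral>\<^sup>+ \<rho>. ennreal (real n) * (\<integral>\<^sup>+ s. ?F \<rho> s \<partial>lborel) \<partial>lborel)"
      proof (rule nn_integral_mono)
	fix \<rho> :: real
	show "(max_rearrangement M g ((\<rho> ^ n) powr \<alpha>) * ennreal (h (\<rho> ^ n))) * ennreal (real n * \<rho> ^ (n - 1)) * indicator {0<..<1} \<rho>
	  \<le> ennreal (real n) * (\<integral>\<^sup>+ s. ?F \<rho> s \<partial>lborel)"
	proof (cases "\<rho> \<in> {0<..<1}")
	  case True
	  then have \<rho>: "0 < \<rho>" "\<rho> < 1" by auto
	  let ?s = "\<rho> ^ (n - 1)"
	  have s: "0 < ?s" "?s < 1" using \<rho> n by (auto intro: power_Suc_less_one simp: power_less_one_iff)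
	  have "(\<rho> ^ n) powr \<alpha> = \<rho> powr (real n * \<alpha>)" using \<rho> by (simp add: powr_realpow[symmetric] powr_powr)
	  also have "real n * \<alpha> = real (n - 1)" using n by (simp add: \<alpha> of_nat_diff)
	  finally have pw: "(\<rho> ^ n) powr \<alpha> = ?s" using \<rho> by (simp add: powr_realpow)
	  have "max_rearrangement M g ?s * ennreal ?s = rearrangement_int M g ?s"
	  proof -
	    have "inverse (ennreal ?s) * ennreal ?s = ennreal (inverse ?s * ?s)"
	      using s(1) by (simp add: inverse_ennreal ennreal_mult)
	    also have "inverse ?s * ?s = 1" by (rule left_inverse[OF less_imp_neq[OF s(1), symmetric]])
	    finally show ?thesis by (simp add: max_rearrangement_eq divide_ennreal_def mult.assoc)
	  qed
	  then have "(max_rearrangement M g ((\<rho> ^ n) powr \<alpha>) * ennreal (h (\<rho> ^ n))) * ennreal (real n * ?s)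
	      = ennreal (real n) * (ennreal (h (\<rho> ^ n)) * rearrangement_int M g ?s)"
	    unfolding pw using s by (simp add: ennreal_mult mult_ac)
	  also have "\<dots> \<le> ennreal (real n) * (ennreal (h (\<rho> ^ n)) * (\<integral>\<^sup>+ s\<in>{0<..<?s}. ennreal (d s) \<partial>lborel))"
	    using rint[OF s] by (intro mult_left_mono) auto
	  also have "ennreal (h (\<rho> ^ n)) * (\<integral>\<^sup>+ s\<in>{0<..<?s}. ennreal (d s) \<partial>lborel)
	      = (\<integral>\<^sup>+ s. ennreal (h (\<rho> ^ n)) * indicator {s<..} ?s * indicator {0<..<1} \<rho> * (ennreal (d s) * indicator {0<..<1} s) \<partial>lborel)"
	    using True s by (subst nn_integral_cmult[symmetric]) (auto simp: indicator_def intro!: nn_integral_cong)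
	  finally show ?thesis using True by simp
	qed simp
      qed
      also have "\<dots> = ennreal (real n) * (\<integral>\<^sup>+ \<rho>. \<integral>\<^sup>+ s. ?F2 \<rho> s \<partial>lborel \<partial>lborel)"
      proof -
	have "indicator {s<..} (\<rho> ^ (n - 1)) = (indicator {p. snd p < fst p ^ (n - 1)} (\<rho>, s) :: ennreal)" for s \<rho> :: real
	  by (auto simp: indicator_def)
	then show ?thesis by (simp add: nn_integral_cmult)
      qed
      also have "(\<integral>\<^sup>+ \<rho>. \<integral>\<^sup>+ s. ?F2 \<rho> s \<partial>lborel \<partial>lborel)
	  = (\<integral>\<^sup>+ s. \<integral>\<^sup>+ \<rho>. ?F2 \<rho> s \<partial>lborel \<partial>lborel)"
	by (rule lborel_pair.Fubini'[symmetric]) measurable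
      also have "\<dots> = (\<integral>\<^sup>+ s\<in>{0<..<1}. ennreal (d s) * G s \<partial>lborel)"
      proof (rule nn_integral_cong)
	fix s :: real
	have "(\<integral>\<^sup>+ \<rho>. ?F2 \<rho> s \<partial>lborel)
	    = (\<integral>\<^sup>+ \<rho>. ?F \<rho> s \<partial>lborel)"
	  by (intro nn_integral_cong) (auto simp: indicator_def)
	also have "\<dots> = G s * (ennreal (d s) * indicator {0<..<1} s)"
	  unfolding G_def by (rule nn_integral_multc) measurable
	finally show "(\<integral>\<^sup>+ \<rho>. ?F2 \<rho> s \<partial>lborel)
	    = ennreal (d s) * G s * indicator {0<..<1} s" by (simp add: mult_ac)
      qed
      also have "\<dots> = (\<Sum>i<K. \<integral>\<^sup>+ s\<in>cell K i. ennreal (d s) * G s \<partial>lborel)"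
	by (rule nn_integral_cells[OF K]) measurable
      also have "\<dots> = (\<Sum>i<K. ennreal (b (\<pi> i)) * (ennreal (real K) * (\<integral>\<^sup>+ s\<in>cell K i. G s \<partial>lborel)))"
      proof (intro sum.cong refl)
	fix i
	have "(\<integral>\<^sup>+ s\<in>cell K i. ennreal (d s) * G s \<partial>lborel) = (\<integral>\<^sup>+ s. ennreal (real K * b (\<pi> i)) * (G s * indicator (cell K i) s) \<partial>lborel)"
	  by (intro nn_integral_cong) (auto simp: indicator_def d_def step_fun_cell[OF K])
	also have "\<dots> = ennreal (real K * b (\<pi> i)) * (\<integral>\<^sup>+ s\<in>cell K i. G s \<partial>lborel)"
	  by (rule nn_integral_cmult) measurable
	finally show "(\<integral>\<^sup>+ s\<in>cell K i. ennreal (d s) * G s \<partial>lborel) = ennreal (b (\<pi> i)) * (ennreal (real K) * (\<integral>\<^sup>+ s\<in>cell K i. G s \<partial>lborel))"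
	  using b by (simp add: ennreal_mult mult_ac)
      qed
      also have "\<dots> \<le> \<tau> G" using G_anti G_le B0 by (intro b_le[OF \<pi> G]) auto
      also have "\<tau> G \<le> ennreal C * \<zeta> (\<lambda>t. ennreal (h t))"
	unfolding \<tau>_def G_def by (rule test[OF h h0 hB h_anti])
      finally show ?thesis using C by (simp add: ennreal_mult mult.assoc mult_left_mono)
    qed
    have P_le: "P g \<le> ennreal (real n * C)"
      unfolding P_def associate_norm_def
    proof (rule SUP_least)
      fix q assume "q \<in> {g \<in> borel_measurable unit_interval. \<zeta> g \<le> 1}"
      then have q: "q \<in> borel_measurable unit_interval" and q1: "\<zeta> q \<le> 1" by auto
      let ?r = "rearrangement unit_interval q"
      let ?B = "\<lambda>t. max_rearrangement M g (t powr \<alpha>)"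
      have [measurable]: "?r \<in> borel_measurable borel" using q by measurable
      have B[measurable]: "?B \<in> borel_measurable borel" using g by measurable
      have "(\<integral>\<^sup>+ t. ?B t * q t \<partial>unit_interval) \<le> (\<integral>\<^sup>+ t. ?B t * ?r t \<partial>unit_interval)"
      proof (rule set_integral_decreasing_le[OF q B])
	fix s t :: real assume "0 < s" "s \<le> t"
	then show "?B t \<le> ?B s" using \<alpha>0 by (intro max_rearrangement_antimono[OF g] powr_mono2) auto
      qed
      also have "\<dots> = (\<integral>\<^sup>+ t. (SUP j. ?B t * min (of_nat j) (?r t)) \<partial>unit_interval)"
      proof (intro nn_integral_cong)
	fix t
	have "(SUP j. min (of_nat j) (?r t)) = (SUP j. of_nat j) \<sqinter> ?r t"
	  by (simp add: inf_min[symmetric] SUP_inf)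
	also have "\<dots> = ?r t" by (simp add: ennreal_SUP_of_nat_eq_top)
	finally show "?B t * ?r t = (SUP j. ?B t * min (of_nat j) (?r t))"
	  by (simp add: SUP_mult_left_ennreal[symmetric])
      qed
      also have "\<dots> = (SUP j. \<integral>\<^sup>+ t. ?B t * min (of_nat j) (?r t) \<partial>unit_interval)"
      proof (rule nn_integral_monotone_convergence_SUP)
	show "incseq (\<lambda>j t. ?B t * min (of_nat j) (?r t))"
	  by (intro incseq_SucI le_funI mult_left_mono min.mono) auto
	show "(\<lambda>t. ?B t * min (of_nat j) (?r t)) \<in> borel_measurable unit_interval" for j
	  by (rule borel_measurable_unit_intervalI) measurable
      qed
      also have "\<dots> \<le> ennreal (real n * C)"
      proof (rule SUP_least)
	fix j :: nat
	define h where "h t = enn2real (min (of_nat j) (?r t))" for t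
	have h_eq: "min (of_nat j) (?r t) = ennreal (h t)" for t
	proof -
	  have "min (of_nat j) (?r t) < top" by (simp add: min_less_iff_disj ennreal_of_nat_eq_real_of_nat)
	  then show ?thesis by (simp add: h_def)
	qed
	have h[measurable]: "h \<in> borel_measurable borel" unfolding h_def[abs_def] by measurable
	have h0: "0 \<le> h t" for t by (simp add: h_def)
	have hle: "h t \<le> real j" for t
	  using h_eq[of t] min.cobounded1[of "of_nat j" "?r t"] by (simp add: ennreal_of_nat_eq_real_of_nat)
	have h_anti: "h t \<le> h s" if "s \<le> t" for s t
	proof -
	  have "ennreal (h t) \<le> ennreal (h s)"
	    unfolding h_eq[symmetric] using rearrangement_antimono[OF q that] by (intro min.mono) auto
	  then show ?thesis using h0[of s] by simp
	qed
	have "\<zeta> (\<lambda>t. ennreal (h t)) \<le> \<zeta> ?r"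
	  unfolding h_eq[symmetric] by (intro banach_function_normD(4)[OF b\<zeta>] borel_measurable_unit_intervalI AE_I2) auto
	also have "\<zeta> ?r = \<zeta> q"
	proof (rule mp[OF \<zeta>[unfolded ri_norm_def, THEN conjunct2, THEN bspec, THEN bspec]])
	  show "?r \<in> borel_measurable unit_interval" by (rule borel_measurable_unit_intervalI) measurable
	  show "q \<in> borel_measurable unit_interval" by (rule q)
	  show "distribution_fun unit_interval ?r = distribution_fun unit_interval q"
	    by (rule distribution_fun_rearrangement[OF U.prob_space_axioms q])
	qed
	also note q1
	finally have "\<zeta> (\<lambda>t. ennreal (h t)) \<le> 1" .
	then have "ennreal (real n * C) * \<zeta> (\<lambda>t. ennreal (h t)) \<le> ennreal (real n * C) * 1"
	  by (rule mult_left_mono) simp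
	moreover have "(\<integral>\<^sup>+ t. ?B t * min (of_nat j) (?r t) \<partial>unit_interval) \<le> ennreal (real n * C) * \<zeta> (\<lambda>t. ennreal (h t))"
	  unfolding h_eq by (rule pair[OF h h0 hle h_anti])
	ultimately show "(\<integral>\<^sup>+ t. ?B t * min (of_nat j) (?r t) \<partial>unit_interval) \<le> ennreal (real n * C)"
	  by simp
      qed
      finally show "(\<integral>\<^sup>+ t. ?B t * q t \<partial>unit_interval) \<le> ennreal (real n * C)" .
    qed
    have "ennreal (\<Sum>i<K. b i * u i) = (\<Sum>i<K. \<integral>\<^sup>+ t\<in>cell K i. step_fun K (\<lambda>i. ennreal (u i)) t * gs t \<partial>lborel)"
    proof -
      have "(\<integral>\<^sup>+ t\<in>cell K i. step_fun K (\<lambda>i. ennreal (u i)) t * gs t \<partial>lborel) = ennreal (b i * u i)" for i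
      proof -
	have "(\<integral>\<^sup>+ t\<in>cell K i. step_fun K (\<lambda>i. ennreal (u i)) t * gs t \<partial>lborel)
	    = (\<integral>\<^sup>+ t. ennreal (u i * (real K * b i)) * indicator (cell K i) t \<partial>lborel)"
	  using u b by (intro nn_integral_cong) (auto simp: indicator_def gs_def step_fun_cell[OF K] ennreal_mult)
	also have "\<dots> = ennreal (u i * (real K * b i)) * ennreal (1 / real K)"
	  by (subst nn_integral_cmult_indicator) (auto simp: emeasure_cell[OF K])
	also have "\<dots> = ennreal (u i * (real K * b i) * (1 / real K))"
	  using u b by (intro ennreal_mult[symmetric]) auto
	also have "u i * (real K * b i) * (1 / real K) = b i * u i" using K by simp
	finally show ?thesis .
      qed
      then show ?thesis using u b by simp
    qed
    also have "\<dots> = (\<integral>\<^sup>+ t. step_fun K (\<lambda>i. ennreal (u i)) t * gs t \<partial>unit_interval)"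
      unfolding nn_integral_unit_interval by (rule nn_integral_cells[OF K, symmetric]) measurable
    also have "\<dots> = (\<integral>\<^sup>+ x. step_fun K (\<lambda>i. ennreal (u i)) (\<sigma> x) * g x \<partial>M)"
      unfolding g_def
      by (rule measure_preserving_nn_integral[OF \<sigma>, of "\<lambda>t. step_fun K (\<lambda>i. ennreal (u i)) t * gs t", symmetric])
	(rule borel_measurable_unit_intervalI, measurable)
    also have "\<dots> \<le> associate_norm M P (\<lambda>x. step_fun K (\<lambda>i. ennreal (u i)) (\<sigma> x)) * P g"
    proof (rule nn_integral_mult_le_associate_norm[OF bP comp g])
      show "P g < \<infinity>" using P_le by (rule order_le_less_trans) simp
    qed measurable
    also have "\<dots> \<le> associate_norm M P (\<lambda>x. step_fun K (\<lambda>i. ennreal (u i)) (\<sigma> x)) * ennreal (real n * C)"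
      by (rule mult_left_mono[OF P_le]) simp
    finally show ?thesis unfolding b_eq by (simp add: mult.commute)
  qed
  let ?r = "rearrangement M f"
  define u where "u j i = enn2real (min (of_nat j) (?r ((real i + 1) / 2 ^ j)))" for j i
  define S where "S j = step_fun (2 ^ j) (\<lambda>i. ennreal (u j i))" for j
  have u0: "0 \<le> u j i" for j i by (simp add: u_def)
  have S[measurable]: "S j \<in> borel_measurable borel" for j unfolding S_def by measurable
  have inc: "incseq (\<lambda>j. S j t)" and sup: "(SUP j. S j t) = ?r t" if "0 < t" for t
    using rearrangement_dyadic_steps[OF f that] unfolding S_def u_def by auto
  have \<sigma>0: "0 < \<sigma> x" if "x \<in> space M" for x
    using measurable_space[OF \<sigma>m that] by (simp add: space_restrict_space)
  have r[measurable]: "?r \<in> borel_measurable borel" using f by measurable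
  have rdist: "distribution_fun M (\<lambda>x. ?r (\<sigma> x)) = distribution_fun M f"
    unfolding measure_preserving_distribution_fun[OF \<sigma> borel_measurable_unit_intervalI[OF r]]
    by (rule distribution_fun_rearrangement[OF M f])
  have "X f = X (\<lambda>x. ?r (\<sigma> x))"
    by (rule mp[OF X[unfolded ri_norm_def, THEN conjunct2, THEN bspec, OF f, THEN bspec, OF comp[OF r]]]) (rule rdist[symmetric])
  also have "\<dots> = (SUP j. X (\<lambda>x. S j (\<sigma> x)))"
    by (rule banach_function_norm_Fatou(2)[OF bX, symmetric]) (auto intro!: comp AE_I2 inc sup \<sigma>0)
  also have "\<dots> \<le> ennreal (real n * C) * associate_norm M P f"
  proof (rule SUP_least)
    fix j
    have "X (\<lambda>x. S j (\<sigma> x)) \<le> ennreal (real n * C) * associate_norm M P (\<lambda>x. S j (\<sigma> x))"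
      using step[of "2 ^ j" "u j", OF _ u0] unfolding \<tau>_def S_def by simp
    also have "associate_norm M P (\<lambda>x. S j (\<sigma> x)) \<le> associate_norm M P (\<lambda>x. ?r (\<sigma> x))"
      by (intro associate_norm_mono AE_I2) (metis SUP_upper UNIV_I sup \<sigma>0)
    also have "associate_norm M P (\<lambda>x. ?r (\<sigma> x)) = associate_norm M P f"
      by (rule mp[OF riP'[unfolded ri_norm_def, THEN conjunct2, THEN bspec, OF comp[OF r], THEN bspec, OF f]]) (rule rdist)
    finally show "X (\<lambda>x. S j (\<sigma> x)) \<le> ennreal (real n * C) * associate_norm M P f"
      by (simp add: mult_left_mono)
  qed
  finally show ?thesis .
qed

section \<open>Functions orthogonal to product bumps\<close>

context unit_edge
begin

abbreviation "subbox m c d \<equiv> PiE {..<m} (\<lambda>i. I \<inter> {c i<..<d i})" for m :: nat and c d :: "nat \<Rightarrow> real"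

lemma sets_box[simp]: "subbox m c d \<in> sets (bcube I m)"
  unfolding bcube_def by (intro sets_PiM_I_finite) (auto simp: sets_edge_iff)

lemma sets_bcube_eq_sigma_boxes:
  "sets (bcube I m) = sigma_sets (PiE {..<m} (\<lambda>_. I)) {subbox m c d |c d. True}" (is "_ = sigma_sets ?\<Omega> ?E")
proof
  have sub: "?E \<subseteq> Pow ?\<Omega>" by (auto intro: PiE_mono)
  show "sigma_sets ?\<Omega> ?E \<subseteq> sets (bcube I m)"
  proof -
    have "?E \<subseteq> sets (bcube I m)"
      by (rule subsetI, elim CollectE exE conjE) (simp only: sets_box)
    from sets.sigma_sets_subset[OF this] show ?thesis unfolding space_bcube .
  qed
  let ?N = "sigma ?\<Omega> ?E"
  have spN: "space ?N = ?\<Omega>" using sub by (rule space_measure_of)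
  have setsN: "sets ?N = sigma_sets ?\<Omega> ?E" using sub by (rule sets_measure_of)
  have coord: "(\<lambda>x. x i) \<in> borel_measurable ?N" if i: "i < m" for i
  proof (rule borel_measurableI_less)
    fix r :: real
    have "{x \<in> space ?N. x i < r} = subbox m (\<lambda>j. a - 1) (\<lambda>j. if j = i then r else a + 2)"
    proof (rule set_eqI)
      fix x
      have J: "I \<inter> {a - 1<..<a + 2} = I" using subset_closure by auto
      have Jr: "I \<inter> {a - 1<..<r} = {t \<in> I. t < r}" using subset_closure by auto
      have "x \<in> subbox m (\<lambda>j. a - 1) (\<lambda>j. if j = i then r else a + 2)
	  \<longleftrightarrow> (\<forall>j\<in>{..<m}. x j \<in> (if j = i then {t \<in> I. t < r} else I)) \<and> x \<in> extensional {..<m}"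
	unfolding PiE_iff by (intro conj_cong ball_cong refl) (auto simp: J Jr[symmetric] simp del: Int_iff)
      also have "\<dots> \<longleftrightarrow> x \<in> ?\<Omega> \<and> x i < r" unfolding PiE_iff using i by (auto split: if_splits)
      finally show "x \<in> {x \<in> space ?N. x i < r} \<longleftrightarrow> x \<in> subbox m (\<lambda>j. a - 1) (\<lambda>j. if j = i then r else a + 2)"
	unfolding spN by simp
    qed
    also have "\<dots> \<in> sets ?N" unfolding setsN
      by (rule sigma_sets.Basic, rule CollectI, intro exI conjI, rule refl, rule TrueI)
    finally show "{x \<in> space ?N. x i < r} \<in> sets ?N" .
  qed
  have "sets (PiM {..<m} (\<lambda>_. edge)) \<subseteq> sets ?N"
  proof (rule sets_PiM_in_sets)
    show "space ?N = (\<Pi>\<^sub>E i\<in>{..<m}. space edge)" unfolding spN by simp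
    fix i A assume i: "i \<in> {..<m}" and A: "A \<in> sets edge"
    then have "A \<in> sets borel" by (simp add: sets_edge_iff)
    from measurable_sets[OF coord this] i
    have "(\<lambda>x. x i) -` A \<inter> space ?N \<in> sets ?N" by simp
    moreover have "(\<lambda>x. x i) -` A \<inter> space ?N = {x \<in> space ?N. x i \<in> A}" by auto
    ultimately show "{x \<in> space ?N. x i \<in> A} \<in> sets ?N" by (simp only:)
  qed
  then show "sets (bcube I m) \<subseteq> sigma_sets ?\<Omega> ?E" unfolding setsN bcube_def .
qed

lemma AE_eq_0_of_box_integrals:
  fixes f :: "(nat \<Rightarrow> real) \<Rightarrow> real"
  assumes f: "integrable (bcube I m) f"
    and zero: "\<And>c d. (\<integral>x. indicator (subbox m c d) x * f x \<partial>bcube I m) = 0"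
  shows "AE x in bcube I m. f x = 0"
proof -
  interpret B: prob_space "bcube I m" by (rule prob_space_bcube)
  show ?thesis
proof (rule B.density_zero[OF f])
  fix A assume "A \<in> sets (bcube I m)"
  let ?\<Omega> = "PiE {..<m} (\<lambda>_. I)" and ?E = "{subbox m c d |c d. True}"
  have sets_eq: "sets (bcube I m) = sigma_sets ?\<Omega> ?E" by (rule sets_bcube_eq_sigma_boxes)
  have int_A: "integrable (bcube I m) (\<lambda>x. indicator A x *\<^sub>R f x)" if "A \<in> sets (bcube I m)" for A
    using integrable_mult_indicator[OF that f] by simp
  have stable: "Int_stable ?E"
  proof (rule Int_stableI)
    fix A B assume "A \<in> ?E" "B \<in> ?E"
    then obtain c d c' d' where AB: "A = subbox m c d" "B = subbox m c' d'" by blast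
    have "A \<inter> B = subbox m (\<lambda>i. max (c i) (c' i)) (\<lambda>i. min (d i) (d' i))"
      unfolding AB PiE_Int by (intro PiE_cong) auto
    then show "A \<inter> B \<in> ?E"
      by (intro CollectI exI[of _ "\<lambda>i. max (c i) (c' i)"] exI[of _ "\<lambda>i. min (d i) (d' i)"] conjI TrueI)
  qed
  have sub: "?E \<subseteq> Pow ?\<Omega>" by (auto intro: PiE_mono)
  have A: "A \<in> sigma_sets ?\<Omega> ?E" using \<open>A \<in> sets (bcube I m)\<close> unfolding sets_eq .
  from stable sub A show "set_lebesgue_integral (bcube I m) A f = 0"
  proof (induction rule: sigma_sets_induct_disjoint)
    case (basic A)
    then show ?case using zero by (auto simp: set_lebesgue_integral_def)
  next
    case empty
    then show ?case by (simp add: set_lebesgue_integral_def)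
  next
    case (compl A)
    have As: "A \<in> sets (bcube I m)" using compl(1) unfolding sets_eq .
    have full: "?\<Omega> = subbox m (\<lambda>_. a - 1) (\<lambda>_. a + 2)"
      using subset_closure by (intro PiE_cong) auto
    have "set_lebesgue_integral (bcube I m) (?\<Omega> - A) f
	= (\<integral>x. indicator ?\<Omega> x * f x - indicator A x *\<^sub>R f x \<partial>bcube I m)"
      unfolding set_lebesgue_integral_def
      by (intro Bochner_Integration.integral_cong) (auto simp: indicator_def space_bcube)
    also have "\<dots> = (\<integral>x. indicator ?\<Omega> x * f x \<partial>bcube I m) - (\<integral>x. indicator A x *\<^sub>R f x \<partial>bcube I m)"
      using int_A[of ?\<Omega>] int_A[OF As] unfolding full
      by (intro Bochner_Integration.integral_diff) auto
    also have "\<dots> = 0" using compl(2) zero unfolding full set_lebesgue_integral_def by simp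
    finally show ?case .
  next
    case (union A)
    have As: "A i \<in> sets (bcube I m)" for i using union(2) unfolding sets_eq by auto
    have "set_lebesgue_integral (bcube I m) (\<Union>i. A i) f = (\<Sum>i. set_lebesgue_integral (bcube I m) (A i) f)"
    proof (rule lebesgue_integral_countable_add[OF As])
      show "A i \<inter> A j = {}" if "i \<noteq> j" for i j using union(1) that by (auto simp: disjoint_family_on_def)
      show "set_integrable (bcube I m) (\<Union>i. A i) f"
	unfolding set_integrable_def by (rule int_A) (intro sets.countable_UN, use As in auto)
    qed
    then show ?case using union(3) by simp
  qed
qed
qed

lemma measurable_prod_bump[measurable]:
  assumes "\<And>i. smooth_real (h i)"
  shows "(\<lambda>x. \<Prod>i<m. h i (x i)) \<in> borel_measurable (bcube I m)"
proof (rule borel_measurable_prod)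
  fix i assume "i \<in> {..<m}"
  then have "(\<lambda>x. x i) \<in> borel_measurable (bcube I m)" by (intro measurable_coord) simp
  from measurable_compose[OF this smooth_real_borel[OF assms]]
  show "(\<lambda>x. h i (x i)) \<in> borel_measurable (bcube I m)" .
qed

lemma prod_bump_bounds: "0 \<le> (\<Prod>i<m. bump (c i) (d i) j (x i))" "(\<Prod>i<m. bump (c i) (d i) j (x i)) \<le> 1"
  using bump_bounds by (auto intro: prod_nonneg prod_le_1)

text \<open>
  The product bumps converge boundedly to the indicator of a box. As \<open>f\<close> vanishes outside a smaller cube,
  only boxes inside that cube have to be tested.
\<close>

lemma AE_eq_0_of_bump_integrals:
  fixes f :: "(nat \<Rightarrow> real) \<Rightarrow> real"
  assumes f: "integrable (bcube I m) f"
    and supp: "AE x in bcube I m. x \<notin> PiE {..<m} (\<lambda>_. {a'<..<b'}) \<longrightarrow> f x = 0"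
    and zero: "\<And>c d j. (\<And>i. i < m \<Longrightarrow> a' \<le> c i \<and> d i \<le> b') \<Longrightarrow>
      (\<integral>x. (\<Prod>i<m. bump (c i) (d i) j (x i)) * f x \<partial>bcube I m) = 0"
  shows "AE x in bcube I m. f x = 0"
proof (rule AE_eq_0_of_box_integrals[OF f])
  fix c d :: "nat \<Rightarrow> real"
  define c' where "c' i = max (c i) a'" for i
  define d' where "d' i = min (d i) b'" for i
  let ?b = "\<lambda>j x. \<Prod>i<m. bump (c' i) (d' i) j (x i)"
  have [measurable]: "f \<in> borel_measurable (bcube I m)" using f by auto
  have bm[measurable]: "?b j \<in> borel_measurable (bcube I m)" for j
    by (intro measurable_prod_bump smooth_bump)
  have "(\<lambda>j. \<integral>x. ?b j x * f x \<partial>bcube I m)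
      \<longlonglongrightarrow> (\<integral>x. indicator (subbox m c' d') x * f x \<partial>bcube I m)"
  proof (rule integral_dominated_convergence[where w="\<lambda>x. \<bar>f x\<bar>"])
    show "(\<lambda>x. indicator (subbox m c' d') x * f x) \<in> borel_measurable (bcube I m)"
      using f by (intro borel_measurable_times borel_measurable_indicator sets_box) auto
    show "(\<lambda>x. ?b j x * f x) \<in> borel_measurable (bcube I m)" for j
      by measurable
    show "integrable (bcube I m) (\<lambda>x. \<bar>f x\<bar>)" using f by simp
    show "AE x in bcube I m. norm (?b j x * f x) \<le> \<bar>f x\<bar>" for j
      using prod_bump_bounds[where c=c' and d=d' and j=j and m=m]
      by (intro AE_I2) (simp add: abs_mult mult_left_le_one_le)
    show "AE x in bcube I m. (\<lambda>j. ?b j x * f x) \<longlonglongrightarrow> indicator (subbox m c' d') x * f x"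
    proof (rule AE_I2)
      fix x assume x: "x \<in> space (bcube I m)"
      have "(\<lambda>j. ?b j x) \<longlonglongrightarrow> (\<Prod>i<m. indicator {c' i<..<d' i} (x i))"
	by (intro tendsto_prod bump_tendsto)
      also have "(\<Prod>i<m. indicator {c' i<..<d' i} (x i)) = (indicator (subbox m c' d') x :: real)"
      proof (cases "x \<in> subbox m c' d'")
	case True
	then have "x i \<in> {c' i<..<d' i}" if "i < m" for i using that by (auto simp: PiE_iff)
	then show ?thesis using True by simp
      next
	case False
	then obtain i where i: "i < m" "x i \<notin> {c' i<..<d' i}" using x by (auto simp: PiE_iff space_bcube)
	have "indicator {c' i<..<d' i} (x i) = (0::real)" by (rule indicator_simps(2)[OF i(2)])
	then have "(\<Prod>i<m. indicator {c' i<..<d' i} (x i)) = (0::real)"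
	  using i(1) by (intro prod_zero bexI[of _ i]) auto
	then show ?thesis using False by simp
      qed
      finally show "(\<lambda>j. ?b j x * f x) \<longlonglongrightarrow> indicator (subbox m c' d') x * f x"
	by (rule tendsto_mult[OF _ tendsto_const])
    qed
  qed
  moreover have "(\<integral>x. ?b j x * f x \<partial>bcube I m) = 0" for j
    by (rule zero) (simp add: c'_def d'_def)
  ultimately have "(\<integral>x. indicator (subbox m c' d') x * f x \<partial>bcube I m) = 0"
    by (simp add: LIMSEQ_const_iff)
  moreover have "(\<integral>x. indicator (subbox m c d) x * f x \<partial>bcube I m) = (\<integral>x. indicator (subbox m c' d') x * f x \<partial>bcube I m)"
  proof (rule integral_cong_AE)
    show "AE x in bcube I m. indicator (subbox m c d) x * f x = indicator (subbox m c' d') x * f x"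
      using supp
    proof eventually_elim
      case (elim x)
      show ?case
      proof (cases "x \<in> PiE {..<m} (\<lambda>_. {a'<..<b'})")
	case True
	then have "x \<in> subbox m c d \<longleftrightarrow> x \<in> subbox m c' d'" by (auto simp: PiE_iff c'_def d'_def)
	then show ?thesis by (simp add: indicator_def)
      qed (use elim in simp)
    qed
    show "(\<lambda>x. indicator (subbox m c d) x * f x) \<in> borel_measurable (bcube I m)"
      "(\<lambda>x. indicator (subbox m c' d') x * f x) \<in> borel_measurable (bcube I m)"
      using f by (intro borel_measurable_times borel_measurable_indicator sets_box; auto)+
  qed
  ultimately show "(\<integral>x. indicator (subbox m c d) x * f x \<partial>bcube I m) = 0" by simp
qed

lemma borel_version:
  fixes f :: "(nat \<Rightarrow> real) \<Rightarrow> real"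
  assumes "f \<in> borel_measurable (cube I m)"
  shows "\<exists>f'. f' \<in> borel_measurable (bcube I m) \<and> (AE x in bcube I m. f x = f' x)"
  using completion_ex_borel_measurable_real[of f "bcube I m"] assms by (auto simp: cube_eq)

lemma integral_cube_cong:
  fixes f f' :: "(nat \<Rightarrow> real) \<Rightarrow> real"
  assumes "f \<in> borel_measurable (cube I m)" "f' \<in> borel_measurable (bcube I m)" "AE x in bcube I m. f x = f' x"
  shows "(\<integral>x. f x \<partial>cube I m) = (\<integral>x. f' x \<partial>bcube I m)" "integrable (cube I m) f \<longleftrightarrow> integrable (bcube I m) f'"
proof -
  have f': "f' \<in> borel_measurable (cube I m)" unfolding cube_eq using assms(2) by (rule measurable_completion)
  have ae: "AE x in cube I m. f x = f' x" unfolding cube_eq using assms(3) by (rule AE_completion)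
  have "(\<integral>x. f x \<partial>cube I m) = (\<integral>x. f' x \<partial>cube I m)" by (rule integral_cong_AE[OF assms(1) f' ae])
  then show "(\<integral>x. f x \<partial>cube I m) = (\<integral>x. f' x \<partial>bcube I m)"
    unfolding cube_eq integral_completion[OF assms(2)] .
  have "integrable (cube I m) f \<longleftrightarrow> integrable (cube I m) f'" by (rule integrable_cong_AE[OF assms(1) f' ae])
  then show "integrable (cube I m) f \<longleftrightarrow> integrable (bcube I m) f'"
    unfolding cube_eq integrable_completion[OF assms(2)] .
qed

lemma sets_PiE_bcube:
  assumes "A \<in> sets borel" "A \<subseteq> I"
  shows "PiE {..<m} (\<lambda>_. A) \<in> sets (bcube I m)"
  unfolding bcube_def by (rule sets_PiM_I_finite) (simp_all add: sets_edge_iff assms)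

lemma is_weak_gradientD:
  assumes "is_weak_gradient I n u g"
  shows "locally_integrable I n u" "i < n \<Longrightarrow> locally_integrable I n (g i)"
    and "i < n \<Longrightarrow> test_function I n \<phi> \<Longrightarrow>
      (\<integral>x. u x * partial_deriv i \<phi> x \<partial>cube I n) = - (\<integral>x. g i x * \<phi> x \<partial>cube I n)"
  using assms by (simp_all add: is_weak_gradient_def)

lemma locally_integrableD:
  assumes "locally_integrable I n f"
  shows "f \<in> borel_measurable (cube I n)"
    and "{l..r} \<subseteq> interior I \<Longrightarrow> set_integrable (cube I n) (PiE {..<n} (\<lambda>_. {l..r})) f"
  using assms by (simp_all add: locally_integrable_def)

text \<open>
  Two weak gradients of the same function have the same pairing with all product bumps. Since they are only
  locally integrable, this is exploited on smaller cubes that exhaust the interior.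
\<close>

lemma weak_gradient_unique:
  assumes n: "0 < n" and g: "is_weak_gradient I n u g" and g': "is_weak_gradient I n u g'" and i: "i < n"
  shows "AE x in bcube I n. g i x = g' i x"
proof -
  define l where "l k = a + 1 / (real k + 3)" for k :: nat
  define r where "r k = a + 1 - 1 / (real k + 3)" for k :: nat
  have lr: "a < l k" "r k < a + 1" for k by (auto simp: l_def r_def)
  have *: "AE x in bcube I n. x \<in> PiE {..<n} (\<lambda>_. {l k<..<r k}) \<longrightarrow> g i x = g' i x" for k
  proof -
    let ?O = "PiE {..<n} (\<lambda>_. {l k<..<r k})" and ?K = "PiE {..<n} (\<lambda>_. {l k..r k})"
    have OK: "?O \<subseteq> ?K" by (rule PiE_mono) auto
    have lI: "{l k..r k} \<subseteq> I" "{l k..r k} \<subseteq> interior I"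
      using lr[of k] interior_subset unfolding interior_I by auto
    have Os: "?O \<in> sets (bcube I n)" "?K \<in> sets (bcube I n)"
    proof -
      have "{l k<..<r k} \<subseteq> I" by (rule order_trans[OF _ lI(1)]) auto
      then show "?O \<in> sets (bcube I n)" by (intro sets_PiE_bcube) simp_all
      show "?K \<in> sets (bcube I n)" using lI(1) by (intro sets_PiE_bcube) simp_all
    qed
    have OC: "?O \<in> sets (cube I n)" "?K \<in> sets (cube I n)"
      unfolding cube_eq by (rule sets_completionI_sets[OF Os(1)], rule sets_completionI_sets[OF Os(2)])
    have meas: "g i \<in> borel_measurable (cube I n)" "g' i \<in> borel_measurable (cube I n)"
      and int: "set_integrable (cube I n) ?K (g i)" "set_integrable (cube I n) ?K (g' i)"
      by (rule locally_integrableD(1)[OF is_weak_gradientD(2)[OF g i]],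
	  rule locally_integrableD(1)[OF is_weak_gradientD(2)[OF g' i]],
	  rule locally_integrableD(2)[OF is_weak_gradientD(2)[OF g i] lI(2)],
	  rule locally_integrableD(2)[OF is_weak_gradientD(2)[OF g' i] lI(2)])
    let ?D = "\<lambda>x. indicator ?O x * (g i x - g' i x)"
    have "set_integrable (cube I n) ?K (\<lambda>x. g i x - g' i x)" using int by (rule set_integral_diff(1))
    then have "set_integrable (cube I n) ?O (\<lambda>x. g i x - g' i x)" by (rule set_integrable_subset[OF _ OC(1) OK])
    then have D: "integrable (cube I n) ?D" unfolding set_integrable_def by simp
    then have Dm: "?D \<in> borel_measurable (cube I n)" by auto
    obtain D' where D': "D' \<in> borel_measurable (bcube I n)" "AE x in bcube I n. ?D x = D' x"
      using borel_version[OF Dm] by blast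
    have D'i: "integrable (bcube I n) D'" using integral_cube_cong(2)[OF Dm D'] D by simp
    have "AE x in bcube I n. D' x = 0"
    proof (rule AE_eq_0_of_bump_integrals[OF D'i])
      show "AE x in bcube I n. x \<notin> ?O \<longrightarrow> D' x = 0"
	using D'(2) by eventually_elim (metis indicator_simps(2) mult_zero_left)
      fix c d :: "nat \<Rightarrow> real" and j
      assume cd: "\<And>i. i < n \<Longrightarrow> l k \<le> c i \<and> d i \<le> r k"
      let ?\<phi> = "\<lambda>x. \<Prod>i<n. bump (c i) (d i) j (x i)"
      have out: "bump (c i) (d i) j t = 0" if "i < n" "t \<notin> {l k<..<r k}" for i t
      proof (rule bump_eq_0)
	have "0 < 1 / real (Suc j)" by simp
	then show "t \<notin> {c i + 1 / real (Suc j)..d i - 1 / real (Suc j)}"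
	  using cd[OF that(1)] that(2) unfolding atLeastAtMost_iff greaterThanLessThan_iff by linarith
      qed
      have out': "bump (c i) (d i) j t = 0" if "i < n" "t \<notin> {l k..r k}" for i t
	using out[OF that(1), of t] that(2) by auto
      have test: "test_function I n ?\<phi>"
	by (rule test_function_prod[OF smooth_bump lr out'])
      have \<phi>b[measurable]: "?\<phi> \<in> borel_measurable (bcube I n)" by (intro measurable_prod_bump smooth_bump)
      then have \<phi>c: "?\<phi> \<in> borel_measurable (cube I n)" unfolding cube_eq by (rule measurable_completion)
      have zero: "?\<phi> x = 0" if "x \<in> space (cube I n)" "x \<notin> ?O" for x
      proof -
	have ext: "x \<in> extensional {..<n}" using that(1) unfolding space_cube PiE_def by (rule IntD2)
	have "\<exists>i<n. x i \<notin> {l k<..<r k}"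
	proof (rule ccontr)
	  assume "\<not> (\<exists>i<n. x i \<notin> {l k<..<r k})"
	  then have "\<And>i. i \<in> {..<n} \<Longrightarrow> x i \<in> {l k<..<r k}" by blast
	  with ext have "x \<in> ?O" unfolding PiE_iff by (intro conjI ballI)
	  then show False using that(2) by simp
	qed
	then obtain i where i: "i < n" "x i \<notin> {l k<..<r k}" by (elim exE conjE)
	show ?thesis by (rule prod_zero) (use out[OF i] i(1) in auto)
      qed
      have int\<phi>: "integrable (cube I n) (\<lambda>x. h x * ?\<phi> x)"
	if "h \<in> borel_measurable (cube I n)" "set_integrable (cube I n) ?K h" for h
      proof (rule Bochner_Integration.integrable_bound)
	show "integrable (cube I n) (\<lambda>x. indicator ?K x *\<^sub>R h x)" using that(2) by (simp add: set_integrable_def)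
	show "(\<lambda>x. h x * ?\<phi> x) \<in> borel_measurable (cube I n)" using that(1) \<phi>c by (rule borel_measurable_times)
	show "AE x in cube I n. norm (h x * ?\<phi> x) \<le> norm (indicator ?K x *\<^sub>R h x)"
	proof (rule AE_I2)
	  fix x assume x: "x \<in> space (cube I n)"
	  show "norm (h x * ?\<phi> x) \<le> norm (indicator ?K x *\<^sub>R h x)"
	  proof (cases "x \<in> ?O")
	    case True
	    then have "x \<in> ?K" using OK by blast
	    then show ?thesis using prod_bump_bounds[where c=c and d=d and j=j and m=n and x=x]
	      by (simp add: abs_mult mult_right_le_one_le)
	  next
	    case False
	    show ?thesis unfolding zero[OF x False] mult_zero_right norm_zero by (rule norm_ge_zero)
	  qed
	qed
      qed
      have "(\<integral>x. ?\<phi> x * D' x \<partial>bcube I n) = (\<integral>x. ?\<phi> x * ?D x \<partial>cube I n)"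
	by (rule integral_cube_cong(1)[symmetric])
	  (use \<phi>c Dm D' in \<open>auto elim!: eventually_mono\<close>)
      also have "\<dots> = (\<integral>x. g i x * ?\<phi> x - g' i x * ?\<phi> x \<partial>cube I n)"
	using zero by (intro Bochner_Integration.integral_cong refl) (auto simp: indicator_def algebra_simps)
      also have "\<dots> = (\<integral>x. g i x * ?\<phi> x \<partial>cube I n) - (\<integral>x. g' i x * ?\<phi> x \<partial>cube I n)"
	by (intro Bochner_Integration.integral_diff int\<phi> meas int)
      also have "\<dots> = 0"
      proof -
	have "(\<integral>x. u x * partial_deriv i ?\<phi> x \<partial>cube I n) = - (\<integral>x. g i x * ?\<phi> x \<partial>cube I n)"
	  by (rule is_weak_gradientD(3)[OF g i test])
	moreover have "(\<integral>x. u x * partial_deriv i ?\<phi> x \<partial>cube I n) = - (\<integral>x. g' i x * ?\<phi> x \<partial>cube I n)"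
	  by (rule is_weak_gradientD(3)[OF g' i test])
	ultimately show ?thesis by linarith
      qed
      finally show "(\<integral>x. ?\<phi> x * D' x \<partial>bcube I n) = 0" .
    qed
    with D'(2) show ?thesis
      by eventually_elim (metis indicator_simps(1) mult_1 right_minus_eq)
  qed
  have "AE x in bcube I n. \<forall>k. x \<in> PiE {..<n} (\<lambda>_. {l k<..<r k}) \<longrightarrow> g i x = g' i x"
    unfolding AE_all_countable using * by blast
  then show ?thesis
    using AE_cube_radius[OF n] AE_space
  proof eventually_elim
    case (elim x)
    obtain k :: nat where k: "2 / (1 - cube_radius n x) < real k" using reals_Archimedean2 by blast
    have "2 < real k * (1 - cube_radius n x)" using k elim(2) by (simp add: pos_divide_less_eq)
    also have "\<dots> \<le> (real k + 3) * (1 - cube_radius n x)" using elim(2) by (intro mult_right_mono) auto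
    finally have "2 / (real k + 3) < 1 - cube_radius n x" by (simp add: pos_divide_less_eq mult.commute)
    then have "cube_radius n x < 1 - 2 * (1 / (real k + 3))" by simp
    then have "\<bar>2 * (x i - (a + 1/2))\<bar> < 1 - 2 * (1 / (real k + 3))" if "i < n" for i
      using that unfolding cube_radius_less_iff by blast
    then have "x i \<in> {l k<..<r k}" if "i < n" for i
    proof -
      have "a + e < z \<and> z < a + 1 - e" if "\<bar>2 * (z - (a + 1/2))\<bar> < 1 - 2 * e" for z e :: real
	using that by (auto simp: abs_less_iff)
      from this[OF \<open>\<And>i. i < n \<Longrightarrow> \<bar>2 * (x i - (a + 1/2))\<bar> < 1 - 2 * (1 / (real k + 3))\<close>[OF that]]
      show ?thesis unfolding l_def r_def greaterThanLessThan_iff .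
    qed
    then have "x \<in> PiE {..<n} (\<lambda>_. {l k<..<r k})" using elim(3) by (auto simp: space_bcube PiE_iff)
    then show ?case using elim(1) by blast
  qed
qed

end

section \<open>Absolute continuity on lines\<close>

context unit_edge
begin

lemma integral_edge_eq:
  fixes h :: "real \<Rightarrow> real"
  assumes h: "continuous_on UNIV h" and out: "\<And>x. x \<notin> {l..u} \<Longrightarrow> h x = 0" and lu: "a < l" "u < a + 1"
  shows "(\<integral>t. h t \<partial>edge) = integral {l..u} h"
proof -
  have "(\<integral>t. h t \<partial>edge) = (\<integral>t. indicator I t *\<^sub>R h t \<partial>lborel)" by (rule integral_restrict_space) simp
  also have "\<dots> = (\<integral>t. indicator {l..u} t *\<^sub>R h t \<partial>lborel)"
  proof (rule Bochner_Integration.integral_cong[OF refl])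
    fix t :: real
    have "{l..u} \<subseteq> I" using lu interior_subset by force
    then show "indicator I t *\<^sub>R h t = indicator {l..u} t *\<^sub>R h t"
      using out[of t] by (cases "t \<in> {l..u}") (auto simp: indicator_def)
  qed
  also have "\<dots> = integral {l..u} h"
    using set_borel_integral_eq_integral(2)[OF borel_integrable_atLeastAtMost'[OF continuous_on_subset[OF h]], of l u]
    by (simp add: set_lebesgue_integral_def)
  finally show ?thesis .
qed

lemma distr_remove_coord:
  assumes k: "k \<le> m"
  shows "distr (bcube I (Suc m)) (bcube I m) (remove_coord m k) = bcube I m"
proof (rule measure_eqI)
  interpret B: prob_space "bcube I m" by (rule prob_space_bcube)
  fix A assume "A \<in> sets (distr (bcube I (Suc m)) (bcube I m) (remove_coord m k))"
  then have A[measurable]: "A \<in> sets (bcube I m)" by simp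
  let ?S = "{x \<in> space (bcube I (Suc m)). remove_coord m k x \<in> A}"
  have S[measurable]: "?S \<in> sets (bcube I (Suc m))" by (rule sets_remove_coord[OF A])
  have "remove_coord m k -` A \<inter> space (bcube I (Suc m)) = ?S" by auto
  then have "emeasure (distr (bcube I (Suc m)) (bcube I m) (remove_coord m k)) A = emeasure (bcube I (Suc m)) ?S"
    by (simp add: emeasure_distr[OF measurable_remove_coord A])
  also have "\<dots> = (\<integral>\<^sup>+ x. indicator ?S x \<partial>bcube I (Suc m))" by (rule nn_integral_indicator[symmetric]) (rule S)
  also have "\<dots> = (\<integral>\<^sup>+ y. \<integral>\<^sup>+ t. indicator ?S (insert_coord (Suc m) k y t) \<partial>edge \<partial>bcube I m)"
    by (rule nn_integral_insert_coord[OF k]) measurable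
  also have "\<dots> = (\<integral>\<^sup>+ y. indicator A y \<partial>bcube I m)"
  proof (rule nn_integral_cong)
    fix y assume y: "y \<in> space (bcube I m)"
    then have ye: "y \<in> extensional {..<m}" by (simp add: space_bcube PiE_def)
    have "(\<integral>\<^sup>+ t. indicator ?S (insert_coord (Suc m) k y t) \<partial>edge) = (\<integral>\<^sup>+ t. indicator A y \<partial>edge)"
    proof (rule nn_integral_cong)
      fix t assume t: "t \<in> space edge"
      have "insert_coord (Suc m) k y t \<in> space (bcube I (Suc m))"
	using y t unfolding space_bcube insert_coord_in_PiE_iff[OF k ye] by simp
      then show "(indicator ?S (insert_coord (Suc m) k y t) :: ennreal) = indicator A y"
	by (simp add: indicator_def remove_coord_insert_coord[OF k ye])
    qed
    also have "\<dots> = indicator A y" using edge.emeasure_space_1 by simp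
    finally show "(\<integral>\<^sup>+ t. indicator ?S (insert_coord (Suc m) k y t) \<partial>edge) = indicator A y" .
  qed
  also have "\<dots> = emeasure (bcube I m) A" by (rule nn_integral_indicator) (rule A)
  finally show "emeasure (distr (bcube I (Suc m)) (bcube I m) (remove_coord m k)) A = emeasure (bcube I m) A" .
qed simp

lemma integrable_remove_coord:
  fixes h :: "(nat \<Rightarrow> real) \<Rightarrow> real"
  assumes "k \<le> m" "integrable (bcube I m) h"
  shows "integrable (bcube I (Suc m)) (\<lambda>x. h (remove_coord m k x))"
proof -
  have "integrable (distr (bcube I (Suc m)) (bcube I m) (remove_coord m k)) h"
    unfolding distr_remove_coord[OF assms(1)] by fact
  then show ?thesis by (rule integrable_distr[OF measurable_remove_coord])
qed

lemma integral_primitive_swap: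
  fixes g \<eta> :: "real \<Rightarrow> real"
  assumes g: "integrable edge g" and \<eta>[measurable]: "\<eta> \<in> borel_measurable borel" and B: "\<And>t. \<bar>\<eta> t\<bar> \<le> B"
  shows "(\<integral>t. \<eta> t * (\<integral>s. indicator {..t} s * g s \<partial>edge) \<partial>edge)
     = (\<integral>s. g s * (\<integral>t. \<eta> t * indicator {s..} t \<partial>edge) \<partial>edge)"
proof -
  interpret P: pair_sigma_finite edge edge ..
  have [measurable]: "g \<in> borel_measurable edge" using g by auto
  have [measurable]: "\<eta> \<in> borel_measurable edge" by (rule measurable_restrict_space1) simp
  have idm[measurable]: "(\<lambda>x. x) \<in> borel_measurable edge" by (rule measurable_restrict_space1) simp
  have B0: "0 \<le> B" using B[of 0] by simp
  define f where "f t s = (if s \<le> t then \<eta> t * g s else 0)" for t s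
  have fm: "(\<lambda>(t, s). f t s) \<in> borel_measurable (edge \<Otimes>\<^sub>M edge)"
    unfolding f_def split_beta by measurable
  have gB: "integrable edge (\<lambda>s. B * \<bar>g s\<bar>)" using g by simp
  have fle: "\<bar>f t s\<bar> \<le> B * \<bar>g s\<bar>" for t s
    using B[of t] B0 by (auto simp: f_def abs_mult intro: mult_right_mono)
  have fi: "integrable edge (f t)" for t
  proof (rule Bochner_Integration.integrable_bound[OF gB])
    show "f t \<in> borel_measurable edge" unfolding f_def[abs_def] by measurable
    show "AE s in edge. norm (f t s) \<le> norm (B * \<bar>g s\<bar>)" using fle B0 by (simp add: abs_mult)
  qed
  have "integrable (edge \<Otimes>\<^sub>M edge) (\<lambda>(t, s). f t s)"
  proof (rule P.Fubini_integrable[OF fm])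
    show "AE t in edge. integrable edge (\<lambda>s. (\<lambda>(t, s). f t s) (t, s))" using fi by simp
    show "integrable edge (\<lambda>t. \<integral>s. norm ((\<lambda>(t, s). f t s) (t, s)) \<partial>edge)"
    proof (rule Bochner_Integration.integrable_bound[of _ "\<lambda>t. \<integral>s. B * \<bar>g s\<bar> \<partial>edge"])
      show "integrable edge (\<lambda>t. \<integral>s. B * \<bar>g s\<bar> \<partial>edge)" by simp
      show "(\<lambda>t. \<integral>s. norm ((\<lambda>(t, s). f t s) (t, s)) \<partial>edge) \<in> borel_measurable edge"
	by (rule edge.borel_measurable_lebesgue_integral) (use measurable_compose[OF fm borel_measurable_norm] in \<open>simp add: split_beta'\<close>)
      show "AE t in edge. norm (\<integral>s. norm ((\<lambda>(t, s). f t s) (t, s)) \<partial>edge) \<le> norm (\<integral>s. B * \<bar>g s\<bar> \<partial>edge)"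
      proof (rule AE_I2)
	fix t
	have "(\<integral>s. \<bar>f t s\<bar> \<partial>edge) \<le> (\<integral>s. B * \<bar>g s\<bar> \<partial>edge)"
	  using fi gB fle by (intro integral_mono) auto
	moreover have "0 \<le> (\<integral>s. \<bar>f t s\<bar> \<partial>edge)" by (rule Bochner_Integration.integral_nonneg) simp
	ultimately show "norm (\<integral>s. norm ((\<lambda>(t, s). f t s) (t, s)) \<partial>edge) \<le> norm (\<integral>s. B * \<bar>g s\<bar> \<partial>edge)" by simp
      qed
    qed
  qed
  from P.Fubini_integral[OF this]
  have swap: "(\<integral>s. \<integral>t. f t s \<partial>edge \<partial>edge) = (\<integral>t. \<integral>s. f t s \<partial>edge \<partial>edge)" .
  have f1: "f t s = \<eta> t * (indicator {..t} s * g s)" and f2: "f t s = g s * (\<eta> t * indicator {s..} t)" for t s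
    by (auto simp: f_def)
  have "(\<integral>t. \<eta> t * (\<integral>s. indicator {..t} s * g s \<partial>edge) \<partial>edge) = (\<integral>t. \<integral>s. f t s \<partial>edge \<partial>edge)"
    unfolding f1 integral_mult_right_zero ..
  also have "\<dots> = (\<integral>s. \<integral>t. f t s \<partial>edge \<partial>edge)" by (rule swap[symmetric])
  also have "\<dots> = (\<integral>s. g s * (\<integral>t. \<eta> t * indicator {s..} t \<partial>edge) \<partial>edge)"
    unfolding f2 integral_mult_right_zero ..
  finally show ?thesis .
qed

text \<open>
  Since the total integral vanishes, a tail of \<open>\<eta>\<close> is the negative of its primitive, which is the factor
  of the test function against which the weak derivative is integrated.
\<close>

lemma integral_tail_eq_primitive:
  fixes \<eta> :: "real \<Rightarrow> real"
  assumes \<eta>: "smooth_real \<eta>" and out: "\<And>x. x \<notin> {l..u} \<Longrightarrow> \<eta> x = 0" and lu: "a < l" "u < a + 1" "l \<le> u"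
    and zero: "integral {l..u} \<eta> = 0"
  shows "(\<integral>t. \<eta> t * indicator {s..} t \<partial>edge) = - integral {l..s} \<eta>"
proof -
  have cont: "continuous_on S \<eta>" for S using \<eta> by (rule smooth_real_continuous)
  have sI: "{l..u} \<subseteq> I" using lu interior_subset by force
  have "(\<integral>t. \<eta> t * indicator {s..} t \<partial>edge) = (\<integral>t. indicator I t *\<^sub>R (\<eta> t * indicator {s..} t) \<partial>lborel)"
    by (rule integral_restrict_space) simp
  also have "\<dots> = (\<integral>t. indicator {max s l..u} t *\<^sub>R \<eta> t \<partial>lborel)"
  proof (rule Bochner_Integration.integral_cong[OF refl])
    fix t :: real
    show "indicator I t *\<^sub>R (\<eta> t * indicator {s..} t) = indicator {max s l..u} t *\<^sub>R \<eta> t"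
    proof (cases "t \<in> {l..u}")
      case True
      then have "t \<in> I" using sI by blast
      then show ?thesis using True by (simp add: indicator_def)
    next
      case False
      then show ?thesis using out[of t] by simp
    qed
  qed
  also have "\<dots> = integral {max s l..u} \<eta>"
    using set_borel_integral_eq_integral(2)[OF borel_integrable_atLeastAtMost'[OF cont], of "max s l" u]
    by (simp add: set_lebesgue_integral_def)
  also have "\<dots> = - integral {l..s} \<eta>"
  proof -
    consider "s \<le> l" | "l < s" "s \<le> u" | "u < s" by linarith
    then show ?thesis
    proof cases
      case 1
      then have "integral {l..s} \<eta> = 0" by (cases "s = l") auto
      then show ?thesis using 1 zero by (simp add: max_absorb2)
    next
      case 2
      have "integral {l..s} \<eta> + integral {s..u} \<eta> = integral {l..u} \<eta>"
	using 2 by (intro Henstock_Kurzweil_Integration.integral_combine integrable_continuous_real cont) auto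
      then show ?thesis using 2 zero by (simp add: max_absorb1)
    next
      case 3
      then have "integral {max s l..u} \<eta> = 0" by simp
      moreover have "integral {l..s} \<eta> = 0"
	using smooth_primitive(2)[OF \<eta> out zero lu(3), of s] 3 by simp
      ultimately show ?thesis by simp
    qed
  qed
  finally show ?thesis .
qed

lemma sum_prod_insert_coord:
  assumes "k \<le> m"
  shows "(\<Prod>i<Suc m. h i (insert_coord (Suc m) k y t i)) = h k t * (\<Prod>i<m. (h (skip_index k i) (y i) :: real))"
  unfolding prod_skip_index[OF assms] insert_coord_same[OF assms]
  by (intro arg_cong2[where f="(*)"] refl prod.cong) (simp add: insert_coord_skip_index assms)

text \<open>
  Subtracting from \<open>u\<close> the primitive of its derivative along the \<open>k\<close>-th coordinate and a weighted mean
  over the line leaves a function that is orthogonal to all product bumps: the factor of such a bump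
  in the \<open>k\<close>-th variable may be corrected by a multiple of the weight, which gives it mean zero and
  hence makes it the derivative of a test function.
\<close>

lemma weak_derivative_primitive:
  fixes u G U :: "(nat \<Rightarrow> real) \<Rightarrow> real"
  assumes k: "k \<le> m" and wg: "is_weak_gradient I (Suc m) u g"
    and U: "integrable (bcube I (Suc m)) U" "AE x in bcube I (Suc m). u x = U x"
    and G: "integrable (bcube I (Suc m)) G" "AE x in bcube I (Suc m). g k x = G x"
  shows "\<exists>\<kappa>. AE x in bcube I (Suc m). U x = \<kappa> (remove_coord m k x)
    + (\<integral>s. indicator {..x k} s * G (insert_coord (Suc m) k (remove_coord m k x) s) \<partial>edge)"
proof -
  let ?n = "Suc m"
  let ?ins = "insert_coord ?n k" and ?del = "remove_coord m k"
  interpret Bn: prob_space "bcube I ?n" by (rule prob_space_bcube)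
  interpret Bm: prob_space "bcube I m" by (rule prob_space_bcube)
  have kn: "k < ?n" using k by simp
  have Um[measurable]: "U \<in> borel_measurable (bcube I ?n)" and Gm[measurable]: "G \<in> borel_measurable (bcube I ?n)"
    using U G by auto
  have idm[measurable]: "(\<lambda>x. x) \<in> borel_measurable edge" by (rule measurable_restrict_space1) simp
  have ext: "y \<in> extensional {..<m}" if "y \<in> space (bcube I m)" for y
    using that by (simp add: space_bcube PiE_def)
  have del_ins: "?del (?ins y t) = y" if "y \<in> space (bcube I m)" for y t
    by (rule remove_coord_insert_coord[OF k ext[OF that]])
  have ins_k: "?ins y t k = t" for y t by (rule insert_coord_same[OF k])
  have xk[measurable]: "(\<lambda>x. x k) \<in> borel_measurable (bcube I ?n)" by (rule measurable_coord[OF kn])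
  define Gp where "Gp x = (\<integral>s. indicator {..x k} s * G (?ins (?del x) s) \<partial>edge)" for x
  have Gins: "(\<lambda>p. G (?ins (?del (fst p)) (snd p))) \<in> borel_measurable (bcube I ?n \<Otimes>\<^sub>M edge)"
  proof -
    have "(\<lambda>p. (?del (fst p), snd p)) \<in> measurable (bcube I ?n \<Otimes>\<^sub>M edge) (bcube I m \<Otimes>\<^sub>M edge)"
      by (intro measurable_Pair measurable_compose[OF measurable_fst measurable_remove_coord] measurable_snd)
    from measurable_compose[OF measurable_compose[OF this measurable_insert_coord[OF k]] Gm]
    show ?thesis by simp
  qed
  have Gpm[measurable]: "Gp \<in> borel_measurable (bcube I ?n)"
  proof -
    have "(\<lambda>(x, s). if s \<le> x k then G (?ins (?del x) s) else 0) \<in> borel_measurable (bcube I ?n \<Otimes>\<^sub>M edge)"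
      using Gins unfolding split_beta by measurable
    from edge.borel_measurable_lebesgue_integral[OF this]
    have "(\<lambda>x. \<integral>s. (if s \<le> x k then G (?ins (?del x) s) else 0) \<partial>edge) \<in> borel_measurable (bcube I ?n)" .
    moreover have "(if s \<le> x k then G (?ins (?del x) s) else 0) = indicator {..x k} s * G (?ins (?del x) s)" for s x
      by simp
    ultimately show ?thesis unfolding Gp_def[abs_def] by simp
  qed
  define A where "A y = (\<integral>s. \<bar>G (?ins y s)\<bar> \<partial>edge)" for y
  have A: "integrable (bcube I m) A"
    unfolding A_def[abs_def] using integral_insert_coord(1)[OF k, of "\<lambda>x. \<bar>G x\<bar>"] G(1) by simp
  have del_AE: "AE x in bcube I ?n. P (?del x)" if "AE y in bcube I m. P y" for P
  proof -
    have "AE y in distr (bcube I ?n) (bcube I m) ?del. P y" unfolding distr_remove_coord[OF k] by fact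
    then show ?thesis by (rule AE_distrD[OF measurable_remove_coord])
  qed
  have Gp_le: "AE x in bcube I ?n. \<bar>Gp x\<bar> \<le> A (?del x)"
    using del_AE[OF integral_insert_coord(2)[OF k G(1)]]
  proof eventually_elim
    case (elim x)
    have "\<bar>Gp x\<bar> \<le> (\<integral>s. \<bar>indicator {..x k} s * G (?ins (?del x) s)\<bar> \<partial>edge)"
      unfolding Gp_def by (rule integral_abs_bound)
    also have "\<dots> \<le> A (?del x)"
      unfolding A_def
    proof (rule integral_mono')
      show "integrable edge (\<lambda>s. \<bar>G (?ins (?del x) s)\<bar>)" using elim by simp
    qed (auto simp: indicator_def)
    finally show ?case .
  qed
  have Gpi: "integrable (bcube I ?n) Gp"
  proof (rule Bochner_Integration.integrable_bound[OF integrable_remove_coord[OF k A] Gpm])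
    show "AE x in bcube I ?n. norm (Gp x) \<le> norm (A (?del x))"
      using Gp_le by eventually_elim (simp add: abs_le_iff)
  qed
  define V where "V x = U x - Gp x" for x
  have V: "integrable (bcube I ?n) V" unfolding V_def[abs_def] using U(1) Gpi by (rule Bochner_Integration.integrable_diff)
  have Vm[measurable]: "V \<in> borel_measurable (bcube I ?n)" using V by auto
  define \<beta> where "\<beta> = bump a (a + 1) 9"
  have \<beta>: "smooth_real \<beta>" unfolding \<beta>_def by (rule smooth_bump)
  define w0 where "w0 = (\<integral>t. \<beta> t \<partial>edge)"
  have bump_edge: "bump c d j \<in> borel_measurable edge" for c d j
    by (rule measurable_restrict_space1) (use smooth_real_borel[OF smooth_bump] in simp)
  have bump_int: "integrable edge (\<lambda>t. bump c d j t * h t)" if "integrable edge h" for c d j h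
  proof (rule Bochner_Integration.integrable_bound[OF that])
    show "(\<lambda>t. bump c d j t * h t) \<in> borel_measurable edge"
      using that by (intro borel_measurable_times bump_edge) auto
    show "AE t in edge. norm (bump c d j t * h t) \<le> norm (h t)"
      using bump_bounds[of c d j] by (intro AE_I2) (simp add: abs_mult mult_left_le_one_le)
  qed
  have bump_int1: "integrable edge (bump c d j)" for c d j
    using bump_int[of "\<lambda>_. 1" c d j] by simp
  have w0: "0 < w0"
  proof -
    have le: "indicator {a + 2/10<..<a + 8/10} t \<le> \<beta> t" for t
    proof (cases "t \<in> {a + 2/10<..<a + 8/10}")
      case True
      then have "\<beta> t = 1" by (simp add: \<beta>_def bump_def smooth_step_values(4))
      then show ?thesis by simp
    qed (use bump_bounds in \<open>simp add: \<beta>_def\<close>)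
    have sub: "{a + 2/10<..<a + 8/10} \<subseteq> I" by (rule order_trans[OF _ interior_subset]) auto
    have J: "{a + 2/10<..<a + 8/10} \<in> sets edge" using sub by (simp add: sets_edge_iff)
    have "emeasure edge {a + 2/10<..<a + 8/10} = emeasure lborel {a + 2/10<..<a + 8/10}"
      using sub by (intro emeasure_restrict_space) auto
    then have "measure edge {a + 2/10<..<a + 8/10} = 6/10" by (simp add: measure_def)
    then have "(6/10::real) = (\<integral>t. indicator {a + 2/10<..<a + 8/10} t \<partial>edge)"
      using J sub by (simp add: Int_absorb2)
    also have "\<dots> \<le> w0" unfolding w0_def
      using J bump_int1 le by (intro integral_mono integrable_real_indicator) (auto simp: \<beta>_def less_top[symmetric])
    finally show ?thesis by simp
  qed
  define \<kappa> where "\<kappa> y = (\<integral>t. \<beta> t * V (?ins y t) \<partial>edge) / w0" for y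
  have \<beta>V: "integrable (bcube I ?n) (\<lambda>x. \<beta> (x k) * V x)"
  proof (rule Bochner_Integration.integrable_bound[OF V])
    show "(\<lambda>x. \<beta> (x k) * V x) \<in> borel_measurable (bcube I ?n)"
      by (intro borel_measurable_times measurable_compose[OF xk smooth_real_borel[OF \<beta>]] Vm)
    show "AE x in bcube I ?n. norm (\<beta> (x k) * V x) \<le> norm (V x)"
      using bump_bounds by (intro AE_I2) (simp add: abs_mult mult_left_le_one_le \<beta>_def)
  qed
  have \<kappa>: "integrable (bcube I m) \<kappa>"
    using integral_insert_coord(1)[OF k \<beta>V] unfolding \<kappa>_def[abs_def] ins_k by simp
  define R where "R x = V x - \<kappa> (?del x)" for x
  have R: "integrable (bcube I ?n) R"
    unfolding R_def[abs_def] using V integrable_remove_coord[OF k \<kappa>] by (rule Bochner_Integration.integrable_diff)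
  have Rm[measurable]: "R \<in> borel_measurable (bcube I ?n)" using R by auto
  have "AE x in bcube I ?n. R x = 0"
  proof (rule AE_eq_0_of_bump_integrals[OF R, where a'=a and b'="a + 1"])
    have "AE x in bcube I ?n. x \<in> PiE {..<?n} (\<lambda>_. {a<..<a+1})"
      using AE_cube_radius[OF zero_less_Suc] AE_space
    proof eventually_elim
      case x: (elim x)
      then have "\<bar>2 * (x i - (a + 1/2))\<bar> < 1" if "i < ?n" for i
	using that cube_radius_less_iff[of ?n x 1] by blast
      then have "x i \<in> {a<..<a+1}" if "i < ?n" for i
	using that unfolding greaterThanLessThan_iff abs_less_iff by fastforce
      then show "x \<in> PiE {..<?n} (\<lambda>_. {a<..<a+1})"
	using x(2) unfolding space_bcube PiE_iff by blast
    qed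
    then show "AE x in bcube I ?n. x \<notin> PiE {..<?n} (\<lambda>_. {a<..<a+1}) \<longrightarrow> R x = 0"
      by eventually_elim blast
    fix c d :: "nat \<Rightarrow> real" and j
    assume cd: "\<And>i. i < ?n \<Longrightarrow> a \<le> c i \<and> d i \<le> a + 1"
    define b where "b = bump (c k) (d k) j"
    define Q where "Q y = (\<Prod>i<m. bump (c (skip_index k i)) (d (skip_index k i)) j (y i))" for y :: "nat \<Rightarrow> real"
    let ?\<Phi> = "\<lambda>x. \<Prod>i<?n. bump (c i) (d i) j (x i)"
    have \<Phi>: "?\<Phi> (?ins y t) = b t * Q y" for y t
      unfolding b_def Q_def by (rule sum_prod_insert_coord[OF k])
    have \<Phi>R: "integrable (bcube I ?n) (\<lambda>x. ?\<Phi> x * R x)"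
    proof (rule Bochner_Integration.integrable_bound[OF R])
      show "(\<lambda>x. ?\<Phi> x * R x) \<in> borel_measurable (bcube I ?n)"
	by (intro borel_measurable_times measurable_prod_bump smooth_bump Rm)
      show "AE x in bcube I ?n. norm (?\<Phi> x * R x) \<le> norm (R x)"
	using prod_bump_bounds[where c=c and d=d and j=j and m="?n"]
	by (intro AE_I2) (simp add: abs_mult mult_left_le_one_le del: prod.lessThan_Suc)
    qed
    define w where "w = (\<integral>t. b t \<partial>edge)"
    define \<eta> where "\<eta> t = b t + (- (w / w0)) * \<beta> t" for t
    have \<eta>: "smooth_real \<eta>"
      unfolding \<eta>_def[abs_def] b_def
      by (intro smooth_real_add smooth_real_mult smooth_real_const smooth_bump \<beta>)
    have \<eta>m: "\<eta> \<in> borel_measurable borel" by (rule smooth_real_borel[OF \<eta>])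
    \<comment> \<open>A common margin for the bump with index \<open>j\<close> and for the weight \<open>\<beta>\<close>, whose margin is \<open>1/10\<close>.\<close>
    define J where "J = real (max (Suc j) 10)"
    define l where "l = a + 1 / J"
    define r where "r = a + 1 - 1 / J"
    have J: "10 \<le> J" "real (Suc j) \<le> J" by (simp_all add: J_def)
    have J1: "1 / J \<le> 1 / 10" "1 / J \<le> 1 / real (Suc j)" "0 < 1 / J"
      using J by (simp_all add: frac_le del: of_nat_Suc)
    have lr: "a < l" "r < a + 1" "l \<le> r" using J1 unfolding l_def r_def by linarith+
    have bump_out: "bump c' d' j' t = 0"
      if "t \<notin> {l..r}" "a \<le> c'" "d' \<le> a + 1" "1 / J \<le> 1 / real (Suc j')" for c' d' j' t
    proof (rule bump_eq_0)
      show "t \<notin> {c' + 1 / real (Suc j')..d' - 1 / real (Suc j')}"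
	using that unfolding l_def r_def atLeastAtMost_iff by linarith
    qed
    have b_out: "b t = 0" if "t \<notin> {l..r}" for t
      unfolding b_def using cd[OF kn] J1 that by (intro bump_out) auto
    have \<beta>_out: "\<beta> t = 0" if "t \<notin> {l..r}" for t
      unfolding \<beta>_def using J1 that by (intro bump_out) auto
    have \<eta>_out: "\<eta> t = 0" if "t \<notin> {l..r}" for t
      unfolding \<eta>_def using b_out[OF that] \<beta>_out[OF that] by simp
    have \<eta>_int: "integrable edge (\<lambda>t. \<eta> t * h t)" if "integrable edge h" for h
    proof -
      have "integrable edge (\<lambda>t. b t * h t + (- (w / w0)) * (\<beta> t * h t))"
	unfolding b_def \<beta>_def
	by (intro Bochner_Integration.integrable_add integrable_mult_right bump_int that)
      then show ?thesis by (simp add: \<eta>_def algebra_simps)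
    qed
    have "(\<integral>t. \<eta> t \<partial>edge) = (\<integral>t. b t \<partial>edge) + (- (w / w0)) * (\<integral>t. \<beta> t \<partial>edge)"
      unfolding \<eta>_def using bump_int1 unfolding b_def \<beta>_def
      by (subst Bochner_Integration.integral_add) auto
    also have "\<dots> = 0" using w0 by (simp add: w_def w0_def)
    finally have "(\<integral>t. \<eta> t \<partial>edge) = 0" .
    then have \<eta>0: "integral {l..r} \<eta> = 0"
      using integral_edge_eq[OF smooth_real_continuous[OF \<eta>] \<eta>_out lr(1,2)] by simp
    define \<theta> where "\<theta> x = integral {l..x} \<eta>" for x
    note prim = smooth_primitive[OF \<eta> \<eta>_out \<eta>0 lr(3), folded \<theta>_def]
    have \<theta>: "smooth_real \<theta>" unfolding \<theta>_def[abs_def] by (rule smooth_primitive(3)[OF \<eta> \<eta>_out \<eta>0 lr(3)])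
    have \<eta>_bd: "\<bar>\<eta> t\<bar> \<le> 1 + \<bar>w / w0\<bar>" for t
    proof -
      have "\<bar>\<eta> t\<bar> \<le> \<bar>b t\<bar> + \<bar>w / w0\<bar> * \<bar>\<beta> t\<bar>"
	unfolding \<eta>_def by (metis abs_minus_cancel abs_mult abs_triangle_ineq)
      also have "\<dots> \<le> 1 + \<bar>w / w0\<bar> * 1"
	using bump_bounds unfolding b_def \<beta>_def by (intro add_mono mult_left_mono) auto
      finally show ?thesis by simp
    qed
    \<comment> \<open>The test function with the primitive in the \<open>k\<close>-th variable.\<close>
    define h where "h i = (if i = k then \<theta> else bump (c i) (d i) j)" for i
    let ?\<phi> = "\<lambda>x. \<Prod>i<?n. h i (x i)"
    have hs: "smooth_real (h i)" for i unfolding h_def using \<theta> smooth_bump by simp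
    have hout: "h i t = 0" if "i < ?n" "t \<notin> {l..r}" for i t
      using prim(2)[of t] bump_out[OF that(2), of "c i" "d i" j] cd[OF that(1)] J1 that by (simp add: h_def)
    have test: "test_function I ?n ?\<phi>" by (rule test_function_prod[OF hs lr(1,2) hout])
    have h_skip: "h (skip_index k i) = bump (c (skip_index k i)) (d (skip_index k i)) j" for i
      by (simp add: h_def skip_index_neq)
    have \<phi>: "?\<phi> (?ins y t) = \<theta> t * Q y" for y t
      using sum_prod_insert_coord[OF k, of h y t] unfolding h_skip Q_def by (simp add: h_def)
    define h' where "h' i = deriv (h i)" for i
    have hk': "deriv (h k) = \<eta>" unfolding h_def using prim(1) by (auto intro!: DERIV_imp_deriv)
    have pd: "partial_deriv k ?\<phi> = (\<lambda>x. \<Prod>i<?n. (h(k := \<eta>)) i (x i))"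
      by (rule HOL.ext) (rule partial_deriv_prod(1)[OF kn, of h, OF smooth_real_deriv(1)[OF hs], unfolded hk'])
    have \<psi>s: "smooth_real ((h(k := \<eta>)) i)" for i using hs \<eta> by simp
    have \<psi>: "(\<Prod>i<?n. (h(k := \<eta>)) i (?ins y t i)) = \<eta> t * Q y" for y t
      using sum_prod_insert_coord[OF k, of "h(k := \<eta>)" y t] unfolding Q_def
      by (simp add: h_skip skip_index_neq fun_upd_other[OF skip_index_neq])
    have hm[measurable]: "?\<phi> \<in> borel_measurable (bcube I ?n)" by (intro measurable_prod_bump hs)
    have \<psi>m: "(\<lambda>x. \<Prod>i<?n. (h(k := \<eta>)) i (x i)) \<in> borel_measurable (bcube I ?n)"
      by (intro measurable_prod_bump \<psi>s)
    have Q01: "0 \<le> Q y" "Q y \<le> 1" for y unfolding Q_def by (rule prod_bump_bounds)+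
    have \<theta>_edge: "\<theta> s = - (\<integral>t. \<eta> t * indicator {s..} t \<partial>edge)" for s
      using integral_tail_eq_primitive[OF \<eta> \<eta>_out lr \<eta>0, of s] by (simp add: \<theta>_def)
    have \<theta>_bd: "\<bar>\<theta> s\<bar> \<le> 1 + \<bar>w / w0\<bar>" for s
    proof -
      have "\<bar>\<theta> s\<bar> \<le> (\<integral>t. \<bar>\<eta> t * indicator {s..} t\<bar> \<partial>edge)"
	unfolding \<theta>_edge abs_minus_cancel by (rule integral_abs_bound)
      also have "\<dots> \<le> (\<integral>t. 1 + \<bar>w / w0\<bar> \<partial>edge)"
	using \<eta>_bd by (intro integral_mono') (auto simp: indicator_def)
      also have "\<dots> = 1 + \<bar>w / w0\<bar>" using edge.prob_space by simp
      finally show ?thesis .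
    qed
    have \<psi>U: "integrable (bcube I ?n) (\<lambda>x. (\<Prod>i<?n. (h(k := \<eta>)) i (x i)) * U x)"
      and \<phi>G: "integrable (bcube I ?n) (\<lambda>x. ?\<phi> x * G x)"
    proof -
      have *: "integrable (bcube I ?n) (\<lambda>x. \<gamma> x * W x)"
	if \<gamma>: "\<gamma> \<in> borel_measurable (bcube I ?n)" and W: "integrable (bcube I ?n) W"
	  and bd: "\<And>y t. \<bar>\<gamma> (?ins y t)\<bar> \<le> 1 + \<bar>w / w0\<bar>" for \<gamma> W :: "(nat \<Rightarrow> real) \<Rightarrow> real"
      proof (rule Bochner_Integration.integrable_bound)
	show "integrable (bcube I ?n) (\<lambda>x. (1 + \<bar>w / w0\<bar>) * W x)" using W by simp
	show "(\<lambda>x. \<gamma> x * W x) \<in> borel_measurable (bcube I ?n)" using \<gamma> W by auto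
	show "AE x in bcube I ?n. norm (\<gamma> x * W x) \<le> norm ((1 + \<bar>w / w0\<bar>) * W x)"
	proof (rule AE_I2)
	  fix x assume x: "x \<in> space (bcube I ?n)"
	  have "?ins (?del x) (x k) = x"
	  proof
	    fix i
	    consider "i = k" | q where "q < m" "i = skip_index k q" | "\<not> i < ?n"
	      using lessThan_Suc_eq_skip_index[OF k] by blast
	    then show "?ins (?del x) (x k) i = x i"
	    proof cases
	      case 2
	      then show ?thesis using k by (simp add: insert_coord_skip_index remove_coord_def)
	    next
	      case 3
	      then show ?thesis using x by (auto simp: insert_coord_def space_bcube PiE_def extensional_def)
	    qed (simp add: ins_k)
	  qed
	  then have "\<bar>\<gamma> x\<bar> \<le> 1 + \<bar>w / w0\<bar>" using bd[of "?del x" "x k"] by simp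
	  then show "norm (\<gamma> x * W x) \<le> norm ((1 + \<bar>w / w0\<bar>) * W x)"
	    by (simp add: abs_mult mult_right_mono)
	qed
      qed
      have le1: "\<bar>e * Q y\<bar> \<le> 1 + \<bar>w / w0\<bar>" if "\<bar>e\<bar> \<le> 1 + \<bar>w / w0\<bar>" for e y
	using mult_mono[OF that Q01(2)[of y]] Q01[of y] by (simp add: abs_mult)
      show "integrable (bcube I ?n) (\<lambda>x. (\<Prod>i<?n. (h(k := \<eta>)) i (x i)) * U x)"
	by (rule *[OF \<psi>m U(1)]) (unfold \<psi>, rule le1[OF \<eta>_bd])
      show "integrable (bcube I ?n) (\<lambda>x. ?\<phi> x * G x)"
	by (rule *[OF hm G(1)]) (unfold \<phi>, rule le1[OF \<theta>_bd])
    qed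
    have "(\<integral>x. ?\<Phi> x * R x \<partial>bcube I ?n) = (\<integral>y. \<integral>t. ?\<Phi> (?ins y t) * R (?ins y t) \<partial>edge \<partial>bcube I m)"
      by (rule integral_insert_coord(3)[OF k \<Phi>R])
    also have "\<dots> = (\<integral>y. \<integral>t. (\<Prod>i<?n. (h(k := \<eta>)) i (?ins y t i)) * U (?ins y t) + ?\<phi> (?ins y t) * G (?ins y t) \<partial>edge \<partial>bcube I m)"
    proof (rule integral_cong_AE)
      show "AE y in bcube I m. (\<integral>t. ?\<Phi> (?ins y t) * R (?ins y t) \<partial>edge)
	  = (\<integral>t. (\<Prod>i<?n. (h(k := \<eta>)) i (?ins y t i)) * U (?ins y t) + ?\<phi> (?ins y t) * G (?ins y t) \<partial>edge)"
	using integral_insert_coord(2)[OF k U(1)] integral_insert_coord(2)[OF k G(1)]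
	  integral_insert_coord(2)[OF k Gpi] AE_space
      proof eventually_elim
	case (elim y)
	note Uy = elim(1) and Gy = elim(2) and Gpy = elim(3)
	have Vy: "integrable edge (\<lambda>t. V (?ins y t))"
	  unfolding V_def using Uy Gpy by (rule Bochner_Integration.integrable_diff)
	have Rins: "R (?ins y t) = V (?ins y t) - \<kappa> y" for t
	  unfolding R_def del_ins[OF elim(4)] ..
	have bV: "integrable edge (\<lambda>t. b t * V (?ins y t))" unfolding b_def by (rule bump_int[OF Vy])
	have \<beta>Vy: "integrable edge (\<lambda>t. \<beta> t * V (?ins y t))" unfolding \<beta>_def by (rule bump_int[OF Vy])
	have "(\<integral>t. ?\<Phi> (?ins y t) * R (?ins y t) \<partial>edge) = (\<integral>t. Q y * (b t * V (?ins y t) - \<kappa> y * b t) \<partial>edge)"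
	  unfolding \<Phi> Rins by (simp add: algebra_simps)
	also have "\<dots> = Q y * ((\<integral>t. b t * V (?ins y t) \<partial>edge) - \<kappa> y * w)"
	  using bV bump_int1 unfolding w_def b_def by simp
	also have "(\<integral>t. b t * V (?ins y t) \<partial>edge) - \<kappa> y * w
	    = (\<integral>t. b t * V (?ins y t) \<partial>edge) + (- (w / w0)) * (\<integral>t. \<beta> t * V (?ins y t) \<partial>edge)"
	  by (simp add: \<kappa>_def)
	also have "\<dots> = (\<integral>t. b t * V (?ins y t) + (- (w / w0)) * (\<beta> t * V (?ins y t)) \<partial>edge)"
	  using bV \<beta>Vy by (subst Bochner_Integration.integral_add) auto
	also have "\<dots> = (\<integral>t. \<eta> t * U (?ins y t) - \<eta> t * Gp (?ins y t) \<partial>edge)"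
	  by (intro Bochner_Integration.integral_cong refl) (simp add: \<eta>_def V_def algebra_simps)
	also have "\<dots> = (\<integral>t. \<eta> t * U (?ins y t) \<partial>edge) - (\<integral>t. \<eta> t * Gp (?ins y t) \<partial>edge)"
	  by (intro Bochner_Integration.integral_diff \<eta>_int Uy Gpy)
	also have "(\<integral>t. \<eta> t * Gp (?ins y t) \<partial>edge) = (\<integral>t. \<eta> t * (\<integral>s. indicator {..t} s * G (?ins y s) \<partial>edge) \<partial>edge)"
	  unfolding Gp_def del_ins[OF elim(4)] ins_k ..
	also have "\<dots> = (\<integral>s. G (?ins y s) * (\<integral>t. \<eta> t * indicator {s..} t \<partial>edge) \<partial>edge)"
	  by (rule integral_primitive_swap[OF Gy \<eta>m \<eta>_bd])
	also have "\<dots> = - (\<integral>s. \<theta> s * G (?ins y s) \<partial>edge)"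
	  unfolding \<theta>_edge by (simp add: mult.commute)
	finally have main: "(\<integral>t. ?\<Phi> (?ins y t) * R (?ins y t) \<partial>edge)
	    = Q y * ((\<integral>t. \<eta> t * U (?ins y t) \<partial>edge) + (\<integral>s. \<theta> s * G (?ins y s) \<partial>edge))" by simp
	have \<theta>G: "integrable edge (\<lambda>s. \<theta> s * G (?ins y s))"
	proof (rule Bochner_Integration.integrable_bound)
	  show "integrable edge (\<lambda>s. (1 + \<bar>w / w0\<bar>) * G (?ins y s))" using Gy by simp
	  have "\<theta> \<in> borel_measurable edge" by (rule measurable_restrict_space1) (use smooth_real_borel[OF \<theta>] in simp)
	  then show "(\<lambda>s. \<theta> s * G (?ins y s)) \<in> borel_measurable edge" using Gy by auto
	  show "AE s in edge. norm (\<theta> s * G (?ins y s)) \<le> norm ((1 + \<bar>w / w0\<bar>) * G (?ins y s))"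
	    using \<theta>_bd by (intro AE_I2) (simp add: abs_mult mult_right_mono)
	qed
	have "(\<integral>t. (\<Prod>i<?n. (h(k := \<eta>)) i (?ins y t i)) * U (?ins y t) + ?\<phi> (?ins y t) * G (?ins y t) \<partial>edge)
	    = (\<integral>t. Q y * (\<eta> t * U (?ins y t) + \<theta> t * G (?ins y t)) \<partial>edge)"
	  unfolding \<phi> \<psi> by (simp add: algebra_simps)
	also have "\<dots> = Q y * ((\<integral>t. \<eta> t * U (?ins y t) \<partial>edge) + (\<integral>s. \<theta> s * G (?ins y s) \<partial>edge))"
	  using \<eta>_int[OF Uy] \<theta>G by (simp add: Bochner_Integration.integral_add)
	finally show ?case unfolding main ..
      qed
      show "(\<lambda>y. \<integral>t. ?\<Phi> (?ins y t) * R (?ins y t) \<partial>edge) \<in> borel_measurable (bcube I m)"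
	using integral_insert_coord(1)[OF k \<Phi>R] by (rule borel_measurable_integrable)
      show "(\<lambda>y. \<integral>t. (\<Prod>i<?n. (h(k := \<eta>)) i (?ins y t i)) * U (?ins y t) + ?\<phi> (?ins y t) * G (?ins y t) \<partial>edge) \<in> borel_measurable (bcube I m)"
	using integral_insert_coord(1)[OF k Bochner_Integration.integrable_add[OF \<psi>U \<phi>G]] by (rule borel_measurable_integrable)
    qed
    also have "\<dots> = (\<integral>x. (\<Prod>i<?n. (h(k := \<eta>)) i (x i)) * U x + ?\<phi> x * G x \<partial>bcube I ?n)"
      by (rule integral_insert_coord(3)[OF k Bochner_Integration.integrable_add[OF \<psi>U \<phi>G], symmetric])
    also have "\<dots> = (\<integral>x. (\<Prod>i<?n. (h(k := \<eta>)) i (x i)) * U x \<partial>bcube I ?n) + (\<integral>x. ?\<phi> x * G x \<partial>bcube I ?n)"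
      by (rule Bochner_Integration.integral_add[OF \<psi>U \<phi>G])
    also have "\<dots> = 0"
    proof -
      have um: "u \<in> borel_measurable (cube I ?n)" "g k \<in> borel_measurable (cube I ?n)"
	by (rule locally_integrableD(1)[OF is_weak_gradientD(1)[OF wg]], rule locally_integrableD(1)[OF is_weak_gradientD(2)[OF wg kn]])
      have cm: "\<gamma> \<in> borel_measurable (cube I ?n)" if "\<gamma> \<in> borel_measurable (bcube I ?n)" for \<gamma> :: "(nat \<Rightarrow> real) \<Rightarrow> real"
	unfolding cube_eq using that by (rule measurable_completion)
      have "(\<integral>x. u x * partial_deriv k ?\<phi> x \<partial>cube I ?n) = (\<integral>x. (\<Prod>i<?n. (h(k := \<eta>)) i (x i)) * U x \<partial>bcube I ?n)"
	unfolding pd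
      proof (rule integral_cube_cong(1))
	show "(\<lambda>x. u x * (\<Prod>i<?n. (h(k := \<eta>)) i (x i))) \<in> borel_measurable (cube I ?n)"
	  by (intro borel_measurable_times um cm \<psi>m)
	show "(\<lambda>x. (\<Prod>i<?n. (h(k := \<eta>)) i (x i)) * U x) \<in> borel_measurable (bcube I ?n)"
	  by (intro borel_measurable_times \<psi>m Um)
	show "AE x in bcube I ?n. u x * (\<Prod>i<?n. (h(k := \<eta>)) i (x i)) = (\<Prod>i<?n. (h(k := \<eta>)) i (x i)) * U x"
	  using U(2) by eventually_elim (simp only: mult.commute)
      qed
      moreover have "(\<integral>x. g k x * ?\<phi> x \<partial>cube I ?n) = (\<integral>x. ?\<phi> x * G x \<partial>bcube I ?n)"
      proof (rule integral_cube_cong(1))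
	show "(\<lambda>x. g k x * ?\<phi> x) \<in> borel_measurable (cube I ?n)" by (intro borel_measurable_times um cm hm)
	show "(\<lambda>x. ?\<phi> x * G x) \<in> borel_measurable (bcube I ?n)" by (intro borel_measurable_times hm Gm)
	show "AE x in bcube I ?n. g k x * ?\<phi> x = ?\<phi> x * G x"
	  using G(2) by eventually_elim (simp only: mult.commute)
      qed
      ultimately show ?thesis using is_weak_gradientD(3)[OF wg kn test] by simp
    qed
    finally show "(\<integral>x. ?\<Phi> x * R x \<partial>bcube I ?n) = 0" .
  qed
  then have "AE x in bcube I ?n. U x = \<kappa> (?del x) + (\<integral>s. indicator {..x k} s * G (?ins (?del x) s) \<partial>edge)"
    by eventually_elim (simp add: R_def V_def Gp_def)
  then show ?thesis by blast
qed

end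

section \<open>Oscillation along lines\<close>

context unit_edge
begin

lemma AE_edge_neq: "AE s in edge. s \<noteq> c"
proof -
  have "AE s in lborel. s \<noteq> (c::real)" by (rule AE_lborel_singleton)
  then show ?thesis using sets_I by (subst AE_restrict_space_iff) auto
qed

lemma primitive_continuous:
  fixes g :: "real \<Rightarrow> real"
  assumes g: "integrable edge g"
  shows "continuous_on UNIV (\<lambda>t. K + (\<integral>s. indicator {..t} s * g s \<partial>edge))"
proof (rule continuous_at_imp_continuous_on, rule ballI)
  fix t :: real
  have gm: "g \<in> borel_measurable edge" using g by (rule borel_measurable_integrable)
  have im: "(\<lambda>s. indicator {..t'} s * g s) \<in> borel_measurable edge" for t' :: real
    by (intro borel_measurable_times gm measurable_restrict_space1) simp
  have "(\<lambda>n. \<integral>s. indicator {..x n} s * g s \<partial>edge) \<longlonglongrightarrow> (\<integral>s. indicator {..t} s * g s \<partial>edge)"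
    if x: "x \<longlonglongrightarrow> t" for x
  proof (rule integral_dominated_convergence[where w="\<lambda>s. \<bar>g s\<bar>"])
    show "integrable edge (\<lambda>s. \<bar>g s\<bar>)" using g by simp
    show "AE s in edge. (\<lambda>n. indicator {..x n} s * g s) \<longlonglongrightarrow> indicator {..t} s * g s"
      using AE_edge_neq[of t]
    proof eventually_elim
      case (elim s)
      have "\<forall>\<^sub>F n in sequentially. indicator {..x n} s * g s = indicator {..t} s * g s"
      proof (cases "s < t")
	case True
	have "\<forall>\<^sub>F n in sequentially. s < x n" by (rule order_tendstoD(1)[OF x True])
	then show ?thesis by eventually_elim (use True in simp)
      next
	case False
	then have "\<forall>\<^sub>F n in sequentially. x n < s" using elim by (intro order_tendstoD(2)[OF x]) simp
	then show ?thesis by eventually_elim (use False elim in simp)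
      qed
      then show ?case by (rule tendsto_eventually)
    qed
    show "AE s in edge. norm (indicator {..x n} s * g s) \<le> \<bar>g s\<bar>" for n
      by (intro AE_I2) (simp add: indicator_def)
  qed (rule im)+
  then show "isCont (\<lambda>t. K + (\<integral>s. indicator {..t} s * g s \<partial>edge)) t"
    unfolding continuous_at_sequentially comp_def by (auto intro: tendsto_add[OF tendsto_const])
qed

text \<open>
  The open interval is sufficient because a line has no atoms. At its end points a level under
  consideration may be attained.
\<close>

lemma primitive_increment:
  fixes g :: "real \<Rightarrow> real" and K :: real
  assumes g: "integrable edge g"
  defines "V \<equiv> \<lambda>t. K + (\<integral>s. indicator {..t} s * g s \<partial>edge)"
  shows "ennreal \<bar>V p - V q\<bar> \<le> (\<integral>\<^sup>+ s. ennreal \<bar>g s\<bar> * indicator {min p q<..<max p q} s \<partial>edge)"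
proof -
  have gm: "g \<in> borel_measurable edge" using g by (rule borel_measurable_integrable)
  have ind: "(\<lambda>s. indicator S s) \<in> borel_measurable edge" if "S \<in> sets borel" for S :: "real set"
    by (rule measurable_restrict_space1) (use that in simp)
  have ordered: "ennreal \<bar>V p - V q\<bar> \<le> (\<integral>\<^sup>+ s. ennreal \<bar>g s\<bar> * indicator {q<..<p} s \<partial>edge)" if "q \<le> p" for p q
  proof -
    have i: "integrable edge (\<lambda>s. indicator S s * g s)" if "S \<in> sets borel" for S :: "real set"
    proof (rule Bochner_Integration.integrable_bound[OF g])
      show "(\<lambda>s. indicator S s * g s) \<in> borel_measurable edge"
      proof (rule borel_measurable_times[OF _ gm])
	show "(\<lambda>s. indicator S s) \<in> borel_measurable edge"
	  by (rule measurable_restrict_space1) (use that in simp)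
      qed
    qed (auto simp: indicator_def)
    have "V p - V q = (\<integral>s. indicator {..p} s * g s - indicator {..q} s * g s \<partial>edge)"
      unfolding V_def using i by (subst Bochner_Integration.integral_diff) auto
    also have "\<dots> = (\<integral>s. indicator {q<..p} s * g s \<partial>edge)"
      using that by (intro Bochner_Integration.integral_cong refl) (auto simp: indicator_def)
    finally have "ennreal \<bar>V p - V q\<bar> \<le> ennreal (\<integral>s. \<bar>indicator {q<..p} s * g s\<bar> \<partial>edge)"
      by (simp only: ennreal_leI integral_abs_bound)
    also have "\<dots> = (\<integral>\<^sup>+ s. ennreal \<bar>indicator {q<..p} s * g s\<bar> \<partial>edge)"
      using i by (intro nn_integral_eq_integral[symmetric]) auto
    also have "\<dots> \<le> (\<integral>\<^sup>+ s. ennreal \<bar>g s\<bar> * indicator {q<..<p} s \<partial>edge)"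
    by (rule nn_integral_mono_AE, use AE_edge_neq[of p] in eventually_elim) (auto simp: indicator_def)
    finally show ?thesis .
  qed
  show ?thesis
  proof (cases "q \<le> p")
    case True
    then show ?thesis using ordered[OF True] by (simp add: min_absorb2 max_absorb1)
  next
    case False
    then show ?thesis using ordered[of p q] by (simp add: min_absorb1 max_absorb2 abs_minus_commute)
  qed
qed

text \<open>
  Where \<open>\<bar>v\<bar>\<close> exceeds the level \<open>\<lambda>\<close>, its excess accumulates between the point in question and the
  nearest point at which the level is attained, hence only over the part of the line where the level
  is exceeded. If no such point exists, the whole line lies in that part, and \<open>v\<close> is compared with its
  mean.
\<close>

lemma line_excess:
  fixes g v :: "real \<Rightarrow> real"
  assumes g: "integrable edge g" and l: "0 \<le> l"
    and v: "AE t in edge. v t = K + (\<integral>s. indicator {..t} s * g s \<partial>edge)"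
  shows "AE t in edge. ennreal \<bar>v t\<bar> \<le> ennreal l
    + (\<integral>\<^sup>+ s. ennreal (\<bar>g s\<bar> + \<bar>v s\<bar>) * indicator {s. l < \<bar>v s\<bar>} s \<partial>edge)"
proof -
  define V where "V t = K + (\<integral>s. indicator {..t} s * g s \<partial>edge)" for t
  define J where "J = (\<integral>\<^sup>+ s. ennreal (\<bar>g s\<bar> + \<bar>V s\<bar>) * indicator {s. l < \<bar>V s\<bar>} s \<partial>edge)"
  have vV: "AE t in edge. v t = V t" using v by (simp add: V_def)
  have gm[measurable]: "g \<in> borel_measurable edge" using g by (rule borel_measurable_integrable)
  have V: "continuous_on S V" for S
    unfolding V_def[abs_def] by (rule continuous_on_subset[OF primitive_continuous[OF g] subset_UNIV])
  have Vm[measurable]: "V \<in> borel_measurable edge"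
    by (rule measurable_restrict_space1) (use borel_measurable_continuous_onI[OF V] in simp)
  have inc: "ennreal \<bar>V p - V q\<bar> \<le> (\<integral>\<^sup>+ s. ennreal \<bar>g s\<bar> * indicator {min p q<..<max p q} s \<partial>edge)" for p q
    unfolding V_def by (rule primitive_increment[OF g])
  have main: "ennreal \<bar>V t\<bar> \<le> ennreal l + J" if t: "t \<in> {a..a+1}" for t
  proof (cases "\<bar>V t\<bar> \<le> l")
    case True
    then have "ennreal \<bar>V t\<bar> \<le> ennreal l" by (rule ennreal_leI)
    also have "\<dots> \<le> ennreal l + J" by simp
    finally show ?thesis .
  next
    case False
    define F where "F = {a..a+1} \<inter> (\<lambda>s. \<bar>V s\<bar>) -` {..l}"
    have "continuous_on {a..a+1} (\<lambda>s. \<bar>V s\<bar>)" by (intro continuous_intros V)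
    then have F: "closed F" unfolding F_def
      by (rule continuous_closed_preimage) auto
    show ?thesis
    proof (cases "F = {}")
      case False
      then obtain q where q: "q \<in> F" "\<And>s. s \<in> F \<Longrightarrow> dist t q \<le> dist t s"
	using distance_attains_inf[OF F] by metis
      have out: "l < \<bar>V s\<bar>" if s: "s \<in> {min t q<..<max t q}" for s
      proof (rule ccontr)
	assume "\<not> l < \<bar>V s\<bar>"
	moreover have "s \<in> {a..a+1}" using s t q(1) unfolding F_def by (auto simp: min_def max_def split: if_splits)
	ultimately have "s \<in> F" unfolding F_def by simp
	from q(2)[OF this] show False using s by (auto simp: dist_real_def min_def max_def split: if_splits)
      qed
      have "\<bar>V q\<bar> \<le> l" using q(1) unfolding F_def by simp
      then have "\<bar>V t\<bar> \<le> l + \<bar>V t - V q\<bar>" by linarith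
      then have "ennreal \<bar>V t\<bar> \<le> ennreal l + ennreal \<bar>V t - V q\<bar>"
	using l by (simp add: ennreal_plus[symmetric] ennreal_leI del: ennreal_plus)
      also have "ennreal \<bar>V t - V q\<bar> \<le> J"
      proof (rule order_trans[OF inc], unfold J_def, rule nn_integral_mono)
	fix s
	show "ennreal \<bar>g s\<bar> * indicator {min t q<..<max t q} s \<le> ennreal (\<bar>g s\<bar> + \<bar>V s\<bar>) * indicator {s. l < \<bar>V s\<bar>} s"
	proof (cases "s \<in> {min t q<..<max t q}")
	  case True
	  then show ?thesis using out[OF True] by (simp add: ennreal_leI)
	qed simp
      qed
      finally show ?thesis by (simp add: add_left_mono)
    next
      case True
      have J: "J = (\<integral>\<^sup>+ s. ennreal \<bar>g s\<bar> \<partial>edge) + (\<integral>\<^sup>+ s. ennreal \<bar>V s\<bar> \<partial>edge)"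
      proof -
	have "J = (\<integral>\<^sup>+ s. ennreal \<bar>g s\<bar> + ennreal \<bar>V s\<bar> \<partial>edge)"
	  unfolding J_def
	proof (rule nn_integral_cong)
	  fix s assume "s \<in> space edge"
	  then have "s \<in> {a..a+1}" using subset_closure by auto
	  then have "l < \<bar>V s\<bar>" using True unfolding F_def by (auto simp: not_le)
	  then show "ennreal (\<bar>g s\<bar> + \<bar>V s\<bar>) * indicator {s. l < \<bar>V s\<bar>} s = ennreal \<bar>g s\<bar> + ennreal \<bar>V s\<bar>"
	    by simp
	qed
	then show ?thesis by (simp add: nn_integral_add)
      qed
      have "ennreal \<bar>V t\<bar> = (\<integral>\<^sup>+ s. ennreal \<bar>V t\<bar> \<partial>edge)" using edge.emeasure_space_1 by simp
      also have "\<dots> \<le> (\<integral>\<^sup>+ s. (\<integral>\<^sup>+ r. ennreal \<bar>g r\<bar> \<partial>edge) + ennreal \<bar>V s\<bar> \<partial>edge)"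
      proof (rule nn_integral_mono)
	fix s
	have "\<bar>V t\<bar> \<le> \<bar>V t - V s\<bar> + \<bar>V s\<bar>" by simp
	then have "ennreal \<bar>V t\<bar> \<le> ennreal \<bar>V t - V s\<bar> + ennreal \<bar>V s\<bar>"
	  by (simp add: ennreal_plus[symmetric] ennreal_leI del: ennreal_plus)
	also have "\<dots> \<le> (\<integral>\<^sup>+ r. ennreal \<bar>g r\<bar> \<partial>edge) + ennreal \<bar>V s\<bar>"
	proof (rule add_right_mono, rule order_trans[OF inc], rule nn_integral_mono)
	  show "ennreal \<bar>g r\<bar> * indicator {min t s<..<max t s} r \<le> ennreal \<bar>g r\<bar>" for r
	    by (simp add: indicator_def)
	qed
	finally show "ennreal \<bar>V t\<bar> \<le> (\<integral>\<^sup>+ r. ennreal \<bar>g r\<bar> \<partial>edge) + ennreal \<bar>V s\<bar>" .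
      qed
      also have "\<dots> = J" unfolding J using edge.emeasure_space_1 by (simp add: nn_integral_add)
      also have "\<dots> \<le> ennreal l + J" by simp
      finally show ?thesis .
    qed
  qed
  have "J = (\<integral>\<^sup>+ s. ennreal (\<bar>g s\<bar> + \<bar>v s\<bar>) * indicator {s. l < \<bar>v s\<bar>} s \<partial>edge)"
    unfolding J_def
  by (rule nn_integral_cong_AE, use vV in eventually_elim) (simp add: indicator_def)
  moreover have "AE t in edge. ennreal \<bar>v t\<bar> \<le> ennreal l + J"
    using vV AE_space
  proof eventually_elim
    case (elim t)
    then have "t \<in> {a..a+1}" using subset_closure by auto
    then show ?case using main elim by simp
  qed
  ultimately show ?thesis by simp
qed

section \<open>Section norms\<close>

lemma measurable_completion_AE:
  assumes f': "f' \<in> measurable N K" and AE: "AE x in N. f x = f' x" and sp: "\<And>x. x \<in> space N \<Longrightarrow> f x \<in> space K"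
  shows "f \<in> measurable (completion N) K"
proof (rule measurableI)
  fix A assume A: "A \<in> sets K"
  have 1: "{x \<in> space (completion N). f' x \<in> A} \<in> sets (completion N)"
    using measurable_sets[OF measurable_completion[OF f'] A] by (simp add: vimage_def Int_def conj_commute)
  have 2: "{x \<in> space (completion N). f x \<noteq> f' x \<and> Q x} \<in> sets (completion N)" for Q
  proof -
    have "AE x in N. \<not> (f x \<noteq> f' x \<and> Q x)" using AE by eventually_elim simp
    from sets_completion_AE[OF this] show ?thesis by (simp add: pred_def)
  qed
  have "f -` A \<inter> space (completion N)
      = ({x \<in> space (completion N). f' x \<in> A} - {x \<in> space (completion N). f x \<noteq> f' x \<and> True})
	\<union> {x \<in> space (completion N). f x \<noteq> f' x \<and> f x \<in> A}" by auto
  also have "\<dots> \<in> sets (completion N)" by (intro sets.Un sets.Diff 1 2)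
  finally show "f -` A \<inter> space (completion N) \<in> sets (completion N)" .
qed (use sp in simp)

lemma esssup_completion:
  fixes f :: "'b \<Rightarrow> ennreal"
  assumes "f \<in> borel_measurable N"
  shows "esssup (completion N) f = esssup N f"
  using assms by (simp add: esssup_eq_AE measurable_completion AE_completion_iff)

lemma less_esssup_iff:
  fixes f :: "'b \<Rightarrow> ennreal"
  assumes f: "f \<in> borel_measurable N"
  shows "c < esssup N f \<longleftrightarrow> emeasure N {x \<in> space N. c < f x} \<noteq> 0"
proof
  show "c < esssup N f \<Longrightarrow> emeasure N {x \<in> space N. c < f x} \<noteq> 0"
    using esssup_pos_measure[OF f] by force
  assume "emeasure N {x \<in> space N. c < f x} \<noteq> 0"
  show "c < esssup N f"
  proof (rule ccontr)
    assume "\<not> c < esssup N f"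
    then have "AE x in N. \<not> c < f x" using esssup_AE[of f N] by (auto simp: not_less intro: order_trans)
    then have "emeasure N {x \<in> space N. c < f x} = 0"
      using f by (subst (asm) AE_iff_measurable[OF _ refl]) auto
    then show False using \<open>emeasure N {x \<in> space N. c < f x} \<noteq> 0\<close> by simp
  qed
qed

abbreviation L_inf :: "(real \<Rightarrow> ennreal) \<Rightarrow> ennreal" where "L_inf \<equiv> L_infinity_norm (lebesgue_on I)"

text \<open>
  A section of a Lebesgue measurable function need only be measurable for almost every line. The
  essential suprema of the sections of a Borel representative are nevertheless a Borel function of the
  line, and they agree with the section norms almost everywhere.
\<close>

lemma section_norm_version:
  fixes f :: "(nat \<Rightarrow> real) \<Rightarrow> real"
  assumes f: "f \<in> borel_measurable (cube I (Suc m))" and k: "k \<le> m"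
  shows "\<exists>\<psi>. \<psi> \<in> borel_measurable (bcube I m) \<and>
    (AE y in bcube I m. section_norm (Suc m) k L_inf f y = \<psi> y
       \<and> (AE t in edge. ennreal \<bar>f (insert_coord (Suc m) k y t)\<bar> \<le> \<psi> y)
       \<and> (\<forall>c. (AE t in edge. ennreal \<bar>f (insert_coord (Suc m) k y t)\<bar> \<le> c) \<longrightarrow> \<psi> y \<le> c))"
proof -
  let ?ins = "insert_coord (Suc m) k"
  obtain f' where f': "f' \<in> borel_measurable (bcube I (Suc m))" and ff': "AE x in bcube I (Suc m). f x = f' x"
    using borel_version[OF f] by blast
  define h where "h p = ennreal \<bar>f' (case p of (y, t) \<Rightarrow> ?ins y t)\<bar>" for p
  have h: "h \<in> borel_measurable (bcube I m \<Otimes>\<^sub>M edge)"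
  proof -
    have "(\<lambda>x. ennreal \<bar>f' x\<bar>) \<in> borel_measurable (bcube I (Suc m))" using f' by measurable
    from measurable_compose[OF measurable_insert_coord[OF k] this] show ?thesis unfolding h_def .
  qed
  have hy: "(\<lambda>t. h (y, t)) \<in> borel_measurable edge" if "y \<in> space (bcube I m)" for y
    by (rule measurable_compose[OF measurable_Pair1'[OF that] h])
  define \<psi> where "\<psi> y = esssup edge (\<lambda>t. h (y, t))" for y
  have "\<psi> \<in> borel_measurable (bcube I m)"
  proof (rule borel_measurableI_greater)
    fix c
    have m: "(\<lambda>y. emeasure edge {t \<in> space edge. c < h (y, t)}) \<in> borel_measurable (bcube I m)"
    proof (rule edge.measurable_emeasure)
      have "{p \<in> space (bcube I m \<Otimes>\<^sub>M edge). snd p \<in> {t \<in> space edge. c < h (fst p, t)}}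
	  = {p \<in> space (bcube I m \<Otimes>\<^sub>M edge). c < h p}" by (auto simp: space_pair_measure)
      also have "\<dots> \<in> sets (bcube I m \<Otimes>\<^sub>M edge)" using h by (rule borel_measurable_less[OF borel_measurable_const])
      finally show "{p \<in> space (bcube I m \<Otimes>\<^sub>M edge). snd p \<in> {t \<in> space edge. c < h (fst p, t)}} \<in> sets (bcube I m \<Otimes>\<^sub>M edge)" .
    qed auto
    have "{y \<in> space (bcube I m). c < \<psi> y} = {y \<in> space (bcube I m). emeasure edge {t \<in> space edge. c < h (y, t)} \<noteq> 0}"
      unfolding \<psi>_def using less_esssup_iff[OF hy] by blast
    also have "\<dots> \<in> sets (bcube I m)" by (rule borel_measurable_neq[OF m borel_measurable_const])
    finally show "{y \<in> space (bcube I m). c < \<psi> y} \<in> sets (bcube I m)" .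
  qed
  moreover have "AE y in bcube I m. section_norm (Suc m) k L_inf f y = \<psi> y
       \<and> (AE t in edge. ennreal \<bar>f (?ins y t)\<bar> \<le> \<psi> y)
       \<and> (\<forall>c. (AE t in edge. ennreal \<bar>f (?ins y t)\<bar> \<le> c) \<longrightarrow> \<psi> y \<le> c)"
    using AE_insert_coord[OF k ff'] AE_space
  proof eventually_elim
    case (elim y)
    note hy = hy[OF elim(2)]
    have eq: "AE t in edge. ennreal \<bar>f (?ins y t)\<bar> = h (y, t)"
      using elim(1) by eventually_elim (simp add: h_def)
    have c: "lebesgue_on I = completion edge" by (rule lebesgue_on_eq_completion) (rule sets_I)
    have fm: "(\<lambda>t. ennreal \<bar>f (?ins y t)\<bar>) \<in> borel_measurable (completion edge)"
      by (rule measurable_completion_AE[OF hy eq]) simp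
    have "section_norm (Suc m) k L_inf f y
	= esssup (completion edge) (\<lambda>t. ennreal \<bar>f (?ins y t)\<bar>)"
      unfolding section_norm_def space_norm_def L_infinity_norm_def c ..
    also have "\<dots> = esssup (completion edge) (\<lambda>t. h (y, t))"
      by (rule esssup_AE_cong[OF fm measurable_completion[OF hy] AE_completion[OF eq]])
    also have "\<dots> = \<psi> y" unfolding \<psi>_def by (rule esssup_completion[OF hy])
    finally have 1: "section_norm (Suc m) k L_inf f y = \<psi> y" .
    have 2: "AE t in edge. ennreal \<bar>f (?ins y t)\<bar> \<le> \<psi> y"
      using eq esssup_AE[of "\<lambda>t. h (y, t)" edge] unfolding \<psi>_def by eventually_elim simp
    have 3: "\<psi> y \<le> c" if "AE t in edge. ennreal \<bar>f (?ins y t)\<bar> \<le> c" for c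
    proof -
      have "AE t in edge. h (y, t) \<le> c" using eq that by eventually_elim simp
      then show ?thesis unfolding \<psi>_def by (rule esssup_I[OF hy])
    qed
    show ?case using 1 2 3 by blast
  qed
  ultimately show ?thesis by blast
qed

lemma borel_measurable_section_norm:
  fixes f :: "(nat \<Rightarrow> real) \<Rightarrow> real"
  assumes f: "f \<in> borel_measurable (cube I (Suc m))" and k: "k \<le> m"
  shows "section_norm (Suc m) k L_inf f \<in> borel_measurable (cube I m)"
proof -
  obtain \<psi> where \<psi>: "\<psi> \<in> borel_measurable (bcube I m)"
    and AE: "AE y in bcube I m. section_norm (Suc m) k L_inf f y = \<psi> y
       \<and> (AE t in edge. ennreal \<bar>f (insert_coord (Suc m) k y t)\<bar> \<le> \<psi> y)
       \<and> (\<forall>c. (AE t in edge. ennreal \<bar>f (insert_coord (Suc m) k y t)\<bar> \<le> c) \<longrightarrow> \<psi> y \<le> c)"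
    using section_norm_version[OF assms] by blast
  from AE have "AE y in bcube I m. section_norm (Suc m) k L_inf f y = \<psi> y"
    by eventually_elim blast
  then show ?thesis unfolding cube_eq by (rule measurable_completion_AE[OF \<psi>]) simp
qed

text \<open>
  The bound of the oscillation on almost every line transfers to the essential supremum by its minimality
  among the essential bounds.
\<close>

lemma section_excess:
  fixes u U G :: "(nat \<Rightarrow> real) \<Rightarrow> real"
  assumes k: "k \<le> m" and wg: "is_weak_gradient I (Suc m) u g" and l: "0 \<le> l"
    and U: "integrable (bcube I (Suc m)) U" "AE x in bcube I (Suc m). u x = U x"
    and G: "integrable (bcube I (Suc m)) G" "AE x in bcube I (Suc m). g k x = G x"
    and least: "AE y in bcube I m. \<forall>c. (AE t in edge. ennreal \<bar>u (insert_coord (Suc m) k y t)\<bar> \<le> c) \<longrightarrow> \<psi> y \<le> c"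
  shows "(\<integral>\<^sup>+ y. \<psi> y - ennreal l \<partial>bcube I m)
    \<le> (\<integral>\<^sup>+ x. ennreal (\<bar>G x\<bar> + \<bar>U x\<bar>) * indicator {x. l < \<bar>U x\<bar>} x \<partial>bcube I (Suc m))"
proof -
  let ?ins = "insert_coord (Suc m) k"
  have Um[measurable]: "U \<in> borel_measurable (bcube I (Suc m))" using U(1) by (rule borel_measurable_integrable)
  have Gm[measurable]: "G \<in> borel_measurable (bcube I (Suc m))" using G(1) by (rule borel_measurable_integrable)
  obtain \<kappa> where \<kappa>: "AE x in bcube I (Suc m). U x = \<kappa> (remove_coord m k x)
    + (\<integral>s. indicator {..x k} s * G (?ins (remove_coord m k x) s) \<partial>edge)"
    using weak_derivative_primitive[OF k wg U G] by blast
  have "(\<integral>\<^sup>+ y. \<psi> y - ennreal l \<partial>bcube I m) \<le> (\<integral>\<^sup>+ y. \<integral>\<^sup>+ t. ennreal (\<bar>G (?ins y t)\<bar> + \<bar>U (?ins y t)\<bar>) * indicator {x. l < \<bar>U x\<bar>} (?ins y t) \<partial>edge \<partial>bcube I m)"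
  proof (rule nn_integral_mono_AE)
    show "AE y in bcube I m. \<psi> y - ennreal l
      \<le> (\<integral>\<^sup>+ t. ennreal (\<bar>G (?ins y t)\<bar> + \<bar>U (?ins y t)\<bar>) * indicator {x. l < \<bar>U x\<bar>} (?ins y t) \<partial>edge)"
      using AE_insert_coord[OF k \<kappa>] AE_insert_coord[OF k U(2)] integral_insert_coord(2)[OF k G(1)] least AE_space
    proof eventually_elim
      case (elim y)
      have del: "remove_coord m k (?ins y t) = y" for t
	using elim(5) by (intro remove_coord_insert_coord[OF k]) (simp add: space_bcube PiE_def)
      have "AE t in edge. U (?ins y t) = \<kappa> y + (\<integral>s. indicator {..t} s * G (?ins y s) \<partial>edge)"
	using elim(1) unfolding del insert_coord_same[OF k] .
      from line_excess[OF elim(3) l this]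
      have "AE t in edge. ennreal \<bar>u (?ins y t)\<bar> \<le> ennreal l
	+ (\<integral>\<^sup>+ s. ennreal (\<bar>G (?ins y s)\<bar> + \<bar>U (?ins y s)\<bar>) * indicator {s. l < \<bar>U (?ins y s)\<bar>} s \<partial>edge)"
	using elim(2) by eventually_elim (simp only:)
      then have "\<psi> y \<le> ennreal l + (\<integral>\<^sup>+ s. ennreal (\<bar>G (?ins y s)\<bar> + \<bar>U (?ins y s)\<bar>) * indicator {s. l < \<bar>U (?ins y s)\<bar>} s \<partial>edge)"
	using elim(4) by blast
      then have "\<psi> y - ennreal l \<le> (\<integral>\<^sup>+ s. ennreal (\<bar>G (?ins y s)\<bar> + \<bar>U (?ins y s)\<bar>) * indicator {s. l < \<bar>U (?ins y s)\<bar>} s \<partial>edge)"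
	by (simp add: ennreal_minus_le_iff)
      then show ?case by (simp add: indicator_def)
    qed
  qed
  also have "\<dots> = (\<integral>\<^sup>+ x. ennreal (\<bar>G x\<bar> + \<bar>U x\<bar>) * indicator {x. l < \<bar>U x\<bar>} x \<partial>bcube I (Suc m))"
  proof (rule nn_integral_insert_coord(1)[OF k, symmetric])
    have "(\<lambda>x. ennreal (\<bar>G x\<bar> + \<bar>U x\<bar>) * indicator {x. l < \<bar>U x\<bar>} x) = (\<lambda>x. if l < \<bar>U x\<bar> then ennreal (\<bar>G x\<bar> + \<bar>U x\<bar>) else 0)"
      by auto
    moreover have "(\<lambda>x. if l < \<bar>U x\<bar> then ennreal (\<bar>G x\<bar> + \<bar>U x\<bar>) else 0) \<in> borel_measurable (bcube I (Suc m))" by measurable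
    ultimately show "(\<lambda>x. ennreal (\<bar>G x\<bar> + \<bar>U x\<bar>) * indicator {x. l < \<bar>U x\<bar>} x) \<in> borel_measurable (bcube I (Suc m))"
      by (simp only:)
  qed
  finally show ?thesis .
qed

end

section \<open>Pairing with a function of prescribed level sets\<close>

text \<open>
  An up-set is a closed ray, or an increasing union of countably many closed rays.
\<close>

lemma nn_integral_up_set_le:
  fixes f :: "real \<Rightarrow> ennreal" and S :: "real set"
  assumes f[measurable]: "f \<in> borel_measurable borel" and S: "S \<subseteq> {0..}"
    and up: "\<And>s t. s \<in> S \<Longrightarrow> s \<le> t \<Longrightarrow> t \<in> S"
    and le: "\<And>s. s \<in> S \<Longrightarrow> (\<integral>\<^sup>+ t\<in>{s..}. f t \<partial>lborel) \<le> R"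
  shows "(\<integral>\<^sup>+ t\<in>S. f t \<partial>lborel) \<le> R"
proof (cases "S = {}")
  case False
  define c where "c = Inf S"
  have bdd: "bdd_below S" using S by (meson atLeast_iff bdd_belowI subset_iff)
  have lower: "c \<le> s" if "s \<in> S" for s unfolding c_def using that bdd by (rule cInf_lower)
  have above: "s \<in> S" if "c < s" for s
  proof -
    obtain r where "r \<in> S" "r < s" using cInf_lessD[OF False] \<open>c < s\<close> unfolding c_def by blast
    then show ?thesis using up by (meson less_imp_le)
  qed
  show ?thesis
  proof (cases "c \<in> S")
    case True
    then have "S = {c..}" using lower up by auto
    then show ?thesis using le[OF True] by simp
  next
    case c: False
    have "S = {c<..}" using lower above c by (auto simp: less_le)
    define A where "A i = {c + 1 / real (Suc i)..}" for i
    have UA: "(\<Union>i. A i) = S"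
    proof (intro set_eqI iffI)
      fix s assume "s \<in> (\<Union>i. A i)"
      then obtain i where "c + 1 / real (Suc i) \<le> s" unfolding A_def by auto
      moreover have "0 < 1 / real (Suc i)" by simp
      ultimately have "c < s" by linarith
      then show "s \<in> S" by (rule above)
    next
      fix s assume "s \<in> S"
      then have "0 < s - c" using \<open>S = {c<..}\<close> by simp
      then obtain i where "inverse (real (Suc i)) < s - c" using reals_Archimedean by blast
      then have "c + 1 / real (Suc i) \<le> s" by (simp add: inverse_eq_divide)
      then show "s \<in> (\<Union>i. A i)" unfolding A_def by auto
    qed
    have inc: "incseq A" unfolding A_def by (intro monoI) (auto intro: order_trans[rotated] simp: frac_le)
    have AS: "A i \<in> sets (density lborel f)" for i by (simp add: A_def)
    have "(\<integral>\<^sup>+ t\<in>S. f t \<partial>lborel) = emeasure (density lborel f) (\<Union>i. A i)"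
      unfolding UA using \<open>S = {c<..}\<close> by (subst emeasure_density) auto
    also have "\<dots> = (SUP i. emeasure (density lborel f) (A i))"
      by (rule SUP_emeasure_incseq[symmetric, OF _ inc]) (use AS in blast)
    also have "\<dots> \<le> R"
    proof (rule SUP_least)
      fix i
      have "emeasure (density lborel f) (A i) = (\<integral>\<^sup>+ t\<in>A i. f t \<partial>lborel)"
	by (subst emeasure_density) (auto simp: A_def)
      also have "\<dots> \<le> R" unfolding A_def by (rule le, rule above) simp
      finally show "emeasure (density lborel f) (A i) \<le> R" .
    qed
    finally show ?thesis .
  qed
qed simp

text \<open>
  Layer cake in the value of the averaged rearrangement \<open>A\<close> of \<open>g\<close>: the set of levels \<open>s\<close> at which
  \<open>A (\<mu> s)\<close> exceeds \<open>y\<close> is an up-set because \<open>A\<close> and \<open>\<mu>\<close> decrease, so that the tail estimate applies to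
  it.
\<close>

lemma pairing_le_of_tail_bounds:
  fixes \<mu> :: "real \<Rightarrow> real" and W :: "real \<Rightarrow> ennreal"
  assumes M: "prob_space M" and g[measurable]: "g \<in> borel_measurable M" and \<psi>[measurable]: "\<psi> \<in> borel_measurable M"
    and \<alpha>: "0 < (\<alpha>::real)" and W[measurable]: "W \<in> borel_measurable borel"
    and \<mu>0: "\<And>s. 0 \<le> \<mu> s" and \<mu>: "\<And>s t. 0 \<le> s \<Longrightarrow> s \<le> t \<Longrightarrow> \<mu> t \<le> \<mu> s"
    and \<mu>m[measurable]: "\<mu> \<in> borel_measurable borel"
    and level: "\<And>s. 0 \<le> s \<Longrightarrow> emeasure M {x \<in> space M. ennreal s < \<psi> x} \<le> ennreal (\<mu> s)"
    and tail: "\<And>s. 0 \<le> s \<Longrightarrow> (\<integral>\<^sup>+ t\<in>{s..}. ennreal (\<mu> t) \<partial>lborel)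
	\<le> c * (\<integral>\<^sup>+ t\<in>{0<..<1}. W t * indicator {t. t powr \<alpha> < \<mu> s} t \<partial>lborel)"
  shows "(\<integral>\<^sup>+ x. \<psi> x * g x \<partial>M) \<le> c * (\<integral>\<^sup>+ t\<in>{0<..<1}. W t * max_rearrangement M g (t powr \<alpha>) \<partial>lborel)"
proof -
  interpret prob_space M by fact
  let ?A = "max_rearrangement M g"
  have Am[measurable]: "?A \<in> borel_measurable borel" by (rule borel_measurable_max_rearrangement[OF g])
  define R where "R y = (\<integral>\<^sup>+ t\<in>{0<..<1}. W t * indicator {t. ennreal y < ?A (t powr \<alpha>)} t \<partial>lborel)" for y
  have "(\<integral>\<^sup>+ x. \<psi> x * g x \<partial>M) = (\<integral>\<^sup>+ s\<in>{0..}. (\<integral>\<^sup>+ x. g x * indicator {x. ennreal s < \<psi> x} x \<partial>M) \<partial>lborel)"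
    by (rule nn_integral_layer_cake) fact+
  also have "\<dots> \<le> (\<integral>\<^sup>+ s\<in>{0..}. ennreal (\<mu> s) * ?A (\<mu> s) \<partial>lborel)"
  proof (rule nn_integral_mono)
    fix s
    show "(\<integral>\<^sup>+ x. g x * indicator {x. ennreal s < \<psi> x} x \<partial>M) * indicator {0..} s \<le> (ennreal (\<mu> s) * ?A (\<mu> s)) * indicator {0..} s"
    proof (cases "0 \<le> s")
      case s: True
      have E: "{x \<in> space M. ennreal s < \<psi> x} \<in> sets M" by measurable
      have "(\<integral>\<^sup>+ x. g x * indicator {x. ennreal s < \<psi> x} x \<partial>M) = (\<integral>\<^sup>+ x\<in>{x \<in> space M. ennreal s < \<psi> x}. g x \<partial>M)"
	by (intro nn_integral_cong) (simp add: indicator_def)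
      also have "\<dots> \<le> ennreal (\<mu> s) * ?A (\<mu> s)"
      proof (cases "\<mu> s = 0")
	case True
	then have "{x \<in> space M. ennreal s < \<psi> x} \<in> null_sets M" using level[OF s] E by (auto simp: null_sets_def)
	then show ?thesis by (simp add: nn_integral_null_set)
      next
	case False
	then have p: "0 < \<mu> s" using \<mu>0[of s] by simp
	have "(\<integral>\<^sup>+ x\<in>{x \<in> space M. ennreal s < \<psi> x}. g x \<partial>M) \<le> rearrangement_int M g (\<mu> s)"
	  by (rule set_integral_le_rearrangement_int[OF g E \<mu>0 level[OF s]])
	also have "\<dots> = ennreal (\<mu> s) * ?A (\<mu> s)"
	  unfolding max_rearrangement_eq using p
	  by (simp add: ennreal_times_divide mult.commute[of "ennreal (\<mu> s)"] ennreal_mult_divide_eq)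
	finally show ?thesis .
      qed
      finally show ?thesis using s by simp
    qed simp
  qed
  also have "\<dots> = (\<integral>\<^sup>+ s. ?A (\<mu> s) * (ennreal (\<mu> s) * indicator {0..} s) \<partial>lborel)"
    by (intro nn_integral_cong) (simp add: mult_ac)
  also have "\<dots> = (\<integral>\<^sup>+ y\<in>{0..}. (\<integral>\<^sup>+ s. (ennreal (\<mu> s) * indicator {0..} s) * indicator {s. ennreal y < ?A (\<mu> s)} s \<partial>lborel) \<partial>lborel)"
    by (rule lborel.nn_integral_layer_cake) measurable
  also have "\<dots> \<le> (\<integral>\<^sup>+ y\<in>{0..}. c * R y \<partial>lborel)"
  proof (intro nn_integral_mono mult_right_mono)
    fix y :: real
    \<comment> \<open>Levels with \<open>\<mu> s = 0\<close> are put into the up-set; they do not contribute to the integral.\<close>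
    define S where "S = {s. 0 \<le> s \<and> (\<mu> s = 0 \<or> ennreal y < ?A (\<mu> s))}"
    have "(\<integral>\<^sup>+ s. (ennreal (\<mu> s) * indicator {0..} s) * indicator {s. ennreal y < ?A (\<mu> s)} s \<partial>lborel) \<le> (\<integral>\<^sup>+ s\<in>S. ennreal (\<mu> s) \<partial>lborel)"
      by (intro nn_integral_mono) (auto simp: S_def indicator_def)
    also have "\<dots> \<le> c * R y"
    proof (rule nn_integral_up_set_le)
      show "S \<subseteq> {0..}" unfolding S_def by auto
      show "t \<in> S" if "s \<in> S" "s \<le> t" for s t
      proof -
	have s: "0 \<le> s" and "\<mu> s = 0 \<or> ennreal y < ?A (\<mu> s)" using that(1) by (auto simp: S_def)
	have le: "\<mu> t \<le> \<mu> s" by (rule \<mu>[OF s that(2)])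
	have "\<mu> t = 0 \<or> ennreal y < ?A (\<mu> t)"
	proof (cases "\<mu> t = 0")
	  case False
	  then have p: "0 < \<mu> t" using \<mu>0[of t] by simp
	  then have "ennreal y < ?A (\<mu> s)" using \<open>\<mu> s = 0 \<or> _\<close> le by auto
	  also have "\<dots> \<le> ?A (\<mu> t)" by (rule max_rearrangement_antimono[OF g p le])
	  finally show ?thesis ..
	qed simp
	then show ?thesis using s that(2) by (simp add: S_def)
      qed
      fix s assume "s \<in> S"
      then have s: "0 \<le> s" and alt: "\<mu> s = 0 \<or> ennreal y < ?A (\<mu> s)" by (auto simp: S_def)
      show "(\<integral>\<^sup>+ t\<in>{s..}. ennreal (\<mu> t) \<partial>lborel) \<le> c * R y"
      proof (rule order_trans[OF tail[OF s]], rule mult_left_mono)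
	show "(\<integral>\<^sup>+ t\<in>{0<..<1}. W t * indicator {t. t powr \<alpha> < \<mu> s} t \<partial>lborel) \<le> R y"
	  unfolding R_def
	proof (rule nn_integral_mono)
	  fix t
	  show "W t * indicator {t. t powr \<alpha> < \<mu> s} t * indicator {0<..<1} t \<le> W t * indicator {t. ennreal y < ?A (t powr \<alpha>)} t * indicator {0<..<1} t"
	  proof (cases "0 < t \<and> t powr \<alpha> < \<mu> s")
	    case True
	    then have p: "0 < t powr \<alpha>" by simp
	    then have "ennreal y < ?A (\<mu> s)" using alt True by auto
	    also have "\<dots> \<le> ?A (t powr \<alpha>)" using True by (intro max_rearrangement_antimono[OF g p]) simp
	    finally show ?thesis using True by simp
	  qed auto
	qed
      qed simp
    qed measurable
    finally show "(\<integral>\<^sup>+ s. (ennreal (\<mu> s) * indicator {0..} s) * indicator {s. ennreal y < ?A (\<mu> s)} s \<partial>lborel) \<le> c * R y" .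
  qed simp
  also have "\<dots> = c * (\<integral>\<^sup>+ y\<in>{0..}. R y \<partial>lborel)"
  proof -
    have [measurable]: "R \<in> borel_measurable borel" unfolding R_def[abs_def] by measurable
    show ?thesis by (simp add: mult.assoc nn_integral_cmult)
  qed
  also have "(\<integral>\<^sup>+ y\<in>{0..}. R y \<partial>lborel) = (\<integral>\<^sup>+ y\<in>{0..}. (\<integral>\<^sup>+ t. (W t * indicator {0<..<1} t) * indicator {t. ennreal y < ?A (t powr \<alpha>)} t \<partial>lborel) \<partial>lborel)"
    unfolding R_def by (simp add: mult_ac)
  also have "\<dots> = (\<integral>\<^sup>+ t. ?A (t powr \<alpha>) * (W t * indicator {0<..<1} t) \<partial>lborel)"
    by (rule lborel.nn_integral_layer_cake[symmetric]) measurable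
  also have "\<dots> = (\<integral>\<^sup>+ t\<in>{0<..<1}. W t * ?A (t powr \<alpha>) \<partial>lborel)"
    by (intro nn_integral_cong) (simp add: mult_ac)
  finally show ?thesis .
qed

section \<open>The Sobolev embedding\<close>

lemma one_over_conj_exponent: "0 < m \<Longrightarrow> 1 / conj_exponent (Suc m) = real m / real (Suc m)"
  by (simp add: conj_exponent_def)

context unit_edge
begin

lemma AE_insert_coordI:
  assumes k: "k \<le> m" and B[measurable]: "B \<in> sets (bcube I (Suc m))"
    and AE: "AE y in bcube I m. AE t in edge. insert_coord (Suc m) k y t \<notin> B"
  shows "AE x in bcube I (Suc m). x \<notin> B"
proof -
  have "emeasure (bcube I (Suc m)) B = (\<integral>\<^sup>+ x. indicator B x \<partial>bcube I (Suc m))" by (rule nn_integral_indicator[symmetric]) (rule B)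
  also have "\<dots> = (\<integral>\<^sup>+ y. \<integral>\<^sup>+ t. indicator B (insert_coord (Suc m) k y t) \<partial>edge \<partial>bcube I m)"
    by (rule nn_integral_insert_coord(1)[OF k]) measurable
  also have "\<dots> = (\<integral>\<^sup>+ y. 0 \<partial>bcube I m)"
  proof (rule nn_integral_cong_AE)
    show "AE y in bcube I m. (\<integral>\<^sup>+ t. indicator B (insert_coord (Suc m) k y t) \<partial>edge) = 0"
      using AE
    proof eventually_elim
      case (elim y)
      have "(\<integral>\<^sup>+ t. indicator B (insert_coord (Suc m) k y t) \<partial>edge) = (\<integral>\<^sup>+ t. 0 \<partial>edge)"
	by (rule nn_integral_cong_AE, use elim in eventually_elim) simp
      then show ?case by simp
    qed
  qed
  finally have "B \<in> null_sets (bcube I (Suc m))" using B by (simp add: null_sets_def)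
  then show ?thesis by (rule AE_not_in)
qed

lemma abs_le_gradient_length:
  assumes "k < n"
  shows "\<bar>weak_gradient I n u k x\<bar> \<le> gradient_length I n u x"
proof -
  have "(weak_gradient I n u k x)\<^sup>2 \<le> (\<Sum>i<n. (weak_gradient I n u i x)\<^sup>2)"
    by (rule member_le_sum) (use assms in auto)
  from real_sqrt_le_mono[OF this] show ?thesis by (simp add: gradient_length_def)
qed

lemma weak_gradient_is_weak_gradient:
  "is_weak_gradient I n u g \<Longrightarrow> is_weak_gradient I n u (weak_gradient I n u)"
  unfolding weak_gradient_def by (rule someI[where P="is_weak_gradient I n u"])

lemma function_space_integrable:
  assumes Z: "ri_norm (cube I n) Z" and f: "f \<in> function_space (cube I n) Z"
  shows "integrable (cube I n) f"
proof -
  have bfn: "banach_function_norm (cube I n) Z" using Z by (simp add: ri_norm_def)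
  obtain C :: real where C: "\<And>f. f \<in> borel_measurable (cube I n) \<Longrightarrow> (\<integral>\<^sup>+ x. f x \<partial>cube I n) \<le> ennreal C * Z f"
    using banach_function_normD(6)[OF bfn] by blast
  have fm: "f \<in> borel_measurable (cube I n)" and fin: "Z (\<lambda>x. ennreal \<bar>f x\<bar>) < \<infinity>"
    using f by (auto simp: function_space_def space_norm_def)
  have "(\<integral>\<^sup>+ x. ennreal \<bar>f x\<bar> \<partial>cube I n) \<le> ennreal C * Z (\<lambda>x. ennreal \<bar>f x\<bar>)"
    by (rule C) (use fm in measurable)
  also have "\<dots> < \<infinity>" using fin by (simp add: ennreal_mult_less_top less_top)
  finally show ?thesis using fm by (simp add: integrable_iff_bounded)
qed

text \<open>
  If \<open>\<bar>u\<bar>\<close> exceeds \<open>s\<close> on a set \<open>E\<close>, the projections of \<open>E\<close> lie in the level sets of the section norms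
  \<open>\<psi>\<^sub>j\<close>, whose total measure \<open>\<mu> s\<close> therefore controls the measure of \<open>E\<close> by the Loomis--Whitney
  inequality. Conversely, the tail of \<open>\<mu>\<close> beyond \<open>s\<close> is the total excess of the \<open>\<psi>\<^sub>j\<close> over \<open>s\<close>, which is
  at most the integral of \<open>\<bar>u\<bar> + \<bar>\<nabla>u\<bar>\<close> over \<open>E\<close>, line by line.
\<close>

lemma sobolev_section_bound:
  assumes m: "0 < m" and Z: "ri_norm (cube I (Suc m)) Z" and u: "u \<in> sobolev_space I (Suc m) Z" and k: "k \<le> m"
  shows "optimal_norm I (Suc m) Z (section_norm (Suc m) k L_inf u)
    \<le> ennreal (real (Suc m)) * sobolev_norm I (Suc m) Z u"
proof -
  let ?n = "Suc m" let ?\<psi> = "\<lambda>j. section_norm (Suc m) j L_inf u"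
  let ?g = "weak_gradient I ?n u"
  let ?\<zeta> = "luxemburg_rep (cube I ?n) Z"
  define \<alpha> where "\<alpha> = real m / real ?n"
  have \<alpha>: "0 < \<alpha>" using m by (simp add: \<alpha>_def)
  interpret Bm: prob_space "bcube I m" by (rule prob_space_bcube)
  interpret Bn: prob_space "bcube I ?n" by (rule prob_space_bcube)
  interpret Cm: prob_space "cube I m" by (rule prob_space_cube)
  interpret Cn: prob_space "cube I ?n" by (rule prob_space_cube)
  have bfn: "banach_function_norm (cube I ?n) Z" using Z by (simp add: ri_norm_def)
  have ufs: "u \<in> function_space (cube I ?n) Z" and gfs: "gradient_length I ?n u \<in> function_space (cube I ?n) Z"
    and wg: "is_weak_gradient I ?n u ?g"
    using u weak_gradient_is_weak_gradient by (auto simp: sobolev_space_def)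
  have um[measurable]: "u \<in> borel_measurable (cube I ?n)"
    and glm[measurable]: "gradient_length I ?n u \<in> borel_measurable (cube I ?n)"
    using ufs gfs by (auto simp: function_space_def)
  have ui: "integrable (cube I ?n) u" and gli: "integrable (cube I ?n) (gradient_length I ?n u)"
    by (rule function_space_integrable[OF Z ufs], rule function_space_integrable[OF Z gfs])
  obtain U where Um: "U \<in> borel_measurable (bcube I ?n)" and uU: "AE x in bcube I ?n. u x = U x"
    using borel_version[OF um] by blast
  have Ui: "integrable (bcube I ?n) U" using integral_cube_cong(2)[OF um Um uU] ui by simp
  have "\<exists>G. integrable (bcube I ?n) G \<and> (AE x in bcube I ?n. ?g j x = G x)" if j: "j \<le> m" for j
  proof -
    have gm: "?g j \<in> borel_measurable (cube I ?n)"
      using locally_integrableD(1)[OF is_weak_gradientD(2)[OF wg]] j by simp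
    have gi: "integrable (cube I ?n) (?g j)"
    proof (rule Bochner_Integration.integrable_bound[OF gli gm])
      show "AE x in cube I ?n. norm (?g j x) \<le> norm (gradient_length I ?n u x)"
	using abs_le_gradient_length[of j ?n u] j by (intro AE_I2) (simp, meson abs_ge_self le_imp_less_Suc order_trans)
    qed
    obtain G where G: "G \<in> borel_measurable (bcube I ?n)" "AE x in bcube I ?n. ?g j x = G x"
      using borel_version[OF gm] by blast
    have "integrable (bcube I ?n) G" using integral_cube_cong(2)[OF gm G] gi by simp
    then show ?thesis using G(2) by blast
  qed
  then obtain G where G: "\<And>j. j \<le> m \<Longrightarrow> integrable (bcube I ?n) (G j)"
      "\<And>j. j \<le> m \<Longrightarrow> AE x in bcube I ?n. ?g j x = G j x" by metis
  define Q where "Q j \<psi> \<longleftrightarrow> \<psi> \<in> borel_measurable (bcube I m) \<and>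
    (AE y in bcube I m. ?\<psi> j y = \<psi> y
       \<and> (AE t in edge. ennreal \<bar>u (insert_coord ?n j y t)\<bar> \<le> \<psi> y)
       \<and> (\<forall>c. (AE t in edge. ennreal \<bar>u (insert_coord ?n j y t)\<bar> \<le> c) \<longrightarrow> \<psi> y \<le> c))" for j \<psi>
  have "\<forall>j. \<exists>\<psi>. j \<le> m \<longrightarrow> Q j \<psi>"
    using section_norm_version[OF um] unfolding Q_def[symmetric] by blast
  from choice[OF this] obtain \<psi> where \<psi>Q: "\<forall>j. j \<le> m \<longrightarrow> Q j (\<psi> j)" by (rule exE)
  have \<psi>m: "\<psi> j \<in> borel_measurable (bcube I m)" if "j \<le> m" for j
    using \<psi>Q[rule_format, OF that] unfolding Q_def by (rule conjunct1)
  have \<psi>: "AE y in bcube I m. ?\<psi> j y = \<psi> j y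
       \<and> (AE t in edge. ennreal \<bar>u (insert_coord ?n j y t)\<bar> \<le> \<psi> j y)
       \<and> (\<forall>c. (AE t in edge. ennreal \<bar>u (insert_coord ?n j y t)\<bar> \<le> c) \<longrightarrow> \<psi> j y \<le> c)" if "j \<le> m" for j
    using \<psi>Q[rule_format, OF that] unfolding Q_def by (rule conjunct2)
  have \<psi>1: "AE y in bcube I m. ?\<psi> j y = \<psi> j y" if "j \<le> m" for j
    using \<psi>[OF that] by eventually_elim blast
  have \<psi>2: "AE y in bcube I m. AE t in edge. ennreal \<bar>u (insert_coord ?n j y t)\<bar> \<le> \<psi> j y" if "j \<le> m" for j
    using \<psi>[OF that] by eventually_elim blast
  have \<psi>3: "AE y in bcube I m. \<forall>c. (AE t in edge. ennreal \<bar>u (insert_coord ?n j y t)\<bar> \<le> c) \<longrightarrow> \<psi> j y \<le> c" if "j \<le> m" for j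
    using \<psi>[OF that] by eventually_elim blast
  define w where "w x = ennreal \<bar>u x\<bar> + ennreal \<bar>gradient_length I ?n u x\<bar>" for x
  have wm: "w \<in> borel_measurable (cube I ?n)" unfolding w_def[abs_def] by measurable
  define P where "P s j = {y \<in> space (bcube I m). ennreal s < \<psi> j y}" for s j
  have P: "P s j \<in> sets (bcube I m)" if "j \<le> m" for s j
    unfolding P_def by (rule borel_measurable_less[OF borel_measurable_const \<psi>m[OF that]])
  define \<mu> where "\<mu> s = (\<Sum>j\<le>m. measure (bcube I m) (P s j))" for s
  have P_dist: "ennreal (measure (bcube I m) (P s j)) = distribution_fun (bcube I m) (\<psi> j) (ennreal s)" for s j
    unfolding distribution_fun_def P_def by (rule Bm.emeasure_eq_measure[symmetric])
  have \<mu>m: "\<mu> \<in> borel_measurable borel"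
  proof -
    have "(\<lambda>s. measure (bcube I m) (P s j)) \<in> borel_measurable borel" if j: "j \<le> m" for j
    proof -
      have "(\<lambda>s. enn2real (distribution_fun (bcube I m) (\<psi> j) (ennreal s))) \<in> borel_measurable borel"
	by (rule measurable_compose[OF measurable_compose[OF measurable_ennreal borel_measurable_distribution_fun[OF \<psi>m[OF j]]]]) measurable
      then show ?thesis unfolding P_dist[symmetric] by simp
    qed
    then show ?thesis unfolding \<mu>_def[abs_def] by (intro borel_measurable_sum) simp
  qed
  have AE_le: "AE x in bcube I ?n. ennreal \<bar>u x\<bar> \<le> \<psi> j (remove_coord m j x)" if j: "j \<le> m" for j
  proof -
    let ?B = "{x \<in> space (bcube I ?n). \<psi> j (remove_coord m j x) < ennreal \<bar>U x\<bar>}"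
    have "AE x in bcube I ?n. x \<notin> ?B"
    proof (rule AE_insert_coordI[OF j])
      show "?B \<in> sets (bcube I ?n)"
	by (rule borel_measurable_less[OF measurable_compose[OF measurable_remove_coord \<psi>m[OF j]]]) (use Um in measurable)
      show "AE y in bcube I m. AE t in edge. insert_coord ?n j y t \<notin> ?B"
	using \<psi>2[OF j] AE_insert_coord[OF j uU] AE_space
      proof eventually_elim
	case (elim y)
	have del: "remove_coord m j (insert_coord ?n j y t) = y" for t
	  using elim(3) by (intro remove_coord_insert_coord[OF j]) (simp add: space_bcube PiE_def)
	show ?case using elim(1,2) by eventually_elim (simp add: del not_less)
      qed
    qed
    then show ?thesis using uU AE_space by eventually_elim (simp add: not_less)
  qed
  have tail: "(\<integral>\<^sup>+ t\<in>{s..}. ennreal (\<mu> t) \<partial>lborel)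
      \<le> ennreal (real ?n) * (\<integral>\<^sup>+ t\<in>{0<..<1}. rearrangement (cube I ?n) w t * indicator {t. t powr \<alpha> < \<mu> s} t \<partial>lborel)"
    if s: "0 \<le> s" for s
  proof -
    define E where "E = {x \<in> space (cube I ?n). s < \<bar>u x\<bar>}"
    have E: "E \<in> sets (cube I ?n)" unfolding E_def by measurable
    define T where "T = measure (cube I ?n) E"
    have excess: "(\<integral>\<^sup>+ t\<in>{s..}. ennreal (measure (bcube I m) (P t j)) \<partial>lborel) \<le> (\<integral>\<^sup>+ x\<in>E. w x \<partial>cube I ?n)"
      if j: "j \<le> m" for j
    proof -
      have "(\<integral>\<^sup>+ t\<in>{s..}. ennreal (measure (bcube I m) (P t j)) \<partial>lborel) = (\<integral>\<^sup>+ y. \<psi> j y - ennreal s \<partial>bcube I m)"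
	unfolding P_dist by (rule Bm.nn_integral_excess[symmetric, OF \<psi>m[OF j] s])
      also have "\<dots> \<le> (\<integral>\<^sup>+ x. ennreal (\<bar>G j x\<bar> + \<bar>U x\<bar>) * indicator {x. s < \<bar>U x\<bar>} x \<partial>bcube I ?n)"
	by (rule section_excess[OF j wg s Ui uU G[OF j] \<psi>3[OF j]])
      also have "\<dots> \<le> (\<integral>\<^sup>+ x\<in>E. w x \<partial>bcube I ?n)"
      proof (rule nn_integral_mono_AE)
	show "AE x in bcube I ?n. ennreal (\<bar>G j x\<bar> + \<bar>U x\<bar>) * indicator {x. s < \<bar>U x\<bar>} x \<le> w x * indicator E x"
	  using uU G(2)[OF j] AE_space
	proof eventually_elim
	  case (elim x)
	  have "\<bar>?g j x\<bar> \<le> gradient_length I ?n u x" by (rule abs_le_gradient_length) (use j in simp)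
	  then have "ennreal (\<bar>G j x\<bar> + \<bar>U x\<bar>) \<le> w x"
	    unfolding w_def elim(1)[symmetric] elim(2)[symmetric]
	    by (simp add: ennreal_plus[symmetric] ennreal_leI del: ennreal_plus)
	  then show ?case using elim(1,3) by (simp add: E_def space_bcube space_cube indicator_def)
	qed
      qed
      also have "\<dots> = (\<integral>\<^sup>+ x\<in>E. w x \<partial>cube I ?n)" unfolding cube_eq by (rule nn_integral_completion[symmetric])
      finally show ?thesis .
    qed
    have "(\<integral>\<^sup>+ t\<in>{s..}. ennreal (\<mu> t) \<partial>lborel) = (\<integral>\<^sup>+ t. (\<Sum>j\<le>m. ennreal (measure (bcube I m) (P t j)) * indicator {s..} t) \<partial>lborel)"
      unfolding \<mu>_def by (simp add: sum_ennreal[symmetric] sum_distrib_right del: sum_ennreal)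
    also have "\<dots> = (\<Sum>j\<le>m. \<integral>\<^sup>+ t\<in>{s..}. ennreal (measure (bcube I m) (P t j)) \<partial>lborel)"
    proof (rule nn_integral_sum)
      fix j assume "j \<in> {..m}"
      then have "(\<lambda>t. distribution_fun (bcube I m) (\<psi> j) (ennreal t)) \<in> borel_measurable borel"
	by (intro measurable_compose[OF measurable_ennreal borel_measurable_distribution_fun] \<psi>m) simp
      then show "(\<lambda>t. ennreal (measure (bcube I m) (P t j)) * indicator {s..} t) \<in> borel_measurable lborel"
	unfolding P_dist by simp
    qed
    also have "\<dots> \<le> (\<Sum>j\<le>m. \<integral>\<^sup>+ x\<in>E. w x \<partial>cube I ?n)" by (rule sum_mono) (use excess in simp)
    also have "\<dots> = ennreal (real ?n) * (\<integral>\<^sup>+ x\<in>E. w x \<partial>cube I ?n)"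
      by (simp add: ennreal_of_nat_eq_real_of_nat[symmetric])
    also have "(\<integral>\<^sup>+ x\<in>E. w x \<partial>cube I ?n) \<le> rearrangement_int (cube I ?n) w T"
      by (rule Cn.set_integral_le_rearrangement_int[OF wm E]) (simp_all add: T_def Cn.emeasure_eq_measure)
    also have "rearrangement_int (cube I ?n) w T
	\<le> (\<integral>\<^sup>+ t\<in>{0<..<1}. rearrangement (cube I ?n) w t * indicator {t. t powr \<alpha> < \<mu> s} t \<partial>lborel)"
      unfolding rearrangement_int_def
    proof (rule nn_integral_mono)
      fix t
      have T1: "T \<le> 1" unfolding T_def by (rule Cn.prob_le_1)
      have "T powr \<alpha> \<le> \<mu> s"
      proof -
	let ?L = "{x \<in> space (bcube I ?n). \<forall>j\<le>m. remove_coord m j x \<in> P s j}"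
	have L: "?L \<in> sets (bcube I ?n)"
	proof -
	  have "?L = (\<Inter>j\<in>{..m}. {x \<in> space (bcube I ?n). remove_coord m j x \<in> P s j})" by auto
	  also have "\<dots> \<in> sets (bcube I ?n)" by (rule sets.finite_INT) (use P in \<open>auto intro: sets_remove_coord\<close>)
	  finally show ?thesis .
	qed
	have "T \<le> measure (cube I ?n) ?L"
	  unfolding T_def
	proof (rule Cn.finite_measure_mono_AE)
	  have "AE x in bcube I ?n. \<forall>j\<in>{..m}. ennreal \<bar>u x\<bar> \<le> \<psi> j (remove_coord m j x)"
	    by (rule AE_finite_allI) (use AE_le in auto)
	  then have "AE x in bcube I ?n. x \<in> E \<longrightarrow> x \<in> ?L"
	    using AE_space
	  proof eventually_elim
	    case (elim x)
	    have "remove_coord m j x \<in> P s j" if "x \<in> E" "j \<le> m" for j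
	    proof -
	      have "ennreal s < ennreal \<bar>u x\<bar>" using that(1) s by (simp add: E_def ennreal_less_iff)
	      also have "\<dots> \<le> \<psi> j (remove_coord m j x)" using elim(1) that(2) by simp
	      finally show ?thesis
		using measurable_space[OF measurable_remove_coord elim(2)] by (simp add: P_def)
	    qed
	    then show ?case using elim(2) by blast
	  qed
	  then show "AE x in cube I ?n. x \<in> E \<longrightarrow> x \<in> ?L" unfolding cube_eq by (rule AE_completion)
	  show "?L \<in> sets (cube I ?n)" unfolding cube_eq using L by (rule sets_completionI_sets)
	qed
	also have "measure (cube I ?n) ?L = measure (bcube I ?n) ?L"
	  unfolding cube_eq using L by (rule measure_completion)
	finally have "T powr \<alpha> \<le> measure (bcube I ?n) ?L powr \<alpha>"
	  using \<alpha> by (intro powr_mono2) (simp_all add: T_def)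
	also have "\<dots> \<le> \<mu> s" unfolding \<alpha>_def \<mu>_def by (rule loomis_whitney_sum) (rule P)
	finally show ?thesis .
      qed
      then have "0 < t \<and> t < T \<longrightarrow> t powr \<alpha> < \<mu> s"
	using powr_less_mono2[OF \<alpha>, of t T] by auto
      then show "rearrangement (cube I ?n) w t * indicator {0<..<T} t
	  \<le> rearrangement (cube I ?n) w t * indicator {t. t powr \<alpha> < \<mu> s} t * indicator {0<..<1} t"
	using T1 by (auto simp: indicator_def)
    qed
    finally show ?thesis by (simp add: mult_left_mono)
  qed
  have \<zeta>: "ri_norm unit_interval ?\<zeta>" and \<zeta>w: "?\<zeta> (rearrangement (cube I ?n) w) = Z w"
    by (rule ri_norm_luxemburg_rep[OF prob_space_cube measure_preserving_cube_to_interval Z], simp)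
       (rule luxemburg_rep_rearrangement[OF prob_space_cube measure_preserving_cube_to_interval Z wm], simp)
  have Zw: "Z w \<le> sobolev_norm I ?n Z u"
    unfolding w_def[abs_def] sobolev_norm_def space_norm_def
    by (rule banach_function_normD(2)[OF bfn]) measurable
  have fin: "Z w < \<infinity>"
    using order_le_less_trans[OF Zw] ufs gfs by (simp add: sobolev_norm_def function_space_def)
  have "(\<integral>\<^sup>+ y. ?\<psi> k y * h y \<partial>cube I m) \<le> ennreal (real ?n) * sobolev_norm I ?n Z u"
    if h: "h \<in> borel_measurable (cube I m)" and h1: "predual_norm I ?n Z h \<le> 1" for h
  proof -
    let ?A = "\<lambda>t. max_rearrangement (cube I m) h (t powr \<alpha>)"
    have Am: "?A \<in> borel_measurable borel"
      by (rule measurable_compose[OF _ borel_measurable_max_rearrangement[OF h]]) measurable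
    have "(\<integral>\<^sup>+ y. ?\<psi> k y * h y \<partial>cube I m) = (\<integral>\<^sup>+ y. \<psi> k y * h y \<partial>cube I m)"
    proof (rule nn_integral_cong_AE)
      have "AE y in bcube I m. ?\<psi> k y * h y = \<psi> k y * h y" using \<psi>1[OF k] by eventually_elim simp
      then show "AE y in cube I m. ?\<psi> k y * h y = \<psi> k y * h y" unfolding cube_eq by (rule AE_completion)
    qed
    also have "\<dots> \<le> ennreal (real ?n) * (\<integral>\<^sup>+ t\<in>{0<..<1}. rearrangement (cube I ?n) w t * ?A t \<partial>lborel)"
    proof (rule pairing_le_of_tail_bounds[OF prob_space_cube h _ \<alpha> borel_measurable_rearrangement[OF wm] _ _ \<mu>m _ tail])
      show "\<psi> k \<in> borel_measurable (cube I m)" unfolding cube_eq by (rule measurable_completion[OF \<psi>m[OF k]])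
      show "0 \<le> \<mu> s" for s unfolding \<mu>_def by (rule sum_nonneg) simp
      show "\<mu> t \<le> \<mu> s" if "s \<le> t" for s t
	unfolding \<mu>_def
      proof (rule sum_mono)
	fix j assume "j \<in> {..m}"
	then have j: "j \<le> m" by simp
	have "P t j \<subseteq> P s j" unfolding P_def using ennreal_leI[OF that] by (auto intro: order_le_less_trans)
	then show "measure (bcube I m) (P t j) \<le> measure (bcube I m) (P s j)"
	  by (rule Bm.finite_measure_mono[OF _ P[OF j]])
      qed
      fix s :: real
      have "{y \<in> space (cube I m). ennreal s < \<psi> k y} = P s k" by (simp add: P_def space_cube space_bcube)
      then have "emeasure (cube I m) {y \<in> space (cube I m). ennreal s < \<psi> k y} = ennreal (measure (bcube I m) (P s k))"
	unfolding cube_eq using P[OF k] by (simp add: Bm.emeasure_eq_measure)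
      also have "\<dots> \<le> ennreal (\<mu> s)"
	unfolding \<mu>_def by (rule ennreal_leI, rule member_le_sum) (use k in auto)
      finally show "emeasure (cube I m) {y \<in> space (cube I m). ennreal s < \<psi> k y} \<le> ennreal (\<mu> s)" .
    qed
    also have "(\<integral>\<^sup>+ t\<in>{0<..<1}. rearrangement (cube I ?n) w t * ?A t \<partial>lborel)
	= (\<integral>\<^sup>+ t. ?A t * rearrangement (cube I ?n) w t \<partial>unit_interval)"
      unfolding nn_integral_unit_interval by (simp add: mult_ac)
    also have "\<dots> \<le> associate_norm unit_interval ?\<zeta> ?A * ?\<zeta> (rearrangement (cube I ?n) w)"
    proof (rule nn_integral_mult_le_associate_norm)
      show "banach_function_norm unit_interval ?\<zeta>" using \<zeta> by (simp add: ri_norm_def)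
      show "?A \<in> borel_measurable unit_interval" by (rule borel_measurable_unit_intervalI[OF Am])
      show "rearrangement (cube I ?n) w \<in> borel_measurable unit_interval"
	by (rule borel_measurable_unit_intervalI[OF borel_measurable_rearrangement[OF wm]])
      show "?\<zeta> (rearrangement (cube I ?n) w) < \<infinity>" unfolding \<zeta>w by (rule fin)
    qed
    also have "associate_norm unit_interval ?\<zeta> ?A = predual_norm I ?n Z h"
      unfolding predual_norm_def one_over_conj_exponent[OF m] \<alpha>_def by simp
    also have "predual_norm I ?n Z h * ?\<zeta> (rearrangement (cube I ?n) w) \<le> 1 * sobolev_norm I ?n Z u"
      unfolding \<zeta>w using h1 Zw by (rule mult_mono) simp_all
    finally show ?thesis by (simp add: mult_left_mono)
  qed
  then show ?thesis unfolding optimal_norm_def associate_norm_def by (intro SUP_least) simp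
qed

end

section \<open>Radial functions\<close>

abbreviation unit_lborel :: "real measure" where "unit_lborel \<equiv> restrict_space lborel {0<..<1}"

text \<open>
  As a function of the radius \<open>r\<close> this decreases from the centre to 0 on the boundary, with slope \<open>- h (r ^ n)\<close>.
  Hence the gradient of the corresponding radial function has the size \<open>2 * h (r ^ n)\<close>, where \<open>r ^ n\<close> is
  uniformly distributed.
\<close>

definition radial_profile :: "nat \<Rightarrow> (real \<Rightarrow> real) \<Rightarrow> real \<Rightarrow> real" where
  "radial_profile n h r = (\<integral>\<rho>. (if r \<le> \<rho> then h (\<rho> ^ n) else 0) \<partial>unit_lborel)"

lemma prob_space_restrict_unit: "prob_space unit_lborel"
  by (rule prob_spaceI) (simp add: emeasure_restrict_space space_restrict_space)

lemma radial_profile_measurable_kernel: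
  assumes hm[measurable]: "h \<in> borel_measurable borel"
  shows "(\<lambda>(r, \<rho>). if r \<le> \<rho> then h (\<rho> ^ n) else 0) \<in> borel_measurable (borel \<Otimes>\<^sub>M unit_lborel)"
proof -
  have "(\<lambda>x. x) \<in> borel_measurable unit_lborel" by (rule measurable_restrict_space1) simp
  from measurable_compose[OF measurable_snd this]
  have s[measurable]: "snd \<in> measurable (borel \<Otimes>\<^sub>M unit_lborel) borel" .
  show ?thesis unfolding split_beta' by measurable
qed

lemma borel_measurable_radial_profile:
  assumes hm: "h \<in> borel_measurable borel"
  shows "radial_profile n h \<in> borel_measurable borel"
proof -
  interpret L: prob_space "unit_lborel" by (rule prob_space_restrict_unit)
  show ?thesis
    unfolding radial_profile_def[abs_def]
    by (rule L.borel_measurable_lebesgue_integral[OF radial_profile_measurable_kernel[OF hm]])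
qed

lemma ennreal_radial_profile:
  assumes hm[measurable]: "h \<in> borel_measurable borel" and h0: "\<And>t. 0 \<le> h t" and hB: "\<And>t. h t \<le> B"
  shows "ennreal (radial_profile n h r) = (\<integral>\<^sup>+ \<rho>\<in>{0<..<1}. (if r \<le> \<rho> then ennreal (h (\<rho> ^ n)) else 0) \<partial>lborel)"
    and "0 \<le> radial_profile n h r" and "radial_profile n h r \<le> B"
proof -
  interpret L: prob_space "unit_lborel" by (rule prob_space_restrict_unit)
  let ?f = "\<lambda>\<rho>. if r \<le> \<rho> then h (\<rho> ^ n) else 0"
  have m: "?f \<in> borel_measurable unit_lborel" by (rule measurable_restrict_space1) measurable
  have B: "0 \<le> B" using h0[of 0] hB[of 0] by linarith
  have i: "integrable unit_lborel ?f"
    by (rule L.integrable_const_bound[where B=B]) (use m h0 hB B in auto)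
  have "ennreal (radial_profile n h r) = (\<integral>\<^sup>+ \<rho>. ennreal (?f \<rho>) \<partial>unit_lborel)"
    unfolding radial_profile_def by (rule nn_integral_eq_integral[symmetric, OF i]) (use h0 in auto)
  also have "\<dots> = (\<integral>\<^sup>+ \<rho>\<in>{0<..<1}. ennreal (?f \<rho>) \<partial>lborel)" by (rule nn_integral_restrict_space) simp
  finally show "ennreal (radial_profile n h r) = (\<integral>\<^sup>+ \<rho>\<in>{0<..<1}. (if r \<le> \<rho> then ennreal (h (\<rho> ^ n)) else 0) \<partial>lborel)"
    by (simp add: if_distrib[of ennreal] cong: if_cong)
  show "0 \<le> radial_profile n h r" unfolding radial_profile_def
    by (rule Bochner_Integration.integral_nonneg) (use h0 in auto)
  show "radial_profile n h r \<le> B"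
    unfolding radial_profile_def by (rule L.integral_le_const[OF i]) (use hB B in auto)
qed

lemma radial_profile_le:
  assumes hm: "h \<in> borel_measurable borel" and h0: "\<And>t. 0 \<le> h t" and hB: "\<And>t. h t \<le> B"
    and dec: "\<And>s t. 0 < s \<Longrightarrow> s \<le> t \<Longrightarrow> t < 1 \<Longrightarrow> h t \<le> h s" and n: "0 < n" and r: "0 < r"
  shows "radial_profile n h r \<le> h (r ^ n)"
proof -
  have "ennreal (radial_profile n h r) \<le> (\<integral>\<^sup>+ \<rho>\<in>{0<..<1::real}. ennreal (h (r ^ n)) \<partial>lborel)"
    unfolding ennreal_radial_profile(1)[OF hm h0 hB]
  proof (rule nn_integral_mono)
    fix \<rho> :: real
    show "(if r \<le> \<rho> then ennreal (h (\<rho> ^ n)) else 0) * indicator {0<..<1} \<rho> \<le> ennreal (h (r ^ n)) * indicator {0<..<1} \<rho>"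
    proof (cases "r \<le> \<rho> \<and> \<rho> \<in> {0<..<1}")
      case True
      then have "h (\<rho> ^ n) \<le> h (r ^ n)"
	using r n by (intro dec zero_less_power power_mono) (auto simp: power_less_one_iff)
      then show ?thesis using True by (simp add: ennreal_leI)
    qed auto
  qed
  also have "\<dots> = ennreal (h (r ^ n))" by (simp add: nn_integral_cmult)
  finally show ?thesis using h0 by (simp add: ennreal_le_iff)
qed

lemma borel_measurable_radial_derivative:
  fixes h :: "real \<Rightarrow> real"
  assumes [measurable]: "h \<in> borel_measurable borel"
  shows "(\<lambda>t. if q \<le> \<bar>2 * (t - c)\<bar> then 2 * sgn (t - c) * h (\<bar>2 * (t - c)\<bar> ^ n) else 0) \<in> borel_measurable borel"
  unfolding sgn_if by measurable

context unit_edge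
begin

text \<open>
  In one variable, a radial function is a superposition of indicators of centred intervals. Testing
  an indicator of \<open>[c - \<rho>/2, c + \<rho>/2]\<close> against a derivative \<open>p'\<close> gives the difference of the values of
  \<open>p\<close> at the end points, and integrating these differences is a change of variables.
\<close>

lemma radial_line_derivative:
  fixes h p p' :: "real \<Rightarrow> real"
  assumes hm[measurable]: "h \<in> borel_measurable borel" and h0: "\<And>t. 0 \<le> h t" and hB: "\<And>t. h t \<le> B"
    and p: "\<And>t. (p has_real_derivative p' t) (at t)" and p': "continuous_on UNIV p'"
  defines "c \<equiv> a + 1/2"
  shows "(\<integral>t. radial_profile n h (max q \<bar>2 * (t - c)\<bar>) * p' t \<partial>edge)
    = (\<integral>t. (if q \<le> \<bar>2 * (t - c)\<bar> then 2 * sgn (t - c) * h (\<bar>2 * (t - c)\<bar> ^ n) else 0) * p t \<partial>edge)"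
proof -
  let ?L = "unit_lborel"
  interpret L: prob_space ?L by (rule prob_space_restrict_unit)
  interpret P: pair_prob_space edge ?L ..
  have pc: "continuous_on S p" for S
    using p by (intro DERIV_continuous_on) (rule has_field_derivative_at_within)
  have pm[measurable]: "p \<in> borel_measurable borel" and p'm[measurable]: "p' \<in> borel_measurable borel"
    by (rule borel_measurable_continuous_onI[OF pc], rule borel_measurable_continuous_onI[OF p'])
  have bounded: "\<exists>D. \<forall>t\<in>{a..a+1}. \<bar>f t\<bar> \<le> D" if "continuous_on UNIV f" for f :: "real \<Rightarrow> real"
  proof -
    have "compact (f ` {a..a+1})"
      by (rule compact_continuous_image[OF continuous_on_subset[OF that]]) auto
    then have "bounded (f ` {a..a+1})" by (rule compact_imp_bounded)
    then show ?thesis unfolding bounded_iff by auto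
  qed
  obtain D where D: "\<And>t. t \<in> {a..a+1} \<Longrightarrow> \<bar>p t\<bar> \<le> D" using bounded[OF pc] by blast
  obtain D' where D': "\<And>t. t \<in> {a..a+1} \<Longrightarrow> \<bar>p' t\<bar> \<le> D'" using bounded[OF p'] by blast
  have B0: "0 \<le> B" using h0[of 0] hB[of 0] by linarith
  have D0: "0 \<le> D" "0 \<le> D'" using D[of a] D'[of a] by auto
  define k where "k \<rho> = (if q \<le> \<rho> then h (\<rho> ^ n) else 0)" for \<rho>
  have km[measurable]: "k \<in> borel_measurable borel" unfolding k_def[abs_def] by measurable
  have k0: "0 \<le> k \<rho>" "\<bar>k \<rho>\<bar> \<le> B" for \<rho> using h0 hB B0 by (auto simp: k_def)
  define F where "F t \<rho> = (if \<bar>2 * (t - c)\<bar> \<le> \<rho> then k \<rho> * p' t else 0)" for t \<rho>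
  have Fm: "(\<lambda>(t, \<rho>). F t \<rho>) \<in> borel_measurable (edge \<Otimes>\<^sub>M ?L)"
  proof -
    have i1: "(\<lambda>x. x) \<in> borel_measurable edge" by (rule measurable_restrict_space1) simp
    have i2: "(\<lambda>x. x) \<in> borel_measurable ?L" by (rule measurable_restrict_space1) simp
    have "fst \<in> measurable (edge \<Otimes>\<^sub>M ?L) borel" using measurable_compose[OF measurable_fst i1] .
    moreover have "snd \<in> measurable (edge \<Otimes>\<^sub>M ?L) borel" using measurable_compose[OF measurable_snd i2] .
    ultimately have "(\<lambda>x. (fst x, snd x)) \<in> measurable (edge \<Otimes>\<^sub>M ?L) (borel \<Otimes>\<^sub>M borel)" by (rule measurable_Pair)
    moreover have "(\<lambda>(t, \<rho>). F t \<rho>) \<in> borel_measurable (borel \<Otimes>\<^sub>M borel)"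
      unfolding F_def split_beta' by measurable
    ultimately have "(\<lambda>x. (\<lambda>(t, \<rho>). F t \<rho>) (fst x, snd x)) \<in> borel_measurable (edge \<Otimes>\<^sub>M ?L)" by (rule measurable_compose)
    then show ?thesis by (simp add: split_beta')
  qed
  have Fi: "integrable (edge \<Otimes>\<^sub>M ?L) (\<lambda>(t, \<rho>). F t \<rho>)"
  proof (rule P.integrable_const_bound[where B="B * D'", OF _ Fm], rule AE_I2)
    fix x assume "x \<in> space (edge \<Otimes>\<^sub>M ?L)"
    then have "fst x \<in> {a..a+1}" using subset_closure by (auto simp: space_pair_measure)
    then have "\<bar>k (snd x)\<bar> * \<bar>p' (fst x)\<bar> \<le> B * D'" using k0 D' B0 by (intro mult_mono) auto
    then show "norm ((\<lambda>(t, \<rho>). F t \<rho>) x) \<le> B * D'" using B0 D0 by (auto simp: F_def split_beta abs_mult)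
  qed
  have "(\<integral>t. radial_profile n h (max q \<bar>2 * (t - c)\<bar>) * p' t \<partial>edge) = (\<integral>t. \<integral>\<rho>. F t \<rho> \<partial>?L \<partial>edge)"
  proof (rule Bochner_Integration.integral_cong[OF refl])
    fix t
    have "radial_profile n h (max q \<bar>2 * (t - c)\<bar>) * p' t
	= (\<integral>\<rho>. (if max q \<bar>2 * (t - c)\<bar> \<le> \<rho> then h (\<rho> ^ n) else 0) * p' t \<partial>?L)"
      unfolding radial_profile_def by (rule integral_mult_left_zero[symmetric])
    also have "\<dots> = (\<integral>\<rho>. F t \<rho> \<partial>?L)"
      by (intro Bochner_Integration.integral_cong refl) (simp add: F_def k_def)
    finally show "radial_profile n h (max q \<bar>2 * (t - c)\<bar>) * p' t = (\<integral>\<rho>. F t \<rho> \<partial>?L)" .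
  qed
  also have "\<dots> = (\<integral>\<rho>. \<integral>t. F t \<rho> \<partial>edge \<partial>?L)" by (rule P.Fubini_integral[OF Fi, symmetric])
  also have "\<dots> = (\<integral>\<rho>. k \<rho> * (p (c + \<rho>/2) - p (c - \<rho>/2)) \<partial>?L)"
  proof (rule Bochner_Integration.integral_cong[OF refl])
    fix \<rho> assume "\<rho> \<in> space ?L"
    then have \<rho>: "0 < \<rho>" "\<rho> < 1" by (auto simp: space_restrict_space)
    have sub: "{c - \<rho>/2..c + \<rho>/2} \<subseteq> I" by (rule order_trans[OF _ interior_subset]) (use \<rho> in \<open>auto simp: c_def\<close>)
    have "(\<integral>t. F t \<rho> \<partial>edge) = (\<integral>t. indicator I t *\<^sub>R F t \<rho> \<partial>lborel)" by (rule integral_restrict_space) simp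
    also have "\<dots> = (\<integral>t. k \<rho> * (indicator {c - \<rho>/2..c + \<rho>/2} t *\<^sub>R p' t) \<partial>lborel)"
    proof (rule Bochner_Integration.integral_cong[OF refl])
      fix t
      have "\<bar>2 * (t - c)\<bar> \<le> \<rho> \<longleftrightarrow> t \<in> {c - \<rho>/2..c + \<rho>/2}" by auto
      then show "indicator I t *\<^sub>R F t \<rho> = k \<rho> * (indicator {c - \<rho>/2..c + \<rho>/2} t *\<^sub>R p' t)"
	unfolding F_def using sub by (auto simp: indicator_def)
    qed
    also have "\<dots> = k \<rho> * (\<integral>t. indicator {c - \<rho>/2..c + \<rho>/2} t *\<^sub>R p' t \<partial>lborel)" by (rule integral_mult_right_zero)
    also have "(\<integral>t. indicator {c - \<rho>/2..c + \<rho>/2} t *\<^sub>R p' t \<partial>lborel) = p (c + \<rho>/2) - p (c - \<rho>/2)"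
    proof (rule integral_FTC_atLeastAtMost)
      show "(p has_vector_derivative p' x) (at x within {c - \<rho>/2..c + \<rho>/2})" for x
	using p by (simp add: has_real_derivative_iff_has_vector_derivative[symmetric] has_field_derivative_at_within)
      show "continuous_on {c - \<rho>/2..c + \<rho>/2} p'" by (rule continuous_on_subset[OF p']) simp
    qed (use \<rho> in simp)
    finally show "(\<integral>t. F t \<rho> \<partial>edge) = k \<rho> * (p (c + \<rho>/2) - p (c - \<rho>/2))" .
  qed
  also have "\<dots> = (\<integral>\<rho>. indicator {0<..<1} \<rho> *\<^sub>R (k \<rho> * (p (c + \<rho>/2) - p (c - \<rho>/2))) \<partial>lborel)"
    by (rule integral_restrict_space) simp
  also have "\<dots> = (\<integral>t. (if q \<le> \<bar>2 * (t - c)\<bar> then 2 * sgn (t - c) * h (\<bar>2 * (t - c)\<bar> ^ n) else 0) * p t \<partial>edge)"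
  proof -
    define K where "K e \<rho> = indicator {0<..<1} \<rho> * (k \<rho> * p (c + e * \<rho>/2))" for e \<rho> :: real
    have Km: "K e \<in> borel_measurable borel" for e unfolding K_def[abs_def] by measurable
    have Ki: "integrable lborel (K e)" if "\<bar>e\<bar> \<le> 1" for e
    proof (rule Bochner_Integration.integrable_bound)
      show "integrable lborel (\<lambda>\<rho>. (B * D) * indicator {0<..<1::real} \<rho>)" by simp
      show "K e \<in> borel_measurable lborel" using Km by simp
      show "AE \<rho> in lborel. norm (K e \<rho>) \<le> norm ((B * D) * indicator {0<..<1} \<rho>)"
      proof (rule AE_I2)
	fix \<rho> :: real
	show "norm (K e \<rho>) \<le> norm ((B * D) * indicator {0<..<1} \<rho>)"
	proof (cases "\<rho> \<in> {0<..<1}")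
	  case True
	  have "\<bar>e * \<rho>\<bar> \<le> 1 * 1" unfolding abs_mult using True that by (intro mult_mono) auto
	  then have "c + e * \<rho>/2 \<in> {a..a+1}" by (auto simp: c_def abs_le_iff)
	  then have "\<bar>k \<rho>\<bar> * \<bar>p (c + e * \<rho>/2)\<bar> \<le> B * D" using k0 D B0 by (intro mult_mono) auto
	  then show ?thesis using True B0 D0 by (simp add: K_def abs_mult)
	qed (simp add: K_def)
      qed
    qed
    have affine: "(\<integral>\<rho>. K e \<rho> \<partial>lborel) = (\<integral>t. 2 * K e (2 * e * (t - c)) \<partial>lborel)"
      and affine_i: "integrable lborel (\<lambda>t. K e (2 * e * (t - c)))" if e: "\<bar>e\<bar> = 1" for e
    proof -
      have "(\<integral>\<rho>. K e \<rho> \<partial>lborel) = \<bar>2 * e\<bar> *\<^sub>R (\<integral>t. K e (- 2 * e * c + 2 * e * t) \<partial>lborel)"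
	by (rule lborel_integral_real_affine) (use e in auto)
      also have "\<dots> = (\<integral>t. 2 * K e (2 * e * (t - c)) \<partial>lborel)"
	using e by (simp add: abs_mult algebra_simps)
      finally show "(\<integral>\<rho>. K e \<rho> \<partial>lborel) = (\<integral>t. 2 * K e (2 * e * (t - c)) \<partial>lborel)" .
      have "integrable lborel (\<lambda>t. K e (- 2 * e * c + 2 * e * t))"
	by (rule lborel_integrable_real_affine) (use e Ki in auto)
      then show "integrable lborel (\<lambda>t. K e (2 * e * (t - c)))" by (simp add: algebra_simps)
    qed
    have "(\<integral>\<rho>. indicator {0<..<1} \<rho> *\<^sub>R (k \<rho> * (p (c + \<rho>/2) - p (c - \<rho>/2))) \<partial>lborel) = (\<integral>\<rho>. K 1 \<rho> - K (- 1) \<rho> \<partial>lborel)"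
      by (intro Bochner_Integration.integral_cong refl) (simp add: K_def algebra_simps)
    also have "\<dots> = (\<integral>\<rho>. K 1 \<rho> \<partial>lborel) - (\<integral>\<rho>. K (- 1) \<rho> \<partial>lborel)"
      by (rule Bochner_Integration.integral_diff) (auto intro: Ki)
    also have "\<dots> = (\<integral>t. 2 * K 1 (2 * 1 * (t - c)) - 2 * K (- 1) (2 * (- 1) * (t - c)) \<partial>lborel)"
      using affine[of 1] affine[of "- 1"] affine_i[of 1] affine_i[of "- 1"]
      by (subst Bochner_Integration.integral_diff) auto
    also have "\<dots> = (\<integral>t. indicator I t *\<^sub>R ((if q \<le> \<bar>2 * (t - c)\<bar> then 2 * sgn (t - c) * h (\<bar>2 * (t - c)\<bar> ^ n) else 0) * p t) \<partial>lborel)"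
    proof (rule integral_cong_AE)
      show "AE t in lborel. 2 * K 1 (2 * 1 * (t - c)) - 2 * K (- 1) (2 * (- 1) * (t - c))
	  = indicator I t *\<^sub>R ((if q \<le> \<bar>2 * (t - c)\<bar> then 2 * sgn (t - c) * h (\<bar>2 * (t - c)\<bar> ^ n) else 0) * p t)"
	using AE_I
      proof eventually_elim
	case (elim t)
	consider "t = c" | "c < t" | "t < c" by linarith
	then show ?case
	proof cases
	  case 1
	  then show ?thesis by (simp add: K_def)
	next
	  case 2
	  then have "K (- 1) (2 * (- 1) * (t - c)) = 0" by (simp add: K_def)
	  moreover have "K 1 (2 * 1 * (t - c)) = indicator I t * (k (2 * (t - c)) * p t)"
	  proof -
	    have "c + 1 * (2 * 1 * (t - c)) / 2 = t" by (simp add: field_simps)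
	    moreover have "indicator {0<..<1} (2 * 1 * (t - c)) = (indicator I t :: real)"
	      using 2 elim by (auto simp: indicator_def c_def)
	    ultimately show ?thesis unfolding K_def by simp
	  qed
	  ultimately show ?thesis using 2 by (simp add: k_def)
	next
	  case 3
	  then have "K 1 (2 * 1 * (t - c)) = 0" by (simp add: K_def)
	  moreover have "K (- 1) (2 * (- 1) * (t - c)) = indicator I t * (k (2 * (c - t)) * p t)"
	  proof -
	    have e: "2 * (- 1) * (t - c) = 2 * (c - t)" by simp
	    have "c + (- 1) * (2 * (c - t)) / 2 = t" by (simp add: field_simps)
	    moreover have "indicator {0<..<1} (2 * (c - t)) = (indicator I t :: real)"
	      using 3 elim by (auto simp: indicator_def c_def)
	    ultimately show ?thesis unfolding K_def e by simp
	  qed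
	  moreover have "\<bar>2 * (t - c)\<bar> = 2 * (c - t)" using 3 by simp
	  ultimately show ?thesis using 3 by (simp add: k_def)
	qed
      qed
      show "(\<lambda>t. 2 * K 1 (2 * 1 * (t - c)) - 2 * K (- 1) (2 * (- 1) * (t - c))) \<in> borel_measurable lborel"
      proof (rule borel_measurable_integrable, rule Bochner_Integration.integrable_diff)
	have "integrable lborel (\<lambda>t. K 1 (2 * 1 * (t - c)))" by (rule affine_i) simp
	then show "integrable lborel (\<lambda>t. 2 * K 1 (2 * 1 * (t - c)))" by (rule integrable_mult_right)
	have "integrable lborel (\<lambda>t. K (- 1) (2 * (- 1) * (t - c)))" by (rule affine_i) simp
	then show "integrable lborel (\<lambda>t. 2 * K (- 1) (2 * (- 1) * (t - c)))" by (rule integrable_mult_right)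
      qed
      show "(\<lambda>t. indicator I t *\<^sub>R ((if q \<le> \<bar>2 * (t - c)\<bar> then 2 * sgn (t - c) * h (\<bar>2 * (t - c)\<bar> ^ n) else 0) * p t)) \<in> borel_measurable lborel"
	by (intro borel_measurable_scaleR borel_measurable_times borel_measurable_indicator)
	  (simp_all add: borel_measurable_radial_derivative[OF hm] pm sets_I)
    qed
    also have "\<dots> = (\<integral>t. (if q \<le> \<bar>2 * (t - c)\<bar> then 2 * sgn (t - c) * h (\<bar>2 * (t - c)\<bar> ^ n) else 0) * p t \<partial>edge)"
      by (rule integral_restrict_space[symmetric]) simp
    finally show ?thesis .
  qed
  finally show ?thesis .
qed

lemma compact_cube: "compact (PiE {..<n} (\<lambda>_. {l..r::real}))"
proof -
  have eq: "PiE {..<n} (\<lambda>_. {l..r}) = PiE UNIV (\<lambda>i. if i < n then {l..r} else {undefined})"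
    by (auto simp: PiE_iff extensional_def split: if_splits)
  have "compactin (product_topology (\<lambda>_. euclidean) UNIV) (PiE UNIV (\<lambda>i. if i < n then {l..r} else {undefined}))"
    unfolding compactin_PiE by auto
  then show ?thesis unfolding eq euclidean_product_topology compactin_euclidean_iff .
qed

text \<open>
  Countable products of the real line have the same Borel sets in the product topology as in the product
  measure, and the closed cube is compact.
\<close>

lemma continuous_on_coord_space_bcube:
  fixes \<phi> :: "(nat \<Rightarrow> real) \<Rightarrow> real"
  assumes \<phi>: "continuous_on (coord_space n) \<phi>"
  shows "\<phi> \<in> borel_measurable (bcube I n)" and "\<exists>B. \<forall>x\<in>space (bcube I n). \<bar>\<phi> x\<bar> \<le> B"
proof -
  have id: "(\<lambda>x. x) \<in> measurable (bcube I n) (restrict_space borel (coord_space n))"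
  proof (rule measurable_restrict_space2)
    show "(\<lambda>x. x) \<in> space (bcube I n) \<rightarrow> coord_space n" by (auto simp: space_bcube PiE_iff)
    show "(\<lambda>x. x) \<in> borel_measurable (bcube I n)"
    proof (rule measurable_coordinatewise_then_product)
      fix i
      show "(\<lambda>x. x i) \<in> borel_measurable (bcube I n)"
      proof (cases "i < n")
	case False
	have "(\<lambda>x. undefined) \<in> borel_measurable (bcube I n)" by simp
	then show ?thesis
	  by (rule measurable_cong[THEN iffD1, rotated]) (use False in \<open>auto simp: space_bcube PiE_iff extensional_def\<close>)
      qed (rule measurable_coord)
    qed
  qed
  show "\<phi> \<in> borel_measurable (bcube I n)"
    using measurable_compose[OF id borel_measurable_continuous_on_restrict[OF \<phi>]] .
  have "compact (\<phi> ` PiE {..<n} (\<lambda>_. {a..a+1}))"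
    by (rule compact_continuous_image[OF continuous_on_subset[OF \<phi>] compact_cube]) auto
  then have "bounded (\<phi> ` PiE {..<n} (\<lambda>_. {a..a+1}))" by (rule compact_imp_bounded)
  then obtain B where "\<And>x. x \<in> PiE {..<n} (\<lambda>_. {a..a+1}) \<Longrightarrow> \<bar>\<phi> x\<bar> \<le> B" unfolding bounded_iff by auto
  moreover have "space (bcube I n) \<subseteq> PiE {..<n} (\<lambda>_. {a..a+1})"
    unfolding space_bcube using subset_closure by (intro PiE_mono) auto
  ultimately show "\<exists>B. \<forall>x\<in>space (bcube I n). \<bar>\<phi> x\<bar> \<le> B" by blast
qed

lemma test_function_line:
  assumes \<phi>: "test_function I (Suc m) \<phi>" and k: "k \<le> m"
  shows "continuous_on (coord_space (Suc m)) \<phi>" "continuous_on (coord_space (Suc m)) (partial_deriv k \<phi>)"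
    and "((\<lambda>t. \<phi> (insert_coord (Suc m) k y t)) has_real_derivative partial_deriv k \<phi> (insert_coord (Suc m) k y t)) (at t)"
    and "continuous_on UNIV (\<lambda>t. partial_deriv k \<phi> (insert_coord (Suc m) k y t))"
proof -
  let ?ins = "insert_coord (Suc m) k y"
  have sm: "smooth_fun (Suc m) \<phi>" using \<phi> by (simp add: test_function_def)
  have s0: "continuous_on (coord_space (Suc m)) (iterated_partial [] \<phi>) \<and>
     (\<forall>i<Suc m. \<forall>x \<in> coord_space (Suc m). (\<lambda>t. iterated_partial [] \<phi> (x(i := t))) differentiable (at (x i)))"
    using sm[unfolded smooth_fun_def, rule_format, of "[]"] by simp
  then show "continuous_on (coord_space (Suc m)) \<phi>" by simp
  show c: "continuous_on (coord_space (Suc m)) (partial_deriv k \<phi>)"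
    using sm[unfolded smooth_fun_def, rule_format, of "[k]"] k by simp
  have ins: "?ins t \<in> coord_space (Suc m)" for t by (auto simp: insert_coord_def)
  have upd: "(?ins t)(k := s) = ?ins s" for t s
    by (rule HOL.ext) (use k in \<open>simp add: insert_coord_def\<close>)
  have at_k: "?ins t k = t" by (rule insert_coord_same[OF k])
  have "(\<lambda>s. \<phi> ((?ins t)(k := s))) differentiable (at (?ins t k))"
    using s0 ins k by simp
  then have d: "(\<lambda>s. \<phi> (?ins s)) differentiable (at t)" unfolding upd at_k .
  have "partial_deriv k \<phi> (?ins t) = deriv (\<lambda>s. \<phi> (?ins s)) t"
    unfolding partial_deriv_def upd at_k ..
  then show "((\<lambda>t. \<phi> (?ins t)) has_real_derivative partial_deriv k \<phi> (?ins t)) (at t)"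
    using d by (metis DERIV_imp_deriv real_differentiable_def)
  have "continuous_on UNIV ?ins"
  proof (rule continuous_on_coordinatewise_then_product)
    fix i
    show "continuous_on UNIV (\<lambda>t. ?ins t i)"
      by (cases "i < Suc m"; cases "i < k"; cases "i = k") (simp_all add: insert_coord_def)
  qed
  then show "continuous_on UNIV (\<lambda>t. partial_deriv k \<phi> (?ins t))"
    by (rule continuous_on_compose2[OF c]) (use ins in auto)
qed

lemma bounded_locally_integrable:
  assumes f: "f \<in> borel_measurable (bcube I n)" and B: "\<And>x. x \<in> space (bcube I n) \<Longrightarrow> \<bar>f x\<bar> \<le> B"
  shows "locally_integrable I n f"
proof -
  interpret C: prob_space "cube I n" by (rule prob_space_cube)
  have fm: "f \<in> borel_measurable (cube I n)" unfolding cube_eq using f by (rule measurable_completion)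
  have fi: "integrable (cube I n) f"
    by (rule C.integrable_const_bound[where B=B, OF _ fm]) (use B in \<open>auto simp: space_cube space_bcube intro!: AE_I2\<close>)
  have "set_integrable (cube I n) (PiE {..<n} (\<lambda>_. {l..r})) f" if "{l..r} \<subseteq> interior I" for l r
  proof -
    have "PiE {..<n} (\<lambda>_. {l..r}) \<in> sets (bcube I n)"
      by (rule sets_PiE_bcube) (use subset_trans[OF that Elementary_Topology.interior_subset] in simp_all)
    then have "PiE {..<n} (\<lambda>_. {l..r}) \<in> sets (cube I n)" unfolding cube_eq by (rule sets_completionI_sets)
    then show ?thesis unfolding set_integrable_def using fi by (rule integrable_mult_indicator)
  qed
  then show ?thesis unfolding locally_integrable_def using fm by blast
qed

text \<open>
  Only a coordinate at maximal distance from the centre contributes. Ties, which form a null set, are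
  included, so that integration by parts is exact on every line.
\<close>

definition radial_partial :: "nat \<Rightarrow> (real \<Rightarrow> real) \<Rightarrow> nat \<Rightarrow> (nat \<Rightarrow> real) \<Rightarrow> real" where
  "radial_partial m h k x = (if cube_radius m (remove_coord m k x) \<le> \<bar>2 * (x k - (a + 1/2))\<bar>
     then - 2 * sgn (x k - (a + 1/2)) * h (\<bar>2 * (x k - (a + 1/2))\<bar> ^ Suc m) else 0)"

lemma radial_is_weak_gradient:
  assumes hm[measurable]: "h \<in> borel_measurable borel" and h0: "\<And>t. 0 \<le> h t" and hB: "\<And>t. h t \<le> B"
  shows "is_weak_gradient I (Suc m) (\<lambda>x. radial_profile (Suc m) h (cube_radius (Suc m) x)) (radial_partial m h)"
proof -
  let ?n = "Suc m" let ?u = "\<lambda>x. radial_profile ?n h (cube_radius ?n x)" let ?g = "radial_partial m h"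
  interpret Bn: prob_space "bcube I ?n" by (rule prob_space_bcube)
  have B0: "0 \<le> B" using h0[of 0] hB[of 0] by linarith
  have um: "?u \<in> borel_measurable (bcube I ?n)"
    by (rule measurable_compose[OF measurable_cube_radius borel_measurable_radial_profile[OF hm]])
  have uB: "\<bar>?u x\<bar> \<le> B" for x
    using ennreal_radial_profile(2,3)[OF hm h0 hB] by simp
  have gm: "?g k \<in> borel_measurable (bcube I ?n)" if k: "k \<le> m" for k
  proof -
    have [measurable]: "(\<lambda>x. x k) \<in> borel_measurable (bcube I ?n)" by (rule measurable_coord) (use k in simp)
    have [measurable]: "(\<lambda>x. cube_radius m (remove_coord m k x)) \<in> borel_measurable (bcube I ?n)"
      by (rule measurable_compose[OF measurable_remove_coord measurable_cube_radius])
    show ?thesis unfolding radial_partial_def[abs_def] sgn_if by measurable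
  qed
  have gB: "\<bar>?g k x\<bar> \<le> 2 * B" for k x
    using h0 hB B0 by (auto simp: radial_partial_def abs_mult sgn_if)
  show ?thesis
    unfolding is_weak_gradient_def
  proof (intro conjI allI impI)
    show "locally_integrable I ?n ?u" by (rule bounded_locally_integrable[OF um uB])
    fix k assume "k < ?n"
    then have k: "k \<le> m" by simp
    show "locally_integrable I ?n (?g k)" by (rule bounded_locally_integrable[OF gm[OF k] gB])
    fix \<phi> assume \<phi>: "test_function I ?n \<phi>"
    let ?ins = "insert_coord ?n k"
    note line = test_function_line[OF \<phi> k]
    note \<phi>b = continuous_on_coord_space_bcube[OF line(1)] and db = continuous_on_coord_space_bcube[OF line(2)]
    have int: "integrable (bcube I ?n) (\<lambda>x. f x * \<theta> x)"
      if "f \<in> borel_measurable (bcube I ?n)" "\<And>x. \<bar>f x\<bar> \<le> C" "0 \<le> C" "\<theta> \<in> borel_measurable (bcube I ?n)"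
	and bd: "\<exists>B. \<forall>x\<in>space (bcube I ?n). \<bar>\<theta> x\<bar> \<le> B" for f \<theta> :: "(nat \<Rightarrow> real) \<Rightarrow> real" and C
    proof -
      obtain D where D: "\<And>x. x \<in> space (bcube I ?n) \<Longrightarrow> \<bar>\<theta> x\<bar> \<le> D" using bd by blast
      show ?thesis
      proof (rule Bn.integrable_const_bound[where B="C * D"])
	show "AE x in bcube I ?n. norm (f x * \<theta> x) \<le> C * D"
	  using that(2,3) D by (intro AE_I2) (simp add: abs_mult mult_mono)
	show "(\<lambda>x. f x * \<theta> x) \<in> borel_measurable (bcube I ?n)" by (intro borel_measurable_times that)
      qed
    qed
    have ui: "integrable (bcube I ?n) (\<lambda>x. ?u x * partial_deriv k \<phi> x)" by (rule int[OF um uB B0 db])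
    have gi: "integrable (bcube I ?n) (\<lambda>x. ?g k x * \<phi> x)" by (rule int[OF gm[OF k] gB _ \<phi>b]) (use B0 in simp)
    have cc: "(\<integral>x. f x \<partial>cube I ?n) = (\<integral>x. f x \<partial>bcube I ?n)"
      if "integrable (bcube I ?n) f" for f :: "(nat \<Rightarrow> real) \<Rightarrow> real"
      unfolding cube_eq using that by (intro integral_completion borel_measurable_integrable)
    have "(\<integral>x. ?u x * partial_deriv k \<phi> x \<partial>cube I ?n) = (\<integral>y. \<integral>t. ?u (?ins y t) * partial_deriv k \<phi> (?ins y t) \<partial>edge \<partial>bcube I m)"
      unfolding cc[OF ui] by (rule integral_insert_coord(3)[OF k ui])
    also have "\<dots> = (\<integral>y. - (\<integral>t. ?g k (?ins y t) * \<phi> (?ins y t) \<partial>edge) \<partial>bcube I m)"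
    proof (rule Bochner_Integration.integral_cong[OF refl])
      fix y assume "y \<in> space (bcube I m)"
      then have del: "remove_coord m k (?ins y t) = y" for t
	by (intro remove_coord_insert_coord[OF k]) (simp add: space_bcube PiE_def)
      have "(\<integral>t. ?u (?ins y t) * partial_deriv k \<phi> (?ins y t) \<partial>edge)
	  = (\<integral>t. radial_profile ?n h (max (cube_radius m y) \<bar>2 * (t - (a + 1/2))\<bar>) * partial_deriv k \<phi> (?ins y t) \<partial>edge)"
	unfolding cube_radius_insert_coord[OF k] ..
      also have "\<dots> = (\<integral>t. (if cube_radius m y \<le> \<bar>2 * (t - (a + 1/2))\<bar>
	  then 2 * sgn (t - (a + 1/2)) * h (\<bar>2 * (t - (a + 1/2))\<bar> ^ ?n) else 0) * \<phi> (?ins y t) \<partial>edge)"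
	by (rule radial_line_derivative[OF hm h0 hB line(3,4)])
      also have "\<dots> = (\<integral>t. - (?g k (?ins y t) * \<phi> (?ins y t)) \<partial>edge)"
	by (intro Bochner_Integration.integral_cong refl) (simp add: radial_partial_def del insert_coord_same[OF k])
      also have "\<dots> = - (\<integral>t. ?g k (?ins y t) * \<phi> (?ins y t) \<partial>edge)" by (rule integral_minus)
      finally show "(\<integral>t. ?u (?ins y t) * partial_deriv k \<phi> (?ins y t) \<partial>edge) = - (\<integral>t. ?g k (?ins y t) * \<phi> (?ins y t) \<partial>edge)" .
    qed
    also have "\<dots> = - (\<integral>x. ?g k x * \<phi> x \<partial>cube I ?n)"
      unfolding cc[OF gi] integral_insert_coord(3)[OF k gi] by (rule integral_minus)
    finally show "(\<integral>x. ?u x * partial_deriv k \<phi> x \<partial>cube I ?n) = - (\<integral>x. ?g k x * \<phi> x \<partial>cube I ?n)" .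
  qed
qed

end

section \<open>Optimality\<close>

lemma borel_measurable_level_tail:
  fixes h :: "real \<Rightarrow> real"
  assumes h[measurable]: "h \<in> borel_measurable borel"
  shows "(\<lambda>s. \<integral>\<^sup>+ \<rho>\<in>{0<..<1}. ennreal (h (\<rho> ^ n)) * indicator {s<..} (\<rho> ^ m) \<partial>lborel) \<in> borel_measurable borel"
proof -
  have "(\<lambda>s. \<integral>\<^sup>+ \<rho>. (if s < \<rho> ^ m \<and> 0 < \<rho> \<and> \<rho> < 1 then ennreal (h (\<rho> ^ n)) else 0) \<partial>lborel) \<in> borel_measurable borel"
    by measurable
  moreover have "ennreal (h (\<rho> ^ n)) * indicator {s<..} (\<rho> ^ m) * indicator {0<..<1} \<rho>
      = (if s < \<rho> ^ m \<and> 0 < \<rho> \<and> \<rho> < 1 then ennreal (h (\<rho> ^ n)) else 0)" for s \<rho>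
    by (simp add: indicator_def)
  ultimately show ?thesis by simp
qed

context unit_edge
begin

lemma cube_radius_eq_coord:
  assumes k: "k \<le> m" and le: "cube_radius m (remove_coord m k x) \<le> \<bar>2 * (x k - (a + 1/2))\<bar>"
  shows "cube_radius (Suc m) x = \<bar>2 * (x k - (a + 1/2))\<bar>"
proof (rule antisym)
  show "\<bar>2 * (x k - (a + 1/2))\<bar> \<le> cube_radius (Suc m) x"
    using cube_radius_le_iff[of "Suc m" x "cube_radius (Suc m) x"] k by simp
  have "\<bar>2 * (x (skip_index k i) - (a + 1/2))\<bar> \<le> \<bar>2 * (x k - (a + 1/2))\<bar>" if "i < m" for i
    using le[unfolded cube_radius_le_iff] that by (simp add: remove_coord_def)
  then show "cube_radius (Suc m) x \<le> \<bar>2 * (x k - (a + 1/2))\<bar>"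
    unfolding cube_radius_le_iff all_skip_index[OF k] by simp
qed

lemma abs_radial_partial_le:
  assumes k: "k \<le> m" and h0: "\<And>t. 0 \<le> h t"
  shows "\<bar>radial_partial m h k x\<bar> \<le> 2 * h (cube_radius (Suc m) x ^ Suc m)"
proof (cases "cube_radius m (remove_coord m k x) \<le> \<bar>2 * (x k - (a + 1/2))\<bar>")
  case True
  have "\<bar>sgn (x k - (a + 1/2))\<bar> * h r \<le> 1 * h r" for r
    by (rule mult_right_mono) (use h0 in \<open>simp_all add: sgn_if\<close>)
  then show ?thesis
    using True h0 unfolding radial_partial_def cube_radius_eq_coord[OF k True]
    by (simp add: abs_mult del: power_Suc)
qed (use h0 in \<open>simp add: radial_partial_def\<close>)

text \<open>
  The essential supremum of a decreasing radial function on a line is its value at the point of the line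
  nearest to the centre, where the radius is that of the projection.
\<close>

lemma level_tail_le_section_norm:
  assumes m: "0 < m" and hm: "h \<in> borel_measurable borel" and h0: "\<And>t. 0 \<le> h t" and hB: "\<And>t. h t \<le> B" and k: "k \<le> m"
  defines "u \<equiv> \<lambda>x. radial_profile (Suc m) h (cube_radius (Suc m) x)"
  shows "AE y in cube I m. (\<integral>\<^sup>+ \<rho>\<in>{0<..<1}. ennreal (h (\<rho> ^ Suc m)) * indicator {cube_to_interval m y<..} (\<rho> ^ m) \<partial>lborel)
    \<le> section_norm (Suc m) k L_inf u y"
proof -
  let ?ins = "insert_coord (Suc m) k"
  have um: "u \<in> borel_measurable (cube I (Suc m))"
    unfolding u_def cube_eq
    by (rule measurable_completion[OF measurable_compose[OF measurable_cube_radius borel_measurable_radial_profile[OF hm]]])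
  obtain \<psi> where "AE y in bcube I m. section_norm (Suc m) k L_inf u y = \<psi> y
       \<and> (AE t in edge. ennreal \<bar>u (?ins y t)\<bar> \<le> \<psi> y)
       \<and> (\<forall>c. (AE t in edge. ennreal \<bar>u (?ins y t)\<bar> \<le> c) \<longrightarrow> \<psi> y \<le> c)"
    using section_norm_version[OF um k] by blast
  then have "AE y in cube I m. section_norm (Suc m) k L_inf u y = \<psi> y
       \<and> (AE t in edge. ennreal \<bar>u (?ins y t)\<bar> \<le> \<psi> y)
       \<and> (\<forall>c. (AE t in edge. ennreal \<bar>u (?ins y t)\<bar> \<le> c) \<longrightarrow> \<psi> y \<le> c)"
    unfolding cube_eq by (rule AE_completion)
  then show ?thesis
    using AE_cube_to_interval[OF m]
  proof eventually_elim
    case (elim y)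
    define r where "r = cube_radius m y"
    have r: "0 < r" "r < 1" and \<sigma>: "cube_to_interval m y = r ^ m" using elim(2) by (simp_all add: r_def)
    have le: "AE t in edge. ennreal \<bar>u (?ins y t)\<bar> \<le> \<psi> y" using elim(1) by blast
    have near: "\<not> (AE t in edge. \<not> t \<in> {a + 1/2 - r/2<..<a + 1/2 + r/2})"
    proof
      assume "AE t in edge. \<not> t \<in> {a + 1/2 - r/2<..<a + 1/2 + r/2}"
      from emeasure_eq_0_AE[OF this]
      have "emeasure edge ({a + 1/2 - r/2<..<a + 1/2 + r/2} \<inter> I) = 0" by (simp add: Int_def conj_commute)
      also have "emeasure edge ({a + 1/2 - r/2<..<a + 1/2 + r/2} \<inter> I)
	  = emeasure lborel ({a + 1/2 - r/2<..<a + 1/2 + r/2} \<inter> {a<..<a+1})" by (rule emeasure_edge) simp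
      also have "{a + 1/2 - r/2<..<a + 1/2 + r/2} \<inter> {a<..<a+1} = {a + 1/2 - r/2<..<a + 1/2 + r/2}" using r by auto
      finally show False using r by simp
    qed
    have "\<exists>t. t \<in> {a + 1/2 - r/2<..<a + 1/2 + r/2} \<and> ennreal \<bar>u (?ins y t)\<bar> \<le> \<psi> y"
    proof (rule ccontr)
      assume no: "\<nexists>t. t \<in> {a + 1/2 - r/2<..<a + 1/2 + r/2} \<and> ennreal \<bar>u (?ins y t)\<bar> \<le> \<psi> y"
      from le have "AE t in edge. \<not> t \<in> {a + 1/2 - r/2<..<a + 1/2 + r/2}" by eventually_elim (use no in blast)
      with near show False ..
    qed
    then obtain t where t: "t \<in> {a + 1/2 - r/2<..<a + 1/2 + r/2}" "ennreal \<bar>u (?ins y t)\<bar> \<le> \<psi> y" by blast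
    have "\<bar>2 * (t - (a + 1/2))\<bar> \<le> r" using t(1) by (auto simp: abs_le_iff field_simps)
    then have ut: "u (?ins y t) = radial_profile (Suc m) h r"
      unfolding u_def cube_radius_insert_coord[OF k] r_def[symmetric] by (simp add: max_absorb1)
    have "(\<integral>\<^sup>+ \<rho>\<in>{0<..<1}. ennreal (h (\<rho> ^ Suc m)) * indicator {cube_to_interval m y<..} (\<rho> ^ m) \<partial>lborel)
	\<le> ennreal (radial_profile (Suc m) h r)"
      unfolding ennreal_radial_profile(1)[OF hm h0 hB] \<sigma>
    proof (rule nn_integral_mono)
      fix \<rho> :: real
      have "r \<le> \<rho>" if "r ^ m < \<rho> ^ m" "0 < \<rho>"
	using power_less_imp_less_base[OF that(1)] that(2) by simp
      then show "ennreal (h (\<rho> ^ Suc m)) * indicator {r ^ m<..} (\<rho> ^ m) * indicator {0<..<1} \<rho>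
	  \<le> (if r \<le> \<rho> then ennreal (h (\<rho> ^ Suc m)) else 0) * indicator {0<..<1} \<rho>"
	by (auto simp: indicator_def)
    qed
    also have "\<dots> \<le> ennreal \<bar>u (?ins y t)\<bar>" unfolding ut by (rule ennreal_leI) simp
    also have "\<dots> \<le> section_norm (Suc m) k L_inf u y" using t(2) elim(1) by simp
    finally show ?case .
  qed
qed

text \<open>
  For the radial function \<open>u\<close> with profile \<open>h\<close> both \<open>\<bar>u\<bar>\<close> and \<open>\<bar>\<nabla>u\<bar>\<close> are at most a constant times \<open>h\<close> composed
  with a measure preserving map, the former because \<open>h\<close> decreases. So the Sobolev norm of \<open>u\<close> is controlled
  by the norm of \<open>h\<close>, whereas its section norms are at least the tail integrals of \<open>h\<close>.
\<close>

lemma radial_test_inequality: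
  assumes m: "0 < m" and Z: "ri_norm (cube I (Suc m)) Z" and X: "ri_norm (cube I m) X" and C: "0 \<le> C"
    and emb: "\<And>u. u \<in> sobolev_space I (Suc m) Z \<Longrightarrow>
      X (section_norm (Suc m) 0 L_inf u) \<le> ennreal C * sobolev_norm I (Suc m) Z u"
    and hm: "h \<in> borel_measurable borel" and h0: "\<And>t. 0 \<le> h t" and hB: "\<And>t. h t \<le> B"
    and dec: "\<And>s t. 0 < s \<Longrightarrow> s \<le> t \<Longrightarrow> t < 1 \<Longrightarrow> h t \<le> h s"
  shows "X (\<lambda>y. \<integral>\<^sup>+ \<rho>\<in>{0<..<1}. ennreal (h (\<rho> ^ Suc m)) * indicator {cube_to_interval m y<..} (\<rho> ^ m) \<partial>lborel)
    \<le> ennreal (C * (1 + 2 * real (Suc m))) * luxemburg_rep (cube I (Suc m)) Z (\<lambda>t. ennreal (h t))"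
proof -
  let ?n = "Suc m" let ?\<sigma> = "cube_to_interval ?n"
  define u where "u x = radial_profile ?n h (cube_radius ?n x)" for x
  define W where "W x = ennreal (h (?\<sigma> x))" for x
  have bfn: "banach_function_norm (cube I ?n) Z" using Z by (simp add: ri_norm_def)
  have bfX: "banach_function_norm (cube I m) X" using X by (simp add: ri_norm_def)
  have mp: "measure_preserving (cube I ?n) unit_interval ?\<sigma>" by (rule measure_preserving_cube_to_interval) simp
  have hu: "(\<lambda>t. ennreal (h t)) \<in> borel_measurable unit_interval"
    by (rule borel_measurable_unit_intervalI) (use hm in measurable)
  have Wm: "W \<in> borel_measurable (cube I ?n)"
    unfolding W_def[abs_def] by (rule measurable_compose[OF measure_preserving_measurable[OF mp] hu])
  have ZW: "luxemburg_rep (cube I ?n) Z (\<lambda>t. ennreal (h t)) = Z W"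
    unfolding W_def[abs_def] by (rule luxemburg_rep_eq[OF prob_space_cube mp Z hu])
  have B0: "0 \<le> B" using h0[of 0] hB[of 0] by linarith
  have "Z W \<le> Z (\<lambda>x. ennreal B * 1)"
    by (rule banach_function_normD(4)[OF bfn _ Wm]) (use hB in \<open>simp_all add: W_def ennreal_leI\<close>)
  also have "\<dots> = ennreal B * Z (\<lambda>_. 1)" by (rule banach_function_normD(3)[OF bfn _ B0]) simp
  also have "\<dots> < \<infinity>" using banach_function_normD(5)[OF bfn] by (simp add: ennreal_mult_less_top less_top)
  finally have finW: "Z W < \<infinity>" .
  have wg: "is_weak_gradient I ?n u (radial_partial m h)"
    unfolding u_def[abs_def] by (rule radial_is_weak_gradient[OF hm h0 hB])
  have wg': "is_weak_gradient I ?n u (weak_gradient I ?n u)" by (rule weak_gradient_is_weak_gradient[OF wg])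
  have um[measurable]: "u \<in> borel_measurable (cube I ?n)" by (rule locally_integrableD(1)[OF is_weak_gradientD(1)[OF wg]])
  have gm: "weak_gradient I ?n u i \<in> borel_measurable (cube I ?n)" if "i < ?n" for i
    by (rule locally_integrableD(1)[OF is_weak_gradientD(2)[OF wg' that]])
  have glm[measurable]: "gradient_length I ?n u \<in> borel_measurable (cube I ?n)"
    unfolding gradient_length_def[abs_def]
    by (intro measurable_compose[OF _ borel_measurable_sqrt] borel_measurable_sum borel_measurable_power gm) simp
  have radius: "AE x in cube I ?n. ?\<sigma> x = cube_radius ?n x ^ ?n \<and> 0 < cube_radius ?n x \<and> cube_radius ?n x < 1"
    by (rule AE_cube_to_interval) simp
  have "AE x in cube I ?n. ennreal \<bar>u x\<bar> \<le> W x"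
    using radius
  proof eventually_elim
    case (elim x)
    have "u x \<le> h (cube_radius ?n x ^ ?n)"
      unfolding u_def by (rule radial_profile_le[OF hm h0 hB dec]) (use elim in simp_all)
    moreover have "0 \<le> u x" unfolding u_def by (rule ennreal_radial_profile(2)[OF hm h0 hB])
    ultimately show ?case using elim by (simp add: W_def ennreal_leI del: power_Suc)
  qed
  then have Zu: "space_norm Z u \<le> Z W"
    unfolding space_norm_def by (rule banach_function_normD(4)[OF bfn Wm, rotated]) measurable
  have "AE x in bcube I ?n. \<forall>i\<in>{..<?n}. weak_gradient I ?n u i x = radial_partial m h i x"
    by (rule AE_finite_allI) (use weak_gradient_unique[OF _ wg' wg] in auto)
  then have "AE x in cube I ?n. \<forall>i\<in>{..<?n}. weak_gradient I ?n u i x = radial_partial m h i x"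
    unfolding cube_eq by (rule AE_completion)
  then have "AE x in cube I ?n. ennreal \<bar>gradient_length I ?n u x\<bar> \<le> ennreal (2 * real ?n) * W x"
    using radius
  proof eventually_elim
    case (elim x)
    have "gradient_length I ?n u x = L2_set (\<lambda>i. weak_gradient I ?n u i x) {..<?n}"
      by (simp only: gradient_length_def L2_set_def)
    also have "\<dots> \<le> (\<Sum>i<?n. \<bar>weak_gradient I ?n u i x\<bar>)" by (rule L2_set_le_sum_abs)
    also have "\<dots> \<le> (\<Sum>i<?n. 2 * h (cube_radius ?n x ^ ?n))"
    proof (rule sum_mono)
      fix i assume i: "i \<in> {..<?n}"
      then have "weak_gradient I ?n u i x = radial_partial m h i x" using elim(1) by blast
      then show "\<bar>weak_gradient I ?n u i x\<bar> \<le> 2 * h (cube_radius ?n x ^ ?n)"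
	using abs_radial_partial_le[of i m h x, OF _ h0] i by simp
    qed
    also have "\<dots> = 2 * real ?n * h (?\<sigma> x)" using elim(2) by simp
    finally have "gradient_length I ?n u x \<le> 2 * real ?n * h (?\<sigma> x)" .
    moreover have "0 \<le> gradient_length I ?n u x" unfolding gradient_length_def by (simp add: sum_nonneg)
    moreover have "ennreal (2 * real ?n) * W x = ennreal (2 * real ?n * h (?\<sigma> x))"
      unfolding W_def by (rule ennreal_mult[symmetric]) (simp_all add: h0)
    ultimately show ?case by (simp only: abs_of_nonneg ennreal_leI)
  qed
  then have "space_norm Z (gradient_length I ?n u) \<le> Z (\<lambda>x. ennreal (2 * real ?n) * W x)"
    unfolding space_norm_def by (rule banach_function_normD(4)[OF bfn _ _, rotated 2]) (use Wm in measurable)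
  also have "\<dots> = ennreal (2 * real ?n) * Z W" by (rule banach_function_normD(3)[OF bfn Wm]) simp
  finally have Zg: "space_norm Z (gradient_length I ?n u) \<le> ennreal (2 * real ?n) * Z W" .
  have "space_norm Z u < \<infinity>" by (rule order_le_less_trans[OF Zu finW])
  moreover have "space_norm Z (gradient_length I ?n u) < \<infinity>"
    by (rule order_le_less_trans[OF Zg]) (use finW in \<open>simp add: ennreal_mult_less_top less_top del: of_nat_Suc\<close>)
  ultimately have uS: "u \<in> sobolev_space I ?n Z"
    unfolding sobolev_space_def function_space_def using wg um glm by blast
  have norm: "sobolev_norm I ?n Z u \<le> ennreal (1 + 2 * real ?n) * Z W"
  proof -
    have "sobolev_norm I ?n Z u \<le> Z W + ennreal (2 * real ?n) * Z W"
      unfolding sobolev_norm_def by (rule add_mono[OF Zu Zg])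
    also have "\<dots> = (ennreal 1 + ennreal (2 * real ?n)) * Z W" by (simp add: distrib_right)
    also have "ennreal 1 + ennreal (2 * real ?n) = ennreal (1 + 2 * real ?n)" by (rule ennreal_plus[symmetric]) simp_all
    finally show ?thesis .
  qed
  let ?T = "\<lambda>y. \<integral>\<^sup>+ \<rho>\<in>{0<..<1}. ennreal (h (\<rho> ^ ?n)) * indicator {cube_to_interval m y<..} (\<rho> ^ m) \<partial>lborel"
  have "X ?T \<le> X (section_norm ?n 0 L_inf u)"
  proof (rule banach_function_normD(4)[OF bfX])
    show "section_norm ?n 0 L_inf u \<in> borel_measurable (cube I m)"
      by (rule borel_measurable_section_norm[OF um]) simp
    show "?T \<in> borel_measurable (cube I m)"
      by (rule measurable_compose[OF measure_preserving_measurable[OF measure_preserving_cube_to_interval[OF m]]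
	    borel_measurable_unit_intervalI[OF borel_measurable_level_tail[OF hm]]])
    show "AE y in cube I m. ?T y \<le> section_norm ?n 0 L_inf u y"
      unfolding u_def[abs_def] by (rule level_tail_le_section_norm[OF m hm h0 hB]) simp
  qed
  also have "\<dots> \<le> ennreal C * sobolev_norm I ?n Z u" by (rule emb[OF uS])
  also have "\<dots> \<le> ennreal C * (ennreal (1 + 2 * real ?n) * Z W)" by (rule mult_left_mono[OF norm]) simp
  also have "\<dots> = ennreal (C * (1 + 2 * real ?n)) * Z W"
    using C by (simp add: ennreal_mult mult.assoc del: of_nat_Suc)
  finally show ?thesis unfolding ZW .
qed

text \<open>
  A single direction is enough, since the test functions are symmetric in the coordinates.
\<close>

lemma ri_norm_le_optimal_norm:
  assumes m: "0 < m" and Z: "ri_norm (cube I (Suc m)) Z" and X: "ri_norm (cube I m) X"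
    and emb: "sobolev_embeds_mixed I (Suc m) Z X"
  shows "\<exists>K::real. \<forall>f\<in>borel_measurable (cube I m). X f \<le> ennreal K * optimal_norm I (Suc m) Z f"
proof -
  let ?n = "Suc m"
  obtain C :: real where C: "\<And>u. u \<in> sobolev_space I ?n Z \<Longrightarrow>
      mixed_norm ?n X L_inf u \<le> ennreal C * sobolev_norm I ?n Z u"
    using emb unfolding sobolev_embeds_mixed_def continuously_embedded_def by blast
  define C' where "C' = max 0 C"
  have test: "X (section_norm ?n 0 L_inf u) \<le> ennreal C' * sobolev_norm I ?n Z u"
    if "u \<in> sobolev_space I ?n Z" for u
  proof -
    have "X (section_norm ?n 0 L_inf u)
	\<le> (\<Sum>k<?n. mixed_norm_dir ?n k X L_inf u)"
      unfolding mixed_norm_dir_def by (rule member_le_sum) auto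
    also have "\<dots> \<le> ennreal C * sobolev_norm I ?n Z u" using C[OF that] by (simp only: mixed_norm_def)
    also have "\<dots> \<le> ennreal C' * sobolev_norm I ?n Z u"
      by (rule mult_right_mono) (simp_all add: C'_def ennreal_leI)
    finally show ?thesis .
  qed
  have C'0: "0 \<le> C'" by (simp add: C'_def)
  have \<zeta>: "ri_norm unit_interval (luxemburg_rep (cube I ?n) Z)"
    by (rule ri_norm_luxemburg_rep[OF prob_space_cube measure_preserving_cube_to_interval Z]) simp
  have "X f \<le> ennreal (real ?n * (C' * (1 + 2 * real ?n))) * optimal_norm I ?n Z f"
    if f: "f \<in> borel_measurable (cube I m)" for f
  proof -
    have "X f \<le> ennreal (real ?n * (C' * (1 + 2 * real ?n)))
	* associate_norm (cube I m) (\<lambda>g. associate_norm unit_interval (luxemburg_rep (cube I ?n) Z)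
	    (\<lambda>t. max_rearrangement (cube I m) g (t powr (1 / conj_exponent ?n)))) f"
    proof (rule norm_le_associate_norm[OF prob_space_cube measure_preserving_cube_to_interval[OF m] X \<zeta> _ _ _ f])
      show "2 \<le> ?n" using m by simp
      show "0 \<le> C' * (1 + 2 * real ?n)" using C'0 by simp
      fix h :: "real \<Rightarrow> real" and B
      assume "h \<in> borel_measurable borel" "\<And>t. 0 \<le> h t" "\<And>t. h t \<le> B" "\<And>s t. 0 < s \<Longrightarrow> s \<le> t \<Longrightarrow> t < 1 \<Longrightarrow> h t \<le> h s"
      from radial_test_inequality[OF m Z X C'0 test this]
      show "X (\<lambda>y. \<integral>\<^sup>+ \<rho>\<in>{0<..<1}. ennreal (h (\<rho> ^ ?n)) * indicator {cube_to_interval m y<..} (\<rho> ^ (?n - 1)) \<partial>lborel)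
	\<le> ennreal (C' * (1 + 2 * real ?n)) * luxemburg_rep (cube I ?n) Z (\<lambda>t. ennreal (h t))" by simp
    qed
    then show ?thesis by (simp only: optimal_norm_def predual_norm_def[abs_def] diff_Suc_1)
  qed
  then show ?thesis by blast
qed

lemma mixed_embeds_mixed_of_norm_le:
  assumes le: "\<forall>f\<in>borel_measurable (cube I m). X2 f \<le> ennreal K * X1 f"
  shows "mixed_embeds_mixed I (Suc m) X1 X2"
proof -
  let ?Y = L_inf
  have dir: "mixed_norm_dir (Suc m) k X2 ?Y f \<le> ennreal K * mixed_norm_dir (Suc m) k X1 ?Y f"
    if "f \<in> borel_measurable (cube I (Suc m))" "k < Suc m" for f k
    unfolding mixed_norm_dir_def using le borel_measurable_section_norm[OF that(1)] that(2) by simp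
  have f_meas: "f \<in> borel_measurable (cube I (Suc m))" if "f \<in> mixed_space I (Suc m) X1 ?Y" for f
    using that by (auto simp: mixed_space_def mixed_space_dir_def)
  have "f \<in> mixed_space I (Suc m) X2 ?Y" if f: "f \<in> mixed_space I (Suc m) X1 ?Y" for f
    unfolding mixed_space_def
  proof
    fix k assume "k \<in> {..<Suc m}"
    then have k: "k < Suc m" by simp
    have "mixed_norm_dir (Suc m) k X1 ?Y f < \<infinity>"
      using f k by (auto simp: mixed_space_def mixed_space_dir_def)
    then have "ennreal K * mixed_norm_dir (Suc m) k X1 ?Y f < \<infinity>"
      by (simp add: ennreal_mult_less_top less_top)
    then have "mixed_norm_dir (Suc m) k X2 ?Y f < \<infinity>"
      by (rule order_le_less_trans[OF dir[OF f_meas[OF f] k]])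
    then show "f \<in> mixed_space_dir I (Suc m) k X2 ?Y" using f_meas[OF f] by (simp add: mixed_space_dir_def)
  qed
  moreover have "mixed_norm (Suc m) X2 ?Y f \<le> ennreal K * mixed_norm (Suc m) X1 ?Y f"
    if "f \<in> mixed_space I (Suc m) X1 ?Y" for f
    unfolding mixed_norm_def sum_distrib_left by (rule sum_mono) (use dir f_meas[OF that] in simp)
  ultimately show ?thesis unfolding mixed_embeds_mixed_def continuously_embedded_def by blast
qed

lemma sobolev_embeds_mixed_optimal:
  assumes m: "0 < m" and Z: "ri_norm (cube I (Suc m)) Z"
  shows "sobolev_embeds_mixed I (Suc m) Z (optimal_norm I (Suc m) Z)"
proof -
  let ?n = "Suc m" let ?Y = L_inf let ?X = "optimal_norm I ?n Z"
  have dir: "mixed_norm_dir ?n k ?X ?Y u \<le> ennreal (real ?n) * sobolev_norm I ?n Z u"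
    if "u \<in> sobolev_space I ?n Z" "k < ?n" for u k
    unfolding mixed_norm_dir_def by (rule sobolev_section_bound[OF m Z that(1)]) (use that(2) in simp)
  have "u \<in> mixed_space I ?n ?X ?Y" if u: "u \<in> sobolev_space I ?n Z" for u
    unfolding mixed_space_def
  proof
    fix k assume "k \<in> {..<?n}"
    then have k: "k < ?n" by simp
    have "sobolev_norm I ?n Z u < \<infinity>" using u by (simp add: sobolev_space_def function_space_def sobolev_norm_def)
    then have "ennreal (real ?n) * sobolev_norm I ?n Z u < \<infinity>" by (simp add: ennreal_mult_less_top less_top del: of_nat_Suc)
    then have "mixed_norm_dir ?n k ?X ?Y u < \<infinity>" by (rule order_le_less_trans[OF dir[OF u k]])
    then show "u \<in> mixed_space_dir I ?n k ?X ?Y"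
      using u by (simp add: mixed_space_dir_def sobolev_space_def function_space_def)
  qed
  moreover have "mixed_norm ?n ?X ?Y u \<le> ennreal (real ?n * real ?n) * sobolev_norm I ?n Z u"
    if u: "u \<in> sobolev_space I ?n Z" for u
  proof -
    have "mixed_norm ?n ?X ?Y u \<le> (\<Sum>k<?n. ennreal (real ?n) * sobolev_norm I ?n Z u)"
      unfolding mixed_norm_def by (rule sum_mono) (use dir[OF u] in simp)
    also have "\<dots> = ennreal (real ?n) * (ennreal (real ?n) * sobolev_norm I ?n Z u)"
      by (simp only: sum_constant card_lessThan ennreal_of_nat_eq_real_of_nat)
    also have "\<dots> = ennreal (real ?n * real ?n) * sobolev_norm I ?n Z u"
      by (simp add: ennreal_mult mult.assoc del: of_nat_Suc)
    finally show ?thesis .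
  qed
  ultimately show ?thesis unfolding sobolev_embeds_mixed_def continuously_embedded_def by blast
qed

end

theorem theorem4p4:
  fixes n :: nat and I :: "real set"
    and Z :: "((nat \<Rightarrow> real) \<Rightarrow> ennreal) \<Rightarrow> ennreal"
  assumes "n \<ge> 2"
    and "is_interval I" and "measure lborel I = 1"
    and "ri_norm (cube I n) Z"
  shows "ri_norm (cube I (n - 1)) (predual_norm I n Z) \<and>
    ri_norm (cube I (n - 1)) (optimal_norm I n Z) \<and>
    sobolev_embeds_mixed I n Z (optimal_norm I n Z) \<and>
    (\<forall>X. ri_norm (cube I (n - 1)) X \<and> sobolev_embeds_mixed I n Z X \<longrightarrow>
       mixed_embeds_mixed I n (optimal_norm I n Z) X)"
proof -
  obtain a where "unit_edge I a" using unit_edge_exists[OF assms(2,3)] by blast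
  then interpret unit_edge I a .
  obtain m where n: "n = Suc m" and m: "0 < m" using assms(1) by (cases n) auto
  have Z: "ri_norm (cube I (Suc m)) Z" using assms(4) n by simp
  let ?\<tau> = "associate_norm unit_interval (luxemburg_rep (cube I (Suc m)) Z)"
  have "ri_norm unit_interval (luxemburg_rep (cube I (Suc m)) Z)"
    by (rule ri_norm_luxemburg_rep[OF prob_space_cube measure_preserving_cube_to_interval Z]) simp
  then have \<tau>: "banach_function_norm unit_interval ?\<tau>"
    by (intro banach_function_norm_associate prob_space_unit_interval) (simp_all add: ri_norm_def)
  have "0 < 1 / conj_exponent (Suc m)" using m by (simp add: one_over_conj_exponent)
  note ri = ri_norm_associate_max_rearrangement[OF prob_space_cube \<tau> this]
  have 1: "ri_norm (cube I m) (predual_norm I (Suc m) Z)"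
    unfolding predual_norm_def[abs_def] diff_Suc_1 by (rule ri(1))
  have 2: "ri_norm (cube I m) (optimal_norm I (Suc m) Z)"
    unfolding optimal_norm_def predual_norm_def[abs_def] diff_Suc_1 by (rule ri(2))
  have 3: "mixed_embeds_mixed I (Suc m) (optimal_norm I (Suc m) Z) X"
    if "ri_norm (cube I m) X" "sobolev_embeds_mixed I (Suc m) Z X" for X
    using ri_norm_le_optimal_norm[OF m Z that] mixed_embeds_mixed_of_norm_le by blast
  show ?thesis unfolding n diff_Suc_1 using 1 2 3 sobolev_embeds_mixed_optimal[OF m Z] by blast
qed

end
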